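(* Let $n\in\{2,3\}$ and $k>0$. Let $V$ and $V'$ be two piecewise constant potentials with polyhedral nested geometry (as defined in the context; the nested cells of $V$ and $V'$ may differ). Let $u^i$ be an entire solution of $(\Delta+k^2)u^i=0$ in $\mathbb{R}^n$, and let $u,u'$ be the total waves of the scattering problem for $V$, respectively $V'$, with incident wave $u^i$. Assume that $u(x_c)\neq0$ or $u'(x_c)\neq0$ for each vertex $x_c$ of the cells of $V$ and $V'$. If the far-field patterns satisfy $A_{u^i}=A'_{u^i}$, then $V=V'$.
   Context: Scattering problem: for $V\in L^\infty(\mathbb{R}^n)$ complex-valued with compact support and $u^i$ an entire solution of $(\Delta+k^2)u^i=0$, the total wave $u\in H^1_{loc}(\mathbb{R}^n)$ solves $(\Delta+k^2(1+V))u=0$ in $\mathbb{R}^n$ and $u-u^i$ satisfies the Sommerfeld radiation condition $\lim_{r=|x|\to\infty}|x|^{(n-1)/2}(\partial_r-ik)(u-u^i)=0$ uniformly in $\hat x$. The far-field pattern $A_{u^i}$ is defined by $u(r\hat x)=u^i(r\hat x)+\frac{e^{ikr}}{r^{(n-1)/2}}A_{u^i}(\hat x)+\mathcal{O}(r^{-n/2})$ uniformly in $\hat x\in\mathbb{S}^{n-1}$. Total waves are continuous, so point values are defined. An admissible cell is a bounded open convex polytope in $\mathbb{R}^n$. Polyhedral nested geometry: for $j\in\mathbb{Z}_+$ let each $D_j\subset\mathbb{R}^n$ be an admissible cell or the empty set, with $D_{j+1}$ compactly contained in $D_j$ ($D_j\Supset D_{j+1}$). A bounded potential $V\in L^\infty(\mathbb{R}^n)$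 is piecewise constant with polyhedral nested geometry if there are constants $V_j\in\mathbb{C}$ with $V_1\neq0$ and $V_{j+1}\neq V_j$ for all $j$ such that $V=\sum_{j=1}^\infty V_j\chi_{\Sigma_j}$ where $\Sigma_j=D_j\setminus\overline{D_{j+1}}$. The cells of $V$ are the nonempty $D_j$. *)

theory Defs
  imports "HOL-Analysis.Analysis"
begin

definition pd :: "(real^'n \<Rightarrow> 'b::real_normed_vector) \<Rightarrow> 'n \<Rightarrow> real^'n \<Rightarrow> 'b" where
  "pd f i x = frechet_derivative f (at x) (axis i 1)"

fun Cm :: "nat \<Rightarrow> (real^'n \<Rightarrow> 'b::real_normed_vector) \<Rightarrow> bool" where
  "Cm 0 f = continuous_on UNIV f"
| "Cm (Suc m) f = ((\<forall>x. f differentiable at x) \<and> continuous_on UNIV f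
                    \<and> (\<forall>i. Cm m (pd f i)))"

definition smooth :: "(real^'n \<Rightarrow> 'b::real_normed_vector) \<Rightarrow> bool" where
  "smooth f = (\<forall>m. Cm m f)"

definition test_function :: "(real^'n \<Rightarrow> real) \<Rightarrow> bool" where
  "test_function \<phi> = (smooth \<phi> \<and> bounded {x. \<phi> x \<noteq> 0})"

definition laplacian :: "(real^'n \<Rightarrow> complex) \<Rightarrow> real^'n \<Rightarrow> complex" where
  "laplacian u x = (\<Sum>i\<in>UNIV. pd (pd u i) i x)"

definition loc_L2 :: "(real^'n \<Rightarrow> complex) \<Rightarrow> bool" where
  "loc_L2 f = (f \<in> borel_measurable lborel \<and>
     (\<forall>K. compact K \<longrightarrow> set_integrable lborel K (\<lambda>x. (cmod (f x))\<^sup>2)))"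

definition weak_gradient :: "(real^'n \<Rightarrow> complex) \<Rightarrow> ('n \<Rightarrow> real^'n \<Rightarrow> complex) \<Rightarrow> bool" where
  "weak_gradient u g = (\<forall>\<phi> i. test_function \<phi> \<longrightarrow>
      integrable lborel (\<lambda>x. u x * of_real (pd \<phi> i x)) \<and>
      integrable lborel (\<lambda>x. g i x * of_real (\<phi> x)) \<and>
      (\<integral>x. u x * of_real (pd \<phi> i x) \<partial>lborel) = - (\<integral>x. g i x * of_real (\<phi> x) \<partial>lborel))"

definition H1_loc :: "(real^'n \<Rightarrow> complex) \<Rightarrow> bool" where
  "H1_loc u = (\<exists>g. loc_L2 u \<and> (\<forall>i. loc_L2 (g i)) \<and> weak_gradient u g)"

definition weak_helmholtz_sol :: "real \<Rightarrow> (real^'n \<Rightarrow> complex) \<Rightarrow> (real^'n \<Rightarrow> complex) \<Rightarrow> bool" where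
  "weak_helmholtz_sol k V u = (\<exists>g. loc_L2 u \<and> (\<forall>i. loc_L2 (g i)) \<and> weak_gradient u g \<and>
     (\<forall>\<phi>. test_function \<phi> \<longrightarrow>
        integrable lborel (\<lambda>x. (\<Sum>i\<in>UNIV. g i x * of_real (pd \<phi> i x))) \<and>
        integrable lborel (\<lambda>x. (of_real (k\<^sup>2) * (1 + V x)) * u x * of_real (\<phi> x)) \<and>
        (\<integral>x. (\<Sum>i\<in>UNIV. g i x * of_real (pd \<phi> i x)) \<partial>lborel)
          = (\<integral>x. (of_real (k\<^sup>2) * (1 + V x)) * u x * of_real (\<phi> x) \<partial>lborel)))"

definition entire_helmholtz :: "real \<Rightarrow> (real^'n \<Rightarrow> complex) \<Rightarrow> bool" where
  "entire_helmholtz k ui = (Cm 2 ui \<and> (\<forall>x. laplacian ui x + of_real (k\<^sup>2) * ui x = 0))"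

definition sommerfeld :: "real \<Rightarrow> (real^'n \<Rightarrow> complex) \<Rightarrow> bool" where
  "sommerfeld k us = (\<forall>\<epsilon>>0. \<exists>R. \<forall>r\<ge>R. \<forall>xh\<in>sphere 0 1.
      \<exists>d. ((\<lambda>t. us (t *\<^sub>R xh)) has_vector_derivative d) (at r) \<and>
          cmod (of_real (r powr ((real CARD('n) - 1) / 2)) * (d - \<i> * of_real k * us (r *\<^sub>R xh))) \<le> \<epsilon>)"

definition total_wave :: "real \<Rightarrow> (real^'n \<Rightarrow> complex) \<Rightarrow> (real^'n \<Rightarrow> complex)
                          \<Rightarrow> (real^'n \<Rightarrow> complex) \<Rightarrow> bool" where
  "total_wave k V ui u = (continuous_on UNIV u \<and> H1_loc u \<and> weak_helmholtz_sol k V u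
                          \<and> sommerfeld k (\<lambda>x. u x - ui x))"

definition far_field :: "real \<Rightarrow> (real^'n \<Rightarrow> complex) \<Rightarrow> (real^'n \<Rightarrow> complex)
                          \<Rightarrow> (real^'n \<Rightarrow> complex) \<Rightarrow> bool" where
  "far_field k ui u A = (\<exists>C R. \<forall>r\<ge>R. \<forall>xh\<in>sphere 0 1. r > 0 \<and>
      cmod (u (r *\<^sub>R xh) - ui (r *\<^sub>R xh)
            - exp (\<i> * of_real (k * r)) / of_real (r powr ((real CARD('n) - 1) / 2)) * A xh)
        \<le> C * r powr (- real CARD('n) / 2))"

definition admissible_cell :: "(real^'n) set \<Rightarrow> bool" where
  "admissible_cell D = (\<exists>S. finite S \<and> D = interior (convex hull S) \<and> D \<noteq> {})"

definition compactly_contained :: "(real^'n) set \<Rightarrow> (real^'n) set \<Rightarrow> bool" where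
  "compactly_contained A B = (compact (closure A) \<and> closure A \<subseteq> B)"

definition Sigma_cell :: "(nat \<Rightarrow> (real^'n) set) \<Rightarrow> nat \<Rightarrow> (real^'n) set" where
  "Sigma_cell D j = D j - closure (D (Suc j))"

text \<open>The function \<Sum>_j c_j \<chi>_{\<Sigma>_j} (the \<Sigma>_j are pairwise disjoint, so at most one term
  is nonzero at each point). Indices j range over the positive integers 1,2,...\<close>
definition pc_potential :: "(nat \<Rightarrow> (real^'n) set) \<Rightarrow> (nat \<Rightarrow> complex) \<Rightarrow> real^'n \<Rightarrow> complex" where
  "pc_potential D c x = (\<Sum>j | j \<ge> 1 \<and> x \<in> Sigma_cell D j. c j)"

definition polyhedral_nested :: "(nat \<Rightarrow> (real^'n) set) \<Rightarrow> (nat \<Rightarrow> complex) \<Rightarrow> bool" where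
  "polyhedral_nested D c = (
     (\<forall>j\<ge>1. admissible_cell (D j) \<or> D j = {}) \<and>
     (\<forall>j\<ge>1. compactly_contained (D (Suc j)) (D j)) \<and>
     c 1 \<noteq> 0 \<and> (\<forall>j\<ge>1. c (Suc j) \<noteq> c j))"

definition pc_nested_potential :: "(real^'n \<Rightarrow> complex) \<Rightarrow> (nat \<Rightarrow> (real^'n) set) \<Rightarrow> (nat \<Rightarrow> complex) \<Rightarrow> bool" where
  "pc_nested_potential V D c = (polyhedral_nested D c \<and> V = pc_potential D c \<and> bounded (range V))"

definition cell_vertices :: "(nat \<Rightarrow> (real^'n) set) \<Rightarrow> (real^'n) set" where
  "cell_vertices D = {x. \<exists>j\<ge>1. D j \<noteq> {} \<and> x extreme_point_of (closure (D j))}"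

end

theory Submission
  imports Defs
begin

text \<open>The difference \<open>w = u - u'\<close> of the total waves is a distributional solution of an equation
  \<open>\<Delta>w + \<lambda>w = 0\<close> wherever the two potentials are equal to the same constant, and it decays like
  \<open>|x|\<^bsup>-n/2\<^esup>\<close>.  By Rellich's lemma, proved with a Carleman estimate on exterior domains, \<open>w\<close> vanishes
  near infinity.  The layers are then peeled off one by one.  If the first \<open>j\<close> layers agree and
  \<open>w = 0\<close> off \<open>D\<^sub>j\<close>, then every point outside the closures of \<open>D\<^sub>j\<^sub>+\<^sub>1\<close> and \<open>D'\<^sub>j\<^sub>+\<^sub>1\<close> is the origin of a ray that
  avoids both of these convex sets, so unique continuation along the ray gives \<open>w = 0\<close> there.
  If the two closures, or the two values of the potentials on them, were different, then near a vertex
  \<open>x\<^sub>c\<close> of one of the cells \<open>w\<close> would be supported in the cell and solve \<open>\<Delta>w + \<lambda>w = f 1\<^sub>D\<close> with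
  \<open>f(x\<^sub>c) \<noteq> 0\<close>.  Close to \<open>x\<^sub>c\<close> there is a point of a codimension two face at which \<open>f \<noteq> 0\<close> and the cell
  is a wedge, and this is excluded by testing with complex exponentials \<open>e\<^bsup>\<tau> \<zeta> \<cdot> x\<^esup>\<close>, \<open>\<zeta> \<cdot> \<zeta> = 0\<close>.\<close>

subsection \<open>Smooth functions on open sets\<close>

text \<open>No spherical harmonics or Bessel functions occur: Rellich's lemma and unique
  continuation both rest on one identity. Written with the Euler field and the rotation fields,
  \<open>|x|^2\<close> times the Laplacian, conjugated by a radial weight, is a symmetric plus a
  skew operator, and their pairing is an explicit quadratic form
  (\<open>commutator_identity\<close>). The two Carleman estimates differ in the weight. The
  difference of the waves is handled as a merely continuous function. Its equation is therefore kept
  in distributional form (\<open>dsol\<close>), and smooth results are applied to mollifications,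
  which solve the equation on a set shrunk by the mollification radius. At a corner the source is
  \<open>k^2 (V' - V) u'\<close> on the cell. The two waves agree at the vertex, so if one of them
  is nonzero there then \<open>u'\<close> is, and by continuity it stays nonzero nearby. This
  permits leaving the vertex, which in dimension three is the apex of an arbitrary polyhedral cone,
  for a nearby point of an edge, where only two half spaces matter.\<close>

fun Cm_on :: "(real^'n) set \<Rightarrow> nat \<Rightarrow> (real^'n \<Rightarrow> 'b::real_normed_vector) \<Rightarrow> bool" where
  "Cm_on S 0 f = continuous_on S f"
| "Cm_on S (Suc m) f = ((\<forall>x\<in>S. f differentiable at x) \<and> (\<forall>i. Cm_on S m (pd f i)))"

definition smooth_in :: "(real^'n) set \<Rightarrow> (real^'n \<Rightarrow> 'b::real_normed_vector) \<Rightarrow> bool" where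
  "smooth_in S f \<longleftrightarrow> (\<forall>m. Cm_on S m f)"

lemma pd_eqI: "(f has_derivative f') (at x) \<Longrightarrow> pd f i x = f' (axis i 1)"
  unfolding pd_def by (metis frechet_derivative_at)

text \<open>\<open>frechet_derivative\<close> is a choice, so without differentiability its locality
  is not automatic. Near \<open>x\<close> both functions have exactly the same candidate
  derivatives, hence the choice is the same.\<close>

lemma pd_cong_open:
  assumes "open S" "x \<in> S" "\<And>y. y \<in> S \<Longrightarrow> f y = g y"
  shows "pd f i x = pd g i x"
proof -
  have "(f has_derivative F) (at x) \<longleftrightarrow> (g has_derivative F) (at x)" for F
    using has_derivative_transform_within_open[OF _ assms(1,2)] assms(3) by metis
  then show ?thesis unfolding pd_def frechet_derivative_def by simp
qed

lemma differentiable_cong_open: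
  assumes "open S" "x \<in> S" "\<And>y. y \<in> S \<Longrightarrow> f y = g y" "f differentiable at x"
  shows "g differentiable at x"
  using assms has_derivative_transform_within_open unfolding differentiable_def by metis

lemma Cm_on_cong:
  assumes "open S" "\<And>x. x \<in> S \<Longrightarrow> f x = g x" "Cm_on S m f"
  shows "Cm_on S m g"
  using assms(2,3)
proof (induction m arbitrary: f g)
  case 0 then show ?case by (simp cong: continuous_on_cong)
next
  case (Suc m)
  then have "g differentiable at x" if "x \<in> S" for x
    using differentiable_cong_open[OF assms(1) that, of f g] that by auto
  moreover have "Cm_on S m (pd g i)" for i
    using Suc.IH[of "pd f i" "pd g i"] Suc.prems pd_cong_open[OF assms(1), of _ f g i] by auto
  ultimately show ?case by simp
qed

lemma Cm_on_imp_continuous: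
  assumes "Cm_on S m f" shows "continuous_on S f"
  using assms by (cases m) (auto intro!: continuous_at_imp_continuous_on differentiable_imp_continuous_within)

text \<open>Allows smoothness to be proved at orders \<open>Suc m\<close> only, where the partial
  derivatives are visible.\<close>

lemma Cm_on_SucD: "Cm_on S (Suc m) f \<Longrightarrow> Cm_on S m f"
proof (induction m arbitrary: f)
  case 0 then show ?case using Cm_on_imp_continuous by fastforce
next
  case (Suc m) then show ?case by (metis Cm_on.simps(2))
qed

lemma smooth_inD:
  assumes "smooth_in S f"
  shows "x \<in> S \<Longrightarrow> f differentiable at x" "smooth_in S (pd f i)" "continuous_on S f"
  using assms unfolding smooth_in_def
  by (metis Cm_on.simps(2)) (use assms[unfolded smooth_in_def] in \<open>metis Cm_on.simps(2)\<close>,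
      use assms[unfolded smooth_in_def] in \<open>metis Cm_on.simps(1)\<close>)

lemma Cm_on_subset: "Cm_on S m f \<Longrightarrow> T \<subseteq> S \<Longrightarrow> Cm_on T m f"
  by (induction m arbitrary: f) (auto intro: continuous_on_subset)

lemma smooth_in_subset: "smooth_in S f \<Longrightarrow> T \<subseteq> S \<Longrightarrow> smooth_in T f"
  unfolding smooth_in_def using Cm_on_subset by blast

lemma smooth_in_cong: "open S \<Longrightarrow> (\<And>x. x \<in> S \<Longrightarrow> f x = g x) \<Longrightarrow> smooth_in S f \<Longrightarrow> smooth_in S g"
  unfolding smooth_in_def using Cm_on_cong by blast

lemma Cm_Cm_on: "Cm m f \<longleftrightarrow> Cm_on UNIV m f"
proof (induction m arbitrary: f)
  case (Suc m)
  have "Cm_on UNIV (Suc m) f \<Longrightarrow> continuous_on UNIV f" using Cm_on_imp_continuous by blast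
  then show ?case using Suc by auto
qed simp

lemma smooth_iff: "smooth f \<longleftrightarrow> smooth_in UNIV f"
  by (simp add: smooth_def smooth_in_def Cm_Cm_on)

lemma pd_const [simp]: "pd (\<lambda>x. c) i x = 0"
  by (simp add: pd_def)

lemma pd_add: "f differentiable at x \<Longrightarrow> g differentiable at x \<Longrightarrow> pd (\<lambda>x. f x + g x) i x = pd f i x + pd g i x"
  unfolding frechet_derivative_works pd_def[of f] pd_def[of g]
  by (drule (1) has_derivative_add) (erule pd_eqI)

lemma pd_mult:
  fixes f g :: "real^'n \<Rightarrow> 'b::real_normed_algebra"
  shows "f differentiable at x \<Longrightarrow> g differentiable at x \<Longrightarrow> pd (\<lambda>x. f x * g x) i x = f x * pd g i x + pd f i x * g x"
  unfolding frechet_derivative_works pd_def[of f] pd_def[of g]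
  by (drule (1) has_derivative_mult) (erule pd_eqI)

lemma pd_bounded_linear:
  assumes "bounded_linear T" "f differentiable at x"
  shows "pd (\<lambda>x. T (f x)) i x = T (pd f i x)"
  using bounded_linear.has_derivative[OF assms(1)] assms(2)
  unfolding frechet_derivative_works pd_def[of f] by (metis pd_eqI)

lemma differentiable_bounded_linear:
  assumes "bounded_linear T" "f differentiable at x"
  shows "(\<lambda>x. T (f x)) differentiable at x"
  using bounded_linear.has_derivative[OF assms(1)] assms(2) unfolding differentiable_def by blast

lemma Cm_on_const: "Cm_on S m (\<lambda>x. c)"
proof (induction m arbitrary: c)
  case (Suc m)
  then have "Cm_on S m (pd (\<lambda>x. c) i)" for i
    using Suc[of 0] by (metis pd_const ext)
  then show ?case by simp
qed simp

lemma Cm_on_add: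
  assumes "open S" shows "Cm_on S m f \<Longrightarrow> Cm_on S m g \<Longrightarrow> Cm_on S m (\<lambda>x. f x + g x)"
proof (induction m arbitrary: f g)
  case (Suc m)
  have "Cm_on S m (pd (\<lambda>x. f x + g x) i)" for i
    by (rule Cm_on_cong[OF assms _ Suc.IH[of "pd f i" "pd g i"]]) (use Suc in \<open>auto simp: pd_add\<close>)
  then show ?case using Suc by auto
qed (auto intro: continuous_intros)

lemma Cm_on_bounded_linear:
  assumes "open S" "bounded_linear T" shows "Cm_on S m f \<Longrightarrow> Cm_on S m (\<lambda>x. T (f x))"
proof (induction m arbitrary: f)
  case 0 then show ?case using linear_continuous_on_compose bounded_linear.continuous_on[OF assms(2)] by auto
next
  case (Suc m)
  have "Cm_on S m (pd (\<lambda>x. T (f x)) i)" for i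
    by (rule Cm_on_cong[OF assms(1) _ Suc.IH[of "pd f i"]]) (use Suc in \<open>auto simp: pd_bounded_linear[OF assms(2)]\<close>)
  then show ?case using Suc.prems differentiable_bounded_linear[OF assms(2), of f] by simp
qed

lemma Cm_on_mult:
  fixes f g :: "real^'n \<Rightarrow> 'b::real_normed_algebra"
  assumes "open S" shows "Cm_on S m f \<Longrightarrow> Cm_on S m g \<Longrightarrow> Cm_on S m (\<lambda>x. f x * g x)"
proof (induction m arbitrary: f g)
  case (Suc m)
  have "Cm_on S m (pd (\<lambda>x. f x * g x) i)" for i
    by (rule Cm_on_cong[OF assms _ Cm_on_add[OF assms Suc.IH[of f "pd g i"] Suc.IH[of "pd f i" g]]])
      (use Suc.prems Cm_on_SucD[OF Suc.prems(1)] Cm_on_SucD[OF Suc.prems(2)] in \<open>auto simp: pd_mult\<close>)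
  then show ?case using Suc by auto
qed (auto intro: continuous_intros)

lemma smooth_in_const [simp]: "smooth_in S (\<lambda>x. c)"
  by (simp add: smooth_in_def Cm_on_const)

lemma smooth_in_add: "open S \<Longrightarrow> smooth_in S f \<Longrightarrow> smooth_in S g \<Longrightarrow> smooth_in S (\<lambda>x. f x + g x)"
  by (simp add: smooth_in_def Cm_on_add)

lemma smooth_in_bounded_linear: "open S \<Longrightarrow> bounded_linear T \<Longrightarrow> smooth_in S f \<Longrightarrow> smooth_in S (\<lambda>x. T (f x))"
  by (simp add: smooth_in_def Cm_on_bounded_linear)

lemma smooth_in_mult:
  fixes f g :: "real^'n \<Rightarrow> 'b::real_normed_algebra"
  shows "open S \<Longrightarrow> smooth_in S f \<Longrightarrow> smooth_in S g \<Longrightarrow> smooth_in S (\<lambda>x. f x * g x)"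
  by (simp add: smooth_in_def Cm_on_mult)

lemma smooth_in_minus: "open S \<Longrightarrow> smooth_in S f \<Longrightarrow> smooth_in S (\<lambda>x. - f x)"
  using smooth_in_bounded_linear[OF _ bounded_linear_minus[OF bounded_linear_ident]] .

lemma smooth_in_diff: "open S \<Longrightarrow> smooth_in S f \<Longrightarrow> smooth_in S g \<Longrightarrow> smooth_in S (\<lambda>x. f x - g x)"
  using smooth_in_add[of S f "\<lambda>x. - g x"] smooth_in_minus[of S g] by simp

lemma smooth_in_sum: "open S \<Longrightarrow> (\<And>a. a \<in> A \<Longrightarrow> smooth_in S (f a)) \<Longrightarrow> smooth_in S (\<lambda>x. \<Sum>a\<in>A. f a x)"
  by (induction A rule: infinite_finite_induct) (auto intro: smooth_in_add)

lemma smooth_in_power: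
  fixes f :: "real^'n \<Rightarrow> 'b::real_normed_algebra_1"
  shows "open S \<Longrightarrow> smooth_in S f \<Longrightarrow> smooth_in S (\<lambda>x. f x ^ k)"
  by (induction k) (auto intro: smooth_in_mult)

lemma pd_linear: "bounded_linear f \<Longrightarrow> pd f i x = f (axis i 1)"
  by (rule pd_eqI) (rule bounded_linear_imp_has_derivative)

lemma smooth_in_linear:
  assumes "bounded_linear f" shows "smooth_in S f"
proof -
  have "pd f i = (\<lambda>x. f (axis i 1))" for i using pd_linear[OF assms] by auto
  then have "Cm_on S (Suc m) f" for m
    using Cm_on_const[of S m] bounded_linear_imp_differentiable[OF assms] by auto
  then show ?thesis unfolding smooth_in_def using Cm_on_SucD by blast
qed

lemma smooth_in_nth: "smooth_in S (\<lambda>x. x $ i)"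
  by (rule smooth_in_linear) (rule bounded_linear_vec_nth)

lemma pd_nth: "pd (\<lambda>x::real^'n. x $ i) j x = (if i = j then 1 else 0)"
  by (simp add: pd_linear[OF bounded_linear_vec_nth] axis_def)

text \<open>A function is smooth as soon as its partial derivatives lie, on the domain, in the
  algebra generated by itself and smooth functions.\<close>

lemma smooth_in_chain:
  fixes f :: "real^'n \<Rightarrow> 'b::real_normed_vector" and G :: "nat \<Rightarrow> real^'n \<Rightarrow> 'a::real_normed_algebra"
  assumes S: "open S" and h: "\<And>i. smooth_in S (h i)"
    and diff: "\<And>j x. x \<in> S \<Longrightarrow> G j differentiable at x"
    and pdG: "\<And>j i x. x \<in> S \<Longrightarrow> pd (G j) i x = G (Suc j) x * h i x"
  shows "smooth_in S (G j)"
proof -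
  have "Cm_on S m (G j)" for m j
  proof (induction m arbitrary: j)
    case 0 then show ?case
      using diff by (auto intro!: continuous_at_imp_continuous_on differentiable_imp_continuous_within)
  next
    case (Suc m)
    have "Cm_on S m (pd (G j) i)" for i
      by (rule Cm_on_cong[OF S _ Cm_on_mult[OF S Suc[of "Suc j"]]])
        (use pdG h in \<open>auto simp: smooth_in_def\<close>)
    then show ?case using diff by auto
  qed
  then show ?thesis by (simp add: smooth_in_def)
qed

lemma has_derivative_chain_real:
  assumes "(g has_real_derivative g') (at (f x))" "f differentiable at x"
  shows "((\<lambda>x. g (f x)) has_derivative (\<lambda>v. g' * frechet_derivative f (at x) v)) (at x)"
  using has_derivative_compose[of f "frechet_derivative f (at x)" x UNIV g "(*) g'"] assms
  unfolding has_field_derivative_def frechet_derivative_works by auto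

lemma smooth_in_compose:
  fixes G :: "nat \<Rightarrow> real \<Rightarrow> real"
  assumes "open S" "smooth_in S f"
    and G: "\<And>j t. t \<in> f ` S \<Longrightarrow> (G j has_real_derivative G (Suc j) t) (at t)"
  shows "smooth_in S (\<lambda>x. G j (f x))"
proof (rule smooth_in_chain[where h = "\<lambda>i. pd f i" and G = "\<lambda>j x. G j (f x)"])
  fix j x i assume x: "x \<in> S"
  note d = has_derivative_chain_real[OF G smooth_inD(1)[OF assms(2) x], of j, simplified]
  show "(\<lambda>x. G j (f x)) differentiable at x" using d x unfolding differentiable_def by auto
  show "pd (\<lambda>x. G j (f x)) i x = G (Suc j) (f x) * pd f i x"
    using pd_eqI[OF d] x by (auto simp: pd_def)
qed (use assms smooth_inD in auto)

lemma pd_compose: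
  assumes "(g has_real_derivative g') (at (f x))" "f differentiable at x"
  shows "pd (\<lambda>x. g (f x)) i x = g' * pd f i x"
  using pd_eqI[OF has_derivative_chain_real[OF assms]] by (simp add: pd_def)

lemma has_derivative_exp_compose:
  fixes f :: "real^'n \<Rightarrow> 'b::{real_normed_field,banach}"
  assumes "f differentiable at x"
  shows "((\<lambda>x. exp (f x)) has_derivative (\<lambda>v. exp (f x) * frechet_derivative f (at x) v)) (at x)"
  using has_derivative_compose[of f "frechet_derivative f (at x)" x UNIV exp "(*) (exp (f x))"] assms
    DERIV_exp[of "f x"]
  unfolding has_field_derivative_def frechet_derivative_works by auto

lemma pd_exp:
  fixes f :: "real^'n \<Rightarrow> 'b::{real_normed_field,banach}"
  assumes "f differentiable at x"
  shows "pd (\<lambda>x. exp (f x)) i x = exp (f x) * pd f i x"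
  using pd_eqI[OF has_derivative_exp_compose[OF assms]] by (simp add: pd_def)

lemma smooth_in_exp:
  fixes f :: "real^'n \<Rightarrow> 'b::{real_normed_field,banach}"
  assumes "open S" "smooth_in S f"
  shows "smooth_in S (\<lambda>x. exp (f x))"
proof (rule smooth_in_chain[where h = "\<lambda>i. pd f i" and G = "\<lambda>j x. exp (f x)"])
  fix j x i assume x: "x \<in> S"
  note d = has_derivative_exp_compose[OF smooth_inD(1)[OF assms(2) x]]
  show "(\<lambda>x. exp (f x)) differentiable at x" using d unfolding differentiable_def by auto
  show "pd (\<lambda>x. exp (f x)) i x = exp (f x) * pd f i x"
    using pd_exp[OF smooth_inD(1)[OF assms(2) x]] .
qed (use assms smooth_inD in auto)

text \<open>The partial derivatives of \<open>1/f\<close> are \<open>-(1/f)^2 pd f i\<close>, in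
  which \<open>1/f\<close> is needed to the lower order only; this drives the induction.\<close>

lemma Cm_on_inverse:
  fixes f :: "real^'n \<Rightarrow> real"
  assumes "open S" "\<And>x. x \<in> S \<Longrightarrow> f x \<noteq> 0" 
  shows "Cm_on S m f \<Longrightarrow> Cm_on S m (\<lambda>x. inverse (f x))"
proof (induction m)
  case (Suc m)
  have f: "Cm_on S m f" using Suc Cm_on_SucD by blast
  have d: "((\<lambda>x. inverse (f x)) has_derivative (\<lambda>v. (- inverse (f x) * inverse (f x)) * frechet_derivative f (at x) v)) (at x)"
    if "x \<in> S" for x
    by (rule has_derivative_chain_real) (use Suc.prems assms(2)[OF that] that in
        \<open>auto intro!: derivative_eq_intros simp: power2_eq_square\<close>)
  have inv: "Cm_on S m (\<lambda>x. inverse (f x))" using Suc.IH f by blast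
  have c: "Cm_on S m (\<lambda>x. (- inverse (f x) * inverse (f x)) * pd f i x)" for i
  proof -
    have "Cm_on S m (\<lambda>x. - inverse (f x))"
      by (rule Cm_on_bounded_linear[OF assms(1) bounded_linear_minus[OF bounded_linear_ident] inv])
    moreover have "Cm_on S m (pd f i)" using Suc.prems by simp
    ultimately show ?thesis by (intro Cm_on_mult inv assms(1))
  qed
  have "Cm_on S m (pd (\<lambda>x. inverse (f x)) i)" for i
    by (rule Cm_on_cong[OF assms(1) _ c[of i]]) (use pd_eqI[OF d] in \<open>auto simp: pd_def\<close>)
  then show ?case using d unfolding Cm_on.simps differentiable_def by blast
qed (use assms in \<open>auto intro!: continuous_intros\<close>)

lemma smooth_in_inverse:
  fixes f :: "real^'n \<Rightarrow> real"
  assumes "open S" "\<And>x. x \<in> S \<Longrightarrow> f x \<noteq> 0" "smooth_in S f"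
  shows "smooth_in S (\<lambda>x. inverse (f x))"
  using assms Cm_on_inverse unfolding smooth_in_def by blast

lemma smooth_in_divide:
  fixes f :: "real^'n \<Rightarrow> real"
  assumes "open S" "\<And>x. x \<in> S \<Longrightarrow> g x \<noteq> 0" "smooth_in S f" "smooth_in S g"
  shows "smooth_in S (\<lambda>x. f x / g x)"
  unfolding divide_inverse by (intro smooth_in_mult smooth_in_inverse assms)

lemma smooth_in_ln:
  fixes f :: "real^'n \<Rightarrow> real"
  assumes "open S" "\<And>x. x \<in> S \<Longrightarrow> f x > 0" "smooth_in S f"
  shows "smooth_in S (\<lambda>x. ln (f x))"
proof -
  have d: "((\<lambda>x. ln (f x)) has_derivative (\<lambda>v. inverse (f x) * frechet_derivative f (at x) v)) (at x)"
    if "x \<in> S" for x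
    by (rule has_derivative_chain_real) (use smooth_inD(1)[OF assms(3) that] assms(2)[OF that] in
        \<open>auto intro!: derivative_eq_intros simp: divide_inverse\<close>)
  have "Cm_on S (Suc m) (\<lambda>x. ln (f x))" for m
  proof -
    have nz: "\<And>x. x \<in> S \<Longrightarrow> f x \<noteq> 0" using assms(2) by fastforce
    have c: "smooth_in S (\<lambda>x. inverse (f x) * pd f i x)" for i
      by (intro smooth_in_mult smooth_in_inverse nz assms(1,3) smooth_inD(2))
    have "smooth_in S (pd (\<lambda>x. ln (f x)) i)" for i
      by (rule smooth_in_cong[OF assms(1) _ c[of i]]) (use pd_eqI[OF d] in \<open>simp add: pd_def\<close>)
    then show ?thesis using d unfolding Cm_on.simps differentiable_def smooth_in_def by blast
  qed
  then show ?thesis unfolding smooth_in_def using Cm_on_SucD by blast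
qed

lemma smooth_in_powr:
  fixes f :: "real^'n \<Rightarrow> real"
  assumes "open S" "\<And>x. x \<in> S \<Longrightarrow> f x > 0" "smooth_in S f"
  shows "smooth_in S (\<lambda>x. f x powr a)"
proof -
  have c: "smooth_in S (\<lambda>x. exp (a * ln (f x)))"
    by (intro smooth_in_exp smooth_in_mult smooth_in_ln smooth_in_const assms)
  show ?thesis
    by (rule smooth_in_cong[OF assms(1) _ c]) (use assms(2) in \<open>fastforce simp: powr_def\<close>)
qed

section \<open>Smooth functions of one real variable\<close>

fun Cm_real :: "nat \<Rightarrow> (real \<Rightarrow> real) \<Rightarrow> bool" where
  "Cm_real 0 g = True"
| "Cm_real (Suc m) g = (\<exists>g'. (\<forall>t. (g has_real_derivative g' t) (at t)) \<and> Cm_real m g')"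

definition smooth_real :: "(real \<Rightarrow> real) \<Rightarrow> bool" where "smooth_real g \<longleftrightarrow> (\<forall>m. Cm_real m g)"

lemma Cm_real_SucD: "Cm_real (Suc m) g \<Longrightarrow> Cm_real m g"
proof (induction m arbitrary: g)
  case (Suc m)
  then obtain g' where "\<forall>t. (g has_real_derivative g' t) (at t)" "Cm_real (Suc m) g'" by auto
  then show ?case using Suc.IH[of g'] by auto
qed simp

lemma Cm_real_const: "Cm_real m (\<lambda>t. c)"
  by (induction m arbitrary: c) (auto intro!: exI[of _ "\<lambda>t. 0"] derivative_eq_intros)

lemma Cm_real_compose_affine: "Cm_real m g \<Longrightarrow> Cm_real m (\<lambda>t. c * g (a * t + b))"
proof (induction m arbitrary: g c)
  case (Suc m)
  then obtain g' where g': "\<And>t. (g has_real_derivative g' t) (at t)" "Cm_real m g'" by auto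
  have "((\<lambda>t. c * g (a * t + b)) has_real_derivative c * a * g' (a * t + b)) (at t)" for t
  proof -
    have "((\<lambda>t. a * t + b) has_real_derivative a) (at t)" by (auto intro!: derivative_eq_intros)
    from DERIV_cmult[OF DERIV_chain2[OF g'(1) this], of c] show ?thesis by (simp add: mult_ac)
  qed
  then show ?case using Suc.IH[OF g'(2), of "c * a"] unfolding Cm_real.simps
    by (intro exI[of _ "\<lambda>t. c * a * g' (a * t + b)"]) simp
qed simp

lemma Cm_real_add: "Cm_real m f \<Longrightarrow> Cm_real m g \<Longrightarrow> Cm_real m (\<lambda>t. f t + g t)"
proof (induction m arbitrary: f g)
  case (Suc m)
  then obtain f' g' where "\<And>t. (f has_real_derivative f' t) (at t)" "Cm_real m f'"
    "\<And>t. (g has_real_derivative g' t) (at t)" "Cm_real m g'" by auto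
  then show ?case using Suc.IH[of f' g'] by (auto intro!: exI[of _ "\<lambda>t. f' t + g' t"] derivative_eq_intros)
qed simp

lemma Cm_real_mult: "Cm_real m f \<Longrightarrow> Cm_real m g \<Longrightarrow> Cm_real m (\<lambda>t. f t * g t)"
proof (induction m arbitrary: f g)
  case (Suc m)
  then obtain f' g' where *: "\<And>t. (f has_real_derivative f' t) (at t)" "Cm_real m f'"
    "\<And>t. (g has_real_derivative g' t) (at t)" "Cm_real m g'" by auto
  have "Cm_real m (\<lambda>t. f' t * g t + f t * g' t)"
    using * Suc.IH Cm_real_SucD[OF Suc.prems(1)] Cm_real_SucD[OF Suc.prems(2)] by (intro Cm_real_add) auto
  moreover have "((\<lambda>t. f t * g t) has_real_derivative f' t * g t + f t * g' t) (at t)" for t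
    using *(1,3) by (auto intro!: derivative_eq_intros)
  ultimately show ?case by (auto intro!: exI[of _ "\<lambda>t. f' t * g t + f t * g' t"])
qed simp

lemma Cm_real_inverse:
  assumes "\<And>t. f t \<noteq> 0"
  shows "Cm_real m f \<Longrightarrow> Cm_real m (\<lambda>t. inverse (f t))"
proof (induction m)
  case (Suc m)
  obtain f' where *: "\<And>t. (f has_real_derivative f' t) (at t)" "Cm_real m f'" using Suc.prems by auto
  have "Cm_real m (\<lambda>t. inverse (f t))" by (rule Suc.IH[OF Cm_real_SucD[OF Suc.prems]])
  then have c: "Cm_real m (\<lambda>t. (-1) * f' t * (inverse (f t) * inverse (f t)))"
    using *(2) Cm_real_mult[of m "\<lambda>t. (-1) * f' t" "\<lambda>t. inverse (f t) * inverse (f t)"]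
      Cm_real_mult[of m "\<lambda>t. -1" f'] Cm_real_mult[of m "\<lambda>t. inverse (f t)" "\<lambda>t. inverse (f t)"] Cm_real_const[of m "-1"] by blast
  have d: "((\<lambda>t. inverse (f t)) has_real_derivative (-1) * f' t * (inverse (f t) * inverse (f t))) (at t)" for t
    using DERIV_inverse'[OF *(1)[of t] assms[of t]] by (simp add: mult_ac)
  show ?case unfolding Cm_real.simps by (rule exI[of _ "\<lambda>t. (-1) * f' t * (inverse (f t) * inverse (f t))"]) (use c d in blast)
qed simp

lemma smooth_real_deriv:
  assumes "smooth_real g"
  shows "(g has_real_derivative deriv g t) (at t)" "smooth_real (deriv g)"
proof -
  have d: "(g has_real_derivative deriv g t) (at t)" for t
    using assms unfolding smooth_real_def by (metis Cm_real.simps(2) DERIV_imp_deriv)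
  then show "(g has_real_derivative deriv g t) (at t)" .
  have "Cm_real m (deriv g)" for m
  proof -
    obtain g' where *: "\<And>t. (g has_real_derivative g' t) (at t)" "Cm_real m g'"
      using assms unfolding smooth_real_def by (metis Cm_real.simps(2))
    have "g' = deriv g" using *(1) DERIV_imp_deriv by (metis ext)
    then show ?thesis using * by simp
  qed
  then show "smooth_real (deriv g)" by (simp add: smooth_real_def)
qed

text \<open>The iterated derivatives of \<open>g\<close> form the chain that
  \<open>smooth_in_compose\<close> asks for.\<close>

lemma smooth_in_compose_real:
  assumes "open S" "smooth_in S f" "smooth_real g"
  shows "smooth_in S (\<lambda>x. g (f x))"
proof -
  have "smooth_real ((deriv ^^ j) g)" for j by (induction j) (auto simp: assms smooth_real_deriv)
  then show ?thesis
    using smooth_in_compose[OF assms(1,2), of "\<lambda>j. (deriv ^^ j) g" 0] smooth_real_deriv(1) by auto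
qed

lemma smooth_real_continuous: "smooth_real g \<Longrightarrow> continuous_on UNIV g"
  using smooth_real_deriv(1) by (meson DERIV_isCont continuous_at_imp_continuous_on)

subsection \<open>A smooth step function\<close>

definition flat :: "real \<Rightarrow> real" where "flat t = (if t \<le> 0 then 0 else exp (- (1 / t)))"

lemma poly_exp_tendsto_0: "((\<lambda>x. poly p x * exp (- x)) \<longlongrightarrow> (0::real)) at_top"
proof -
  have "((\<lambda>x. \<Sum>i\<le>degree p. coeff p i * (x ^ i / exp x)) \<longlongrightarrow> (\<Sum>i\<le>degree p. coeff p i * 0)) at_top"
    by (intro tendsto_sum tendsto_mult tendsto_const tendsto_power_div_exp_0)
  then show ?thesis by (simp add: poly_altdef sum_distrib_right exp_minus divide_inverse mult.assoc)
qed

text \<open>Functions \<open>p(1/t) exp(-1/t)\<close>, extended by 0, are closed under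
  differentiation: the chain rule gives \<open>t^-2 (p - p')(1/t) exp(-1/t)\<close>, and
  \<open>monom 1 2\<close> is the factor \<open>t^-2\<close>. At 0 the difference quotient is again
  of this form, with \<open>pCons 0 p\<close> absorbing the division by \<open>t\<close>, and it
  tends to 0. So one induction over all polynomials yields every derivative of
  \<open>flat\<close>.\<close>

lemma flat_poly_deriv:
  fixes p :: "real poly"
  defines "F \<equiv> \<lambda>p t. if t \<le> 0 then 0 else poly p (1 / t) * exp (- (1 / t))"
  shows "(F p has_real_derivative F (monom 1 2 * (p - pderiv p)) t) (at t)"
proof (cases t "0::real" rule: linorder_cases)
  case less
  have "((\<lambda>t. 0) has_real_derivative 0) (at t)" by simp
  then have "(F p has_real_derivative 0) (at t)"
    by (rule has_field_derivative_transform_within_open[where S = "{..<0}"]) (use less in \<open>auto simp: F_def\<close>)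
  then show ?thesis using less by (simp add: F_def)
next
  case greater
  have "((\<lambda>t. poly p (1 / t) * exp (- (1 / t))) has_real_derivative
      F (monom 1 2 * (p - pderiv p)) t) (at t)"
    using greater by (auto intro!: derivative_eq_intros poly_DERIV DERIV_chain2[where f = "poly p"]
        simp: F_def poly_monom field_simps power2_eq_square)
  then show ?thesis
    by (rule has_field_derivative_transform_within_open[where S = "{0<..}"]) (use greater in \<open>auto simp: F_def\<close>)
next
  case equal
  have "((\<lambda>t. poly (pCons 0 p) (inverse t) * exp (- inverse t)) \<longlongrightarrow> 0) (at_right 0)"
    using filterlim_compose[OF poly_exp_tendsto_0 filterlim_inverse_at_top_right, of "pCons 0 p"] .
  then have r: "((\<lambda>t. F p t / t) \<longlongrightarrow> 0) (at_right 0)"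
    by (rule filterlim_cong[THEN iffD1, rotated -1])
      (auto simp: F_def eventually_at_right_field divide_inverse intro!: exI[of _ 1])
  have "((\<lambda>t. 0) \<longlongrightarrow> (0::real)) (at_left (0::real))" by simp
  then have l: "((\<lambda>t. F p t / t) \<longlongrightarrow> 0) (at_left 0)"
    by (rule filterlim_cong[THEN iffD1, rotated -1])
      (auto simp: F_def eventually_at_left_field intro!: exI[of _ "-1"])
  have "((\<lambda>t. F p t / t) \<longlongrightarrow> 0) (at 0)" using l r by (simp add: filterlim_at_split)
  then show ?thesis using equal by (simp add: has_field_derivative_iff F_def)
qed

lemma smooth_real_flat: "smooth_real flat"
proof -
  have "Cm_real m (\<lambda>t. if t \<le> 0 then 0 else poly p (1 / t) * exp (- (1 / t)))" for m p
  proof (induction m arbitrary: p)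
    case (Suc m)
    show ?case unfolding Cm_real.simps
      by (rule exI[of _ "\<lambda>t. if t \<le> 0 then 0 else poly (monom 1 2 * (p - pderiv p)) (1 / t) * exp (- (1 / t))"])
        (use flat_poly_deriv[of p] Suc in blast)
  qed simp
  from this[of _ "1 :: real poly"] show ?thesis unfolding smooth_real_def flat_def[abs_def] poly_1 mult_1 by blast
qed

lemma flat_nonneg: "flat t \<ge> 0" and flat_pos: "t > 0 \<Longrightarrow> flat t > 0" and flat_0: "t \<le> 0 \<Longrightarrow> flat t = 0"
  by (auto simp: flat_def)

text \<open>Smooth transition from 0 on the negative axis to 1 beyond 1, from which the cutoffs with
  a plateau are built. The denominator is positive because \<open>t\<close> and \<open>1 - t\<close>
  are never both nonpositive.\<close>

definition step :: "real \<Rightarrow> real" where "step t = flat t / (flat t + flat (1 - t))"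

lemma step_den: "flat t + flat (1 - t) > 0"
proof (cases "t > 0")
  case True then show ?thesis using flat_pos[of t] flat_nonneg[of "1-t"] by linarith
next
  case False then show ?thesis using flat_nonneg[of t] flat_pos[of "1-t"] by linarith
qed

lemma step_0: "t \<le> 0 \<Longrightarrow> step t = 0" and step_1: "t \<ge> 1 \<Longrightarrow> step t = 1"
  using step_den[of t] by (auto simp: step_def flat_0)

lemma smooth_real_step: "smooth_real step"
  unfolding smooth_real_def
proof
  fix m
  have f: "Cm_real m flat" using smooth_real_flat by (simp add: smooth_real_def)
  have g: "Cm_real m (\<lambda>t. 1 * flat ((-1) * t + 1))" by (rule Cm_real_compose_affine[OF f])
  have "Cm_real m (\<lambda>t. flat t * inverse (flat t + 1 * flat ((-1) * t + 1)))"
  proof (rule Cm_real_mult[OF f Cm_real_inverse[OF _ Cm_real_add[OF f g]]])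
    show "flat t + 1 * flat ((-1) * t + 1) \<noteq> 0" for t using step_den[of t] by (simp add: add.commute)
  qed
  moreover have "(\<lambda>t. flat t * inverse (flat t + 1 * flat ((-1) * t + 1))) = step"
    by (auto simp: step_def divide_inverse)
  ultimately show "Cm_real m step" by simp
qed

section \<open>Mean value theorem along lines and symmetry of second derivatives\<close>

lemma frechet_pd:
  fixes f :: "real^'n \<Rightarrow> 'b::real_normed_vector"
  assumes "f differentiable at x"
  shows "frechet_derivative f (at x) v = (\<Sum>i\<in>UNIV. (v $ i) *\<^sub>R pd f i x)"
proof -
  have l: "linear (frechet_derivative f (at x))" using assms by (rule linear_frechet_derivative)
  have "v = (\<Sum>i\<in>UNIV. (v $ i) *\<^sub>R axis i 1)"
    using basis_expansion[of v] by (simp add: scalar_mult_eq_scaleR)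
  then have "frechet_derivative f (at x) v = frechet_derivative f (at x) (\<Sum>i\<in>UNIV. (v $ i) *\<^sub>R axis i 1)"
    by simp
  also have "\<dots> = (\<Sum>i\<in>UNIV. (v $ i) *\<^sub>R frechet_derivative f (at x) (axis i 1))"
    by (simp add: linear_sum[OF l] linear_scale[OF l])
  finally show ?thesis by (simp add: pd_def)
qed

lemma line_derivative:
  fixes f :: "real^'n \<Rightarrow> real"
  assumes "f differentiable at (z + t *\<^sub>R v)"
  shows "((\<lambda>t. f (z + t *\<^sub>R v)) has_real_derivative (\<Sum>i\<in>UNIV. v $ i * pd f i (z + t *\<^sub>R v))) (at t)"
proof -
  have "((\<lambda>t. z + t *\<^sub>R v) has_derivative (\<lambda>t. t *\<^sub>R v)) (at t)" by (auto intro!: derivative_eq_intros)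
  from has_derivative_compose[OF this assms[unfolded frechet_derivative_works]]
  have "((\<lambda>t. f (z + t *\<^sub>R v)) has_derivative (\<lambda>s. (\<Sum>i\<in>UNIV. v $ i * pd f i (z + t *\<^sub>R v)) * s)) (at t)"
    unfolding frechet_pd[OF assms] by (simp add: sum_distrib_right sum_distrib_left mult_ac)
  then show ?thesis unfolding has_field_derivative_def .
qed

lemma mean_value_line:
  fixes f :: "real^'n \<Rightarrow> real"
  assumes "\<And>t. 0 \<le> t \<Longrightarrow> t \<le> 1 \<Longrightarrow> f differentiable at (z + t *\<^sub>R v)"
  obtains t where "0 < t" "t < 1" "f (z + v) - f z = (\<Sum>i\<in>UNIV. v $ i * pd f i (z + t *\<^sub>R v))"
proof -
  obtain t where "0 < t" "t < 1" "f (z + 1 *\<^sub>R v) - f (z + 0 *\<^sub>R v) = (1 - 0) * (\<Sum>i\<in>UNIV. v $ i * pd f i (z + t *\<^sub>R v))"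
    using MVT2[of 0 1 "\<lambda>t. f (z + t *\<^sub>R v)" "\<lambda>t. \<Sum>i\<in>UNIV. v $ i * pd f i (z + t *\<^sub>R v)"] line_derivative[OF assms] by auto
  then show ?thesis using that by auto
qed

text \<open>The mean value theorem is applied in direction \<open>i\<close> and then in direction
  \<open>j\<close>. The second difference itself is symmetric in \<open>i\<close> and
  \<open>j\<close>, so exchanging them represents the same number by the other mixed derivative at
  another nearby point; continuity then gives \<open>pd_commute\<close>.\<close>

lemma second_difference:
  fixes f :: "real^'n \<Rightarrow> real"
  assumes S: "smooth_in S f" and h: "0 < h" and sub: "cball x (2 * h) \<subseteq> S"
  shows "\<exists>y\<in>cball x (2 * h). f (x + h *\<^sub>R axis i 1 + h *\<^sub>R axis j 1) - f (x + h *\<^sub>R axis i 1) - f (x + h *\<^sub>R axis j 1) + f x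
     = h\<^sup>2 * pd (pd f i) j y"
proof -
  have mem: "x + t *\<^sub>R axis i 1 + s *\<^sub>R axis j 1 \<in> cball x (2*h)" if "0 \<le> t" "t \<le> h" "0 \<le> s" "s \<le> h" for s t
  proof -
    have "norm (t *\<^sub>R (axis i 1::real^'n) + s *\<^sub>R axis j 1) \<le> t + s"
      using norm_triangle_ineq[of "t *\<^sub>R (axis i 1::real^'n)" "s *\<^sub>R axis j 1"] that by simp
    then show ?thesis using that norm_minus_cancel[of "t *\<^sub>R (axis i 1::real^'n) + s *\<^sub>R axis j 1"]
      by (simp add: dist_norm algebra_simps)
  qed
  have mem0: "x + t *\<^sub>R axis i 1 \<in> cball x (2*h)" if "0 \<le> t" "t \<le> h" for t using mem[of t 0] that h by simp
  have D: "((\<lambda>t. f (x + t *\<^sub>R axis i 1 + h *\<^sub>R axis j 1) - f (x + t *\<^sub>R axis i 1)) has_real_derivative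
      pd f i (x + t *\<^sub>R axis i 1 + h *\<^sub>R axis j 1) - pd f i (x + t *\<^sub>R axis i 1)) (at t)" if t: "0 \<le> t" "t \<le> h" for t
  proof (rule DERIV_diff)
    have "f differentiable at ((x + h *\<^sub>R axis j 1) + t *\<^sub>R axis i 1)"
      using smooth_inD(1)[OF S, of "x + h *\<^sub>R axis j 1 + t *\<^sub>R axis i 1"] mem[of t h] t h sub by (auto simp: add_ac)
    from line_derivative[OF this]
    show "((\<lambda>t. f (x + t *\<^sub>R axis i 1 + h *\<^sub>R axis j 1)) has_real_derivative pd f i (x + t *\<^sub>R axis i 1 + h *\<^sub>R axis j 1)) (at t)"
      by (simp add: axis_def add_ac if_distrib if_distribR sum.delta cong: if_cong)
    have "f differentiable at (x + t *\<^sub>R axis i 1)"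
      using smooth_inD(1)[OF S, of "x + t *\<^sub>R axis i 1"] mem0[of t] t h sub by (auto simp: add_ac)
    from line_derivative[OF this]
    show "((\<lambda>t. f (x + t *\<^sub>R axis i 1)) has_real_derivative pd f i (x + t *\<^sub>R axis i 1)) (at t)"
      by (simp add: axis_def add_ac if_distrib if_distribR sum.delta cong: if_cong)
  qed
  obtain t where t: "0 < t" "t < h" "f (x + h *\<^sub>R axis i 1 + h *\<^sub>R axis j 1) - f (x + h *\<^sub>R axis i 1) -
      (f (x + 0 *\<^sub>R axis i 1 + h *\<^sub>R axis j 1) - f (x + 0 *\<^sub>R axis i 1)) =
      (h - 0) * (pd f i (x + t *\<^sub>R axis i 1 + h *\<^sub>R axis j 1) - pd f i (x + t *\<^sub>R axis i 1))"
    using MVT2[OF h, of "\<lambda>t. f (x + t *\<^sub>R axis i 1 + h *\<^sub>R axis j 1) - f (x + t *\<^sub>R axis i 1)", OF D] by metis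
  have D2: "((\<lambda>s. pd f i (x + t *\<^sub>R axis i 1 + s *\<^sub>R axis j 1)) has_real_derivative
     pd (pd f i) j (x + t *\<^sub>R axis i 1 + s *\<^sub>R axis j 1)) (at s)" if s: "0 \<le> s" "s \<le> h" for s
  proof -
    have "pd f i differentiable at (x + t *\<^sub>R axis i 1 + s *\<^sub>R axis j 1)"
      using smooth_inD(1)[OF smooth_inD(2)[OF S]] mem[of t s] t s sub by auto
    from line_derivative[OF this] show ?thesis
      by (simp add: axis_def add_ac if_distrib if_distribR sum.delta cong: if_cong)
  qed
  obtain s where s: "0 < s" "s < h" "pd f i (x + t *\<^sub>R axis i 1 + h *\<^sub>R axis j 1) - pd f i (x + t *\<^sub>R axis i 1 + 0 *\<^sub>R axis j 1)
      = (h - 0) * pd (pd f i) j (x + t *\<^sub>R axis i 1 + s *\<^sub>R axis j 1)"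
    using MVT2[OF h, of "\<lambda>s. pd f i (x + t *\<^sub>R axis i 1 + s *\<^sub>R axis j 1)", OF D2] by metis
  show ?thesis
    by (rule bexI[of _ "x + t *\<^sub>R axis i 1 + s *\<^sub>R axis j 1"]) (use t s mem[of t s] in \<open>auto simp: power2_eq_square algebra_simps\<close>)
qed

lemma pd_commute:
  fixes f :: "real^'n \<Rightarrow> real"
  assumes "open S" "smooth_in S f" "x \<in> S"
  shows "pd (pd f i) j x = pd (pd f j) i x"
proof -
  have lim: "\<exists>y z. y \<in> cball x r \<and> z \<in> cball x r \<and> y \<in> S \<and> z \<in> S \<and> pd (pd f i) j y = pd (pd f j) i z" if r: "r > 0" for r
  proof -
    obtain e where e: "e > 0" "cball x e \<subseteq> S" using assms(1,3) open_contains_cball by blast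
    define h where "h = min r e / 2"
    have h: "0 < h" "cball x (2*h) \<subseteq> S" "cball x (2*h) \<subseteq> cball x r" using e r by (auto simp: h_def)
    obtain y where y: "y \<in> cball x (2*h)" "f (x + h *\<^sub>R axis i 1 + h *\<^sub>R axis j 1) - f (x + h *\<^sub>R axis i 1) - f (x + h *\<^sub>R axis j 1) + f x
     = h\<^sup>2 * pd (pd f i) j y" using second_difference[OF assms(2) h(1,2)] by blast
    obtain z where z: "z \<in> cball x (2*h)" "f (x + h *\<^sub>R axis j 1 + h *\<^sub>R axis i 1) - f (x + h *\<^sub>R axis j 1) - f (x + h *\<^sub>R axis i 1) + f x
     = h\<^sup>2 * pd (pd f j) i z" using second_difference[OF assms(2) h(1,2)] by blast
    have "h\<^sup>2 * pd (pd f i) j y = h\<^sup>2 * pd (pd f j) i z" using y(2) z(2) by (simp add: algebra_simps)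
    then have "pd (pd f i) j y = pd (pd f j) i z" using h(1) by simp
    then show ?thesis using y(1) z(1) h by blast
  qed
  have c: "continuous_on S (pd (pd f i) j)" "continuous_on S (pd (pd f j) i)"
    using assms(2) smooth_inD by blast+
  show ?thesis
  proof (rule ccontr)
    assume "pd (pd f i) j x \<noteq> pd (pd f j) i x"
    define e where "e = \<bar>pd (pd f i) j x - pd (pd f j) i x\<bar> / 2"
    have e: "e > 0" using \<open>pd (pd f i) j x \<noteq> pd (pd f j) i x\<close> by (simp add: e_def)
    obtain d1 where d1: "d1 > 0" "\<And>y. y \<in> S \<Longrightarrow> dist y x < d1 \<Longrightarrow> \<bar>pd (pd f i) j y - pd (pd f i) j x\<bar> < e"
      using c(1) assms(3) e unfolding continuous_on_iff dist_real_def by meson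
    obtain d2 where d2: "d2 > 0" "\<And>y. y \<in> S \<Longrightarrow> dist y x < d2 \<Longrightarrow> \<bar>pd (pd f j) i y - pd (pd f j) i x\<bar> < e"
      using c(2) assms(3) e unfolding continuous_on_iff dist_real_def by meson
    obtain y z where yz: "y \<in> cball x (min d1 d2 / 2)" "z \<in> cball x (min d1 d2 / 2)" "y \<in> S" "z \<in> S" "pd (pd f i) j y = pd (pd f j) i z"
      using lim[of "min d1 d2 / 2"] d1(1) d2(1) by auto
    then have "\<bar>pd (pd f i) j y - pd (pd f i) j x\<bar> < e" "\<bar>pd (pd f j) i z - pd (pd f j) i x\<bar> < e"
      using d1(1) d2(1) d1(2)[OF yz(3)] d2(2)[OF yz(4)] yz(1,2) by (auto simp: dist_commute)
    then show False using yz(5) unfolding e_def by argo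
  qed
qed

subsection \<open>Integration by parts and mollification\<close>

text \<open>The sum of \<open>laplacian\<close> with a polymorphic codomain: test functions and the
  Carleman estimates are real valued, waves and exponentials complex.\<close>

definition lap :: "(real^'n \<Rightarrow> 'b::real_normed_vector) \<Rightarrow> real^'n \<Rightarrow> 'b" where
  "lap f x = (\<Sum>i\<in>UNIV. pd (pd f i) i x)"

lemma integrable_cont_supp:
  fixes f :: "real^'n \<Rightarrow> 'b::euclidean_space"
  assumes "continuous_on UNIV f" "\<And>x. norm x > M \<Longrightarrow> f x = 0"
  shows "integrable lborel f"
proof -
  have "integrable lborel (\<lambda>x. indicator (cball 0 M) x *\<^sub>R f x)"
    by (rule borel_integrable_compact[OF compact_cball]) (rule continuous_on_subset[OF assms(1)], simp)
  moreover have "(\<lambda>x. indicator (cball 0 M) x *\<^sub>R f x) = f"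
    using assms(2) by (auto simp: indicator_def fun_eq_iff not_le)
  ultimately show ?thesis by simp
qed

lemma integral_translate:
  fixes f :: "real^'n \<Rightarrow> 'b::euclidean_space"
  shows "(\<integral>x. f (x + c) \<partial>lborel) = (\<integral>x. f x \<partial>lborel)"
proof (cases "f \<in> borel_measurable borel")
  case True
  have "(\<integral>x. f x \<partial>lborel) = (\<integral>x. f x \<partial>(distr lborel borel ((+) c)))" by (simp add: lborel_distr_plus)
  also have "\<dots> = (\<integral>x. f (c + x) \<partial>lborel)" by (rule integral_distr) (use True in auto)
  finally show ?thesis by (simp add: add.commute)
next
  \<comment> \<open>A non-measurable integrand is not integrable, and neither is its translate; both
    integrals then have the default value 0. The lemma can thus be stated without any hypothesis on
    \<open>f\<close>.\<close>
  case False
  have "(\<lambda>x. f (x + c)) \<notin> borel_measurable borel"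
  proof
    assume m: "(\<lambda>x. f (x + c)) \<in> borel_measurable borel"
    have "(\<lambda>x::real^'n. x - c) \<in> borel_measurable borel" by measurable
    from measurable_compose[OF this m] show False using False by simp
  qed
  then show ?thesis using False by (metis borel_measurable_integrable measurable_lborel2 not_integrable_integral_eq)
qed

lemma integrable_translate:
  fixes f :: "real^'n \<Rightarrow> 'b::euclidean_space"
  assumes "integrable lborel f" shows "integrable lborel (\<lambda>x. f (x + c))"
proof -
  have "integrable (distr lborel borel ((+) c)) f" using assms by (simp add: lborel_distr_plus)
  then have "integrable lborel (\<lambda>x. f (c + x))" by (subst (asm) integrable_distr_eq) (use assms in auto)
  then show ?thesis by (simp add: add.commute)
qed

lemma pd_zero_outside:
  fixes f :: "real^'n \<Rightarrow> 'b::real_normed_vector"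
  assumes "\<And>x. norm x > M \<Longrightarrow> f x = 0" "norm x > M" shows "pd f i x = 0"
proof -
  have "open {x::real^'n. norm x > M}" by (intro open_Collect_less continuous_intros)
  then have "pd f i x = pd (\<lambda>x. 0) i x" by (rule pd_cong_open) (use assms in auto)
  then show ?thesis by simp
qed

lemma bounded_of_supp:
  fixes f :: "real^'n \<Rightarrow> real"
  assumes "continuous_on UNIV f" "\<And>x. norm x > M \<Longrightarrow> f x = 0"
  obtains B where "B > 0" "\<And>x. \<bar>f x\<bar> \<le> B"
proof -
  have "bounded (f ` cball 0 M)"
    by (intro compact_imp_bounded compact_continuous_image continuous_on_subset[OF assms(1)]) auto
  then obtain B where B: "B > 0" "\<And>x. x \<in> cball 0 M \<Longrightarrow> \<bar>f x\<bar> \<le> B"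
    unfolding bounded_pos by (metis imageI real_norm_def)
  have "\<bar>f x\<bar> \<le> B" for x using assms(2)[of x] B by (cases "norm x \<le> M") auto
  then show ?thesis using that B(1) by blast
qed

text \<open>Translation invariance makes every difference quotient of \<open>f\<close> integrate to
  0. The quotients converge to the partial derivative, and by the mean value theorem they are
  dominated by its supremum on a fixed ball. No iterated integrals are involved.\<close>

theorem integral_pd_zero:
  fixes f :: "real^'n \<Rightarrow> real"
  assumes diff: "\<And>x. f differentiable at x" and cont: "continuous_on UNIV (pd f i)"
    and supp: "\<And>x. norm x > M \<Longrightarrow> f x = 0"
  shows "integrable lborel (pd f i)" "(\<integral>x. pd f i x \<partial>lborel) = 0"
proof -
  have fc: "continuous_on UNIV f"
    using diff by (auto intro!: continuous_at_imp_continuous_on differentiable_imp_continuous_within)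
  have fi: "integrable lborel f" using integrable_cont_supp[OF fc supp] .
  show int: "integrable lborel (pd f i)" by (rule integrable_cont_supp[OF cont pd_zero_outside]) (use supp in auto)
  obtain B where B: "B > 0" "\<And>x. \<bar>pd f i x\<bar> \<le> B"
    using bounded_of_supp[OF cont pd_zero_outside[of M f]] supp by metis
  define h where "h m = inverse (real (Suc m))" for m
  have h: "0 < h m" "h m \<le> 1" for m by (auto simp: h_def field_simps)
  have hlim: "h \<longlonglongrightarrow> 0" unfolding h_def by (rule LIMSEQ_inverse_real_of_nat)
  define q where "q m x = (f (x + h m *\<^sub>R axis i 1) - f x) / h m" for m x
  have line: "((\<lambda>t. f (x + t *\<^sub>R axis i 1)) has_real_derivative pd f i (x + t *\<^sub>R axis i 1)) (at t)" for x t
    using line_derivative[OF diff, where z = x and t = t and v = "axis i 1"]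
    by (simp add: axis_def if_distrib if_distribR sum.delta cong: if_cong)
  have mvt: "\<exists>t. q m x = pd f i (x + t *\<^sub>R axis i 1)" for m x
  proof -
    obtain t where "f (x + h m *\<^sub>R axis i 1) - f (x + 0 *\<^sub>R axis i 1) = (h m - 0) * pd f i (x + t *\<^sub>R axis i 1)"
      using MVT2[OF h(1)[of m], of "\<lambda>t. f (x + t *\<^sub>R axis i 1)", OF line] by metis
    then show ?thesis using h(1)[of m] by (auto simp: q_def field_simps)
  qed
  \<comment> \<open>The step sizes are at most 1, so all quotients vanish off one ball;
    \<open>\<bar>M\<bar>\<close> covers a negative \<open>M\<close>.\<close>
  have qsupp: "q m x = 0" if "norm x > \<bar>M\<bar> + 1" for m x
  proof -
    have "norm (x + h m *\<^sub>R axis i 1) \<ge> norm x - norm (h m *\<^sub>R (axis i 1 :: real^'n))"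
      using norm_diff_ineq[of x "h m *\<^sub>R axis i 1"] by simp
    then have "norm (x + h m *\<^sub>R axis i 1) > M" using that h[of m] by simp
    then show ?thesis using supp[of x] supp[of "x + h m *\<^sub>R axis i 1"] that by (simp add: q_def)
  qed
  have "(\<lambda>m. \<integral>x. q m x \<partial>lborel) \<longlonglongrightarrow> (\<integral>x. pd f i x \<partial>lborel)"
  proof (rule integral_dominated_convergence[where w = "\<lambda>x. indicator (cball 0 (\<bar>M\<bar> + 1)) x *\<^sub>R B"])
    show "integrable lborel (\<lambda>x::real^'n. indicator (cball 0 (\<bar>M\<bar> + 1)) x *\<^sub>R B)"
      by (rule borel_integrable_compact) auto
    show "AE x in lborel. (\<lambda>m. q m x) \<longlonglongrightarrow> pd f i x"
    proof (rule AE_I2)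
      fix x
      have "((\<lambda>t. (f (x + t *\<^sub>R axis i 1) - f x) / t) \<longlongrightarrow> pd f i x) (at 0)"
        using line[of x 0] by (simp add: has_field_derivative_iff)
      moreover have "filterlim h (at 0) sequentially"
        using hlim h(1) by (auto simp: filterlim_at less_imp_neq[symmetric])
      ultimately show "(\<lambda>m. q m x) \<longlonglongrightarrow> pd f i x" unfolding q_def by (rule filterlim_compose)
    qed
    show "AE x in lborel. norm (q m x) \<le> indicator (cball 0 (\<bar>M\<bar> + 1)) x *\<^sub>R B" for m
    proof (rule AE_I2)
      fix x
      show "norm (q m x) \<le> indicator (cball 0 (\<bar>M\<bar> + 1)) x *\<^sub>R B"
        using mvt[of m x] B(2) qsupp[of x m] by (cases "norm x \<le> \<bar>M\<bar> + 1") auto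
    qed
    have "continuous_on UNIV (q m)" for m
      unfolding q_def using h(1)[of m] by (intro continuous_intros continuous_on_compose2[OF fc]) auto
    then show "q m \<in> borel_measurable lborel" for m by (simp add: borel_measurable_continuous_onI)
    show "pd f i \<in> borel_measurable lborel" using int by auto
  qed
  moreover have "(\<integral>x. q m x \<partial>lborel) = 0" for m
    unfolding q_def using integral_translate[of f "h m *\<^sub>R axis i 1"] integrable_translate[OF fi, of "h m *\<^sub>R axis i 1"] fi
    by simp
  ultimately show "(\<integral>x. pd f i x \<partial>lborel) = 0" by (simp add: LIMSEQ_const_iff)
qed

section \<open>Test functions\<close>

lemma test_functionD:
  assumes "test_function \<eta>"
  shows "smooth_in UNIV \<eta>" "\<eta> differentiable at x" "continuous_on UNIV \<eta>"
  using assms by (auto simp: test_function_def smooth_iff intro: smooth_inD)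

lemma test_function_supp:
  assumes "test_function \<eta>" obtains M where "M > 0" "\<And>x. norm x > M \<Longrightarrow> \<eta> x = 0"
  using assms unfolding test_function_def bounded_pos by (metis leD mem_Collect_eq)

lemma test_functionI:
  assumes "smooth_in UNIV \<eta>" "\<And>x. norm x > M \<Longrightarrow> \<eta> x = 0" shows "test_function \<eta>"
  using assms unfolding test_function_def smooth_iff bounded_iff by (metis linorder_not_less mem_Collect_eq)

lemma test_function_pd: assumes "test_function \<eta>" shows "test_function (pd \<eta> i)"
  by (rule test_function_supp[OF assms], rule test_functionI[OF smooth_inD(2)[OF test_functionD(1)[OF assms]] pd_zero_outside])

lemma test_function_add:
  assumes "test_function f" "test_function g" shows "test_function (\<lambda>x. f x + g x)"
proof -
  obtain M where M: "\<And>x. norm x > M \<Longrightarrow> f x = 0" using test_function_supp[OF assms(1)] by metis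
  obtain N where N: "\<And>x. norm x > N \<Longrightarrow> g x = 0" using test_function_supp[OF assms(2)] by metis
  show ?thesis
    by (rule test_functionI[where M = "max M N",
          OF smooth_in_add[OF open_UNIV test_functionD(1)[OF assms(1)] test_functionD(1)[OF assms(2)]]])
      (simp add: M N)
qed

lemma test_function_mult:
  assumes "test_function f" "smooth_in UNIV g" shows "test_function (\<lambda>x. f x * g x)"
  by (rule test_function_supp[OF assms(1)], rule test_functionI[OF smooth_in_mult[OF open_UNIV test_functionD(1)[OF assms(1)] assms(2)]]) auto

lemma test_function_0: "test_function (\<lambda>x. 0)"
  by (rule test_functionI[where M = 0]) auto

lemma test_function_sum:
  assumes "\<And>a. test_function (f a)" shows "test_function (\<lambda>x. \<Sum>a\<in>A. f a x)"
proof (induction A rule: infinite_finite_induct)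
  case (insert a A)
  then show ?case using test_function_add[OF assms[of a] insert.IH] by simp
qed (use test_function_0 in simp_all)

lemma test_function_lap: "test_function \<eta> \<Longrightarrow> test_function (lap \<eta>)"
  unfolding lap_def[abs_def] by (intro test_function_sum test_function_pd)

lemma test_lipschitz:
  fixes \<eta> :: "real^'n \<Rightarrow> real"
  assumes "test_function \<eta>"
  obtains B where "B \<ge> 0" "\<And>z v. \<bar>\<eta> (z + v) - \<eta> z\<bar> \<le> B * norm v"
proof -
  have "\<exists>B>0. \<forall>x. \<bar>pd \<eta> i x\<bar> \<le> B" for i
  proof -
    obtain M where M: "\<And>x. norm x > M \<Longrightarrow> pd \<eta> i x = 0" using test_function_supp[OF test_function_pd[OF assms, of i]] by metis
    show ?thesis using bounded_of_supp[OF test_functionD(3)[OF test_function_pd[OF assms]] M] by metis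
  qed
  then obtain B where B: "\<And>i. B i > 0" "\<And>i x. \<bar>pd \<eta> i x\<bar> \<le> B i" by metis
  have "\<bar>\<eta> (z + v) - \<eta> z\<bar> \<le> (\<Sum>i\<in>UNIV. B i) * norm v" for z v
  proof -
    obtain t where "\<eta> (z + v) - \<eta> z = (\<Sum>i\<in>UNIV. v $ i * pd \<eta> i (z + t *\<^sub>R v))"
      using mean_value_line[of \<eta> z v] test_functionD(2)[OF assms] by metis
    also have "\<bar>\<dots>\<bar> \<le> (\<Sum>i\<in>UNIV. \<bar>v $ i * pd \<eta> i (z + t *\<^sub>R v)\<bar>)" by (rule sum_abs)
    also have "\<dots> \<le> (\<Sum>i\<in>UNIV. B i * norm v)"
      by (rule sum_mono) (simp add: abs_mult mult.commute[of "B _"] mult_mono B component_le_norm_cart)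
    finally show ?thesis by (simp add: sum_distrib_right)
  qed
  then show ?thesis using that[of "\<Sum>i\<in>UNIV. B i"] B(1) by (simp add: sum_nonneg less_imp_le)
qed

text \<open>A remainder that is quadratic uniformly in the base point: this is what lets
  \<open>conv_has_derivative\<close> differentiate under the integral sign.\<close>

lemma test_taylor:
  fixes \<eta> :: "real^'n \<Rightarrow> real"
  assumes "test_function \<eta>"
  obtains C where "C \<ge> 0" "\<And>z v. \<bar>\<eta> (z + v) - \<eta> z - (\<Sum>i\<in>UNIV. v $ i * pd \<eta> i z)\<bar> \<le> C * (norm v)\<^sup>2"
proof -
  have "\<exists>B\<ge>0. \<forall>z v. \<bar>pd \<eta> i (z + v) - pd \<eta> i z\<bar> \<le> B * norm v" for i
    using test_lipschitz[OF test_function_pd[OF assms, of i]] by metis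
  then obtain B where B: "\<And>i. B i \<ge> 0" "\<And>i z v. \<bar>pd \<eta> i (z + v) - pd \<eta> i z\<bar> \<le> B i * norm v" by metis
  have "\<bar>\<eta> (z + v) - \<eta> z - (\<Sum>i\<in>UNIV. v $ i * pd \<eta> i z)\<bar> \<le> (\<Sum>i\<in>UNIV. B i) * (norm v)\<^sup>2" for z v
  proof -
    obtain t where t: "0 < t" "t < 1" "\<eta> (z + v) - \<eta> z = (\<Sum>i\<in>UNIV. v $ i * pd \<eta> i (z + t *\<^sub>R v))"
      using mean_value_line[of \<eta> z v] test_functionD(2)[OF assms] by metis
    have "\<bar>\<eta> (z + v) - \<eta> z - (\<Sum>i\<in>UNIV. v $ i * pd \<eta> i z)\<bar> = \<bar>\<Sum>i\<in>UNIV. v $ i * (pd \<eta> i (z + t *\<^sub>R v) - pd \<eta> i z)\<bar>"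
      unfolding t(3) by (simp add: sum_subtractf right_diff_distrib)
    also have "\<dots> \<le> (\<Sum>i\<in>UNIV. \<bar>v $ i * (pd \<eta> i (z + t *\<^sub>R v) - pd \<eta> i z)\<bar>)" by (rule sum_abs)
    also have "\<dots> \<le> (\<Sum>i\<in>UNIV. norm v * (B i * norm v))"
    proof (rule sum_mono)
      fix i
      have "B i * norm (t *\<^sub>R v) \<le> B i * norm v" using t(1,2) B(1)[of i]
        by (intro mult_left_mono) (auto simp: mult_left_le_one_le)
      then have "\<bar>pd \<eta> i (z + t *\<^sub>R v) - pd \<eta> i z\<bar> \<le> B i * norm v" using B(2)[of i z "t *\<^sub>R v"] by linarith
      then show "\<bar>v $ i * (pd \<eta> i (z + t *\<^sub>R v) - pd \<eta> i z)\<bar> \<le> norm v * (B i * norm v)"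
        unfolding abs_mult by (intro mult_mono component_le_norm_cart) auto
    qed
    finally show ?thesis by (simp add: sum_distrib_left sum_distrib_right power2_eq_square mult_ac)
  qed
  then show ?thesis using that[of "\<Sum>i\<in>UNIV. B i"] B(1) by (simp add: sum_nonneg)
qed

section \<open>Convolution of a continuous function with a test function\<close>

definition conv :: "(real^'n \<Rightarrow> 'b::euclidean_space) \<Rightarrow> (real^'n \<Rightarrow> real) \<Rightarrow> real^'n \<Rightarrow> 'b" where
  "conv w \<eta> x = (\<integral>y. \<eta> (x - y) *\<^sub>R w y \<partial>lborel)"

lemma conv_integrable:
  fixes w :: "real^'n \<Rightarrow> 'b::euclidean_space"
  assumes "continuous_on UNIV w" "test_function \<eta>"
  shows "integrable lborel (\<lambda>y. \<eta> (x - y) *\<^sub>R w y)"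
proof -
  obtain M where M: "M > 0" "\<And>x. norm x > M \<Longrightarrow> \<eta> x = 0" using test_function_supp[OF assms(2)] by metis
  show ?thesis
  proof (rule integrable_cont_supp[where M = "M + norm x"])
    show "continuous_on UNIV (\<lambda>y. \<eta> (x - y) *\<^sub>R w y)"
      by (intro continuous_intros assms continuous_on_compose2[OF test_functionD(3)[OF assms(2)]]) auto
    show "\<eta> (x - y) *\<^sub>R w y = 0" if "norm y > M + norm x" for y
    proof -
      have "norm (x - y) > M" using that norm_triangle_ineq2[of y x] by (simp add: norm_minus_commute)
      then show ?thesis using M(2) by simp
    qed
  qed
qed

text \<open>The Taylor remainder of the kernel is integrated against \<open>w\<close>. Since the
  kernel has bounded support, continuity of \<open>w\<close> is enough and no integrability over the
  whole space is asked.\<close>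

lemma conv_has_derivative:
  fixes w :: "real^'n \<Rightarrow> 'b::euclidean_space"
  assumes w: "continuous_on UNIV w" and \<eta>: "test_function \<eta>"
  shows "(conv w \<eta> has_derivative (\<lambda>v. \<Sum>i\<in>UNIV. v $ i *\<^sub>R conv w (pd \<eta> i) x)) (at x)"
proof -
  obtain M where M: "M > 0" "\<And>x. norm x > M \<Longrightarrow> \<eta> x = 0" using test_function_supp[OF \<eta>] by metis
  obtain C where C: "C \<ge> 0" "\<And>z v. \<bar>\<eta> (z + v) - \<eta> z - (\<Sum>i\<in>UNIV. v $ i * pd \<eta> i z)\<bar> \<le> C * (norm v)\<^sup>2"
    using test_taylor[OF \<eta>] by metis
  \<comment> \<open>For \<open>dist y x < 1\<close> the kernels centred at \<open>x\<close> and at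
    \<open>y\<close> both vanish off this common ball.\<close>
  define K where "K = (\<integral>y. indicator (cball x (M+1)) y *\<^sub>R norm (w y) \<partial>lborel)"
  have Ki: "integrable lborel (\<lambda>y. indicator (cball x (M+1)) y *\<^sub>R norm (w y))"
    by (intro borel_integrable_compact compact_cball continuous_intros continuous_on_subset[OF w]) auto
  note ci = conv_integrable[OF w \<eta>] conv_integrable[OF w test_function_pd[OF \<eta>]]
  have est: "norm (conv w \<eta> y - conv w \<eta> x - (\<Sum>i\<in>UNIV. (y - x) $ i *\<^sub>R conv w (pd \<eta> i) x)) \<le> C * K * (norm (y - x))\<^sup>2"
    if y: "dist y x < 1" for y
  proof -
    let ?D = "\<lambda>z. \<eta> (y - z) - \<eta> (x - z) - (\<Sum>i\<in>UNIV. (y - x) $ i * pd \<eta> i (x - z))"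
    have Deq: "?D z *\<^sub>R w z = \<eta> (y - z) *\<^sub>R w z - \<eta> (x - z) *\<^sub>R w z - (\<Sum>i\<in>UNIV. (y - x) $ i *\<^sub>R (pd \<eta> i (x - z) *\<^sub>R w z))" for z
      by (simp add: scaleR_left_diff_distrib scaleR_sum_left)
    have Di: "integrable lborel (\<lambda>z. ?D z *\<^sub>R w z)" unfolding Deq
      by (intro Bochner_Integration.integrable_diff Bochner_Integration.integrable_sum integrable_scaleR_right ci)
    have "conv w \<eta> y - conv w \<eta> x - (\<Sum>i\<in>UNIV. (y - x) $ i *\<^sub>R conv w (pd \<eta> i) x) = (\<integral>z. ?D z *\<^sub>R w z \<partial>lborel)"
      unfolding Deq conv_def using ci
      by (subst Bochner_Integration.integral_diff Bochner_Integration.integral_sum integral_scaleR_right;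
          (intro Bochner_Integration.integrable_diff Bochner_Integration.integrable_sum integrable_scaleR_right ci)?)+ (rule refl)
    also have "norm \<dots> \<le> (\<integral>z. C * (norm (y - x))\<^sup>2 * (indicator (cball x (M+1)) z *\<^sub>R norm (w z)) \<partial>lborel)"
    proof (rule Bochner_Integration.integral_norm_bound_integral[OF Di integrable_mult_right[OF Ki]])
      fix z
      have D: "\<bar>?D z\<bar> \<le> C * (norm (y - x))\<^sup>2" using C(2)[of "x - z" "y - x"] by (simp add: algebra_simps)
      show "norm (?D z *\<^sub>R w z) \<le> C * (norm (y - x))\<^sup>2 * (indicator (cball x (M+1)) z *\<^sub>R norm (w z))"
      proof (cases "z \<in> cball x (M+1)")
        case True then show ?thesis using D by (simp add: mult_right_mono)
      next
        case False
        then have "norm (x - z) > M" "norm (y - z) > M" using y dist_triangle[of x z y] by (auto simp: dist_norm norm_minus_commute)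
        then have "\<eta> (y - z) = 0" "\<eta> (x - z) = 0" "\<And>i. pd \<eta> i (x - z) = 0"
          using M(2) pd_zero_outside[of M \<eta>] by auto
        then show ?thesis using False by simp
      qed
    qed
    finally show ?thesis unfolding integral_mult_right_zero K_def[symmetric] by (simp only: mult_ac)
  qed
  show ?thesis
  proof (rule has_derivativeI_sandwich[where e = 1 and H = "\<lambda>y. C * K * norm (y - x)"])
    show "bounded_linear (\<lambda>v. \<Sum>i\<in>UNIV. v $ i *\<^sub>R conv w (pd \<eta> i) x)"
      by (intro bounded_linear_sum bounded_linear_scaleR_const bounded_linear_vec_nth)
    show "norm (conv w \<eta> y - conv w \<eta> x - (\<Sum>i\<in>UNIV. (y - x) $ i *\<^sub>R conv w (pd \<eta> i) x)) / norm (y - x) \<le> C * K * norm (y - x)"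
      if "y \<noteq> x" "dist y x < 1" for y
      using est[OF that(2)] that(1) by (simp add: divide_le_eq power2_eq_square)
    have "((\<lambda>y. C * K * norm (y - x)) \<longlongrightarrow> C * K * norm (x - x)) (at x)" by (intro tendsto_intros)
    then show "((\<lambda>y. C * K * norm (y - x)) \<longlongrightarrow> 0) (at x)" by simp
  qed auto
qed

lemma pd_conv:
  fixes w :: "real^'n \<Rightarrow> 'b::euclidean_space"
  assumes "continuous_on UNIV w" "test_function \<eta>"
  shows "pd (conv w \<eta>) i = conv w (pd \<eta> i)"
  using pd_eqI[OF conv_has_derivative[OF assms]]
  by (auto simp: axis_def fun_eq_iff if_distrib if_distribR sum.delta cong: if_cong)

lemma smooth_conv:
  fixes w :: "real^'n \<Rightarrow> 'b::euclidean_space"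
  assumes "continuous_on UNIV w" "test_function \<eta>"
  shows "smooth_in UNIV (conv w \<eta>)"
proof -
  have d: "conv w \<eta> differentiable at x" if "test_function \<eta>" for \<eta> x
    using conv_has_derivative[OF assms(1) that] differentiable_def by blast
  have "Cm_on UNIV m (conv w \<eta>)" if "test_function \<eta>" for m \<eta>
    using that
  proof (induction m arbitrary: \<eta>)
    case 0 then show ?case
      using d by (auto intro!: continuous_at_imp_continuous_on differentiable_imp_continuous_within)
  next
    case (Suc m) then show ?case using d pd_conv[OF assms(1) Suc.prems] test_function_pd[OF Suc.prems] by auto
  qed
  then show ?thesis using assms by (simp add: smooth_in_def)
qed

lemma lap_conv:
  fixes w :: "real^'n \<Rightarrow> 'b::euclidean_space"
  assumes "continuous_on UNIV w" "test_function \<eta>"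
  shows "lap (conv w \<eta>) x = conv w (lap \<eta>) x"
proof -
  have "lap (conv w \<eta>) x = (\<Sum>i\<in>UNIV. conv w (pd (pd \<eta> i) i) x)"
    by (simp add: lap_def pd_conv[OF assms(1)] assms(2) test_function_pd)
  also have "\<dots> = conv w (lap \<eta>) x"
    unfolding conv_def lap_def scaleR_sum_left
    by (subst Bochner_Integration.integral_sum)
      (rule conv_integrable[OF assms(1) test_function_pd[OF test_function_pd[OF assms(2)]]], rule refl)
  finally show ?thesis .
qed

lemma pd_reflect:
  fixes f :: "real^'n \<Rightarrow> 'b::real_normed_vector"
  assumes "\<And>x. f differentiable at x"
  shows "(\<lambda>y. f (x - y)) differentiable at y" "pd (\<lambda>y. f (x - y)) i y = - pd f i (x - y)"
proof -
  have "((\<lambda>y. x - y) has_derivative (\<lambda>v. - v)) (at y)" by (auto intro!: derivative_eq_intros)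
  from has_derivative_compose[OF this assms[of "x - y", unfolded frechet_derivative_works]]
  have d: "((\<lambda>y. f (x - y)) has_derivative (\<lambda>v. frechet_derivative f (at (x - y)) (- v))) (at y)" .
  then show "(\<lambda>y. f (x - y)) differentiable at y" unfolding differentiable_def by blast
  show "pd (\<lambda>y. f (x - y)) i y = - pd f i (x - y)"
    using pd_eqI[OF d] linear_neg[OF linear_frechet_derivative[OF assms]] by (simp add: pd_def)
qed

lemma smooth_reflect:
  fixes f :: "real^'n \<Rightarrow> 'b::real_normed_vector"
  assumes "smooth_in UNIV f" shows "smooth_in UNIV (\<lambda>y. f (x - y))"
proof -
  have "Cm_on UNIV m (\<lambda>y. c *\<^sub>R f (x - y))" if "smooth_in UNIV f" for m f c
    using that
  proof (induction m arbitrary: f c)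
    case 0 then show ?case using smooth_inD(3)[of UNIV f] by (auto intro!: continuous_intros continuous_on_compose2[of UNIV f])
  next
    case (Suc m)
    have "pd (\<lambda>y. c *\<^sub>R f (x - y)) i = (\<lambda>y. (- c) *\<^sub>R pd f i (x - y))" for i
      using smooth_inD(1)[OF Suc.prems] by (auto simp: pd_reflect pd_bounded_linear[OF bounded_linear_scaleR_right])
    moreover have "(\<lambda>y. c *\<^sub>R f (x - y)) differentiable at y" for y
      using smooth_inD(1)[OF Suc.prems] by (auto simp: pd_reflect intro!: differentiable_bounded_linear[OF bounded_linear_scaleR_right])
    ultimately show ?case using Suc.IH[OF smooth_inD(2)[OF Suc.prems], of "- c"] by auto
  qed
  from this[OF assms, of _ 1] show ?thesis by (simp add: smooth_in_def)
qed

lemma test_function_reflect: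
  assumes "test_function \<eta>" shows "test_function (\<lambda>y. \<eta> (x - y))"
proof -
  obtain M where M: "M > 0" "\<And>x. norm x > M \<Longrightarrow> \<eta> x = 0" using test_function_supp[OF assms] by metis
  show ?thesis
  proof (rule test_functionI[where M = "M + norm x", OF smooth_reflect[OF test_functionD(1)[OF assms]]])
    show "\<eta> (x - y) = 0" if "norm y > M + norm x" for y
      using M(2)[of "x - y"] that norm_triangle_ineq2[of y x] by (simp add: norm_minus_commute)
  qed
qed

lemma lap_reflect:
  assumes "test_function \<eta>" shows "lap (\<lambda>y. \<eta> (x - y)) y = lap \<eta> (x - y)"
proof -
  have "pd (pd (\<lambda>y. \<eta> (x - y)) i) i y = pd (pd \<eta> i) i (x - y)" for i
  proof -
    have "pd (\<lambda>y. \<eta> (x - y)) i = (\<lambda>y. - pd \<eta> i (x - y))"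
      using pd_reflect test_functionD(2)[OF assms] by blast
    then show ?thesis
      using pd_reflect[of "pd \<eta> i" x] test_functionD(2)[OF test_function_pd[OF assms]]
      by (simp add: pd_bounded_linear[OF bounded_linear_minus[OF bounded_linear_ident]])
  qed
  then show ?thesis by (simp add: lap_def)
qed

text \<open>The distributional equation \<open>lap w + l w = 0\<close> in \<open>S\<close>, with
  both derivatives on the test function, so that it makes sense for a continuous \<open>w\<close>.
  The closure condition says that the support lies in \<open>S\<close>; it is compact because test
  functions vanish off a bounded set.\<close>

definition dsol :: "complex \<Rightarrow> (real^'n) set \<Rightarrow> (real^'n \<Rightarrow> complex) \<Rightarrow> bool" where
  "dsol l S w \<longleftrightarrow> (\<forall>\<phi>. test_function \<phi> \<longrightarrow> closure {x. \<phi> x \<noteq> 0} \<subseteq> S \<longrightarrow>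
     (\<integral>y. lap \<phi> y *\<^sub>R w y \<partial>lborel) + l * (\<integral>y. \<phi> y *\<^sub>R w y \<partial>lborel) = 0)"

text \<open>The value of the convolution at \<open>x\<close> is the pairing of \<open>w\<close> with
  \<open>y -> \<eta> (x - y)\<close>, a test function supported in \<open>cball x e\<close>, and
  reflection preserves the Laplacian.\<close>

lemma dsol_conv:
  assumes "dsol l S w" "continuous_on UNIV w" "test_function \<eta>"
    "\<And>y. norm y > e \<Longrightarrow> \<eta> y = 0" "cball x e \<subseteq> S"
  shows "lap (conv w \<eta>) x + l * conv w \<eta> x = 0"
proof -
  have "closure {y. \<eta> (x - y) \<noteq> 0} \<subseteq> cball x e"
    by (rule closure_minimal) (use assms(4) in \<open>auto simp: dist_norm, meson not_le\<close>)
  then have "closure {y. \<eta> (x - y) \<noteq> 0} \<subseteq> S" using assms(5) by blast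
  then have "(\<integral>y. lap (\<lambda>y. \<eta> (x - y)) y *\<^sub>R w y \<partial>lborel) + l * (\<integral>y. \<eta> (x - y) *\<^sub>R w y \<partial>lborel) = 0"
    using assms(1) test_function_reflect[OF assms(3)] unfolding dsol_def by blast
  then show ?thesis unfolding lap_conv[OF assms(2,3)] lap_reflect[OF assms(3)] conv_def .
qed

lemma radial_smooth: "smooth_in S (\<lambda>x. x \<bullet> (x::real^'n))"
proof -
  have "smooth_in UNIV (\<lambda>x::real^'n. \<Sum>i\<in>UNIV. x $ i * x $ i)"
    by (intro smooth_in_sum smooth_in_mult smooth_in_nth open_UNIV)
  moreover have "(\<lambda>x::real^'n. \<Sum>i\<in>UNIV. x $ i * x $ i) = (\<lambda>x. x \<bullet> x)" by (simp add: inner_vec_def)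
  ultimately have "smooth_in UNIV (\<lambda>x::real^'n. x \<bullet> x)" by metis
  then show ?thesis by (rule smooth_in_subset) simp
qed

lemma mollifier_exists:
  fixes e :: real assumes "e > 0"
  obtains \<eta> :: "real^'n \<Rightarrow> real" where "test_function \<eta>" "\<And>x. \<eta> x \<ge> 0" "\<And>x. norm x > e \<Longrightarrow> \<eta> x = 0"
    "(\<integral>x. \<eta> x \<partial>lborel) = 1"
proof -
  define f where "f x = flat (e\<^sup>2 - x \<bullet> x)" for x :: "real^'n"
  have sm: "smooth_in UNIV f" unfolding f_def
    by (rule smooth_in_compose_real[OF open_UNIV smooth_in_diff[OF open_UNIV smooth_in_const radial_smooth] smooth_real_flat])
  have z: "f x = 0" if "norm x > e" for x
  proof -
    have "e\<^sup>2 \<le> (norm x)\<^sup>2" using that assms by (intro power_mono) auto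
    then show ?thesis by (simp add: f_def power2_norm_eq_inner flat_0)
  qed
  have t: "test_function f" by (rule test_functionI[OF sm z])
  have i: "integrable lborel f" by (rule integrable_cont_supp[OF test_functionD(3)[OF t] z])
  have nn: "f x \<ge> 0" for x by (simp add: f_def flat_nonneg)
  have pos: "(\<integral>x. f x \<partial>lborel) > 0"
  proof -
    have "(\<integral>x. f x \<partial>lborel) \<noteq> 0"
    proof
      assume "(\<integral>x. f x \<partial>lborel) = 0"
      then have "AE x in lborel. f x = 0" using integral_nonneg_eq_0_iff_AE[OF i] nn by auto
      moreover have "f x \<noteq> 0" if "x \<in> ball 0 e" for x
      proof -
        have "(norm x)\<^sup>2 < e\<^sup>2" using that by (intro power_strict_mono) auto
        then show ?thesis using flat_pos[of "e\<^sup>2 - x \<bullet> x"] by (simp add: f_def power2_norm_eq_inner)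
      qed
      ultimately have "AE x in lborel. x \<notin> ball (0::real^'n) e" by (auto elim!: eventually_mono)
      then have "emeasure lborel (ball (0::real^'n) e) = 0"
        by (subst (asm) AE_iff_measurable[where N = "ball 0 e"]) auto
      then show False using emeasure_lborel_ball_finite[of "0::real^'n" e] content_ball_pos[OF assms, of "0::real^'n"] 
        by (simp add: measure_def)
    qed
    moreover have "(\<integral>x. f x \<partial>lborel) \<ge> 0" using nn by (simp add: integral_nonneg_AE)
    ultimately show ?thesis by simp
  qed
  show ?thesis
  proof (rule that[of "\<lambda>x. f x * (1 / (\<integral>x. f x \<partial>lborel))"])
    show "test_function (\<lambda>x. f x * (1 / integral\<^sup>L lborel f))" by (rule test_function_mult[OF t smooth_in_const])
  qed (use nn z pos i in auto)
qed

lemma conv_approx: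
  fixes w :: "real^'n \<Rightarrow> 'b::euclidean_space"
  assumes w: "continuous_on UNIV w" and \<eta>: "test_function \<eta>" "\<And>x. \<eta> x \<ge> 0" "\<And>x. norm x > d \<Longrightarrow> \<eta> x = 0" "(\<integral>x. \<eta> x \<partial>lborel) = 1"
    and close: "\<And>y. dist y x \<le> d \<Longrightarrow> norm (w y - w x) \<le> e"
  shows "norm (conv w \<eta> x - w x) \<le> e"
proof -
  have one: "(\<integral>y. \<eta> (x - y) \<partial>lborel) = 1" and onei: "integrable lborel (\<lambda>y. \<eta> (x - y))"
  proof -
    have i1: "integrable lborel (\<lambda>y. \<eta> (x - y))"
      using conv_integrable[of "\<lambda>y. 1::real" \<eta> x] \<eta>(1) by simp
    then show "integrable lborel (\<lambda>y. \<eta> (x - y))" .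
    have "(\<integral>y. \<eta> (x - y) \<partial>lborel) = (\<integral>y. \<eta> (x - y) \<partial>(distr lborel borel (\<lambda>y. x - y)))"
    proof -
      have "lborel = distr lborel borel (\<lambda>y. x - y :: real^'n)"
        using lborel_affine[of "-1" x] by (simp add: density_1)
      then show ?thesis by simp
    qed
    also have "\<dots> = (\<integral>y. \<eta> (x - (x - y)) \<partial>lborel)"
      by (rule integral_distr) (use i1 in auto)
    finally show "(\<integral>y. \<eta> (x - y) \<partial>lborel) = 1" using \<eta>(4) by simp
  qed
  have "conv w \<eta> x - w x = (\<integral>y. \<eta> (x - y) *\<^sub>R (w y - w x) \<partial>lborel)"
    unfolding conv_def scaleR_diff_right using conv_integrable[OF w \<eta>(1)] onei one by simp
  also have "norm (\<integral>y. \<eta> (x - y) *\<^sub>R (w y - w x) \<partial>lborel) \<le> (\<integral>y. \<eta> (x - y) * e \<partial>lborel)"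
  proof (rule Bochner_Integration.integral_norm_bound_integral)
    show "integrable lborel (\<lambda>y. \<eta> (x - y) *\<^sub>R (w y - w x))"
      unfolding scaleR_diff_right using conv_integrable[OF w \<eta>(1)] onei by simp
    show "integrable lborel (\<lambda>y. \<eta> (x - y) * e)" using onei by simp
    show "norm (\<eta> (x - y) *\<^sub>R (w y - w x)) \<le> \<eta> (x - y) * e" for y
      using close[of y] \<eta>(2)[of "x - y"] \<eta>(3)[of "x - y"]
      by (cases "dist y x \<le> d") (auto simp: dist_norm norm_minus_commute intro: mult_left_mono)
  qed
  also have "\<dots> = e" using one by simp
  finally show ?thesis .
qed

subsection \<open>Euler and rotation vector fields\<close>

lemma Cm_on_Un: "open S \<Longrightarrow> open T \<Longrightarrow> Cm_on S m f \<Longrightarrow> Cm_on T m f \<Longrightarrow> Cm_on (S \<union> T) m f"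
  by (induction m arbitrary: f) (auto intro: continuous_on_open_Un)

lemma smooth_in_Un: "open S \<Longrightarrow> open T \<Longrightarrow> smooth_in S f \<Longrightarrow> smooth_in T f \<Longrightarrow> smooth_in (S \<union> T) f"
  by (simp add: smooth_in_def Cm_on_Un)

text \<open>Test functions that vanish near the origin. They absorb radial weights that are smooth
  only off 0, so every weighted integral below converges and every integration by parts is free of
  boundary terms.\<close>

definition punctured_test :: "(real^'n \<Rightarrow> real) \<Rightarrow> bool" where
  "punctured_test v \<longleftrightarrow> test_function v \<and> (\<exists>r>0. \<forall>x. norm x < r \<longrightarrow> v x = 0)"

abbreviation "smooth0 \<equiv> smooth_in (-{0})"

lemma open_punctured: "open (-{0::real^'n})" by auto

lemma punctured_testD:
  assumes "punctured_test v"
  shows "test_function v" "smooth_in UNIV v" "v differentiable at x" "continuous_on UNIV v" "smooth0 v"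
  using assms test_functionD smooth_in_subset[OF test_functionD(1), of v "-{0}"] by (auto simp: punctured_test_def)

lemma punctured_test_integrable: assumes "punctured_test v" shows "integrable lborel v"
  by (rule test_function_supp[OF punctured_testD(1)[OF assms]]) (rule integrable_cont_supp[OF punctured_testD(4)[OF assms]])

text \<open>Smoothness is glued from the complement of the origin and a ball on which
  \<open>v\<close>, hence the product, vanishes; thus \<open>a\<close> may be singular at 0.\<close>

lemma punctured_test_mult:
  assumes "smooth0 a" "punctured_test v" shows "punctured_test (\<lambda>x. a x * v x)"
proof -
  obtain r where r: "r > 0" "\<And>x. norm x < r \<Longrightarrow> v x = 0" using assms(2) by (auto simp: punctured_test_def)
  obtain M where M: "\<And>x. norm x > M \<Longrightarrow> v x = 0" using test_function_supp[OF punctured_testD(1)[OF assms(2)]] by metis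
  have s1: "smooth0 (\<lambda>x. a x * v x)"
    by (rule smooth_in_mult[OF open_punctured assms(1) punctured_testD(5)[OF assms(2)]])
  have s2: "smooth_in (ball 0 r) (\<lambda>x. a x * v x)"
    by (rule smooth_in_cong[OF open_ball _ smooth_in_const[of _ 0]]) (use r in simp)
  have "(-{0}) \<union> ball (0::real^'n) r = UNIV" using r(1) by auto
  then have "smooth_in UNIV (\<lambda>x. a x * v x)" using smooth_in_Un[OF open_punctured open_ball s1 s2] by metis
  then have "test_function (\<lambda>x. a x * v x)" by (rule test_functionI[where M = M]) (use M in simp)
  then show ?thesis using r by (auto simp: punctured_test_def)
qed

lemma punctured_test_add:
  assumes "punctured_test f" "punctured_test g" shows "punctured_test (\<lambda>x. f x + g x)"
proof -
  obtain r where r: "r > 0" "\<And>x. norm x < r \<Longrightarrow> f x = 0" using assms(1) by (auto simp: punctured_test_def)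
  obtain s where s: "s > 0" "\<And>x. norm x < s \<Longrightarrow> g x = 0" using assms(2) by (auto simp: punctured_test_def)
  show ?thesis unfolding punctured_test_def
    using test_function_add[OF punctured_testD(1)[OF assms(1)] punctured_testD(1)[OF assms(2)]] r s
    by (auto intro!: exI[of _ "min r s"])
qed

lemma punctured_test_pd: assumes "punctured_test v" shows "punctured_test (pd v i)"
proof -
  obtain r where r: "r > 0" "\<And>x. norm x < r \<Longrightarrow> v x = 0" using assms by (auto simp: punctured_test_def)
  have "pd v i x = 0" if "norm x < r" for x
    using pd_cong_open[of "ball 0 r" x v "\<lambda>x. 0" i] r that by simp
  then show ?thesis using r(1) test_function_pd[OF punctured_testD(1)[OF assms]] by (auto simp: punctured_test_def)
qed

lemma punctured_test_0: "punctured_test (\<lambda>x. 0)"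
  using test_function_0 by (auto simp: punctured_test_def intro: exI[of _ 1])

lemma punctured_test_sum:
  assumes "\<And>a. punctured_test (f a)" shows "punctured_test (\<lambda>x. \<Sum>a\<in>A. f a x)"
proof (induction A rule: infinite_finite_induct)
  case (insert a A)
  then show ?case using punctured_test_add[OF assms[of a] insert.IH] by simp
qed (use punctured_test_0 in simp_all)

text \<open>On \<open>L\<^sup>2\<close> the operators \<open>euler0\<close> and \<open>rot i j\<close> are skew and commute, and \<open>rot i j\<close> commutes with radial functions.\<close>

definition euler :: "(real^'n \<Rightarrow> real) \<Rightarrow> real^'n \<Rightarrow> real" where
  "euler v x = (\<Sum>i\<in>UNIV. x $ i * pd v i x)"

definition euler0 :: "(real^'n \<Rightarrow> real) \<Rightarrow> real^'n \<Rightarrow> real" where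
  "euler0 v x = euler v x + real CARD('n) / 2 * v x"

definition rot :: "'n \<Rightarrow> 'n \<Rightarrow> (real^'n \<Rightarrow> real) \<Rightarrow> real^'n \<Rightarrow> real" where
  "rot i j v x = x $ i * pd v j x - x $ j * pd v i x"

lemma smooth_in_euler: "open S \<Longrightarrow> smooth_in S v \<Longrightarrow> smooth_in S (euler v)"
  unfolding euler_def[abs_def] by (intro smooth_in_sum smooth_in_mult smooth_in_nth smooth_inD(2))

lemma punctured_test_euler: "punctured_test v \<Longrightarrow> punctured_test (euler v)"
  unfolding euler_def[abs_def] by (intro punctured_test_sum punctured_test_mult smooth_in_nth punctured_test_pd)

lemma punctured_test_euler0: "punctured_test v \<Longrightarrow> punctured_test (euler0 v)"
  unfolding euler0_def[abs_def] by (intro punctured_test_add punctured_test_mult smooth_in_const punctured_test_euler)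

lemma punctured_test_rot: assumes "punctured_test v" shows "punctured_test (rot i j v)"
proof -
  have "punctured_test (\<lambda>x. x $ i * pd v j x + (-1) * (x $ j * pd v i x))"
    by (intro punctured_test_add punctured_test_mult smooth_in_nth punctured_test_pd assms smooth_in_const)
  then show ?thesis by (simp add: rot_def[abs_def])
qed

lemma euler_mult: "f differentiable at x \<Longrightarrow> g differentiable at x \<Longrightarrow> euler (\<lambda>x. f x * g x) x = euler f x * g x + f x * euler g x"
  unfolding euler_def by (simp add: pd_mult sum_distrib_left sum_distrib_right sum.distrib[symmetric] algebra_simps)

lemma rot_mult: "f differentiable at x \<Longrightarrow> g differentiable at x \<Longrightarrow> rot i j (\<lambda>x. f x * g x) x = rot i j f x * g x + f x * rot i j g x"
  unfolding rot_def by (simp add: pd_mult algebra_simps)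

lemma euler_add: "f differentiable at x \<Longrightarrow> g differentiable at x \<Longrightarrow> euler (\<lambda>x. f x + g x) x = euler f x + euler g x"
  unfolding euler_def by (simp add: pd_add sum.distrib algebra_simps)

lemma euler0_add: "f differentiable at x \<Longrightarrow> g differentiable at x \<Longrightarrow> euler0 (\<lambda>x. f x + g x) x = euler0 f x + euler0 g x"
  unfolding euler0_def by (simp add: euler_add algebra_simps)

lemma rot_add: "f differentiable at x \<Longrightarrow> g differentiable at x \<Longrightarrow> rot i j (\<lambda>x. f x + g x) x = rot i j f x + rot i j g x"
  unfolding rot_def by (simp add: pd_add algebra_simps)

lemma zero_near_imp:
  assumes "punctured_test v"
  shows "v 0 = 0" "pd v i 0 = 0" "euler0 v 0 = 0" "rot i j v 0 = 0"
proof -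
  show "v 0 = 0" using assms by (auto simp: punctured_test_def)
  moreover show "pd v i 0 = 0" using punctured_test_pd[OF assms, of i] by (auto simp: punctured_test_def)
  ultimately show "euler0 v 0 = 0" "rot i j v 0 = 0" by (auto simp: euler0_def euler_def rot_def)
qed

lemma euler0_mult:
  assumes "smooth0 a" "punctured_test v"
  shows "euler0 (\<lambda>x. a x * v x) x = euler a x * v x + a x * euler0 v x"
proof (cases "x = 0")
  case True then show ?thesis using zero_near_imp[OF assms(2)] zero_near_imp[OF punctured_test_mult[OF assms]] by simp
next
  case False
  then have "a differentiable at x" using smooth_inD(1)[OF assms(1)] by simp
  then show ?thesis by (simp add: euler0_def euler_mult punctured_testD(3)[OF assms(2)] algebra_simps)
qed

text \<open>Rotation invariance in infinitesimal form. It gives at once that multiplication by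
  \<open>a\<close> commutes with \<open>rot i j\<close>, and it is inherited by
  \<open>euler a\<close>.\<close>

definition radial :: "(real^'n \<Rightarrow> real) \<Rightarrow> bool" where
  "radial a \<longleftrightarrow> smooth0 a \<and> (\<forall>i j x. x \<noteq> 0 \<longrightarrow> rot i j a x = 0)"

lemma radialD: "radial a \<Longrightarrow> smooth0 a" by (simp add: radial_def)

lemma rot_mult_radial:
  assumes "radial a" "punctured_test v"
  shows "rot i j (\<lambda>x. a x * v x) x = a x * rot i j v x"
proof (cases "x = 0")
  case True then show ?thesis using zero_near_imp[OF assms(2)] zero_near_imp[OF punctured_test_mult[OF radialD[OF assms(1)] assms(2)]] by simp
next
  case False
  then have "a differentiable at x" using smooth_inD(1)[OF radialD[OF assms(1)]] by simp
  then show ?thesis using assms(1) False by (simp add: rot_mult punctured_testD(3)[OF assms(2)] radial_def)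
qed

lemma sum_axis_mult: "(\<Sum>j\<in>UNIV. axis i (1::real) $ j * f j) = f i"
proof -
  have "(\<Sum>j\<in>UNIV. axis i (1::real) $ j * f j) = (\<Sum>j\<in>UNIV. if j = i then f j else 0)"
    by (rule sum.cong) (auto simp: axis_def)
  then show ?thesis by simp
qed

lemma pd_euler:
  assumes "smooth_in S v" "x \<in> S"
  shows "pd (euler v) i x = pd v i x + (\<Sum>j\<in>UNIV. x $ j * pd (pd v j) i x)"
proof -
  have d: "pd v j differentiable at x" for j using smooth_inD(1)[OF smooth_inD(2)[OF assms(1)] assms(2)] .
  have "((\<lambda>x. \<Sum>j\<in>UNIV. x $ j * pd v j x) has_derivative
     (\<lambda>h. \<Sum>j\<in>UNIV. x $ j * frechet_derivative (pd v j) (at x) h + h $ j * pd v j x)) (at x)"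
    by (intro has_derivative_sum has_derivative_mult bounded_linear_imp_has_derivative[OF bounded_linear_vec_nth]
        d[unfolded frechet_derivative_works])
  from pd_eqI[OF this, of i] show ?thesis unfolding euler_def[abs_def] pd_def[symmetric] sum.distrib sum_axis_mult
    by simp
qed

lemma pd_rot:
  assumes "smooth_in S v" "x \<in> S"
  shows "pd (rot i j v) k x = x $ i * pd (pd v j) k x + (if i = k then pd v j x else 0)
     - (x $ j * pd (pd v i) k x + (if j = k then pd v i x else 0))"
proof -
  have d: "pd v j differentiable at x" for j using smooth_inD(1)[OF smooth_inD(2)[OF assms(1)] assms(2)] .
  have "((\<lambda>x. x $ i * pd v j x - x $ j * pd v i x) has_derivative
     (\<lambda>h. (x $ i * frechet_derivative (pd v j) (at x) h + h $ i * pd v j x)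
        - (x $ j * frechet_derivative (pd v i) (at x) h + h $ j * pd v i x))) (at x)"
    by (intro has_derivative_diff has_derivative_mult bounded_linear_imp_has_derivative[OF bounded_linear_vec_nth]
        d[unfolded frechet_derivative_works])
  from pd_eqI[OF this, of k] show ?thesis unfolding rot_def[abs_def]
    by (simp add: pd_def axis_def)
qed

lemma sum_delta_mult: "(\<Sum>k\<in>(UNIV::'n::finite set). f k * (if i = k then c k else (0::real))) = f i * c i"
proof -
  have "(\<Sum>k\<in>UNIV. f k * (if i = k then c k else 0)) = (\<Sum>k\<in>UNIV. if i = k then f k * c k else 0)"
    by (rule sum.cong) auto
  then show ?thesis by simp
qed

text \<open>The Euler field is invariant under rotations. In coordinates, both sides have the same
  first order terms, and the second order terms agree by symmetry of the mixed derivatives.\<close>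

lemma rot_euler:
  assumes "open S" "smooth_in S v" "x \<in> S"
  shows "rot i j (euler v) x = euler (rot i j v) x"
proof -
  have "euler (rot i j v) x = (\<Sum>k\<in>UNIV. x $ k * (x $ i * pd (pd v j) k x)) + (\<Sum>k\<in>UNIV. x $ k * (if i = k then pd v j x else 0))
     - ((\<Sum>k\<in>UNIV. x $ k * (x $ j * pd (pd v i) k x)) + (\<Sum>k\<in>UNIV. x $ k * (if j = k then pd v i x else 0)))"
    unfolding euler_def pd_rot[OF assms(2,3)] by (simp add: right_diff_distrib distrib_left sum.distrib sum_subtractf)
  also have "\<dots> = x $ i * (\<Sum>k\<in>UNIV. x $ k * pd (pd v k) j x) + x $ i * pd v j x
      - (x $ j * (\<Sum>k\<in>UNIV. x $ k * pd (pd v k) i x) + x $ j * pd v i x)"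
    unfolding sum_delta_mult sum_distrib_left
    using pd_commute[OF assms, of j] pd_commute[OF assms, of i] by (simp add: mult.left_commute)
  finally show ?thesis unfolding rot_def[of i j "euler v"] pd_euler[OF assms(2,3)] by (simp add: algebra_simps)
qed

lemma radial_euler: assumes "radial a" shows "radial (euler a)"
proof -
  have "rot i j (euler a) x = 0" if "x \<noteq> 0" for i j x
  proof -
    have "euler (rot i j a) x = euler (\<lambda>x. 0) x" unfolding euler_def
      using pd_cong_open[OF open_punctured, of x "rot i j a" "\<lambda>x. 0"] assms that by (simp add: radial_def)
    then show ?thesis using rot_euler[OF open_punctured radialD[OF assms], of x i j] that by (simp add: euler_def)
  qed
  then show ?thesis using smooth_in_euler[OF open_punctured radialD[OF assms]] by (simp add: radial_def)
qed

lemma rot_euler0: assumes "punctured_test v" shows "rot i j (euler0 v) x = euler0 (rot i j v) x"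
proof -
  have s: "smooth_in UNIV v" using punctured_testD(2)[OF assms] .
  have "rot i j (\<lambda>x. euler v x + real CARD('a) / 2 * v x) x = rot i j (euler v) x + real CARD('a) / 2 * rot i j v x"
    using smooth_inD(1)[OF smooth_in_euler[OF open_UNIV s], of x] smooth_inD(1)[OF s, of x]
      rot_mult[of "\<lambda>x. real CARD('a) / 2" x v i j]
    by (subst rot_add) (auto simp: rot_def[of i j "\<lambda>x. real CARD('a) / 2"] simp del: times_divide_eq_left)
  then show ?thesis using rot_euler[OF open_UNIV s, of x i j] by (simp add: euler0_def[abs_def])
qed

text \<open>Half the sum of the squares \<open>(rot i j)\<^sup>2\<close> is the spherical Laplacian.\<close>

lemma lap_polar:
  fixes v :: "real^'n \<Rightarrow> real"
  assumes "smooth_in S v" "x \<in> S"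
  shows "(x \<bullet> x) * lap v x = euler (euler v) x + (real CARD('n) - 2) * euler v x + (\<Sum>i\<in>UNIV. \<Sum>j\<in>UNIV. rot i j (rot i j v) x) / 2"
proof -
  let ?H = "\<Sum>i\<in>UNIV. \<Sum>j\<in>UNIV. x $ i * x $ j * pd (pd v j) i x"
  let ?n = "real CARD('n)"
  have EE: "euler (euler v) x = euler v x + ?H"
    unfolding euler_def[of "euler v"] pd_euler[OF assms] by (simp add: distrib_left sum.distrib sum_distrib_left euler_def mult.assoc)
  \<comment> \<open>With \<open>H\<close> the Hessian form \<open>?H\<close>, the double sum is
    \<open>2 |x|^2 lap v - 2 H + 2 euler v - 2 n euler v\<close>, and \<open>H\<close> is
    \<open>euler (euler v) - euler v\<close>. Halving compensates that each rotation plane is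
    counted twice.\<close>
  have "rot i j (rot i j v) x = x $ i * x $ i * pd (pd v j) j x + (if i = j then x $ i * pd v j x else 0)
     - x $ i * x $ j * pd (pd v i) j x - x $ i * pd v i x - x $ j * x $ i * pd (pd v j) i x - x $ j * pd v j x
     + x $ j * x $ j * pd (pd v i) i x + (if i = j then x $ j * pd v i x else 0)" for i j
    unfolding rot_def[of i j "rot i j v"] pd_rot[OF assms] by (auto simp: algebra_simps)
  then have "(\<Sum>i\<in>UNIV. \<Sum>j\<in>UNIV. rot i j (rot i j v) x) =
      (\<Sum>i\<in>UNIV. \<Sum>j\<in>UNIV. x $ i * x $ i * pd (pd v j) j x) + (\<Sum>i\<in>UNIV. \<Sum>j\<in>UNIV. if i = j then x $ i * pd v j x else 0)
     - (\<Sum>i\<in>UNIV. \<Sum>j\<in>UNIV. x $ i * x $ j * pd (pd v i) j x) - (\<Sum>i\<in>UNIV. \<Sum>j\<in>(UNIV::'n set). x $ i * pd v i x)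
     - (\<Sum>i\<in>UNIV. \<Sum>j\<in>UNIV. x $ j * x $ i * pd (pd v j) i x) - (\<Sum>i\<in>(UNIV::'n set). \<Sum>j\<in>UNIV. x $ j * pd v j x)
     + (\<Sum>i\<in>UNIV. \<Sum>j\<in>UNIV. x $ j * x $ j * pd (pd v i) i x) + (\<Sum>i\<in>UNIV. \<Sum>j\<in>UNIV. if i = j then x $ j * pd v i x else 0)"
    by (simp only: sum.distrib sum_subtractf)
  also have "(\<Sum>i\<in>UNIV. \<Sum>j\<in>UNIV. x $ i * x $ i * pd (pd v j) j x) = (x \<bullet> x) * lap v x"
    by (simp add: inner_vec_def lap_def sum_product)
  also have "(\<Sum>i\<in>UNIV. \<Sum>j\<in>UNIV. x $ j * x $ j * pd (pd v i) i x) = (x \<bullet> x) * lap v x"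
    by (subst sum.swap) (simp add: inner_vec_def lap_def sum_product)
  also have "(\<Sum>i\<in>UNIV. \<Sum>j\<in>UNIV. if i = j then x $ i * pd v j x else 0) = euler v x" by (simp add: euler_def)
  also have "(\<Sum>i\<in>UNIV. \<Sum>j\<in>UNIV. if i = j then x $ j * pd v i x else 0) = euler v x" by (simp add: euler_def)
  also have "(\<Sum>i\<in>UNIV. \<Sum>j\<in>(UNIV::'n set). x $ i * pd v i x) = ?n * euler v x" by (simp add: euler_def sum_distrib_left)
  also have "(\<Sum>i\<in>(UNIV::'n set). \<Sum>j\<in>UNIV. x $ j * pd v j x) = ?n * euler v x" by (simp add: euler_def)
  also have "(\<Sum>i\<in>UNIV. \<Sum>j\<in>UNIV. x $ i * x $ j * pd (pd v i) j x) = ?H"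
    by (subst sum.swap) (simp add: mult.commute)
  also have "(\<Sum>i\<in>UNIV. \<Sum>j\<in>UNIV. x $ j * x $ i * pd (pd v j) i x) = ?H" by (simp add: mult.commute)
  finally show ?thesis using EE by (simp add: field_simps)
qed

subsection \<open>Integral identities for the conjugated Laplacian\<close>

text \<open>Both integrands are divergences of compactly supported fields: of \<open>p x\<close>,
  and of \<open>p\<close> times the divergence free field generating the rotation in the plane of
  \<open>i\<close> and \<open>j\<close>.\<close>

lemma integral_div:
  assumes "punctured_test p"
  shows "(\<integral>x. euler p x + real CARD('n) * p (x::real^'n) \<partial>lborel) = 0" "(\<integral>x. rot i j p x \<partial>lborel) = 0"
proof -
  have s: "punctured_test (\<lambda>x. x $ k * p x)" for k by (rule punctured_test_mult[OF smooth_in_nth assms])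
  have z: "(\<integral>x. pd (\<lambda>x. x $ k * p x) l x \<partial>lborel) = 0" for k l
  proof -
    note t = punctured_testD(1)[OF s[of k]]
    obtain M where "\<And>x. norm x > M \<Longrightarrow> x $ k * p x = 0" using test_function_supp[OF t] by metis
    then show ?thesis using integral_pd_zero(2)[OF test_functionD(2)[OF t] test_functionD(3)[OF test_function_pd[OF t]]] by blast
  qed
  have i: "integrable lborel (pd (\<lambda>x. x $ k * p x) l)" for k l
    using punctured_test_integrable[OF punctured_test_pd[OF s]] .
  have e: "pd (\<lambda>x. x $ k * p x) l x = x $ k * pd p l x + (if k = l then 1 else 0) * p x" for k l x
    by (subst pd_mult) (auto simp: pd_nth punctured_testD(3)[OF assms] bounded_linear_imp_differentiable[OF bounded_linear_vec_nth])
  have "(\<integral>x. (\<Sum>k\<in>UNIV. pd (\<lambda>x. x $ k * p x) k x) \<partial>lborel) = 0"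
    by (subst Bochner_Integration.integral_sum) (use z i in auto)
  moreover have "(\<Sum>k\<in>UNIV. pd (\<lambda>x. x $ k * p x) k x) = euler p x + real CARD('n) * p x" for x
    unfolding e by (simp add: euler_def sum.distrib)
  ultimately show "(\<integral>x. euler p x + real CARD('n) * p (x::real^'n) \<partial>lborel) = 0" by simp
  have "(\<integral>x. pd (\<lambda>x. x $ i * p x) j x - pd (\<lambda>x. x $ j * p x) i x \<partial>lborel) = 0"
    by (subst Bochner_Integration.integral_diff) (use z i in auto)
  moreover have "pd (\<lambda>x. x $ i * p x) j x - pd (\<lambda>x. x $ j * p x) i x = rot i j p x" for x
    unfolding e by (auto simp: rot_def)
  ultimately show "(\<integral>x. rot i j p x \<partial>lborel) = 0" by simp
qed

lemma punctured_test_mult2: "punctured_test f \<Longrightarrow> punctured_test g \<Longrightarrow> punctured_test (\<lambda>x. f x * g x)"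
  using punctured_test_mult punctured_testD(5) by blast

lemma euler0_skew:
  assumes "punctured_test f" "punctured_test g"
  shows "(\<integral>x. euler0 f x * g x \<partial>lborel) = - (\<integral>x. f x * euler0 g x \<partial>lborel)"
proof -
  have "(\<integral>x. euler0 f x * g x + f x * euler0 g x \<partial>lborel) = 0"
  proof -
    have "euler0 f x * g x + f x * euler0 g x = euler (\<lambda>x. f x * g x) x + real CARD('a) * (f x * g x)" for x
      using assms by (simp add: euler_mult punctured_testD(3) euler0_def algebra_simps)
    then show ?thesis using integral_div(1)[OF punctured_test_mult2[OF assms]] by simp
  qed
  then show ?thesis
    by (subst (asm) Bochner_Integration.integral_add)
      (use assms in \<open>auto intro!: punctured_test_integrable punctured_test_mult2 punctured_test_euler0\<close>)
qed

lemma rot_skew: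
  assumes "punctured_test f" "punctured_test g"
  shows "(\<integral>x. rot i j f x * g x \<partial>lborel) = - (\<integral>x. f x * rot i j g x \<partial>lborel)"
proof -
  have "(\<integral>x. rot i j f x * g x + f x * rot i j g x \<partial>lborel) = 0"
  proof -
    have "rot i j f x * g x + f x * rot i j g x = rot i j (\<lambda>x. f x * g x) x" for x
      using assms by (simp add: rot_mult punctured_testD(3))
    then show ?thesis using integral_div(2)[OF punctured_test_mult2[OF assms]] by simp
  qed
  then show ?thesis
    by (subst (asm) Bochner_Integration.integral_add)
      (use assms in \<open>auto intro!: punctured_test_integrable punctured_test_mult2 punctured_test_rot\<close>)
qed

lemma smooth0_euler: "smooth0 a \<Longrightarrow> smooth0 (euler a)"
  by (rule smooth_in_euler[OF open_punctured])

lemma weighted_integrable: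
  assumes "smooth0 c" "punctured_test f" "punctured_test g"
  shows "integrable lborel (\<lambda>x. c x * (f x * g x))"
  by (rule punctured_test_integrable[OF punctured_test_mult[OF assms(1) punctured_test_mult2[OF assms(2,3)]]])

text \<open>By skewness of \<open>euler0\<close> the integral reappears with the opposite sign; what
  remains is the derivative that falls on the weight.\<close>

lemma integral_euler0_self:
  assumes "smooth0 a" "punctured_test v"
  shows "(\<integral>x. a x * (v x * euler0 v x) \<partial>lborel) = - (1/2) * (\<integral>x. euler a x * (v x * v x) \<partial>lborel)"
proof -
  note i = weighted_integrable[OF assms(1) assms(2) punctured_test_euler0[OF assms(2)]]
    weighted_integrable[OF smooth0_euler[OF assms(1)] assms(2) assms(2)]
  have "(\<integral>x. euler0 v x * (a x * v x) \<partial>lborel) = - (\<integral>x. v x * euler0 (\<lambda>x. a x * v x) x \<partial>lborel)"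
    by (rule euler0_skew[OF assms(2) punctured_test_mult[OF assms]])
  also have "(\<integral>x. v x * euler0 (\<lambda>x. a x * v x) x \<partial>lborel) = (\<integral>x. euler a x * (v x * v x) + a x * (v x * euler0 v x) \<partial>lborel)"
    unfolding euler0_mult[OF assms] by (simp add: algebra_simps)
  also have "\<dots> = (\<integral>x. euler a x * (v x * v x) \<partial>lborel) + (\<integral>x. a x * (v x * euler0 v x) \<partial>lborel)"
    using i by simp
  finally show ?thesis by (simp add: mult_ac)
qed

lemma integral_euler0_mult:
  assumes "smooth0 a" "punctured_test z" "punctured_test v"
  shows "(\<integral>x. euler0 z x * (a x * v x) \<partial>lborel) = - (\<integral>x. euler a x * (v x * z x) \<partial>lborel) - (\<integral>x. a x * (z x * euler0 v x) \<partial>lborel)"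
proof -
  note i = weighted_integrable[OF smooth0_euler[OF assms(1)] assms(3) assms(2)]
    weighted_integrable[OF assms(1) assms(2) punctured_test_euler0[OF assms(3)]]
  have "(\<integral>x. euler0 z x * (a x * v x) \<partial>lborel) = - (\<integral>x. z x * euler0 (\<lambda>x. a x * v x) x \<partial>lborel)"
    by (rule euler0_skew[OF assms(2) punctured_test_mult[OF assms(1,3)]])
  also have "(\<integral>x. z x * euler0 (\<lambda>x. a x * v x) x \<partial>lborel) = (\<integral>x. euler a x * (v x * z x) + a x * (z x * euler0 v x) \<partial>lborel)"
    unfolding euler0_mult[OF assms(1,3)] by (simp add: algebra_simps)
  also have "\<dots> = (\<integral>x. euler a x * (v x * z x) \<partial>lborel) + (\<integral>x. a x * (z x * euler0 v x) \<partial>lborel)"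
    using i by simp
  finally show ?thesis by simp
qed

text \<open>The sum runs over ordered pairs, so it is twice the spherical Laplacian; hence the
  division by 2 in \<open>sym_part\<close>.\<close>

definition angular :: "(real^'n \<Rightarrow> real) \<Rightarrow> real^'n \<Rightarrow> real" where
  "angular v x = (\<Sum>i\<in>UNIV. \<Sum>j\<in>UNIV. rot i j (rot i j v) x)"

text \<open>Here \<open>b\<close> stands for a general zero order term. It will be
  \<open>a^2 - (n-2)^2/4\<close>, with \<open>k^2 |x|^2\<close> added in the exterior
  estimate.\<close>

definition sym_part :: "(real^'n \<Rightarrow> real) \<Rightarrow> (real^'n \<Rightarrow> real) \<Rightarrow> real^'n \<Rightarrow> real" where
  "sym_part b v x = euler0 (euler0 v) x + angular v x / 2 + b x * v x"

text \<open>This is \<open>-(a euler0 + euler0 a)\<close> as an operator, with the second product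
  expanded; symmetrising the product with \<open>a\<close> is what keeps it skew.\<close>

definition skew_part :: "(real^'n \<Rightarrow> real) \<Rightarrow> (real^'n \<Rightarrow> real) \<Rightarrow> real^'n \<Rightarrow> real" where
  "skew_part a v x = - (2 * (a x * euler0 v x) + euler a x * v x)"

lemma punctured_test_angular: "punctured_test v \<Longrightarrow> punctured_test (angular v)"
  unfolding angular_def[abs_def] by (intro punctured_test_sum punctured_test_rot)

lemma punctured_test_sym: assumes "smooth0 b" "punctured_test v" shows "punctured_test (sym_part b v)"
proof -
  have "punctured_test (\<lambda>x. euler0 (euler0 v) x + (1/2) * angular v x + b x * v x)"
    by (intro punctured_test_add punctured_test_euler0 punctured_test_mult[OF smooth_in_const]
       punctured_test_angular assms(2) punctured_test_mult[OF assms(1)])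
  then show ?thesis by (simp add: sym_part_def[abs_def])
qed

lemma punctured_test_skew: assumes "smooth0 a" "punctured_test v" shows "punctured_test (skew_part a v)"
proof -
  have "punctured_test (\<lambda>x. (-1) * (2 * (a x * euler0 v x) + euler a x * v x))"
    by (intro punctured_test_add punctured_test_mult[OF smooth_in_const] punctured_test_mult[OF assms(1)]
       punctured_test_mult[OF smooth0_euler[OF assms(1)]] punctured_test_euler0 assms(2))
  then show ?thesis by (simp add: skew_part_def[abs_def])
qed

lemma radial_part_integral:
  assumes a: "smooth0 a" and v: "punctured_test v"
  shows "(\<integral>x. euler0 (euler0 v) x * skew_part a v x \<partial>lborel)
     = 2 * (\<integral>x. euler a x * (euler0 v x * euler0 v x) \<partial>lborel) - (1/2) * (\<integral>x. euler (euler (euler a)) x * (v x * v x) \<partial>lborel)"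
proof -
  note z = punctured_test_euler0[OF v]
  note a1 = smooth0_euler[OF a] and a2 = smooth0_euler[OF smooth0_euler[OF a]]
  have i: "integrable lborel (\<lambda>x. euler0 (euler0 v) x * (a x * euler0 v x))" "integrable lborel (\<lambda>x. euler0 (euler0 v) x * (euler a x * v x))"
    using weighted_integrable[OF a punctured_test_euler0[OF z] z] weighted_integrable[OF a1 punctured_test_euler0[OF z] v]
    by (simp_all add: mult_ac)
  have "(\<integral>x. euler0 (euler0 v) x * skew_part a v x \<partial>lborel)
      = (\<integral>x. (-2) * (euler0 (euler0 v) x * (a x * euler0 v x)) - euler0 (euler0 v) x * (euler a x * v x) \<partial>lborel)"
    by (intro Bochner_Integration.integral_cong) (simp_all add: skew_part_def algebra_simps)
  also have "\<dots> = (-2) * (\<integral>x. euler0 (euler0 v) x * (a x * euler0 v x) \<partial>lborel) - (\<integral>x. euler0 (euler0 v) x * (euler a x * v x) \<partial>lborel)"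
    using i by simp
  also have "(\<integral>x. euler0 (euler0 v) x * (a x * euler0 v x) \<partial>lborel) = (\<integral>x. a x * (euler0 v x * euler0 (euler0 v) x) \<partial>lborel)"
    by (simp add: mult_ac)
  also have "\<dots> = - (1/2) * (\<integral>x. euler a x * (euler0 v x * euler0 v x) \<partial>lborel)" by (rule integral_euler0_self[OF a z])
  also have "(\<integral>x. euler0 (euler0 v) x * (euler a x * v x) \<partial>lborel)
     = - (\<integral>x. euler (euler a) x * (v x * euler0 v x) \<partial>lborel) - (\<integral>x. euler a x * (euler0 v x * euler0 v x) \<partial>lborel)"
    by (rule integral_euler0_mult[OF a1 z v])
  also have "(\<integral>x. euler (euler a) x * (v x * euler0 v x) \<partial>lborel) = - (1/2) * (\<integral>x. euler (euler (euler a)) x * (v x * v x) \<partial>lborel)"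
    by (rule integral_euler0_self[OF a2 v])
  finally show ?thesis by simp
qed

text \<open>For radial \<open>a\<close> the field \<open>rot i j\<close> commutes with the skew
  part. Moving one rotation across therefore leaves minus the pairing of \<open>rot i j v\<close>
  with its own image under a skew operator, which is 0.\<close>

lemma angular_part_integral:
  assumes a: "radial a" and v: "punctured_test v"
  shows "(\<integral>x. rot i j (rot i j v) x * skew_part a v x \<partial>lborel) = 0"
proof -
  note a0 = radialD[OF a] and a1 = smooth0_euler[OF radialD[OF a]]
  note w = punctured_test_rot[OF v, of i j] and z = punctured_test_euler0[OF v]
  have L: "rot i j (skew_part a v) x = - 2 * (a x * euler0 (rot i j v) x) - euler a x * rot i j v x" for x
  proof -
    have s: "skew_part a v = (\<lambda>x. (\<lambda>x. -2 :: real) x * (a x * euler0 v x) + (\<lambda>x. -1 :: real) x * (euler a x * v x))"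
      by (auto simp: skew_part_def)
    have "rot i j (\<lambda>x. (\<lambda>x. -2 :: real) x * (a x * euler0 v x) + (\<lambda>x. -1 :: real) x * (euler a x * v x)) x = -2 * rot i j (\<lambda>x. a x * euler0 v x) x + (-1) * rot i j (\<lambda>x. euler a x * v x) x"
    proof -
      note p = punctured_testD(3)[OF punctured_test_mult[OF a0 z], of x] punctured_testD(3)[OF punctured_test_mult[OF a1 v], of x]
      have c: "rot i j (\<lambda>x. c * f x) x = c * rot i j f x" if "f differentiable at x" for f c
        using rot_mult[of "\<lambda>x. c" x f i j] that by (simp add: rot_def)
      show ?thesis unfolding c[OF p(1), symmetric] c[OF p(2), symmetric]
        by (rule rot_add) (intro differentiable_mult differentiable_const p)+
    qed
    then show ?thesis unfolding s[symmetric]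
      using rot_mult_radial[OF a z] rot_mult_radial[OF radial_euler[OF a] v] rot_euler0[OF v] by simp
  qed
  have i: "integrable lborel (\<lambda>x. a x * (rot i j v x * euler0 (rot i j v) x))" "integrable lborel (\<lambda>x. euler a x * (rot i j v x * rot i j v x))"
    using weighted_integrable[OF a0 w punctured_test_euler0[OF w]] weighted_integrable[OF a1 w w] by auto
  have "(\<integral>x. rot i j (rot i j v) x * skew_part a v x \<partial>lborel) = - (\<integral>x. rot i j v x * rot i j (skew_part a v) x \<partial>lborel)"
    by (rule rot_skew[OF w punctured_test_skew[OF a0 v]])
  also have "(\<integral>x. rot i j v x * rot i j (skew_part a v) x \<partial>lborel)
     = (\<integral>x. (-2) * (a x * (rot i j v x * euler0 (rot i j v) x)) - euler a x * (rot i j v x * rot i j v x) \<partial>lborel)"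
    unfolding L by (simp add: algebra_simps)
  also have "\<dots> = (-2) * (\<integral>x. a x * (rot i j v x * euler0 (rot i j v) x) \<partial>lborel) - (\<integral>x. euler a x * (rot i j v x * rot i j v x) \<partial>lborel)"
    using i by simp
  also have "\<dots> = 0" unfolding integral_euler0_self[OF a0 w] by simp
  finally show ?thesis by simp
qed

lemma potential_part_integral:
  assumes a: "smooth0 a" and b: "smooth0 b" and v: "punctured_test v"
  shows "(\<integral>x. (b x * v x) * skew_part a v x \<partial>lborel) = (\<integral>x. a x * euler b x * (v x * v x) \<partial>lborel)"
proof -
  note ab = smooth_in_mult[OF open_punctured a b] and z = punctured_test_euler0[OF v]
  note ba1 = smooth_in_mult[OF open_punctured b smooth0_euler[OF a]]
  note ab1 = smooth_in_mult[OF open_punctured a smooth0_euler[OF b]]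
  have i: "integrable lborel (\<lambda>x. (a x * b x) * (v x * euler0 v x))" "integrable lborel (\<lambda>x. (b x * euler a x) * (v x * v x))"
    "integrable lborel (\<lambda>x. (a x * euler b x) * (v x * v x))"
    using weighted_integrable[OF ab v z] weighted_integrable[OF ba1 v v] weighted_integrable[OF ab1 v v] by auto
  have e: "euler (\<lambda>x. a x * b x) x * (v x * v x) = b x * euler a x * (v x * v x) + a x * euler b x * (v x * v x)" for x
  proof (cases "x = 0")
    case True then show ?thesis using zero_near_imp(1)[OF v] by simp
  next
    case False then show ?thesis using smooth_inD(1)[OF a, of x] smooth_inD(1)[OF b, of x] by (simp add: euler_mult algebra_simps)
  qed
  have "(\<integral>x. (b x * v x) * skew_part a v x \<partial>lborel) = (\<integral>x. (-2) * ((a x * b x) * (v x * euler0 v x)) - (b x * euler a x) * (v x * v x) \<partial>lborel)"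
    by (intro Bochner_Integration.integral_cong) (simp_all add: skew_part_def algebra_simps)
  also have "\<dots> = (-2) * (\<integral>x. (a x * b x) * (v x * euler0 v x) \<partial>lborel) - (\<integral>x. (b x * euler a x) * (v x * v x) \<partial>lborel)"
    using i by simp
  also have "(\<integral>x. (a x * b x) * (v x * euler0 v x) \<partial>lborel) = - (1/2) * (\<integral>x. euler (\<lambda>x. a x * b x) x * (v x * v x) \<partial>lborel)"
    by (rule integral_euler0_self[OF ab v])
  also have "(\<integral>x. euler (\<lambda>x. a x * b x) x * (v x * v x) \<partial>lborel)
     = (\<integral>x. b x * euler a x * (v x * v x) \<partial>lborel) + (\<integral>x. a x * euler b x * (v x * v x) \<partial>lborel)"
    unfolding e using i by simp
  finally show ?thesis by (simp add: field_simps)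
qed

text \<open>This is \<open>2 \<langle>S v, A v\<rangle> = \<langle>[S, A] v, v\<rangle>\<close> for the symmetric part \<open>S\<close> and the skew part \<open>A\<close>.\<close>

theorem commutator_identity:
  assumes a: "radial a" and b: "smooth0 b" and v: "punctured_test v"
  shows "2 * (\<integral>x. sym_part b v x * skew_part a v x \<partial>lborel)
     = 4 * (\<integral>x. euler a x * (euler0 v x * euler0 v x) \<partial>lborel) - (\<integral>x. euler (euler (euler a)) x * (v x * v x) \<partial>lborel)
      + 2 * (\<integral>x. a x * euler b x * (v x * v x) \<partial>lborel)"
proof -
  note a0 = radialD[OF a]
  note A = punctured_test_skew[OF a0 v]
  have i: "integrable lborel (\<lambda>x. euler0 (euler0 v) x * skew_part a v x)"
    "integrable lborel (\<lambda>x. angular v x * skew_part a v x)"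
    "integrable lborel (\<lambda>x. b x * v x * skew_part a v x)"
    "\<And>i j. integrable lborel (\<lambda>x. rot i j (rot i j v) x * skew_part a v x)"
    by (intro punctured_test_integrable punctured_test_mult2 A punctured_test_euler0 punctured_test_angular
        punctured_test_mult[OF b] punctured_test_rot v)+
  have ang: "(\<integral>x. angular v x * skew_part a v x \<partial>lborel) = 0"
    unfolding angular_def sum_distrib_right
    by (subst Bochner_Integration.integral_sum, (intro Bochner_Integration.integrable_sum i(4)))
      (subst Bochner_Integration.integral_sum, rule i(4), simp add: angular_part_integral[OF a v])
  have "(\<integral>x. sym_part b v x * skew_part a v x \<partial>lborel)
     = (\<integral>x. euler0 (euler0 v) x * skew_part a v x + (1/2) * (angular v x * skew_part a v x) + b x * v x * skew_part a v x \<partial>lborel)"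
    by (simp add: sym_part_def algebra_simps)
  also have "\<dots> = (\<integral>x. euler0 (euler0 v) x * skew_part a v x \<partial>lborel) + (1/2) * (\<integral>x. angular v x * skew_part a v x \<partial>lborel)
      + (\<integral>x. b x * v x * skew_part a v x \<partial>lborel)"
    using i by simp
  finally show ?thesis
    using ang radial_part_integral[OF a0 v] potential_part_integral[OF a0 b v] by simp
qed

text \<open>Converts the integral of \<open>p (euler0 v)^2\<close> into a pairing with
  \<open>sym_part b v\<close>, up to zero order terms. It serves the exterior estimate, where the
  commutator contains such an integral with the wrong sign. Nonnegativity of \<open>p\<close> allows
  the angular part to be discarded.\<close>

theorem sym_part_weighted:
  assumes p: "radial p" "\<And>x. x \<noteq> 0 \<Longrightarrow> p x \<ge> 0" and b: "smooth0 b" and v: "punctured_test v"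
  shows "(\<integral>x. sym_part b v x * (p x * v x) \<partial>lborel)
     \<le> - (\<integral>x. p x * (euler0 v x * euler0 v x) \<partial>lborel) + (1/2) * (\<integral>x. euler (euler p) x * (v x * v x) \<partial>lborel)
      + (\<integral>x. p x * b x * (v x * v x) \<partial>lborel)"
proof -
  note p0 = radialD[OF p(1)]
  note P = punctured_test_mult[OF p0 v] and z = punctured_test_euler0[OF v]
  have i: "integrable lborel (\<lambda>x. euler0 (euler0 v) x * (p x * v x))"
    "integrable lborel (\<lambda>x. angular v x * (p x * v x))"
    "integrable lborel (\<lambda>x. b x * v x * (p x * v x))"
    "\<And>i j. integrable lborel (\<lambda>x. rot i j (rot i j v) x * (p x * v x))"
    by (intro punctured_test_integrable punctured_test_mult2 P punctured_test_euler0 punctured_test_angular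
        punctured_test_mult[OF b] punctured_test_rot v)+
  have L: "(\<integral>x. rot i j (rot i j v) x * (p x * v x) \<partial>lborel) \<le> 0" for i j
  proof -
    have "(\<integral>x. rot i j (rot i j v) x * (p x * v x) \<partial>lborel) = - (\<integral>x. p x * (rot i j v x * rot i j v x) \<partial>lborel)"
      unfolding rot_skew[OF punctured_test_rot[OF v] P] rot_mult_radial[OF p(1) v] by (simp add: mult_ac)
    moreover have "(\<integral>x. p x * (rot i j v x * rot i j v x) \<partial>lborel) \<ge> 0"
    proof (rule Bochner_Integration.integral_nonneg)
      show "0 \<le> p x * (rot i j v x * rot i j v x)" for x
        using p(2)[of x] zero_near_imp(4)[OF v, of i j] by (cases "x = 0") auto
    qed
    ultimately show ?thesis by simp
  qed
  have ang: "(\<integral>x. angular v x * (p x * v x) \<partial>lborel) \<le> 0"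
    unfolding angular_def sum_distrib_right
    by (subst Bochner_Integration.integral_sum, (intro Bochner_Integration.integrable_sum i(4)))
      (subst Bochner_Integration.integral_sum, rule i(4), intro sum_nonpos L)
  have "(\<integral>x. sym_part b v x * (p x * v x) \<partial>lborel)
     = (\<integral>x. euler0 (euler0 v) x * (p x * v x) + (1/2) * (angular v x * (p x * v x)) + b x * v x * (p x * v x) \<partial>lborel)"
    by (simp add: sym_part_def algebra_simps)
  also have "\<dots> = (\<integral>x. euler0 (euler0 v) x * (p x * v x) \<partial>lborel) + (1/2) * (\<integral>x. angular v x * (p x * v x) \<partial>lborel)
      + (\<integral>x. b x * v x * (p x * v x) \<partial>lborel)"
    using i by simp
  also have "(\<integral>x. b x * v x * (p x * v x) \<partial>lborel) = (\<integral>x. p x * b x * (v x * v x) \<partial>lborel)" by (simp add: mult_ac)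
  also have "(\<integral>x. euler0 (euler0 v) x * (p x * v x) \<partial>lborel)
     = - (\<integral>x. euler p x * (v x * euler0 v x) \<partial>lborel) - (\<integral>x. p x * (euler0 v x * euler0 v x) \<partial>lborel)"
    by (rule integral_euler0_mult[OF p0 z v])
  also have "(\<integral>x. euler p x * (v x * euler0 v x) \<partial>lborel) = - (1/2) * (\<integral>x. euler (euler p) x * (v x * v x) \<partial>lborel)"
    by (rule integral_euler0_self[OF smooth0_euler[OF p0] v])
  finally show ?thesis using ang by simp
qed

text \<open>Conjugation of \<open>|x|\<^sup>2 \<Delta>\<close> with a radial weight \<open>\<omega> = e\<^sup>\<phi>\<close>, where \<open>euler \<phi> = a - 1\<close>.\<close>

theorem conjugated_lap:
  fixes w :: "real^'n \<Rightarrow> real"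
  assumes om: "radial om" and a: "smooth0 a" and w: "punctured_test w"
    and Eom: "\<And>x. x \<noteq> 0 \<Longrightarrow> euler om x = (a x - 1) * om x"
  defines "v \<equiv> \<lambda>x. om x * w x" and "b \<equiv> \<lambda>x. a x * a x - (real CARD('n) - 2)\<^sup>2 / 4"
  shows "om x * ((x \<bullet> x) * lap w x) = sym_part b v x + skew_part a v x"
proof (cases "x = 0")
  case True
  have v: "punctured_test v" unfolding v_def by (rule punctured_test_mult[OF radialD[OF om] w])
  have "angular v 0 = 0" using zero_near_imp(4)[OF punctured_test_rot[OF v]] by (simp add: angular_def)
  then show ?thesis using True zero_near_imp[OF v] zero_near_imp[OF punctured_test_euler0[OF v]]
    by (simp add: sym_part_def skew_part_def)
next
  case False
  note o0 = radialD[OF om]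
  have v: "punctured_test v" unfolding v_def by (rule punctured_test_mult[OF o0 w])
  define y where "y x = om x * euler0 w x" for x
  have y: "punctured_test y" unfolding y_def by (rule punctured_test_mult[OF o0 punctured_test_euler0[OF w]])
  have am: "smooth0 (\<lambda>x. a x - 1)" by (rule smooth_in_diff[OF open_punctured a smooth_in_const])
  have am1: "euler (\<lambda>x. a x - 1) x = euler a x"
    unfolding euler_def using pd_add[of a x "\<lambda>x. -1"] smooth_inD(1)[OF a, of x] False by simp
  have Ev: "euler0 v = (\<lambda>x. (a x - 1) * v x + y x)"
  proof
    fix x show "euler0 v x = (a x - 1) * v x + y x"
    proof (cases "x = 0")
      case True then show ?thesis using zero_near_imp[OF v] zero_near_imp[OF y] by simp
    next
      case False then show ?thesis unfolding v_def y_def euler0_mult[OF o0 w] Eom[OF False] by (simp add: algebra_simps)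
    qed
  qed
  have EEv: "euler0 (euler0 v) x = euler a x * v x + (a x - 1) * euler0 v x + euler0 y x"
    unfolding Ev[THEN arg_cong[of _ _ euler0]]
    by (subst euler0_add) (use punctured_testD(3)[OF punctured_test_mult[OF am v]] punctured_testD(3)[OF y] euler0_mult[OF am v] am1 in auto)
  have Ey: "euler0 y x = (a x - 1) * y x + om x * euler0 (euler0 w) x"
    unfolding y_def euler0_mult[OF o0 punctured_test_euler0[OF w]] Eom[OF False] by simp
  have LL: "rot i j (rot i j v) x = om x * rot i j (rot i j w) x" for i j
  proof -
    have "rot i j v = (\<lambda>x. om x * rot i j w x)" unfolding v_def using rot_mult_radial[OF om w] by blast
    then show ?thesis using rot_mult_radial[OF om punctured_test_rot[OF w]] by simp
  qed
  have ang: "angular v x = om x * angular w x"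
    unfolding angular_def LL by (simp add: sum_distrib_left)
  let ?n = "real CARD('n)"
  have EEw: "euler0 (euler0 w) x = euler (euler w) x + ?n * euler w x + ?n\<^sup>2 / 4 * w x"
  proof -
    have "euler (euler0 w) x = euler (euler w) x + ?n / 2 * euler w x"
    proof -
      have "euler (\<lambda>x. euler w x + ?n / 2 * w x) x = euler (euler w) x + euler (\<lambda>x. ?n / 2 * w x) x"
        by (rule euler_add[OF punctured_testD(3)[OF punctured_test_euler[OF w]]
            punctured_testD(3)[OF punctured_test_mult[OF smooth_in_const w]]])
      also have "euler (\<lambda>x. ?n / 2 * w x) x = ?n / 2 * euler w x"
        using euler_mult[of "\<lambda>x. ?n / 2" x w] punctured_testD(3)[OF w, of x] by (simp add: euler_def)
      finally show ?thesis by (simp add: euler0_def[abs_def])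
    qed
    then show ?thesis by (simp add: euler0_def[of "euler0 w"] euler0_def[of w] field_simps power2_eq_square)
  qed
  have "(x \<bullet> x) * lap w x = euler0 (euler0 w) x - 2 * euler0 w x - (?n\<^sup>2 / 4 - ?n) * w x + angular w x / 2"
    unfolding lap_polar[OF punctured_testD(2)[OF w] UNIV_I] EEw euler0_def[of w] angular_def
    by (simp add: field_simps power2_eq_square)
  then have "om x * ((x \<bullet> x) * lap w x) = om x * (euler0 (euler0 w) x - 2 * euler0 w x - (?n\<^sup>2 / 4 - ?n) * w x + angular w x / 2)"
    by simp
  also have "\<dots> = om x * euler0 (euler0 w) x - 2 * y x - (?n\<^sup>2 / 4 - ?n) * v x + angular v x / 2"
    unfolding ang y_def by (simp add: v_def algebra_simps)
  \<comment> \<open>On \<open>v\<close>, the conjugated \<open>euler0\<close> is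
    \<open>X = euler0 - (a - 1)\<close>, and \<open>y\<close> is \<open>X v\<close>. Then
    \<open>X^2 - 2 X = (euler0 - a)^2 - 1\<close>. The mixed terms of the square form
    \<open>skew_part\<close>, and \<open>-1 - n^2/4 + n = -(n-2)^2/4\<close> is the constant in
    \<open>b\<close>.\<close>
  also have "\<dots> = sym_part b v x + skew_part a v x"
  proof -
    have ev: "euler0 v x = (a x - 1) * v x + y x" using Ev by (rule fun_cong)
    show ?thesis unfolding sym_part_def skew_part_def EEv Ey b_def ev
      by (simp add: power2_eq_square field_simps)
  qed
  finally show ?thesis .
qed

subsection \<open>Unique continuation\<close>

text \<open>The square of \<open>g\<close> is dropped. In both Carleman estimates \<open>g\<close>
  is the skew part and the gain comes from the cross term.\<close>

lemma integral_square_sum_ge: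
  assumes "punctured_test f" "punctured_test g"
  shows "(\<integral>x. (f x + g x)\<^sup>2 \<partial>lborel) \<ge> (\<integral>x. (f x)\<^sup>2 \<partial>lborel) + 2 * (\<integral>x. f x * g x \<partial>lborel)"
proof -
  have i: "integrable lborel (\<lambda>x. f x * f x)" "integrable lborel (\<lambda>x. g x * g x)" "integrable lborel (\<lambda>x. f x * g x)"
    by (intro punctured_test_integrable punctured_test_mult2 assms)+
  have "(\<integral>x. (f x + g x)\<^sup>2 \<partial>lborel) = (\<integral>x. f x * f x + 2 * (f x * g x) + g x * g x \<partial>lborel)"
    by (simp add: power2_eq_square algebra_simps)
  also have "\<dots> = (\<integral>x. f x * f x \<partial>lborel) + 2 * (\<integral>x. f x * g x \<partial>lborel) + (\<integral>x. g x * g x \<partial>lborel)"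
    using i by simp
  finally show ?thesis by (simp add: power2_eq_square)
qed

lemma AE_not_in_open:
  fixes S :: "(real^'n) set"
  assumes "open S" "AE x in lborel. x \<notin> S" shows "S = {}"
proof (rule ccontr)
  assume "S \<noteq> {}"
  then obtain x e where e: "e > 0" "ball x e \<subseteq> S" using assms(1) open_contains_ball by blast
  have "AE y in lborel. y \<notin> ball x e" using assms(2) by eventually_elim (use e in auto)
  then have "emeasure lborel (ball x e) = 0"
    by (subst (asm) AE_iff_measurable[where N = "ball x e"]) auto
  then show False using content_ball_pos[OF e(1), of x] by (simp add: measure_def)
qed

lemma continuous_nonneg_integral_le_0:
  fixes g :: "real^'n \<Rightarrow> real"
  assumes S: "open S" and c: "continuous_on UNIV g" and nn: "\<And>x. g x \<ge> 0"
    and i: "integrable lborel (\<lambda>x. indicator S x * g x)" and le: "(\<integral>x. indicator S x * g x \<partial>lborel) \<le> 0"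
    and x: "x \<in> S"
  shows "g x = 0"
proof -
  have "(\<integral>x. indicator S x * g x \<partial>lborel) \<ge> 0" by (rule Bochner_Integration.integral_nonneg) (simp add: nn)
  then have "AE x in lborel. indicator S x * g x = 0"
    using integral_nonneg_eq_0_iff_AE[OF i] nn le by (simp add: order_antisym)
  then have "AE x in lborel. x \<notin> S \<inter> {x. g x > 0}" by eventually_elim (auto simp: indicator_def)
  moreover have "open (S \<inter> {x. g x > 0})"
    by (intro open_Int S open_Collect_less continuous_intros c)
  ultimately have "S \<inter> {x. g x > 0} = {}" using AE_not_in_open by blast
  then show ?thesis using x nn[of x] by force
qed

lemma radial_const: "radial (\<lambda>x. c)" by (simp add: radial_def rot_def)

lemma radial_mult: assumes "radial a" "radial b" shows "radial (\<lambda>x. a x * b x)"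
proof -
  have "rot i j (\<lambda>x. a x * b x) x = 0" if "x \<noteq> 0" for i j x
    using rot_mult[of a x b i j] smooth_inD(1)[OF radialD[OF assms(1)], of x] smooth_inD(1)[OF radialD[OF assms(2)], of x] assms that
    by (simp add: radial_def)
  then show ?thesis using smooth_in_mult[OF open_punctured radialD[OF assms(1)] radialD[OF assms(2)]] by (simp add: radial_def)
qed

lemma radial_add: assumes "radial a" "radial b" shows "radial (\<lambda>x. a x + b x)"
proof -
  have "rot i j (\<lambda>x. a x + b x) x = 0" if "x \<noteq> 0" for i j x
    using rot_add[of a x b i j] smooth_inD(1)[OF radialD[OF assms(1)], of x] smooth_inD(1)[OF radialD[OF assms(2)], of x] assms that
    by (simp add: radial_def)
  then show ?thesis using smooth_in_add[OF open_punctured radialD[OF assms(1)] radialD[OF assms(2)]] by (simp add: radial_def)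
qed

lemma radial_compose:
  assumes "radial f" "\<And>x. x \<noteq> 0 \<Longrightarrow> (g has_real_derivative g' (f x)) (at (f x))" "smooth0 (\<lambda>x. g (f x))"
  shows "radial (\<lambda>x. g (f x))"
proof -
  have "rot i j (\<lambda>x. g (f x)) x = 0" if "x \<noteq> 0" for i j x
  proof -
    have "rot i j (\<lambda>x. g (f x)) x = g' (f x) * rot i j f x" unfolding rot_def
      using pd_compose[OF assms(2)[OF that] smooth_inD(1)[OF radialD[OF assms(1)]]] that by (simp add: algebra_simps)
    then show ?thesis using assms(1) that by (simp add: radial_def)
  qed
  then show ?thesis using assms(3) by (simp add: radial_def)
qed

lemma euler_compose:
  assumes "(g has_real_derivative g') (at (f x))" "f differentiable at x"
  shows "euler (\<lambda>x. g (f x)) x = g' * euler f x"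
  unfolding euler_def pd_compose[OF assms] by (simp add: sum_distrib_left algebra_simps)

lemma pd_norm_sq: "pd (\<lambda>x::real^'n. x \<bullet> x) i x = 2 * x $ i"
proof -
  have "((\<lambda>x::real^'n. x \<bullet> x) has_derivative (\<lambda>h. 2 * (x \<bullet> h))) (at x)"
    by (auto intro!: derivative_eq_intros simp: inner_commute)
  from pd_eqI[OF this, of i] show ?thesis by (simp add: inner_axis)
qed

lemma radial_norm_sq: "radial (\<lambda>x::real^'n. x \<bullet> x)"
  by (simp add: radial_def radial_smooth rot_def pd_norm_sq)

lemma euler_norm_sq: "euler (\<lambda>x::real^'n. x \<bullet> x) x = 2 * (x \<bullet> x)"
  unfolding euler_def pd_norm_sq by (simp add: inner_vec_def sum_distrib_left algebra_simps)

lemma differentiable_norm_sq: "(\<lambda>x::real^'n. x \<bullet> x) differentiable at x"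
  using smooth_inD(1)[OF radial_smooth[of UNIV]] by auto

lemma euler_const_mult: "f differentiable at x \<Longrightarrow> euler (\<lambda>x. c * f x) x = c * euler f x"
  using euler_mult[of "\<lambda>x. c" x f] by (simp add: euler_def)

theorem carleman_inner:
  fixes w :: "real^'n \<Rightarrow> real" and m :: nat
  assumes w: "punctured_test w"
  defines "a \<equiv> \<lambda>x::real^'n. x \<bullet> x + (1 - 2 * real m)" and "om \<equiv> \<lambda>x::real^'n. inverse ((x \<bullet> x) ^ m) * exp ((1/2) * (x \<bullet> x))"
  shows "(\<integral>x. (8 * (a x)\<^sup>2 - 8) * (x \<bullet> x) * (om x * w x)\<^sup>2 \<partial>lborel) \<le> (\<integral>x. (om x * ((x \<bullet> x) * lap w x))\<^sup>2 \<partial>lborel)"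
proof -
  let ?q = "\<lambda>x::real^'n. x \<bullet> x"
  have pos: "?q x \<noteq> 0" if "x \<noteq> 0" for x using that by simp
  have rp: "radial (\<lambda>x::real^'n. ?q x ^ m)"
    by (induction m) (simp_all add: radial_const radial_mult[OF radial_norm_sq])
  have ri: "radial (\<lambda>x::real^'n. inverse (?q x ^ m))"
    by (rule radial_compose[OF rp, of inverse "\<lambda>t. - (inverse t * inverse t)"])
      (use pos in \<open>auto intro!: derivative_eq_intros smooth_in_inverse open_punctured radialD[OF rp] simp: power2_eq_square\<close>)
  have rh: "radial (\<lambda>x::real^'n. (1/2) * ?q x)" by (rule radial_mult[OF radial_const radial_norm_sq])
  have re: "radial (\<lambda>x::real^'n. exp ((1/2) * ?q x))"
    by (rule radial_compose[OF rh, of exp exp]) (auto intro!: derivative_eq_intros smooth_in_exp open_punctured radialD[OF rh, simplified])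
  have om: "radial om" unfolding om_def by (rule radial_mult[OF ri re])
  have a: "radial a" unfolding a_def by (rule radial_add[OF radial_norm_sq radial_const])
  have Ea: "euler a = (\<lambda>x. 2 * ?q x)"
    unfolding a_def by (auto simp: fun_eq_iff euler_add differentiable_norm_sq euler_norm_sq) (simp add: euler_def)
  have EEa: "euler (euler (euler a)) = (\<lambda>x. 8 * ?q x)"
  proof -
    have "euler (\<lambda>x::real^'n. c * ?q x) = (\<lambda>x. (2 * c) * ?q x)" for c
      by (simp add: fun_eq_iff euler_const_mult differentiable_norm_sq euler_norm_sq)
    from this[of 2] this[of "2 * 2"] show ?thesis unfolding Ea by simp
  qed
  have Eom: "euler om x = (a x - 1) * om x" if x: "x \<noteq> 0" for x
  proof -
    have "euler (\<lambda>x. ?q x ^ m) x = real m * ?q x ^ (m - 1) * (2 * ?q x)"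
      using euler_compose[of "\<lambda>t. t ^ m" "real m * ?q x ^ (m - 1)" ?q x] differentiable_norm_sq
      by (auto intro!: derivative_eq_intros simp: euler_norm_sq)
    also have "\<dots> = 2 * real m * ?q x ^ m" by (cases m) auto
    finally have p: "euler (\<lambda>x. ?q x ^ m) x = 2 * real m * ?q x ^ m" .
    have i: "euler (\<lambda>x. inverse (?q x ^ m)) x = - (2 * real m) * inverse (?q x ^ m)"
    proof -
      have "(inverse has_real_derivative - (inverse (?q x ^ m) * inverse (?q x ^ m))) (at (?q x ^ m))"
        using pos[OF x] by (auto intro!: derivative_eq_intros simp: power2_eq_square)
      then have "euler (\<lambda>x. inverse (?q x ^ m)) x = - (inverse (?q x ^ m) * inverse (?q x ^ m)) * euler (\<lambda>x. ?q x ^ m) x"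
        by (rule euler_compose) (use smooth_inD(1)[OF radialD[OF rp], of x] x in simp)
      then show ?thesis unfolding p using pos[OF x] by simp
    qed
    have e: "euler (\<lambda>x. exp ((1/2) * ?q x)) x = ?q x * exp ((1/2) * ?q x)"
    proof -
      have "euler (\<lambda>x. exp ((1/2) * ?q x)) x = exp ((1/2) * ?q x) * euler (\<lambda>x. (1/2) * ?q x) x"
        by (rule euler_compose[OF DERIV_exp]) (use smooth_inD(1)[OF radialD[OF rh], of x] x in simp)
      also have "euler (\<lambda>x. (1/2) * ?q x) x = ?q x"
        unfolding euler_const_mult[OF differentiable_norm_sq] euler_norm_sq by simp
      finally show ?thesis by simp
    qed
    have "euler om x = - (2 * real m) * inverse (?q x ^ m) * exp ((1/2) * ?q x) + inverse (?q x ^ m) * (?q x * exp ((1/2) * ?q x))"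
      unfolding om_def
      by (subst euler_mult) (use smooth_inD(1)[OF radialD[OF ri], of x] smooth_inD(1)[OF radialD[OF re], of x] x i e in auto)
    also have "\<dots> = (a x - 1) * om x" unfolding a_def om_def by algebra
    finally show ?thesis .
  qed
  define v where "v x = om x * w x" for x
  define b where "b x = a x * a x - (real CARD('n) - 2)\<^sup>2 / 4" for x
  have a0: "smooth0 a" and o0: "smooth0 om" using a om radialD by auto
  have v: "punctured_test v" unfolding v_def by (rule punctured_test_mult[OF o0 w])
  have b0: "smooth0 b" unfolding b_def by (intro smooth_in_diff smooth_in_mult open_punctured a0 smooth_in_const)
  have Eb: "euler b x = 4 * a x * ?q x" if "x \<noteq> 0" for x
  proof -
    have d: "a differentiable at x" using smooth_inD(1)[OF a0] that by simp
    have "euler (\<lambda>x. a x * a x + (- ((real CARD('n) - 2)\<^sup>2 / 4))) x = 2 * a x * euler a x"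
      by (subst euler_add) (use d in \<open>auto simp: euler_mult\<close>, simp add: euler_def)
    then show ?thesis by (simp add: b_def[abs_def] Ea)
  qed
  have eq: "om x * (?q x * lap w x) = sym_part b v x + skew_part a v x" for x
    using conjugated_lap[OF om a0 w Eom, of x] by (simp add: v_def[abs_def] b_def[abs_def])
  note S = punctured_test_sym[OF b0 v] and A = punctured_test_skew[OF a0 v]
  have q0: "smooth0 (\<lambda>x::real^'n. c * ?q x)" for c by (intro smooth_in_mult smooth_in_const radial_smooth open_punctured)
  have aEb: "smooth0 (\<lambda>x. a x * euler b x)" by (intro smooth_in_mult open_punctured a0 smooth0_euler b0)
  have i3: "integrable lborel (\<lambda>x. a x * euler b x * (v x * v x))" by (rule weighted_integrable[OF aEb v v])
  have i2: "integrable lborel (\<lambda>x. 8 * ?q x * (v x * v x))" by (rule weighted_integrable[OF q0 v v])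
  have "(\<integral>x. (om x * (?q x * lap w x))\<^sup>2 \<partial>lborel) \<ge> (\<integral>x. (sym_part b v x)\<^sup>2 \<partial>lborel) + 2 * (\<integral>x. sym_part b v x * skew_part a v x \<partial>lborel)"
    unfolding eq by (rule integral_square_sum_ge[OF S A])
  moreover have "(\<integral>x. (sym_part b v x)\<^sup>2 \<partial>lborel) \<ge> 0" by (rule Bochner_Integration.integral_nonneg) simp
  moreover have "(\<integral>x. euler a x * (euler0 v x * euler0 v x) \<partial>lborel) \<ge> 0" by (rule Bochner_Integration.integral_nonneg) (simp add: Ea)
  ultimately have "(\<integral>x. (om x * (?q x * lap w x))\<^sup>2 \<partial>lborel)
     \<ge> 2 * (\<integral>x. a x * euler b x * (v x * v x) \<partial>lborel) - (\<integral>x. euler (euler (euler a)) x * (v x * v x) \<partial>lborel)"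
    using commutator_identity[OF a b0 v] by linarith
  also have "2 * (\<integral>x. a x * euler b x * (v x * v x) \<partial>lborel) - (\<integral>x. euler (euler (euler a)) x * (v x * v x) \<partial>lborel)
      = (\<integral>x. 2 * (a x * euler b x * (v x * v x)) - 8 * ?q x * (v x * v x) \<partial>lborel)"
    unfolding EEa using i2 i3 by simp
  also have "\<dots> = (\<integral>x. (8 * (a x)\<^sup>2 - 8) * (x \<bullet> x) * (om x * w x)\<^sup>2 \<partial>lborel)"
  proof (intro Bochner_Integration.integral_cong refl)
    fix x show "2 * (a x * euler b x * (v x * v x)) - 8 * ?q x * (v x * v x) = (8 * (a x)\<^sup>2 - 8) * (x \<bullet> x) * (om x * w x)\<^sup>2"
      using Eb[of x] zero_near_imp(1)[OF v] by (cases "x = 0") (auto simp: v_def power2_eq_square algebra_simps)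
  qed
  finally show ?thesis .
qed

lemma pd_Re: "w differentiable at x \<Longrightarrow> pd (\<lambda>x. Re (w x)) i x = Re (pd w i x)"
  by (rule pd_bounded_linear[OF bounded_linear_Re])

lemma pd_Im: "w differentiable at x \<Longrightarrow> pd (\<lambda>x. Im (w x)) i x = Im (pd w i x)"
  by (rule pd_bounded_linear[OF bounded_linear_Im])

lemma smooth_Re_Im:
  assumes "open S" "smooth_in S w"
  shows "smooth_in S (\<lambda>x. Re (w x))" "smooth_in S (\<lambda>x. Im (w x))"
  using smooth_in_bounded_linear[OF assms(1) bounded_linear_Re assms(2)] smooth_in_bounded_linear[OF assms(1) bounded_linear_Im assms(2)] by auto

lemma lap_Re_Im:
  assumes "smooth_in UNIV w"
  shows "lap (\<lambda>x. Re (w x)) x = Re (lap w x)" "lap (\<lambda>x. Im (w x)) x = Im (lap w x)"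
proof -
  have "pd (\<lambda>x. Re (w x)) i = (\<lambda>x. Re (pd w i x))" "pd (\<lambda>x. Im (w x)) i = (\<lambda>x. Im (pd w i x))" for i
    using pd_Re pd_Im smooth_inD(1)[OF assms] by blast+
  moreover have "pd w i differentiable at x" for i
    using smooth_inD(1)[OF smooth_inD(2)[OF assms]] by blast
  ultimately show "lap (\<lambda>x. Re (w x)) x = Re (lap w x)" "lap (\<lambda>x. Im (w x)) x = Im (lap w x)"
    by (simp_all add: lap_def pd_Re pd_Im)
qed

text \<open>The cross term is doubled by an addition since the algebra is not assumed to have a
  unit, hence no numeral 2.\<close>

lemma lap_mult:
  fixes f g :: "real^'n \<Rightarrow> 'b::real_normed_algebra"
  assumes "smooth_in S f" "smooth_in S g" "open S" "x \<in> S"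
  shows "lap (\<lambda>x. f x * g x) x = f x * lap g x + lap f x * g x + (\<Sum>i\<in>UNIV. pd f i x * pd g i x + pd f i x * pd g i x)"
proof -
  note d = smooth_inD(1)[OF assms(1)] smooth_inD(1)[OF assms(2)]
    smooth_inD(1)[OF smooth_inD(2)[OF assms(1)]] smooth_inD(1)[OF smooth_inD(2)[OF assms(2)]]
  have "pd (pd (\<lambda>x. f x * g x) i) i x = f x * pd (pd g i) i x + pd f i x * pd g i x + (pd f i x * pd g i x + pd (pd f i) i x * g x)" for i
  proof -
    have "pd (pd (\<lambda>x. f x * g x) i) i x = pd (\<lambda>x. f x * pd g i x + pd f i x * g x) i x"
      by (rule pd_cong_open[OF assms(3,4)]) (simp add: pd_mult d)
    also have "\<dots> = pd (\<lambda>x. f x * pd g i x) i x + pd (\<lambda>x. pd f i x * g x) i x"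
      using d assms(4) by (intro pd_add) auto
    finally show ?thesis using d assms(4) by (simp add: pd_mult)
  qed
  then show ?thesis by (simp add: lap_def sum.distrib sum_distrib_left sum_distrib_right)
qed

lemma smooth_lap: "open S \<Longrightarrow> smooth_in S v \<Longrightarrow> smooth_in S (lap v)"
  unfolding lap_def[abs_def] by (intro smooth_in_sum smooth_inD(2))

lemma lap_cong_open:
  assumes "open S" "x \<in> S" "\<And>y. y \<in> S \<Longrightarrow> f y = g y" shows "lap f x = lap g x"
proof -
  have "pd (pd f i) i x = pd (pd g i) i x" for i
    by (rule pd_cong_open[OF assms(1,2)]) (rule pd_cong_open[OF assms(1) _ assms(3)])
  then show ?thesis by (simp add: lap_def)
qed

lemma lap_0: "lap (\<lambda>x::real^'n. 0::'b::real_normed_vector) x = 0"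
proof -
  have "pd (\<lambda>x::real^'n. 0::'b) = (\<lambda>i x. 0)" by (intro ext) simp
  then show ?thesis by (simp add: lap_def)
qed

text \<open>The weights \<open>\<omega>\<^sub>m = |x|\<^sup>-\<^sup>2\<^sup>m e\<^bsup>|x|\<^sup>2/2\<^esup>\<close> of the inner Carleman estimate concentrate at the
  origin as \<open>m\<close> grows, so the cutoff error at \<open>|x| \<ge> R\<^sub>1\<close> is negligible.\<close>

lemma unique_continuation_smooth:
  fixes w :: "real^'n \<Rightarrow> complex"
  assumes w: "smooth_in UNIV w" and eq: "\<And>x. norm x < R \<Longrightarrow> lap w x + l * w x = 0"
    and r: "0 < r" "\<And>x. norm x < r \<Longrightarrow> w x = 0" and x0: "norm x0 < R"
  shows "w x0 = 0"
proof (cases "x0 = 0")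
  case True then show ?thesis using r by simp
next
  case False
  \<comment> \<open>Quarter points between \<open>norm x0\<close> and \<open>R\<close>: the cutoff
    acts between \<open>R1\<close> and \<open>R2\<close>, the conclusion is drawn in the ball of
    radius \<open>R0\<close>, and the gap between \<open>R0\<close> and \<open>R1\<close> produces
    the geometric factor in \<open>main\<close>.\<close>
  define R0 where "R0 = norm x0 + (R - norm x0) / 4"
  define R1 where "R1 = norm x0 + (R - norm x0) / 2"
  define R2 where "R2 = norm x0 + 3 * (R - norm x0) / 4"
  have "0 < R0 \<and> norm x0 < R0 \<and> R0 < R1 \<and> R1 < R2 \<and> R2 < R"
    unfolding R0_def R1_def R2_def by (intro conjI) (use x0 norm_ge_zero[of x0] in argo)+
  then have RR: "0 < R0" "norm x0 < R0" "R0 < R1" "R1 < R2" "R2 < R" by auto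
  have RR2: "R1\<^sup>2 < R2\<^sup>2" using RR by (intro power_strict_mono) auto
  define chi where "chi x = step ((R2\<^sup>2 - x \<bullet> x) * (1 / (R2\<^sup>2 - R1\<^sup>2)))" for x :: "real^'n"
  have chi_s: "smooth_in UNIV chi" unfolding chi_def
    by (rule smooth_in_compose_real[OF open_UNIV smooth_in_mult[OF open_UNIV smooth_in_diff[OF open_UNIV smooth_in_const radial_smooth] smooth_in_const] smooth_real_step])
  have chi1: "chi x = 1" if "norm x \<le> R1" for x
  proof -
    have "(norm x)\<^sup>2 \<le> R1\<^sup>2" using that by (intro power_mono) auto
    then show ?thesis unfolding chi_def power2_norm_eq_inner[symmetric] using RR2 by (intro step_1) (simp add: field_simps)
  qed
  have chi0: "chi x = 0" if "norm x \<ge> R2" for x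
  proof -
    have "(norm x)\<^sup>2 \<ge> R2\<^sup>2" using that RR by (intro power_mono) auto
    then show ?thesis unfolding chi_def power2_norm_eq_inner[symmetric] using RR2 by (intro step_0) (simp add: field_simps)
  qed
  define w1 where "w1 x = chi x * Re (w x)" for x
  define w2 where "w2 x = chi x * Im (w x)" for x
  note sRI = smooth_Re_Im[OF open_UNIV w]
  have s12: "smooth_in UNIV w1" "smooth_in UNIV w2" unfolding w1_def w2_def
    by (intro smooth_in_mult open_UNIV chi_s sRI)+
  have p12: "punctured_test w1" "punctured_test w2" unfolding punctured_test_def
    using test_functionI[OF s12(1), of R2] test_functionI[OF s12(2), of R2] chi0 r by (auto simp: w1_def w2_def intro!: exI[of _ r])
  \<comment> \<open>As \<open>l\<close> is complex, the real and imaginary parts satisfy a coupled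
    real system. \<open>e1\<close> and \<open>e2\<close> are the errors committed by the cutoff,
    which live in \<open>R1 \<le> norm x \<le> R2\<close>.\<close>
  define e1 where "e1 x = lap w1 x + (Re l * w1 x - Im l * w2 x)" for x
  define e2 where "e2 x = lap w2 x + (Re l * w2 x + Im l * w1 x)" for x
  have ec: "continuous_on UNIV e1" "continuous_on UNIV e2" unfolding e1_def e2_def
    using smooth_inD(3)[OF smooth_lap[OF open_UNIV s12(1)]] smooth_inD(3)[OF smooth_lap[OF open_UNIV s12(2)]]
      smooth_inD(3)[OF s12(1)] smooth_inD(3)[OF s12(2)] by (auto intro!: continuous_intros)
  have e_in: "e1 x = 0" "e2 x = 0" if "norm x < R1" for x
  proof -
    have "lap w1 x = lap (\<lambda>x. Re (w x)) x" "lap w2 x = lap (\<lambda>x. Im (w x)) x"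
      by (rule lap_cong_open[OF open_ball[of 0 R1]]; use that chi1 in \<open>simp add: w1_def w2_def\<close>)+
    moreover have "lap w x = - (l * w x)" using eq[of x] that RR by (simp add: eq_neg_iff_add_eq_0)
    ultimately show "e1 x = 0" "e2 x = 0" using chi1[of x] that lap_Re_Im[OF w]
      by (simp_all add: e1_def e2_def w1_def w2_def algebra_simps)
  qed
  have e_out: "e1 x = 0" "e2 x = 0" if "norm x > R2" for x
  proof -
    have o: "open {x::real^'n. norm x > R2}" by (intro open_Collect_less continuous_intros)
    have "lap w1 x = lap (\<lambda>x. 0) x" "lap w2 x = lap (\<lambda>x. 0) x"
      by (rule lap_cong_open[OF o]; use that chi0 in \<open>simp add: w1_def w2_def\<close>)+
    then show "e1 x = 0" "e2 x = 0" using that chi0[of x] by (simp_all add: e1_def e2_def w1_def w2_def lap_0)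
  qed
  define N where "N x = (w1 x)\<^sup>2 + (w2 x)\<^sup>2" for x
  define EE where "EE x = (e1 x)\<^sup>2 + (e2 x)\<^sup>2" for x
  have EEi: "integrable lborel EE"
    by (rule integrable_cont_supp[where M = R2]) (auto simp: EE_def e_out intro!: continuous_intros ec)
  have Nc: "continuous_on UNIV N" unfolding N_def using smooth_inD(3)[OF s12(1)] smooth_inD(3)[OF s12(2)] by (intro continuous_intros)
  have Nout: "N x = 0" if "norm x > R2" for x using chi0[of x] that by (simp add: N_def w1_def w2_def)
  define K where "K = 2 * (R2\<^sup>2)\<^sup>2 * exp (R2\<^sup>2) * (\<integral>x. EE x \<partial>lborel)"
  define G where "G = (\<integral>x. indicator (ball 0 R0) x * ((x \<bullet> x) * N x) \<partial>lborel)"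
  have Gi: "integrable lborel (\<lambda>x. indicator (ball 0 R0) x * ((x \<bullet> x) * N x))"
  proof -
    have "integrable lborel (\<lambda>x. (x \<bullet> x) * N x)"
      by (rule integrable_cont_supp[where M = R2]) (auto simp: Nout intro!: continuous_intros Nc)
    from integrable_mult_indicator[OF _ this, of "ball 0 R0"] show ?thesis by simp
  qed
  \<comment> \<open>The bound on \<open>m\<close> gives \<open>-a \<ge> 2 + |l|^2 |x|^2\<close> on
    the support, so that \<open>8 a^2 - 8\<close> exceeds by at least 1 the amount
    \<open>2 |l|^2 |x|^2\<close> needed to absorb the zero order term of the system.\<close>
  have main: "G \<le> K * ((R0\<^sup>2 / R1\<^sup>2) ^ (2 * m))" if m: "2 * real m \<ge> R2\<^sup>2 + 3 + (cmod l)\<^sup>2 * R2\<^sup>2" for m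
  proof -
    define a where "a x = x \<bullet> x + (1 - 2 * real m)" for x :: "real^'n"
    define om where "om x = inverse ((x \<bullet> x) ^ m) * exp ((1/2) * (x \<bullet> x))" for x :: "real^'n"
    have om2: "(om x)\<^sup>2 = inverse ((x \<bullet> x) ^ (2 * m)) * exp (x \<bullet> x)" for x
      by (simp add: om_def power_mult_distrib power_inverse[symmetric] power_mult[symmetric] mult.commute exp_double[symmetric])
    have sm_om: "smooth0 om" unfolding om_def
      by (intro smooth_in_mult smooth_in_inverse smooth_in_exp smooth_in_power open_punctured radial_smooth smooth_in_const) simp
    have osq: "smooth0 (\<lambda>x. (om x)\<^sup>2 * f x)" if "smooth0 f" for f
      by (intro smooth_in_mult open_punctured smooth_in_power sm_om that)
    have int: "integrable lborel (\<lambda>x. f x * (p x * q x))" if "smooth0 f" "punctured_test p" "punctured_test q" for f p q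
      by (rule weighted_integrable[OF that])
    have pl: "punctured_test (lap w1)" "punctured_test (lap w2)"
      unfolding lap_def[abs_def] by (intro punctured_test_sum punctured_test_pd p12)+
    have sa: "smooth0 (\<lambda>x. (8 * (a x)\<^sup>2 - 8) * (x \<bullet> x))" "smooth0 (\<lambda>x::real^'n. (x \<bullet> x)\<^sup>2)"
      unfolding a_def by (intro smooth_in_mult smooth_in_diff smooth_in_add smooth_in_power open_punctured radial_smooth smooth_in_const)+
    have iL: "integrable lborel (\<lambda>x. (8 * (a x)\<^sup>2 - 8) * (x \<bullet> x) * (om x * p x)\<^sup>2)" if "punctured_test p" for p
      using int[OF osq[OF sa(1)] that that] by (simp add: power2_eq_square mult_ac)
    have iR: "integrable lborel (\<lambda>x. (om x * ((x \<bullet> x) * p x))\<^sup>2)" if "punctured_test p" for p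
      using int[OF osq[OF sa(2)] that that] by (simp add: power2_eq_square mult_ac)
    have c1: "(\<integral>x. (8 * (a x)\<^sup>2 - 8) * (x \<bullet> x) * (om x * p x)\<^sup>2 \<partial>lborel) \<le> (\<integral>x. (om x * ((x \<bullet> x) * lap p x))\<^sup>2 \<partial>lborel)"
      if "punctured_test p" for p
      using carleman_inner[OF that, of m] by (simp add: a_def om_def)
    have pw: "(om x * ((x \<bullet> x) * lap w1 x))\<^sup>2 + (om x * ((x \<bullet> x) * lap w2 x))\<^sup>2
        \<le> 2 * ((om x * ((x \<bullet> x) * e1 x))\<^sup>2 + (om x * ((x \<bullet> x) * e2 x))\<^sup>2) + 2 * (cmod l)\<^sup>2 * ((om x * ((x \<bullet> x) * w1 x))\<^sup>2 + (om x * ((x \<bullet> x) * w2 x))\<^sup>2)" for x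
    proof -
      have sq: "(A - B)\<^sup>2 \<le> 2 * A\<^sup>2 + 2 * B\<^sup>2" for A B :: real
        using zero_le_power2[of "A + B"] by (simp add: power2_eq_square algebra_simps)
      have "(lap w1 x)\<^sup>2 \<le> 2 * (e1 x)\<^sup>2 + 2 * (Re l * w1 x - Im l * w2 x)\<^sup>2" "(lap w2 x)\<^sup>2 \<le> 2 * (e2 x)\<^sup>2 + 2 * (Re l * w2 x + Im l * w1 x)\<^sup>2"
        using sq[of "e1 x" "Re l * w1 x - Im l * w2 x"] sq[of "e2 x" "Re l * w2 x + Im l * w1 x"] by (simp_all add: e1_def e2_def)
      moreover have "(Re l * w1 x - Im l * w2 x)\<^sup>2 + (Re l * w2 x + Im l * w1 x)\<^sup>2 = (cmod l)\<^sup>2 * ((w1 x)\<^sup>2 + (w2 x)\<^sup>2)"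
        unfolding cmod_power2 by (simp add: power2_eq_square algebra_simps)
      moreover have "p + q \<le> 2 * (c + d) + 2 * g" if "p \<le> 2 * c + 2 * c'" "q \<le> 2 * d + 2 * d'" "c' + d' = g" for p q c d c' d' g :: real
        using that by argo
      ultimately have "(lap w1 x)\<^sup>2 + (lap w2 x)\<^sup>2 \<le> 2 * ((e1 x)\<^sup>2 + (e2 x)\<^sup>2) + 2 * ((cmod l)\<^sup>2 * ((w1 x)\<^sup>2 + (w2 x)\<^sup>2))" by blast
      from mult_left_mono[OF this, of "(om x * (x \<bullet> x))\<^sup>2"] show ?thesis
        by (simp add: power_mult_distrib algebra_simps)
    qed
    have cl: "(om x)\<^sup>2 * ((x \<bullet> x) * N x) \<le> (8 * (a x)\<^sup>2 - 8) * (x \<bullet> x) * (om x * w1 x)\<^sup>2 + (8 * (a x)\<^sup>2 - 8) * (x \<bullet> x) * (om x * w2 x)\<^sup>2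
        - 2 * (cmod l)\<^sup>2 * ((om x * ((x \<bullet> x) * w1 x))\<^sup>2 + (om x * ((x \<bullet> x) * w2 x))\<^sup>2)" for x
    proof (cases "norm x \<le> R2")
      case False then show ?thesis using chi0[of x] by (simp add: N_def w1_def w2_def)
    next
      case True
      then have x2: "x \<bullet> x \<le> R2\<^sup>2" unfolding power2_norm_eq_inner[symmetric] by (intro power_mono) auto
      have "- a x \<ge> 2 + (cmod l)\<^sup>2 * R2\<^sup>2" using x2 m by (simp add: a_def)
      moreover have "(cmod l)\<^sup>2 * (x \<bullet> x) \<le> (cmod l)\<^sup>2 * R2\<^sup>2" using x2 by (intro mult_left_mono) auto
      ultimately have t: "- a x \<ge> 2 + (cmod l)\<^sup>2 * (x \<bullet> x)" by linarith
      have t0: "(cmod l)\<^sup>2 * (x \<bullet> x) \<ge> 0" by simp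
      have "(- a x)\<^sup>2 \<ge> (2 + (cmod l)\<^sup>2 * (x \<bullet> x))\<^sup>2" by (rule power_mono[OF t]) (use t0 in linarith)
      moreover have "A \<ge> 4 + 4 * T" if "A \<ge> (2 + T)\<^sup>2" for A T :: real
      proof -
        have "(2 + T)\<^sup>2 = 4 + 4 * T + T\<^sup>2" by (simp add: power2_sum)
        then show ?thesis using that zero_le_power2[of T] by linarith
      qed
      ultimately have "(a x)\<^sup>2 \<ge> 4 + 4 * ((cmod l)\<^sup>2 * (x \<bullet> x))" by simp
      then have "8 * (a x)\<^sup>2 - 8 - 2 * (cmod l)\<^sup>2 * (x \<bullet> x) \<ge> 1" using t0 by linarith
      from mult_right_mono[OF this, of "(om x)\<^sup>2 * ((x \<bullet> x) * N x)"]
      have "(om x)\<^sup>2 * ((x \<bullet> x) * N x) \<le> (8 * (a x)\<^sup>2 - 8 - 2 * (cmod l)\<^sup>2 * (x \<bullet> x)) * ((om x)\<^sup>2 * ((x \<bullet> x) * N x))"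
        by (simp add: N_def)
      then show ?thesis by (simp add: N_def power2_eq_square algebra_simps)
    qed
    have lhsi: "integrable lborel (\<lambda>x. (om x)\<^sup>2 * ((x \<bullet> x) * N x))"
    proof -
      have "integrable lborel (\<lambda>x. ((om x)\<^sup>2 * (x \<bullet> x)) * (w1 x * w1 x) + ((om x)\<^sup>2 * (x \<bullet> x)) * (w2 x * w2 x))"
        by (intro Bochner_Integration.integrable_add int osq radial_smooth p12)
      then show ?thesis by (simp add: N_def power2_eq_square algebra_simps)
    qed
    have "(\<integral>x. (om x)\<^sup>2 * ((x \<bullet> x) * N x) \<partial>lborel)
       \<le> (\<integral>x. (8 * (a x)\<^sup>2 - 8) * (x \<bullet> x) * (om x * w1 x)\<^sup>2 + (8 * (a x)\<^sup>2 - 8) * (x \<bullet> x) * (om x * w2 x)\<^sup>2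
        - 2 * (cmod l)\<^sup>2 * ((om x * ((x \<bullet> x) * w1 x))\<^sup>2 + (om x * ((x \<bullet> x) * w2 x))\<^sup>2) \<partial>lborel)"
      using lhsi iL[OF p12(1)] iL[OF p12(2)] iR[OF p12(1)] iR[OF p12(2)] cl
      by (intro Bochner_Integration.integral_mono) auto
    also have "\<dots> = (\<integral>x. (8 * (a x)\<^sup>2 - 8) * (x \<bullet> x) * (om x * w1 x)\<^sup>2 \<partial>lborel) + (\<integral>x. (8 * (a x)\<^sup>2 - 8) * (x \<bullet> x) * (om x * w2 x)\<^sup>2 \<partial>lborel)
       - (\<integral>x. 2 * (cmod l)\<^sup>2 * ((om x * ((x \<bullet> x) * w1 x))\<^sup>2 + (om x * ((x \<bullet> x) * w2 x))\<^sup>2) \<partial>lborel)"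
      using iL[OF p12(1)] iL[OF p12(2)] iR[OF p12(1)] iR[OF p12(2)] by simp
    also have "\<dots> \<le> (\<integral>x. (om x * ((x \<bullet> x) * lap w1 x))\<^sup>2 \<partial>lborel) + (\<integral>x. (om x * ((x \<bullet> x) * lap w2 x))\<^sup>2 \<partial>lborel)
       - (\<integral>x. 2 * (cmod l)\<^sup>2 * ((om x * ((x \<bullet> x) * w1 x))\<^sup>2 + (om x * ((x \<bullet> x) * w2 x))\<^sup>2) \<partial>lborel)"
      using c1[OF p12(1)] c1[OF p12(2)] by linarith
    also have "\<dots> = (\<integral>x. (om x * ((x \<bullet> x) * lap w1 x))\<^sup>2 + (om x * ((x \<bullet> x) * lap w2 x))\<^sup>2
        - 2 * (cmod l)\<^sup>2 * ((om x * ((x \<bullet> x) * w1 x))\<^sup>2 + (om x * ((x \<bullet> x) * w2 x))\<^sup>2) \<partial>lborel)"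
      using iR[OF pl(1)] iR[OF pl(2)] iR[OF p12(1)] iR[OF p12(2)] by simp
    also have "\<dots> \<le> (\<integral>x. 2 * (R2\<^sup>2)\<^sup>2 * (inverse (R1\<^sup>2 ^ (2 * m)) * exp (R2\<^sup>2)) * EE x \<partial>lborel)"
    proof (rule Bochner_Integration.integral_mono)
      show "integrable lborel (\<lambda>x. (om x * ((x \<bullet> x) * lap w1 x))\<^sup>2 + (om x * ((x \<bullet> x) * lap w2 x))\<^sup>2
        - 2 * (cmod l)\<^sup>2 * ((om x * ((x \<bullet> x) * w1 x))\<^sup>2 + (om x * ((x \<bullet> x) * w2 x))\<^sup>2))"
        using iR[OF pl(1)] iR[OF pl(2)] iR[OF p12(1)] iR[OF p12(2)] by simp
      show "integrable lborel (\<lambda>x. 2 * (R2\<^sup>2)\<^sup>2 * (inverse (R1\<^sup>2 ^ (2 * m)) * exp (R2\<^sup>2)) * EE x)" using EEi by simp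
      fix x :: "real^'n"
      have "2 * ((om x * ((x \<bullet> x) * e1 x))\<^sup>2 + (om x * ((x \<bullet> x) * e2 x))\<^sup>2) = 2 * (x \<bullet> x)\<^sup>2 * (om x)\<^sup>2 * EE x"
        by (simp add: EE_def power_mult_distrib algebra_simps)
      also have "\<dots> \<le> 2 * (R2\<^sup>2)\<^sup>2 * (inverse (R1\<^sup>2 ^ (2 * m)) * exp (R2\<^sup>2)) * EE x"
      proof (cases "R1 \<le> norm x \<and> norm x \<le> R2")
        case True
        then have x2: "x \<bullet> x \<le> R2\<^sup>2" "R1\<^sup>2 \<le> x \<bullet> x" unfolding power2_norm_eq_inner[symmetric] using RR by (auto intro!: power_mono)
        have R1p: "0 < R1\<^sup>2" using RR by simp
        have "(om x)\<^sup>2 \<le> inverse (R1\<^sup>2 ^ (2 * m)) * exp (R2\<^sup>2)" unfolding om2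
          using x2 R1p by (intro mult_mono le_imp_inverse_le power_mono) auto
        moreover have "(x \<bullet> x)\<^sup>2 \<le> (R2\<^sup>2)\<^sup>2" using x2 by (intro power_mono) auto
        ultimately show ?thesis by (intro mult_right_mono mult_mono) (auto simp: EE_def)
      next
        case False then have "EE x = 0" using e_in[of x] e_out[of x] by (auto simp: EE_def)
        then show ?thesis by simp
      qed
      finally show "(om x * ((x \<bullet> x) * lap w1 x))\<^sup>2 + (om x * ((x \<bullet> x) * lap w2 x))\<^sup>2
        - 2 * (cmod l)\<^sup>2 * ((om x * ((x \<bullet> x) * w1 x))\<^sup>2 + (om x * ((x \<bullet> x) * w2 x))\<^sup>2)
        \<le> 2 * (R2\<^sup>2)\<^sup>2 * (inverse (R1\<^sup>2 ^ (2 * m)) * exp (R2\<^sup>2)) * EE x"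
        using pw[of x] by linarith
    qed
    also have "\<dots> = K * inverse (R1\<^sup>2 ^ (2 * m))" by (simp add: K_def mult_ac)
    finally have up: "(\<integral>x. (om x)\<^sup>2 * ((x \<bullet> x) * N x) \<partial>lborel) \<le> K * inverse (R1\<^sup>2 ^ (2 * m))" .
    have "inverse (R0\<^sup>2 ^ (2 * m)) * G = (\<integral>x. inverse (R0\<^sup>2 ^ (2 * m)) * (indicator (ball 0 R0) x * ((x \<bullet> x) * N x)) \<partial>lborel)"
      by (simp add: G_def)
    also have "\<dots> \<le> (\<integral>x. (om x)\<^sup>2 * ((x \<bullet> x) * N x) \<partial>lborel)"
    proof (rule Bochner_Integration.integral_mono[OF integrable_mult_right[OF Gi] lhsi])
      fix x :: "real^'n"
      have nn: "(x \<bullet> x) * N x \<ge> 0" by (simp add: N_def)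
      show "inverse (R0\<^sup>2 ^ (2 * m)) * (indicator (ball 0 R0) x * ((x \<bullet> x) * N x)) \<le> (om x)\<^sup>2 * ((x \<bullet> x) * N x)"
      proof (cases "x \<in> ball 0 R0 \<and> x \<noteq> 0")
        case True
        then have "x \<bullet> x \<le> R0\<^sup>2" unfolding power2_norm_eq_inner[symmetric] by (intro power_mono) auto
        then have "inverse (R0\<^sup>2 ^ (2 * m)) \<le> inverse ((x \<bullet> x) ^ (2 * m))" using True
          by (intro le_imp_inverse_le power_mono zero_less_power) auto
        also have "\<dots> \<le> (om x)\<^sup>2" unfolding om2 using mult_left_mono[of 1 "exp (x \<bullet> x)" "inverse ((x \<bullet> x) ^ (2 * m))"] by simp
        finally show ?thesis using mult_right_mono[OF _ nn] True by simp
      next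
        case False then show ?thesis using nn by auto
      qed
    qed
    finally have "inverse (R0\<^sup>2 ^ (2 * m)) * G \<le> K * inverse (R1\<^sup>2 ^ (2 * m))" using up by linarith
    then show ?thesis using RR by (simp add: field_simps power_divide)
  qed
  have "(\<lambda>m. K * ((R0\<^sup>2 / R1\<^sup>2) ^ (2 * m))) \<longlonglongrightarrow> K * 0"
  proof (intro tendsto_mult tendsto_const)
    have "R0\<^sup>2 < R1\<^sup>2" using RR by (intro power_strict_mono) auto
    then have "(R0\<^sup>2 / R1\<^sup>2)\<^sup>2 < 1\<^sup>2" using RR by (intro power_strict_mono) auto
    then have "(\<lambda>m. ((R0\<^sup>2 / R1\<^sup>2)\<^sup>2) ^ m) \<longlonglongrightarrow> 0" by (intro LIMSEQ_realpow_zero) auto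
    then show "(\<lambda>m. (R0\<^sup>2 / R1\<^sup>2) ^ (2 * m)) \<longlonglongrightarrow> 0" by (simp add: power_mult)
  qed
  moreover have "eventually (\<lambda>m. G \<le> K * ((R0\<^sup>2 / R1\<^sup>2) ^ (2 * m))) sequentially"
  proof -
    obtain M :: nat where M: "real M \<ge> R2\<^sup>2 + 3 + (cmod l)\<^sup>2 * R2\<^sup>2" using real_arch_simple by blast
    show ?thesis by (rule eventually_sequentiallyI[of M]) (rule main, use M in linarith)
  qed
  ultimately have G0: "G \<le> 0" using tendsto_lowerbound[of _ 0 sequentially G] by simp
  have "(x0 \<bullet> x0) * N x0 = 0"
  proof (rule continuous_nonneg_integral_le_0[OF open_ball _ _ Gi])
    show "continuous_on UNIV (\<lambda>x. (x \<bullet> x) * N x)" by (intro continuous_intros Nc)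
    show "0 \<le> (x \<bullet> x) * N x" for x by (simp add: N_def)
    show "(\<integral>x. indicator (ball 0 R0) x * ((x \<bullet> x) * N x) \<partial>lborel) \<le> 0" using G0 by (simp add: G_def)
    show "x0 \<in> ball 0 R0" using RR by simp
  qed
  then have "N x0 = 0" using False by simp
  then show ?thesis using chi1[of x0] RR by (simp add: N_def w1_def w2_def complex_eq_iff)
qed

lemma conv_shift:
  fixes w :: "real^'n \<Rightarrow> complex"
  shows "conv (\<lambda>y. w (y + c)) \<eta> x = conv w \<eta> (x + c)"
  using integral_translate[of "\<lambda>y. \<eta> (x + c - y) *\<^sub>R w y" c] by (simp add: conv_def algebra_simps)

text \<open>A mollification at scale \<open>s\<close> solves the equation in the ball of radius
  \<open>R - s\<close> and vanishes in the one of radius \<open>r - s\<close>, so it vanishes at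
  \<open>x\<close>. Continuity of \<open>w\<close> at \<open>x\<close> lets \<open>s\<close> be
  taken small enough for any given error.\<close>

lemma unique_continuation_ball:
  fixes w :: "real^'n \<Rightarrow> complex"
  assumes w: "continuous_on UNIV w" and sol: "dsol l S w" and sub: "ball x0 R \<subseteq> S"
    and r: "0 < r" "\<And>x. x \<in> ball x0 r \<Longrightarrow> w x = 0" and x: "x \<in> ball x0 R"
  shows "w x = 0"
proof -
  have "norm (w x) \<le> e" if e: "e > 0" for e
  proof -
    have "isCont w x" using w by (simp add: continuous_on_eq_continuous_at)
    then obtain d where d: "d > 0" "\<And>y. dist y x < d \<Longrightarrow> dist (w y) (w x) < e"
      using e unfolding continuous_at by (metis Lim_at_zero continuous_at continuous_at_eps_delta e)
    define s where "s = min (d/2) (min (r/2) ((R - dist x0 x)/2))"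
    have s: "s > 0" "s < d" "s < r" "dist x0 x < R - s"
  proof -
    have "dist x0 x < R" using x by simp
    moreover have "s \<le> (R - dist x0 x) / 2" unfolding s_def by (rule order_trans[OF min.cobounded2 min.cobounded2])
    ultimately show "dist x0 x < R - s" by argo
    show "s > 0" "s < d" "s < r" using d r x by (auto simp: s_def)
  qed
    obtain \<eta> :: "real^'n \<Rightarrow> real" where \<eta>: "test_function \<eta>" "\<And>x. \<eta> x \<ge> 0" "\<And>x. norm x > s \<Longrightarrow> \<eta> x = 0" "(\<integral>x. \<eta> x \<partial>lborel) = 1"
      using mollifier_exists[OF s(1)] by metis
    define w' where "w' y = w (y + x0)" for y
    have w'c: "continuous_on UNIV w'" unfolding w'_def by (intro continuous_on_compose2[OF w] continuous_intros) auto
    have sh: "conv w' \<eta> y = conv w \<eta> (y + x0)" for \<eta> y unfolding w'_def by (rule conv_shift)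
    have "conv w' \<eta> (x - x0) = 0"
    proof (rule unique_continuation_smooth[where R = "R - s" and r = "r - s" and l = l])
      show "smooth_in UNIV (conv w' \<eta>)" by (rule smooth_conv[OF w'c \<eta>(1)])
      show "lap (conv w' \<eta>) y + l * conv w' \<eta> y = 0" if "norm y < R - s" for y
      proof -
        have "cball (y + x0) s \<subseteq> ball x0 R"
          using that by (intro cball_subset_ball_iff[THEN iffD2]) (auto simp: dist_norm)
        then have "lap (conv w \<eta>) (y + x0) + l * conv w \<eta> (y + x0) = 0"
          using dsol_conv[OF sol w \<eta>(1,3)] sub by blast
        then show ?thesis by (simp add: lap_conv[OF w'c \<eta>(1)] lap_conv[OF w \<eta>(1)] sh)
      qed
      show "conv w' \<eta> y = 0" if "norm y < r - s" for y
      proof -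
        have "\<eta> (y + x0 - z) *\<^sub>R w z = 0" for z
        proof (cases "norm (y + x0 - z) > s")
          case False
          then have "dist x0 z < r" using that norm_triangle_ineq[of "z - x0 - y" y] by (simp add: dist_norm norm_minus_commute algebra_simps)
          then show ?thesis using r(2)[of z] by simp
        qed (simp add: \<eta>(3))
        then have "(\<lambda>z. \<eta> (y + x0 - z) *\<^sub>R w z) = (\<lambda>z. 0)" by (rule ext)
        then have "conv w \<eta> (y + x0) = 0" by (simp add: conv_def)
        then show ?thesis by (simp add: sh)
      qed
    qed (use s in \<open>auto simp: dist_norm norm_minus_commute\<close>)
    then have "conv w \<eta> x = 0" by (simp add: sh)
    moreover have "norm (conv w \<eta> x - w x) \<le> e"
    proof (rule conv_approx[OF w \<eta>(1,2,3,4)])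
      show "norm (w y - w x) \<le> e" if "dist y x \<le> s" for y
        using d(2)[of y] that s(2) by (simp add: dist_norm)
    qed
    ultimately show ?thesis by simp
  qed
  then have "norm (w x) \<le> 0" by (rule field_le_epsilon[of _ 0, simplified])
  then show ?thesis by simp
qed

text \<open>By compactness balls of one radius \<open>e\<close> around all points of the segment
  stay in \<open>S\<close>. Zeros are passed along a chain of points with gaps shorter than
  \<open>e\<close>: each next point is interior to the ball just cleared.\<close>

theorem unique_continuation_segment:
  fixes w :: "real^'n \<Rightarrow> complex"
  assumes w: "continuous_on UNIV w" and sol: "dsol l S w" and S: "open S" and seg: "closed_segment p q \<subseteq> S"
    and r: "0 < r" "\<And>x. x \<in> ball p r \<Longrightarrow> w x = 0"
  shows "w q = 0"
proof -
  obtain e where e: "e > 0" "(\<Union>x\<in>closed_segment p q. ball x e) \<subseteq> S"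
    using compact_subset_open_imp_ball_epsilon_subset[OF compact_segment S seg] by metis
  obtain N :: nat where N: "real N > norm (q - p) / e" using reals_Archimedean2 by blast
  then have N0: "N > 0" using e(1) by (metis divide_nonneg_pos gr0I norm_ge_zero not_less of_nat_0)
  define y where "y k = p + (real k / real N) *\<^sub>R (q - p)" for k :: nat
  have "\<exists>r>0. \<forall>x\<in>ball (y k) r. w x = 0" if "k \<le> N" for k
    using that
  proof (induction k)
    case 0 then show ?case using r by (auto simp: y_def intro!: exI[of _ r])
  next
    case (Suc k)
    then obtain r where r: "r > 0" "\<forall>x\<in>ball (y k) r. w x = 0" by auto
    have "y k \<in> closed_segment p q" unfolding closed_segment_def
      using Suc.prems N0 by (auto simp: y_def algebra_simps intro!: exI[of _ "real k / real N"])
    then have "ball (y k) e \<subseteq> S" using e(2) by blast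
    then have z: "w x = 0" if "x \<in> ball (y k) e" for x
      using unique_continuation_ball[OF w sol, of "y k" e r x] r that by blast
    have "y (Suc k) - y k = (1 / real N) *\<^sub>R (q - p)"
      by (simp add: y_def scaleR_left_distrib add_divide_distrib)
    then have d: "dist (y k) (y (Suc k)) = norm (q - p) / real N" by (simp add: dist_norm norm_minus_commute[of "y k"])
    have "dist (y k) (y (Suc k)) < e" unfolding d using N N0 e(1) by (simp add: field_simps)
    then have "y (Suc k) \<in> ball (y k) e" by simp
    then obtain s where "s > 0" "ball (y (Suc k)) s \<subseteq> ball (y k) e" using open_contains_ball open_ball by metis
    then show ?case using z by (intro exI[of _ s]) auto
  qed
  from this[of N] show ?thesis using N0 by (auto simp: y_def)
qed

subsection \<open>Rellich's lemma\<close>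

lemma euler_cong0: "(\<And>y. y \<noteq> 0 \<Longrightarrow> f y = g y) \<Longrightarrow> x \<noteq> 0 \<Longrightarrow> euler f x = euler g x"
  unfolding euler_def using pd_cong_open[OF open_punctured, of x f g] by simp

lemma euler_powr_norm_sq:
  assumes "x \<noteq> (0::real^'n)"
  shows "euler (\<lambda>x. (x \<bullet> x) powr t) x = 2 * t * (x \<bullet> x) powr t"
proof -
  have p: "x \<bullet> x > 0" using assms by simp
  have "((\<lambda>s. s powr t) has_real_derivative t * (x \<bullet> x) powr (t - 1)) (at (x \<bullet> x))"
    using p by (auto intro!: derivative_eq_intros)
  then have "euler (\<lambda>x. (x \<bullet> x) powr t) x = t * (x \<bullet> x) powr (t - 1) * euler (\<lambda>x. x \<bullet> x) x"
    by (rule euler_compose) (rule differentiable_norm_sq)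
  also have "\<dots> = 2 * t * ((x \<bullet> x) powr (t - 1) * (x \<bullet> x) powr 1)" using p by (simp add: euler_norm_sq)
  also have "\<dots> = 2 * t * (x \<bullet> x) powr t" unfolding powr_add[symmetric] by simp
  finally show ?thesis .
qed

lemma radial_powr_norm_sq: "radial (\<lambda>x::real^'n. (x \<bullet> x) powr t)"
  by (rule radial_compose[OF radial_norm_sq, where g' = "\<lambda>s. t * s powr (t - 1)"])
    (auto intro!: derivative_eq_intros smooth_in_powr open_punctured radial_smooth)

text \<open>On functions of \<open>sat_q\<close> the Euler field acts as \<open>(t/2) d/dt\<close>.
  The second function is, up to its constant, \<open>t\<close> times the derivative of the first, so
  both together give two Euler derivatives of \<open>decay\<close>.\<close>

lemma saturation_derivs:
  fixes t :: real
  assumes "t \<ge> 0"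
  shows "((\<lambda>t. c * (t / (1 + t)\<^sup>2)) has_real_derivative c * ((1 - t) / (1 + t)^3)) (at t)" (is ?A)
    and "((\<lambda>t. c * ((t - t\<^sup>2) / (1 + t)^3)) has_real_derivative c * ((1 - 4 * t + t\<^sup>2) / (1 + t)^4)) (at t)" (is ?B)
proof -
  have nz: "1 + t \<noteq> 0" using assms by linarith
  have "((\<lambda>t. t / (1 + t)\<^sup>2) has_real_derivative (1 * (1 + t)\<^sup>2 - t * (2 * (1 + t))) / ((1 + t)\<^sup>2 * (1 + t)\<^sup>2)) (at t)"
    using nz by (auto intro!: derivative_eq_intros simp: power2_eq_square)
  also have "(1 * (1 + t)\<^sup>2 - t * (2 * (1 + t))) / ((1 + t)\<^sup>2 * (1 + t)\<^sup>2) = (1 - t) / (1 + t)^3"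
    using nz by (subst frac_eq_eq) (simp, simp, algebra)
  finally show ?A by (rule DERIV_cmult)
  have "((\<lambda>t. (t - t\<^sup>2) / (1 + t)^3) has_real_derivative ((1 - 2 * t) * (1 + t)^3 - (t - t\<^sup>2) * (3 * (1 + t)\<^sup>2)) / ((1 + t)^3 * (1 + t)^3)) (at t)"
    using nz by (auto intro!: derivative_eq_intros simp: power2_eq_square)
  also have "((1 - 2 * t) * (1 + t)^3 - (t - t\<^sup>2) * (3 * (1 + t)\<^sup>2)) / ((1 + t)^3 * (1 + t)^3) = (1 - 4 * t + t\<^sup>2) / (1 + t)^4"
    using nz by (subst frac_eq_eq) (simp, simp, algebra)
  finally show ?B by (rule DERIV_cmult)
qed

text \<open>The weight \<open>|x|\<^sup>-\<^sup>1 (\<surd>|x| / (1 + e \<surd>|x|))\<^sup>2\<^sup>m\<close> grows like \<open>|x|\<^sup>m\<^sup>-\<^sup>1\<close> on the region \<open>e \<surd>|x| \<le> 1\<close>, which is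
  any prescribed one for small \<open>e\<close>, but is \<open>O(|x|\<^sup>-\<^sup>1)\<close> at infinity: that much decay makes a cutoff at infinity
  possible for functions that are only \<open>O(|x|\<^bsup>-n/2\<^esup>)\<close>.\<close>

context
  fixes m :: nat and e :: real
  assumes m: "m \<ge> 1" and e: "e > 0"
begin

definition sat_q :: "real^'n \<Rightarrow> real" where "sat_q x = e * (x \<bullet> x) powr (1/4)"
text \<open>\<open>slope\<close> is the coefficient \<open>a\<close> of
  \<open>conjugated_lap\<close> for the weight \<open>outer_wt\<close>, and \<open>decay\<close> is
  minus its Euler derivative. The power 1/4 of \<open>x \<bullet> x\<close> is the square root of
  the norm.\<close>

definition slope :: "real^'n \<Rightarrow> real" where "slope x = real m / (1 + sat_q x)"
definition decay :: "real^'n \<Rightarrow> real" where "decay x = real m / 2 * (sat_q x / (1 + sat_q x)\<^sup>2)"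
definition sat :: "real^'n \<Rightarrow> real" where "sat x = (x \<bullet> x) powr (1/4) / (1 + sat_q x)"
definition outer_wt :: "real^'n \<Rightarrow> real" where "outer_wt x = (x \<bullet> x) powr (-1/2) * sat x ^ (2 * m)"

lemma sat_q_nonneg: "sat_q x \<ge> 0" using e by (simp add: sat_q_def)

lemma sat_q_radial: "radial (sat_q :: real^'n \<Rightarrow> real)"
  unfolding sat_q_def[abs_def] by (rule radial_mult[OF radial_const radial_powr_norm_sq])

lemma euler_sat_q: "x \<noteq> 0 \<Longrightarrow> euler sat_q x = sat_q x / 2"
proof -
  assume x: "x \<noteq> 0"
  have "euler sat_q x = e * euler (\<lambda>x. (x \<bullet> x) powr (1/4)) x"
    unfolding sat_q_def[abs_def] by (rule euler_const_mult) (use smooth_inD(1)[OF radialD[OF radial_powr_norm_sq]] x in simp)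
  then show ?thesis unfolding euler_powr_norm_sq[OF x] by (simp add: sat_q_def)
qed

lemma euler_comp_sat_q:
  assumes "x \<noteq> 0" "(g has_real_derivative g') (at (sat_q x))"
  shows "euler (\<lambda>x. g (sat_q x)) x = g' * (sat_q x / 2)"
  using euler_compose[OF assms(2) smooth_inD(1)[OF radialD[OF sat_q_radial]]] assms(1)
  unfolding euler_sat_q[OF assms(1)] by simp

lemma radial_comp_sat_q:
  assumes "\<And>t. t \<ge> 0 \<Longrightarrow> (g has_real_derivative g' t) (at t)" "smooth0 (\<lambda>x::real^'n. g (sat_q x))"
  shows "radial (\<lambda>x::real^'n. g (sat_q x))"
  using radial_compose[OF sat_q_radial assms(1)[OF sat_q_nonneg] assms(2)] .

lemma smooth_sat_q1: "smooth0 (\<lambda>x::real^'n. 1 + sat_q x)"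
  by (intro smooth_in_add open_punctured smooth_in_const radialD[OF sat_q_radial])

lemma sat_q1_pos: "1 + sat_q x > 0" using sat_q_nonneg[of x] by linarith

lemma sat_q1_nz: "1 + sat_q x \<noteq> 0" using sat_q1_pos[of x] by simp

lemma slope_radial: "radial (slope :: real^'n \<Rightarrow> real)"
  unfolding slope_def[abs_def]
  by (rule radial_comp_sat_q[where g = "\<lambda>t. real m / (1 + t)" and g' = "\<lambda>t. - real m / (1 + t)\<^sup>2"])
    (auto intro!: derivative_eq_intros smooth_in_divide open_punctured smooth_sat_q1 simp: sat_q1_nz power2_eq_square)

lemma decay_radial: "radial (decay :: real^'n \<Rightarrow> real)"
  unfolding decay_def[abs_def]
  by (rule radial_comp_sat_q[where g = "\<lambda>t. real m / 2 * (t / (1 + t)\<^sup>2)" and g' = "\<lambda>t. real m / 2 * ((1 - t) / (1 + t)^3)"])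
    (rule saturation_derivs(1), simp, intro smooth_in_divide smooth_in_mult smooth_in_power open_punctured smooth_sat_q1
      radialD[OF sat_q_radial] smooth_in_const, simp add: sat_q1_nz)

lemma euler_slope: assumes "x \<noteq> 0" shows "euler slope x = - decay x"
proof -
  have "euler (\<lambda>x. (\<lambda>t. real m / (1 + t)) (sat_q x)) x = (- real m / (1 + sat_q x)\<^sup>2) * (sat_q x / 2)"
    by (rule euler_comp_sat_q[OF assms]) (use sat_q1_nz[of x] in \<open>auto intro!: derivative_eq_intros simp: power2_eq_square\<close>)
  then show ?thesis by (simp add: slope_def[abs_def] decay_def)
qed

lemma euler_euler_decay: assumes x: "x \<noteq> 0" shows "euler (euler decay) x = decay x / 4 * ((1 - 4 * sat_q x + (sat_q x)\<^sup>2) / (1 + sat_q x)\<^sup>2)"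
proof -
  have 1: "euler decay y = real m / 4 * ((sat_q y - (sat_q y)\<^sup>2) / (1 + sat_q y)^3)" if "y \<noteq> 0" for y
  proof -
    have "((\<lambda>t. real m / 2 * (t / (1 + t)\<^sup>2)) has_real_derivative real m / 2 * ((1 - sat_q y) / (1 + sat_q y)^3)) (at (sat_q y))"
      by (rule saturation_derivs(1)[OF sat_q_nonneg])
    from euler_comp_sat_q[OF that this]
    have "euler decay y = real m / 2 * ((1 - sat_q y) / (1 + sat_q y)^3) * (sat_q y / 2)"
      by (simp only: decay_def[abs_def])
    moreover have "sat_q y - (sat_q y)\<^sup>2 = (1 - sat_q y) * sat_q y" by (simp add: power2_eq_square algebra_simps)
    ultimately show ?thesis by simp
  qed
  have "euler (euler decay) x = euler (\<lambda>y. (\<lambda>t. real m / 4 * ((t - t\<^sup>2) / (1 + t)^3)) (sat_q y)) x"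
    by (rule euler_cong0[OF _ x]) (simp add: 1)
  also have "\<dots> = (real m / 4 * ((1 - 4 * sat_q x + (sat_q x)\<^sup>2) / (1 + sat_q x)^4)) * (sat_q x / 2)"
    by (rule euler_comp_sat_q[OF x]) (rule saturation_derivs(2)[OF sat_q_nonneg])
  also have "\<dots> = decay x / 4 * ((1 - 4 * sat_q x + (sat_q x)\<^sup>2) / (1 + sat_q x)\<^sup>2)"
  proof -
    have "(1 + sat_q x)^4 = (1 + sat_q x)\<^sup>2 * (1 + sat_q x)\<^sup>2" by (simp add: power2_eq_square eval_nat_numeral)
    then show ?thesis unfolding decay_def by (simp only: times_divide_eq_right times_divide_eq_left divide_divide_eq_left) (simp add: mult_ac)
  qed
  finally show ?thesis .
qed

lemma sat_radial: "radial (sat :: real^'n \<Rightarrow> real)"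
proof -
  have "radial (\<lambda>x::real^'n. inverse (1 + sat_q x))"
    by (rule radial_comp_sat_q[where g = "\<lambda>t. inverse (1 + t)" and g' = "\<lambda>t. - (inverse (1 + t))\<^sup>2"])
      (auto intro!: derivative_eq_intros smooth_in_inverse open_punctured smooth_sat_q1 simp: sat_q1_nz power2_eq_square)
  moreover have "sat = (\<lambda>x::real^'n. (x \<bullet> x) powr (1/4) * inverse (1 + sat_q x))"
  proof
    fix x :: "real^'n"
    show "sat x = (x \<bullet> x) powr (1/4) * inverse (1 + sat_q x)"
      unfolding sat_def by (rule divide_inverse)
  qed
  ultimately show ?thesis using radial_mult[OF radial_powr_norm_sq[of "1/4"]] by simp
qed

lemma sat_pow_radial: "radial (\<lambda>x::real^'n. sat x ^ j)"
  by (induction j) (simp_all add: radial_const radial_mult[OF sat_radial])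

lemma outer_wt_radial: "radial (outer_wt :: real^'n \<Rightarrow> real)"
  unfolding outer_wt_def[abs_def] by (rule radial_mult[OF radial_powr_norm_sq sat_pow_radial])

lemma euler_outer_wt: assumes x: "(x::real^'n) \<noteq> 0" shows "euler outer_wt x = (slope x - 1) * outer_wt x"
proof -
  \<comment> \<open>Expresses \<open>sat\<close> through \<open>sat_q\<close> alone, so that the
    chain rule \<open>euler_comp_sat_q\<close> applies.\<close>
  have hq: "sat y = inverse e * (1 - inverse (1 + sat_q y))" for y :: "real^'n"
  proof -
    have "1 - inverse (1 + sat_q y) = e * ((y \<bullet> y) powr (1/4)) / (1 + sat_q y)"
      using sat_q1_nz[of y] by (simp add: divide_simps) (simp add: sat_q_def)
    then show ?thesis using e by (simp add: sat_def)
  qed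
  have "euler (\<lambda>y. (\<lambda>t. inverse e * (1 - inverse (1 + t))) (sat_q y)) x = (inverse e * (inverse (1 + sat_q x))\<^sup>2) * (sat_q x / 2)"
    by (rule euler_comp_sat_q[OF x]) (use sat_q1_nz[of x] in \<open>auto intro!: derivative_eq_intros simp: power2_eq_square\<close>)
  then have Eh: "euler sat x = sat x * (1 / (2 * (1 + sat_q x)))"
    unfolding hq[abs_def] using e sat_q1_nz[of x] by (simp add: field_simps power2_eq_square)
  have "euler (\<lambda>x. sat x ^ (2 * m)) x = real (2 * m) * sat x ^ (2 * m - 1) * euler sat x"
    by (rule euler_compose) (use smooth_inD(1)[OF radialD[OF sat_radial]] x in \<open>auto intro!: derivative_eq_intros\<close>)
  also have "\<dots> = slope x * (sat x ^ (2 * m - 1) * sat x)"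
  proof -
    have "real (2 * m) * X * (h * (1 / (2 * u))) = real m / u * (X * h)" if "u \<noteq> 0" for X h u :: real
      using that by (simp add: field_simps)
    then show ?thesis unfolding Eh slope_def using sat_q1_nz[of x] by blast
  qed
  also have "sat x ^ (2 * m - 1) * sat x = sat x ^ (2 * m)" using m by (cases m) auto
  finally have Ehm: "euler (\<lambda>x. sat x ^ (2 * m)) x = slope x * sat x ^ (2 * m)" .
  have "euler outer_wt x = euler (\<lambda>x. (x \<bullet> x) powr (-1/2)) x * sat x ^ (2 * m) + (x \<bullet> x) powr (-1/2) * euler (\<lambda>x. sat x ^ (2 * m)) x"
    unfolding outer_wt_def[abs_def]
    by (rule euler_mult) (use smooth_inD(1)[OF radialD[OF radial_powr_norm_sq]] smooth_inD(1)[OF radialD[OF sat_pow_radial]] x in auto)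
  then show ?thesis unfolding Ehm euler_powr_norm_sq[OF x] by (simp add: outer_wt_def algebra_simps)
qed

text \<open>Write \<open>a\<close>, \<open>p\<close>, \<open>q\<close> for slope, decay and
  \<open>sat_q\<close>. Since \<open>p \<le> a/2\<close>, the \<open>k^2\<close> term is at least
  \<open>2 a k^2 |x|^2\<close>, and half of it is spent on the rest. With
  \<open>p \<le> a q / 2\<close> and \<open>1 \<le> a\<close>-independent bounds
  \<open>a \<le> m\<close>, the three error terms cost 4, 1 and 1 times \<open>m^2 a q\<close>,
  whence the constant 6. As \<open>q\<close> is \<open>e\<close> times the root of the norm,
  \<open>6 m^2 q \<le> k^2 |x|^2\<close> amounts to the bound on \<open>e\<close> with exponent 3/2
  of the norm, and it is most restrictive at the inner radius \<open>R\<close>.\<close>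

lemma weight_inequality:
  fixes x :: "real^'n"
  assumes R: "0 < R" "R \<le> norm x" and ek: "6 * (real m)\<^sup>2 * e \<le> k\<^sup>2 * (R\<^sup>2) powr (3/4)"
  shows "slope x * (k\<^sup>2 * (x \<bullet> x)) \<le> 4 * (slope x - decay x) * (k\<^sup>2 * (x \<bullet> x)) - 8 * (slope x)\<^sup>2 * decay x - 4 * (decay x)\<^sup>2 - euler (euler decay) x"
proof -
  have x: "x \<noteq> 0" using R by auto
  let ?q = "sat_q x" and ?a = "slope x" and ?p = "decay x" and ?m = "real m"
  have q: "?q \<ge> 0" by (rule sat_q_nonneg)
  have m1: "?m \<ge> 1" using m by simp
  have a0: "?a > 0" "?a \<le> ?m" using q m1 by (auto simp: slope_def divide_le_eq mult_ge1_I)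
  have pa: "?p = ?a * (?q / (2 * (1 + ?q)))" using sat_q1_nz[of x] by (simp add: decay_def slope_def power2_eq_square)
  have "?q / (2 * (1 + ?q)) \<le> 1/2" "?q / (2 * (1 + ?q)) \<le> ?q / 2" "?q / (2 * (1 + ?q)) \<ge> 0"
    using q mult_nonneg_nonneg[OF q q] by (auto simp: divide_simps algebra_simps)
  moreover have "0 \<le> c * s \<and> c * s \<le> c / 2 \<and> c * s \<le> c * d / 2" if "s \<le> 1/2" "s \<le> d / 2" "s \<ge> 0" "c > 0" for c d s :: real
    using that mult_left_mono[of s "1/2" c] mult_left_mono[of s "d/2" c] by simp
  ultimately have p: "?p \<ge> 0" "?p \<le> ?a / 2" "?p \<le> ?a * ?q / 2" using a0(1) unfolding pa by blast+
  have E: "euler (euler decay) x \<le> ?p / 4"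
  proof -
    have "1 - 4 * ?q + ?q\<^sup>2 \<le> (1 + ?q)\<^sup>2" using q by (simp add: power2_sum)
    then have "(1 - 4 * ?q + ?q\<^sup>2) / (1 + ?q)\<^sup>2 \<le> 1" using sat_q1_pos[of x] by (simp add: divide_le_eq)
    from mult_left_mono[OF this, of "?p / 4"] show ?thesis unfolding euler_euler_decay[OF x] using p by simp
  qed
  have X: "6 * ?m\<^sup>2 * ?q \<le> k\<^sup>2 * (x \<bullet> x)"
  proof -
    have xx: "x \<bullet> x > 0" using x by simp
    have "R\<^sup>2 \<le> x \<bullet> x" unfolding power2_norm_eq_inner[symmetric] using R by (intro power_mono) auto
    then have "(R\<^sup>2) powr (3/4) \<le> (x \<bullet> x) powr (3/4)" by (intro powr_mono2) auto
    then have "6 * ?m\<^sup>2 * e \<le> k\<^sup>2 * (x \<bullet> x) powr (3/4)" using ek mult_left_mono[of _ _ "k\<^sup>2"] by (meson order_trans zero_le_power2)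
    then have "6 * ?m\<^sup>2 * e * (x \<bullet> x) powr (1/4) \<le> k\<^sup>2 * (x \<bullet> x) powr (3/4) * (x \<bullet> x) powr (1/4)" by (rule mult_right_mono) simp
    also have "\<dots> = k\<^sup>2 * (x \<bullet> x)" using xx by (simp add: mult.assoc powr_add[symmetric])
    finally show ?thesis by (simp add: sat_q_def mult.assoc)
  qed
  have t1: "8 * ?a\<^sup>2 * ?p \<le> 4 * ?m\<^sup>2 * (?a * ?q)"
  proof -
    have "?a\<^sup>2 \<le> ?m\<^sup>2" using a0 by (intro power_mono) auto
    then have "?a\<^sup>2 * ?p \<le> ?m\<^sup>2 * (?a * ?q / 2)" using p by (intro mult_mono) auto
    then have "8 * (?a\<^sup>2 * ?p) \<le> 8 * (?m\<^sup>2 * (?a * ?q / 2))" by (rule mult_left_mono) simp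
    also have "\<dots> = 4 * ?m\<^sup>2 * (?a * ?q)" by simp
    finally show ?thesis by (simp only: mult.assoc)
  qed
  have t2: "4 * ?p\<^sup>2 \<le> ?m\<^sup>2 * (?a * ?q)"
  proof -
    have "?p * ?p \<le> (?m / 2) * (?a * ?q / 2)" using p a0 by (intro mult_mono) auto
    moreover have "?m * (?a * ?q) \<le> ?m\<^sup>2 * (?a * ?q)" using m1 a0 q by (intro mult_right_mono) (auto simp: power2_eq_square)
    ultimately show ?thesis by (simp add: power2_eq_square)
  qed
  have t3: "?p / 4 \<le> ?m\<^sup>2 * (?a * ?q)"
  proof -
    have "1 * (?a * ?q) \<le> ?m\<^sup>2 * (?a * ?q)" using m1 a0 q by (intro mult_right_mono) auto
    moreover have "0 \<le> ?a * ?q" using a0 q by simp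
    ultimately show ?thesis using p(3) by simp
  qed
  have t4: "6 * ?m\<^sup>2 * (?a * ?q) \<le> ?a * (k\<^sup>2 * (x \<bullet> x))" using mult_left_mono[OF X, of ?a] a0 by (simp add: mult_ac)
  have t5: "2 * ?a * (k\<^sup>2 * (x \<bullet> x)) \<le> 4 * (?a - ?p) * (k\<^sup>2 * (x \<bullet> x))" using p by (intro mult_right_mono) auto
  show ?thesis using t1 t2 t3 t4 t5 E by linarith
qed

text \<open>A saturating weight has \<open>euler slope = - decay\<close>, so the commutator contains
  \<open>-4\<close> times the integral of \<open>decay (euler0 v)^2\<close>. This is repaired by
  keeping the square of the symmetric part: completing the square with \<open>2 decay v\<close>
  bounds it together with 4 times its pairing with \<open>decay v\<close> from below, and
  \<open>sym_part_weighted\<close> turns that pairing into the missing first order integral. Zero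
  order terms remain, dominated by the \<open>k^2 |x|^2\<close> part of \<open>b\<close>.\<close>

theorem carleman_outer:
  fixes w :: "real^'n \<Rightarrow> real"
  assumes w: "punctured_test w" and R: "0 < R" "\<And>x. norm x < R \<Longrightarrow> w x = 0"
    and ek: "6 * (real m)\<^sup>2 * e \<le> k\<^sup>2 * (R\<^sup>2) powr (3/4)"
  shows "(\<integral>x. slope x * (k\<^sup>2 * (x \<bullet> x)) * (outer_wt x * w x)\<^sup>2 \<partial>lborel) \<le> (\<integral>x. (outer_wt x * ((x \<bullet> x) * (lap w x + k\<^sup>2 * w x)))\<^sup>2 \<partial>lborel)"
proof -
  define v where "v x = outer_wt x * w x" for x
  define kap where "kap = (real CARD('n) - 2)\<^sup>2 / 4"
  define b where "b x = slope x * slope x - kap + k\<^sup>2 * (x \<bullet> x)" for x :: "real^'n"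
  note a0 = radialD[OF slope_radial, where 'a = 'n] and p0 = radialD[OF decay_radial, where 'a = 'n]
  have v: "punctured_test v" unfolding v_def by (rule punctured_test_mult[OF radialD[OF outer_wt_radial] w])
  have bs: "smooth0 b" unfolding b_def
    by (intro smooth_in_add smooth_in_diff smooth_in_mult open_punctured a0 smooth_in_const radial_smooth)
  have eq: "outer_wt x * ((x \<bullet> x) * (lap w x + k\<^sup>2 * w x)) = sym_part b v x + skew_part slope v x" for x
    using conjugated_lap[OF outer_wt_radial a0 w euler_outer_wt, of x]
    by (simp add: v_def[abs_def] b_def sym_part_def kap_def algebra_simps)
  have Eb: "euler b x = 2 * (k\<^sup>2 * (x \<bullet> x)) - 2 * slope x * decay x" if x: "x \<noteq> 0" for x
  proof -
    have d: "slope differentiable at x" using smooth_inD(1)[OF a0] x by simp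
    have d2: "(\<lambda>x. slope x * slope x) differentiable at x" using d by auto
    have "euler (\<lambda>x. slope x * slope x + (- kap + k\<^sup>2 * (x \<bullet> x))) x = euler (\<lambda>x. slope x * slope x) x + euler (\<lambda>x. - kap + k\<^sup>2 * (x \<bullet> x)) x"
      by (rule euler_add[OF d2]) (auto intro: differentiable_norm_sq)
    also have "euler (\<lambda>x. slope x * slope x) x = 2 * slope x * euler slope x" using euler_mult[OF d d] by simp
    also have "euler (\<lambda>x. - kap + k\<^sup>2 * (x \<bullet> x)) x = euler (\<lambda>x. - kap) x + euler (\<lambda>x. k\<^sup>2 * (x \<bullet> x)) x"
      by (rule euler_add) (auto intro: differentiable_norm_sq)
    also have "euler (\<lambda>x. k\<^sup>2 * (x \<bullet> x)) x = 2 * (k\<^sup>2 * (x \<bullet> x))"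
      unfolding euler_const_mult[OF differentiable_norm_sq] euler_norm_sq by simp
    also have "euler (\<lambda>x. - kap) x = 0" by (simp add: euler_def)
    finally have "euler (\<lambda>x. slope x * slope x + (- kap + k\<^sup>2 * (x \<bullet> x))) x = 2 * (k\<^sup>2 * (x \<bullet> x)) - 2 * slope x * decay x"
      unfolding euler_slope[OF x] by simp
    moreover have "b = (\<lambda>x. slope x * slope x + (- kap + k\<^sup>2 * (x \<bullet> x)))" by (simp add: b_def fun_eq_iff)
    ultimately show ?thesis by simp
  qed
  note S = punctured_test_sym[OF bs v] and A = punctured_test_skew[OF a0 v] and P = punctured_test_mult[OF p0 v]
  have v0: "v 0 = 0" using zero_near_imp(1)[OF v] .
  have sEEp: "smooth0 (euler (euler decay) :: real^'n \<Rightarrow> real)" by (rule smooth0_euler[OF smooth0_euler[OF p0]])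
  have i1: "integrable lborel (\<lambda>x. euler (euler decay) x * (v x * v x))" by (rule weighted_integrable[OF sEEp v v])
  have i2: "integrable lborel (\<lambda>x. slope x * euler b x * (v x * v x))"
    by (rule weighted_integrable[OF smooth_in_mult[OF open_punctured a0 smooth0_euler[OF bs]] v v])
  have i3: "integrable lborel (\<lambda>x. decay x * b x * (v x * v x))"
    by (rule weighted_integrable[OF smooth_in_mult[OF open_punctured p0 bs] v v])
  have i4: "integrable lborel (\<lambda>x. (decay x * v x)\<^sup>2)" "integrable lborel (\<lambda>x. (sym_part b v x)\<^sup>2)" "integrable lborel (\<lambda>x. sym_part b v x * (decay x * v x))"
    unfolding power2_eq_square by (intro punctured_test_integrable punctured_test_mult2 P S)+
  have i5: "integrable lborel (\<lambda>x. slope x * (k\<^sup>2 * (x \<bullet> x)) * (outer_wt x * w x)\<^sup>2)"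
    using weighted_integrable[OF smooth_in_mult[OF open_punctured a0 smooth_in_mult[OF open_punctured smooth_in_const radial_smooth]] v v]
    by (simp add: v_def power2_eq_square)
  have EEE: "(\<integral>x. euler (euler (euler slope)) x * (v x * v x) \<partial>lborel) = - (\<integral>x. euler (euler decay) x * (v x * v x) \<partial>lborel)"
  proof -
    have neg: "euler f x = - euler g x" if "\<And>y. y \<noteq> 0 \<Longrightarrow> f y = - g y" "x \<noteq> 0" "smooth0 g" for f g :: "real^'n \<Rightarrow> real" and x
    proof -
      have "euler f x = euler (\<lambda>y. (-1) * g y) x" by (rule euler_cong0) (use that in auto)
      then show ?thesis using euler_const_mult[of g x "-1"] smooth_inD(1)[OF that(3), of x] that(2) by simp
    qed
    have "euler (euler slope) y = - euler decay y" if "y \<noteq> 0" for y :: "real^'n" by (rule neg[OF euler_slope that p0])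
    then have E: "euler (euler (euler slope)) y = - euler (euler decay) y" if "y \<noteq> 0" for y :: "real^'n"
      using neg[OF _ that smooth0_euler[OF p0]] by blast
    have "(\<lambda>x. euler (euler (euler slope)) x * (v x * v x)) = (\<lambda>x. - (euler (euler decay) x * (v x * v x)))"
    proof
      fix x :: "real^'n"
      show "euler (euler (euler slope)) x * (v x * v x) = - (euler (euler decay) x * (v x * v x))"
        using v0 E[of x] by (cases "x = 0") simp_all
    qed
    then show ?thesis by simp
  qed
  have Eaa: "(\<integral>x. euler slope x * (euler0 v x * euler0 v x) \<partial>lborel) = - (\<integral>x. decay x * (euler0 v x * euler0 v x) \<partial>lborel)"
  proof -
    have "(\<lambda>x. euler slope x * (euler0 v x * euler0 v x)) = (\<lambda>x. - (decay x * (euler0 v x * euler0 v x)))"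
    proof
      fix x :: "real^'n"
      show "euler slope x * (euler0 v x * euler0 v x) = - (decay x * (euler0 v x * euler0 v x))"
        using zero_near_imp(3)[OF v] euler_slope[of x] by (cases "x = 0") simp_all
    qed
    then show ?thesis by simp
  qed
  have decay_nn: "decay x \<ge> 0" for x :: "real^'n" using sat_q_nonneg[of x] by (simp add: decay_def)
  have sq: "(\<integral>x. (sym_part b v x)\<^sup>2 \<partial>lborel) + 4 * (\<integral>x. sym_part b v x * (decay x * v x) \<partial>lborel) \<ge> - 4 * (\<integral>x. (decay x * v x)\<^sup>2 \<partial>lborel)"
  proof -
    have "0 \<le> (\<integral>x. (sym_part b v x + 2 * (decay x * v x))\<^sup>2 \<partial>lborel)" by (rule Bochner_Integration.integral_nonneg) simp
    also have "\<dots> = (\<integral>x. (sym_part b v x)\<^sup>2 + 4 * (sym_part b v x * (decay x * v x)) + 4 * (decay x * v x)\<^sup>2 \<partial>lborel)"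
      by (intro Bochner_Integration.integral_cong refl) (simp add: power2_eq_square algebra_simps)
    also have "\<dots> = (\<integral>x. (sym_part b v x)\<^sup>2 \<partial>lborel) + 4 * (\<integral>x. sym_part b v x * (decay x * v x) \<partial>lborel) + 4 * (\<integral>x. (decay x * v x)\<^sup>2 \<partial>lborel)"
      using i4 by simp
    finally show ?thesis by simp
  qed
  have "(\<integral>x. (outer_wt x * ((x \<bullet> x) * (lap w x + k\<^sup>2 * w x)))\<^sup>2 \<partial>lborel)
    \<ge> (\<integral>x. (sym_part b v x)\<^sup>2 \<partial>lborel) + 2 * (\<integral>x. sym_part b v x * skew_part slope v x \<partial>lborel)"
    unfolding eq by (rule integral_square_sum_ge[OF S A])
  moreover note commutator_identity[OF slope_radial bs v] sym_part_weighted[OF decay_radial decay_nn bs v] sq EEE Eaa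
  ultimately have "(\<integral>x. (outer_wt x * ((x \<bullet> x) * (lap w x + k\<^sup>2 * w x)))\<^sup>2 \<partial>lborel)
     \<ge> 2 * (\<integral>x. slope x * euler b x * (v x * v x) \<partial>lborel) - 4 * (\<integral>x. decay x * b x * (v x * v x) \<partial>lborel)
       - 4 * (\<integral>x. (decay x * v x)\<^sup>2 \<partial>lborel) - (\<integral>x. euler (euler decay) x * (v x * v x) \<partial>lborel)"
    by argo
  moreover have "2 * (\<integral>x. slope x * euler b x * (v x * v x) \<partial>lborel) - 4 * (\<integral>x. decay x * b x * (v x * v x) \<partial>lborel)
       - 4 * (\<integral>x. (decay x * v x)\<^sup>2 \<partial>lborel) - (\<integral>x. euler (euler decay) x * (v x * v x) \<partial>lborel)
     = (\<integral>x. 2 * (slope x * euler b x * (v x * v x)) - 4 * (decay x * b x * (v x * v x)) - 4 * (decay x * v x)\<^sup>2 - euler (euler decay) x * (v x * v x) \<partial>lborel)"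
    using i1 i2 i3 i4 by simp
  moreover have "(\<integral>x. slope x * (k\<^sup>2 * (x \<bullet> x)) * (outer_wt x * w x)\<^sup>2 \<partial>lborel)
     \<le> (\<integral>x. 2 * (slope x * euler b x * (v x * v x)) - 4 * (decay x * b x * (v x * v x)) - 4 * (decay x * v x)\<^sup>2 - euler (euler decay) x * (v x * v x) \<partial>lborel)"
  proof (rule Bochner_Integration.integral_mono[OF i5])
    show "integrable lborel (\<lambda>x. 2 * (slope x * euler b x * (v x * v x)) - 4 * (decay x * b x * (v x * v x)) - 4 * (decay x * v x)\<^sup>2 - euler (euler decay) x * (v x * v x))"
      using i1 i2 i3 i4 by simp
    fix x :: "real^'n"
    show "slope x * (k\<^sup>2 * (x \<bullet> x)) * (outer_wt x * w x)\<^sup>2 \<le>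
       2 * (slope x * euler b x * (v x * v x)) - 4 * (decay x * b x * (v x * v x)) - 4 * (decay x * v x)\<^sup>2 - euler (euler decay) x * (v x * v x)"
    proof (cases "norm x < R")
      case True
      then show ?thesis using R(2) by (simp add: v_def)
    next
      case False
      then have x: "x \<noteq> 0" using R(1) by auto
      have kp: "kap \<ge> 0" by (simp add: kap_def)
      \<comment> \<open>The dimensional constant \<open>kap\<close> enters \<open>b\<close>
        negatively and \<open>b\<close> is multiplied by \<open>-4 decay\<close>, so its
        contribution has the favourable sign.\<close>
      have "4 * (decay x * kap) \<ge> 0" using decay_nn[of x] kp by simp
      moreover have "slope x * (k\<^sup>2 * (x \<bullet> x)) \<le> 4 * (slope x - decay x) * (k\<^sup>2 * (x \<bullet> x)) - 8 * (slope x)\<^sup>2 * decay x - 4 * (decay x)\<^sup>2 - euler (euler decay) x"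
        by (rule weight_inequality[OF R(1) _ ek]) (use False in simp)
      ultimately have "slope x * (k\<^sup>2 * (x \<bullet> x)) \<le> 2 * (slope x * euler b x) - 4 * (decay x * b x) - 4 * (decay x)\<^sup>2 - euler (euler decay) x"
        unfolding Eb[OF x] b_def by (simp add: power2_eq_square algebra_simps)
      then have "slope x * (k\<^sup>2 * (x \<bullet> x)) * (v x)\<^sup>2 \<le> (2 * (slope x * euler b x) - 4 * (decay x * b x) - 4 * (decay x)\<^sup>2 - euler (euler decay) x) * (v x)\<^sup>2"
        by (rule mult_right_mono) simp
      also have "\<dots> = 2 * (slope x * euler b x * (v x * v x)) - 4 * (decay x * b x * (v x * v x)) - 4 * (decay x * v x)\<^sup>2 - euler (euler decay) x * (v x * v x)"
        by (simp add: power2_eq_square algebra_simps)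
      finally show ?thesis by (simp only: v_def)
    qed
  qed
  ultimately show ?thesis by linarith
qed

end

lemma punctured_testI:
  assumes "smooth0 v" "r > 0" "\<And>x. norm x < r \<Longrightarrow> v x = 0" "\<And>x. norm x > M \<Longrightarrow> v x = 0"
  shows "punctured_test v"
proof -
  have s2: "smooth_in (ball 0 r) v"
    by (rule smooth_in_cong[OF open_ball _ smooth_in_const[of _ 0]]) (use assms in simp)
  have "(-{0}) \<union> ball (0::real^'a) r = UNIV" using assms(2) by auto
  then have "smooth_in UNIV v" using smooth_in_Un[OF open_punctured open_ball assms(1) s2] by metis
  then show ?thesis using test_functionI[of v M] assms by (auto simp: punctured_test_def)
qed

section \<open>Logarithmic cutoff at infinity\<close>

lemma dyadic_interval:
  fixes t :: real
  assumes "2 ^ N \<le> t" "t \<le> 2 ^ M" "N \<le> M"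
  shows "\<exists>j\<in>{N..M}. 2 ^ j \<le> t \<and> t \<le> 2 ^ Suc j"
  using assms(3,2)
proof (induction M rule: dec_induct)
  case base then show ?case using assms(1) by (auto intro!: bexI[of _ N])
next
  case (step M)
  show ?case
  proof (cases "t \<le> 2 ^ M")
    case True then show ?thesis using step.IH step.hyps by fastforce
  next
    case False then show ?thesis using step by (intro bexI[of _ M]) auto
  qed
qed

text \<open>A step function above \<open>|x|^(-n)\<close> for
  \<open>2^N \<le> norm x \<le> 2^(2N)\<close>. Each of its \<open>N + 1\<close> summands has the
  same integral, so the total grows linearly in \<open>N\<close>; this replaces integration in polar
  coordinates.\<close>

definition dyadic_bound :: "nat \<Rightarrow> real^'n \<Rightarrow> real" where
  "dyadic_bound N x = (\<Sum>j\<in>{N..2*N}. indicator (cball 0 (2 ^ Suc j)) x * inverse ((2 ^ j) ^ CARD('n)))"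

lemma dyadic_bound:
  shows "integrable lborel (dyadic_bound N :: real^'n \<Rightarrow> real)"
    and "(\<integral>x. dyadic_bound N (x::real^'n) \<partial>lborel) = real (N + 1) * (unit_ball_vol (real CARD('n)) * 2 ^ CARD('n))"
proof -
  have i: "integrable lborel (\<lambda>x::real^'n. indicator (cball 0 (2 ^ Suc j)) x * inverse ((2 ^ j) ^ CARD('n)) :: real)" for j :: nat
    using borel_integrable_compact[OF compact_cball, of "0::real^'n" "2 ^ Suc j" "\<lambda>x. inverse ((2 ^ j) ^ CARD('n)) :: real"] by (simp del: power_Suc)
  then show "integrable lborel (dyadic_bound N :: real^'n \<Rightarrow> real)"
    unfolding dyadic_bound_def[abs_def] by (intro Bochner_Integration.integrable_sum)
  have v: "(\<integral>x. indicator (cball 0 (2 ^ Suc j)) (x::real^'n) * inverse ((2 ^ j) ^ CARD('n)) \<partial>lborel) = unit_ball_vol (real CARD('n)) * 2 ^ CARD('n)" for j :: nat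
  proof -
    have "measure lborel (cball (0::real^'n) (2 ^ Suc j)) = unit_ball_vol (real CARD('n)) * (2 ^ Suc j) ^ CARD('n)"
      using content_cball[of "2 ^ Suc j" "0::real^'n"] by simp
    then show ?thesis by (simp add: power_mult_distrib)
  qed
  show "(\<integral>x. dyadic_bound N (x::real^'n) \<partial>lborel) = real (N + 1) * (unit_ball_vol (real CARD('n)) * 2 ^ CARD('n))"
    unfolding dyadic_bound_def using i v by (subst Bochner_Integration.integral_sum) auto
qed

lemma dyadic_bound_nonneg: "dyadic_bound N x \<ge> 0"
  unfolding dyadic_bound_def by (intro sum_nonneg) simp

lemma dyadic_bound_ge:
  fixes x :: "real^'n"
  assumes "2 ^ N \<le> norm x" "norm x \<le> 2 ^ (2 * N)"
  shows "inverse (norm x ^ CARD('n)) \<le> dyadic_bound N x"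
proof -
  obtain j where j: "j \<in> {N..2*N}" "2 ^ j \<le> norm x" "norm x \<le> 2 ^ Suc j"
    using dyadic_interval[OF assms] by auto
  have "inverse (norm x ^ CARD('n)) \<le> inverse ((2 ^ j) ^ CARD('n))"
    using j(2) by (intro le_imp_inverse_le power_mono zero_less_power) auto
  also have "\<dots> = indicator (cball 0 (2 ^ Suc j)) x * inverse ((2 ^ j) ^ CARD('n))" using j(3) by simp
  also have "\<dots> \<le> dyadic_bound N x" unfolding dyadic_bound_def
    by (rule member_le_sum[OF j(1)]) auto
  finally show ?thesis .
qed

text \<open>Depending on the logarithm of the norm, it has gradient of size \<open>c/|x|\<close> and
  Laplacian of size \<open>c/|x|^2\<close> for \<open>c \<le> 1\<close>. With \<open>c\<close> of
  order \<open>1/N\<close>, its squared error against \<open>|x|^(-n)\<close> is of order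
  \<open>1/N\<close>.\<close>

definition log_cutoff :: "real \<Rightarrow> real^'n \<Rightarrow> real" where
  "log_cutoff c x = step (2 - c * ln (x \<bullet> x))"

lemma log_cutoff_arg:
  assumes "x \<noteq> (0::real^'n)"
  shows "(\<lambda>x. 2 - c * ln (x \<bullet> x)) differentiable at x" "euler (\<lambda>x. 2 - c * ln (x \<bullet> x)) x = - 2 * c"
    "pd (\<lambda>x. 2 - c * ln (x \<bullet> x)) i x = - c * (2 * x $ i / (x \<bullet> x))"
proof -
  have d: "((\<lambda>s. 2 - c * ln s) has_real_derivative - c / (x \<bullet> x)) (at (x \<bullet> x))"
    using assms by (auto intro!: derivative_eq_intros)
  show "(\<lambda>x. 2 - c * ln (x \<bullet> x)) differentiable at x"
    using has_derivative_chain_real[OF d differentiable_norm_sq] unfolding differentiable_def by blast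
  show "euler (\<lambda>x. 2 - c * ln (x \<bullet> x)) x = - 2 * c"
    using euler_compose[OF d differentiable_norm_sq] assms by (simp add: euler_norm_sq)
  show "pd (\<lambda>x. 2 - c * ln (x \<bullet> x)) i x = - c * (2 * x $ i / (x \<bullet> x))"
    using pd_compose[OF d differentiable_norm_sq, of i] by (simp add: pd_norm_sq)
qed

lemma radial_log_cutoff_arg: "radial (\<lambda>x::real^'n. 2 - c * ln (x \<bullet> x))"
proof (rule radial_compose[OF radial_norm_sq, where g = "\<lambda>s. 2 - c * ln s" and g' = "\<lambda>s. - c / s"])
  show "((\<lambda>s. 2 - c * ln s) has_real_derivative - c / (x \<bullet> x)) (at (x \<bullet> x))" if "x \<noteq> 0" for x :: "real^'n"
    using that by (auto intro!: derivative_eq_intros)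
  show "smooth0 (\<lambda>x::real^'n. 2 - c * ln (x \<bullet> x))"
    by (intro smooth_in_diff smooth_in_mult smooth_in_ln open_punctured smooth_in_const radial_smooth) simp
qed

lemma radial_comp_smooth_real:
  assumes "radial f" "smooth_real g" shows "radial (\<lambda>x. g (f x))"
  by (rule radial_compose[OF assms(1) smooth_real_deriv(1)[OF assms(2)] smooth_in_compose_real[OF open_punctured radialD[OF assms(1)] assms(2)]])

text \<open>Rotation fields annihilate the cutoff, so only the Euler part of
  \<open>lap_polar\<close> survives; the Euler derivative of the argument is the constant
  \<open>-2 c\<close>.\<close>

lemma log_cutoff_derivs:
  fixes x :: "real^'n" and c :: real
  defines "s \<equiv> 2 - c * ln (x \<bullet> x)"
  assumes x: "x \<noteq> 0"
  shows "pd (log_cutoff c) i x = deriv step s * (- c * (2 * x $ i / (x \<bullet> x)))"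
    and "(x \<bullet> x) * lap (log_cutoff c) x = 4 * c\<^sup>2 * deriv (deriv step) s - (real CARD('n) - 2) * (2 * c * deriv step s)"
proof -
  note d1 = smooth_real_deriv(1)[OF smooth_real_step] and d2 = smooth_real_deriv(1)[OF smooth_real_deriv(2)[OF smooth_real_step]]
  show "pd (log_cutoff c) i x = deriv step s * (- c * (2 * x $ i / (x \<bullet> x)))"
    unfolding log_cutoff_def[abs_def] s_def
    using pd_compose[OF d1 log_cutoff_arg(1)[OF x]] log_cutoff_arg(3)[OF x] by simp
  have E1: "euler (log_cutoff c) y = deriv step (2 - c * ln (y \<bullet> y)) * (- 2 * c)" if "y \<noteq> 0" for y :: "real^'n"
    unfolding log_cutoff_def[abs_def]
    using euler_compose[OF d1 log_cutoff_arg(1)[OF that]] log_cutoff_arg(2)[OF that] by simp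
  have E2: "euler (euler (log_cutoff c)) x = 4 * c\<^sup>2 * deriv (deriv step) s"
  proof -
    have "euler (euler (log_cutoff c)) x = euler (\<lambda>y. (- 2 * c) * deriv step (2 - c * ln (y \<bullet> y))) x"
      by (rule euler_cong0[OF _ x]) (simp add: E1)
    also have "\<dots> = (- 2 * c) * euler (\<lambda>y. deriv step (2 - c * ln (y \<bullet> y))) x"
    proof (rule euler_const_mult)
      show "(\<lambda>y. deriv step (2 - c * ln (y \<bullet> y))) differentiable at x"
        using has_derivative_chain_real[OF d2 log_cutoff_arg(1)[OF x]] unfolding differentiable_def by blast
    qed
    also have "euler (\<lambda>y. deriv step (2 - c * ln (y \<bullet> y))) x = deriv (deriv step) s * (- 2 * c)"
      unfolding s_def using euler_compose[OF d2 log_cutoff_arg(1)[OF x]] log_cutoff_arg(2)[OF x] by simp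
    finally show ?thesis by (simp add: power2_eq_square)
  qed
  have rad: "radial (log_cutoff c :: real^'n \<Rightarrow> real)"
    unfolding log_cutoff_def[abs_def] by (rule radial_comp_smooth_real[OF radial_log_cutoff_arg smooth_real_step])
  have "rot i j (rot i j (log_cutoff c)) x = 0" for i j
  proof -
    have "pd (rot i j (log_cutoff c)) l x = pd (\<lambda>x. 0) l x" for l
      by (rule pd_cong_open[OF open_punctured]) (use rad x in \<open>auto simp: radial_def\<close>)
    then show ?thesis by (simp add: rot_def[of i j "rot i j (log_cutoff c)"])
  qed
  then show "(x \<bullet> x) * lap (log_cutoff c) x = 4 * c\<^sup>2 * deriv (deriv step) s - (real CARD('n) - 2) * (2 * c * deriv step s)"
    using lap_polar[OF radialD[OF rad], of x] x E1[OF x] E2 by (simp add: s_def)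
qed

lemma step_deriv_bound: obtains M where "M > 0" "\<And>t. t \<in> {0..1} \<Longrightarrow> \<bar>deriv step t\<bar> \<le> M \<and> \<bar>deriv (deriv step) t\<bar> \<le> M"
proof -
  have c: "continuous_on {0..1} (deriv step)" "continuous_on {0..1} (deriv (deriv step))"
    using smooth_real_continuous[OF smooth_real_deriv(2)[OF smooth_real_step]] smooth_real_continuous[OF smooth_real_deriv(2)[OF smooth_real_deriv(2)[OF smooth_real_step]]]
    by (auto intro: continuous_on_subset)
  obtain A where A: "A > 0" "\<And>t. t \<in> {0..1} \<Longrightarrow> \<bar>deriv step t\<bar> \<le> A"
    using compact_imp_bounded[OF compact_continuous_image[OF c(1) compact_Icc]] unfolding bounded_pos by (metis imageI real_norm_def)
  obtain B where B: "B > 0" "\<And>t. t \<in> {0..1} \<Longrightarrow> \<bar>deriv (deriv step) t\<bar> \<le> B"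
    using compact_imp_bounded[OF compact_continuous_image[OF c(2) compact_Icc]] unfolding bounded_pos by (metis imageI real_norm_def)
  show ?thesis using A B by (intro that[of "max A B"]) (auto simp: le_max_iff_disj)
qed

text \<open>This \<open>c\<close> makes \<open>c ln (x \<bullet> x)\<close> the logarithm of the
  norm to base \<open>2^N\<close>, which is 1 at \<open>2^N\<close> and 2 at
  \<open>2^(2N)\<close>.\<close>

lemma log_cutoff_values:
  fixes x :: "real^'n" and N :: nat
  defines "c \<equiv> 1 / (2 * real N * ln 2)"
  assumes N: "N \<ge> 1" and x: "x \<noteq> 0"
  shows "norm x \<le> 2 ^ N \<Longrightarrow> log_cutoff c x = 1" "norm x \<ge> 2 ^ (2 * N) \<Longrightarrow> log_cutoff c x = 0"
    "2 ^ N \<le> norm x \<Longrightarrow> norm x \<le> 2 ^ (2 * N) \<Longrightarrow> 2 - c * ln (x \<bullet> x) \<in> {0..1}" "0 < c" "c \<le> 1"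
proof -
  have l2: "ln 2 \<ge> (2/3::real)" by (rule ln2_ge_two_thirds)
  have N1: "real N \<ge> 1" using N by simp
  have den: "2 * real N * ln 2 \<ge> 1" using mult_mono[of 1 "real N" "2/3" "ln 2"] N1 l2 by simp
  have den0: "2 * real N * ln 2 > 0" using den by linarith
  show c0: "0 < c" "c \<le> 1" unfolding c_def zero_less_divide_1_iff divide_le_eq_1_pos[OF den0] by (fact den0, fact den)
  have lx: "ln (x \<bullet> x) = 2 * ln (norm x)" using x by (simp add: power2_norm_eq_inner[symmetric] ln_realpow)
  have cl: "c * (2 * (real N * ln 2)) = 1" using N unfolding c_def by simp
  have up: "c * ln (x \<bullet> x) \<le> real l" if "norm x \<le> 2 ^ (l * N)" for l :: nat
  proof -
    have "ln (norm x) \<le> ln (2 ^ (l * N))" using that x by simp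
    then have "ln (x \<bullet> x) \<le> 2 * (real (l * N) * ln 2)" unfolding lx by (simp add: ln_realpow)
    then have "c * ln (x \<bullet> x) \<le> c * (2 * (real (l * N) * ln 2))" using c0 by (intro mult_left_mono) auto
    also have "\<dots> = real l * (c * (2 * (real N * ln 2)))" by (simp only: of_nat_mult mult_ac)
    finally show ?thesis unfolding cl by simp
  qed
  have lo: "c * ln (x \<bullet> x) \<ge> real l" if "norm x \<ge> 2 ^ (l * N)" for l :: nat
  proof -
    have "ln (norm x) \<ge> ln (2 ^ (l * N))" using that x by simp
    then have "ln (x \<bullet> x) \<ge> 2 * (real (l * N) * ln 2)" unfolding lx by (simp add: ln_realpow)
    then have "c * ln (x \<bullet> x) \<ge> c * (2 * (real (l * N) * ln 2))" using c0 by (intro mult_left_mono) auto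
    moreover have "c * (2 * (real (l * N) * ln 2)) = real l * (c * (2 * (real N * ln 2)))" by (simp only: of_nat_mult mult_ac)
    ultimately show ?thesis unfolding cl by linarith
  qed
  show "norm x \<le> 2 ^ N \<Longrightarrow> log_cutoff c x = 1" using up[of 1] by (simp add: log_cutoff_def step_1)
  show "norm x \<ge> 2 ^ (2 * N) \<Longrightarrow> log_cutoff c x = 0" using lo[of 2] by (simp add: log_cutoff_def step_0)
  show "2 ^ N \<le> norm x \<Longrightarrow> norm x \<le> 2 ^ (2 * N) \<Longrightarrow> 2 - c * ln (x \<bullet> x) \<in> {0..1}"
    using up[of 2] lo[of 1] by simp
qed

lemma smooth_log_cutoff: "smooth0 (log_cutoff c)"
  unfolding log_cutoff_def[abs_def] using radialD[OF radial_comp_smooth_real[OF radial_log_cutoff_arg smooth_real_step]] .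

text \<open>By the equation for \<open>w\<close> only terms with a derivative of the cutoff remain,
  and each carries a factor \<open>c\<close> (a factor \<open>c^2\<close> is at most
  \<open>c\<close>). The Laplacian of the cutoff contributes \<open>4 + 2n\<close>, the gradient
  term \<open>4n\<close>, because \<open>euler w\<close> is at most \<open>n |x| D\<close>.\<close>

lemma log_cutoff_error:
  fixes x :: "real^'n" and w :: "real^'n \<Rightarrow> real" and N :: nat
  defines "c \<equiv> 1 / (2 * real N * ln 2)" and "n \<equiv> real CARD('n)"
  assumes N: "N \<ge> 1" and x: "2 ^ N \<le> norm x" "norm x \<le> 2 ^ (2 * N)"
    and w: "smooth_in UNIV w" and eq: "lap w x + k\<^sup>2 * w x = 0"
    and bd: "\<bar>w x\<bar> \<le> D" "\<And>i. \<bar>pd w i x\<bar> \<le> D"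
    and M: "M > 0" "\<And>t. t \<in> {0..1} \<Longrightarrow> \<bar>deriv step t\<bar> \<le> M \<and> \<bar>deriv (deriv step) t\<bar> \<le> M"
  shows "\<bar>(x \<bullet> x) * (lap (\<lambda>x. log_cutoff c x * w x) x + k\<^sup>2 * (log_cutoff c x * w x))\<bar> \<le> c * (M * (4 + 6 * n)) * norm x * D"
proof -
  have nx1: "norm x \<ge> 1" using x(1) one_le_power[of "2::real" N] by linarith
  have x0: "x \<noteq> 0" using nx1 by auto
  define s where "s = 2 - c * ln (x \<bullet> x)"
  note cv = log_cutoff_values[OF N x0, folded c_def]
  have s: "s \<in> {0..1}" unfolding s_def using cv(3) x by blast
  have c0: "0 < c" "c \<le> 1" using cv by auto
  have D0: "D \<ge> 0" using bd(1) by linarith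
  have n1: "n \<ge> 1" unfolding n_def using one_le_card_finite by (simp add: Suc_leI)
  let ?f = "log_cutoff c :: real^'n \<Rightarrow> real"
  have w0: "smooth0 w" using smooth_in_subset[OF w] by simp
  have "lap (\<lambda>x. ?f x * w x) x = ?f x * lap w x + lap ?f x * w x + (\<Sum>i\<in>UNIV. pd ?f i x * pd w i x + pd ?f i x * pd w i x)"
    by (rule lap_mult[OF smooth_log_cutoff w0 open_punctured]) (use x0 in simp)
  then have "lap (\<lambda>x. ?f x * w x) x + k\<^sup>2 * (?f x * w x) = ?f x * (lap w x + k\<^sup>2 * w x) + lap ?f x * w x + 2 * (\<Sum>i\<in>UNIV. pd ?f i x * pd w i x)"
  proof -
    assume a: "lap (\<lambda>x. ?f x * w x) x = ?f x * lap w x + lap ?f x * w x + (\<Sum>i\<in>UNIV. pd ?f i x * pd w i x + pd ?f i x * pd w i x)"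
    show ?thesis unfolding a sum.distrib by (simp add: distrib_left)
  qed
  then have "(x \<bullet> x) * (lap (\<lambda>x. ?f x * w x) x + k\<^sup>2 * (?f x * w x)) = ((x \<bullet> x) * lap ?f x) * w x + 2 * ((x \<bullet> x) * (\<Sum>i\<in>UNIV. pd ?f i x * pd w i x))"
    unfolding eq by (simp add: algebra_simps)
  also have "(x \<bullet> x) * (\<Sum>i\<in>UNIV. pd ?f i x * pd w i x) = (- 2 * c * deriv step s) * euler w x"
    unfolding log_cutoff_derivs(1)[OF x0] euler_def sum_distrib_left s_def[symmetric] using x0 by (intro sum.cong) auto
  also have "(x \<bullet> x) * lap ?f x = 4 * c\<^sup>2 * deriv (deriv step) s - (n - 2) * (2 * c * deriv step s)"
    unfolding log_cutoff_derivs(2)[OF x0] s_def n_def ..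
  finally have F: "(x \<bullet> x) * (lap (\<lambda>x. ?f x * w x) x + k\<^sup>2 * (?f x * w x))
     = (4 * c\<^sup>2 * deriv (deriv step) s - (n - 2) * (2 * c * deriv step s)) * w x + 2 * ((- 2 * c * deriv step s) * euler w x)" .
  have b1: "\<bar>4 * c\<^sup>2 * deriv (deriv step) s\<bar> \<le> 4 * (c * M)"
  proof -
    have "c\<^sup>2 \<le> c" using c0 by (simp add: power2_eq_square mult_left_le)
    then have "c\<^sup>2 * \<bar>deriv (deriv step) s\<bar> \<le> c * M" using M s c0 by (intro mult_mono) auto
    then show ?thesis by (simp add: abs_mult)
  qed
  have b2: "\<bar>(n - 2) * (2 * c * deriv step s)\<bar> \<le> 2 * n * (c * M)"
  proof -
    have "\<bar>n - 2\<bar> \<le> n" using n1 by linarith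
    then have "\<bar>n - 2\<bar> * (c * \<bar>deriv step s\<bar>) \<le> n * (c * M)" using M s c0 by (intro mult_mono) auto
    then show ?thesis using c0 by (simp add: abs_mult)
  qed
  have bE: "\<bar>euler w x\<bar> \<le> n * (norm x * D)"
  proof -
    have "\<bar>euler w x\<bar> \<le> (\<Sum>i\<in>UNIV. \<bar>x $ i * pd w i x\<bar>)" unfolding euler_def by (rule sum_abs)
    also have "\<dots> \<le> (\<Sum>i\<in>(UNIV::'n set). norm x * D)"
      unfolding abs_mult by (intro sum_mono mult_mono component_le_norm_cart bd) auto
    finally show ?thesis by (simp add: n_def)
  qed
  have t1: "\<bar>(4 * c\<^sup>2 * deriv (deriv step) s - (n - 2) * (2 * c * deriv step s)) * w x\<bar> \<le> ((4 + 2 * n) * (c * M)) * (norm x * D)"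
  proof -
    have "\<bar>4 * c\<^sup>2 * deriv (deriv step) s - (n - 2) * (2 * c * deriv step s)\<bar> \<le> (4 + 2 * n) * (c * M)"
      using b1 b2 by (simp add: distrib_right)
    moreover have "\<bar>w x\<bar> \<le> norm x * D" using bd(1) mult_right_mono[OF nx1 D0] by simp
    ultimately show ?thesis unfolding abs_mult using c0 M n1 by (intro mult_mono) auto
  qed
  have t2: "\<bar>2 * ((- 2 * c * deriv step s) * euler w x)\<bar> \<le> 4 * n * (c * M) * (norm x * D)"
  proof -
    have "c * \<bar>deriv step s\<bar> \<le> c * M" using M s c0 by simp
    then have "(c * \<bar>deriv step s\<bar>) * \<bar>euler w x\<bar> \<le> (c * M) * (n * (norm x * D))" using bE c0 M by (intro mult_mono) auto
    then show ?thesis using c0 by (simp add: abs_mult mult_ac)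
  qed
  have "\<bar>(x \<bullet> x) * (lap (\<lambda>x. ?f x * w x) x + k\<^sup>2 * (?f x * w x))\<bar> \<le> ((4 + 2 * n) * (c * M)) * (norm x * D) + 4 * n * (c * M) * (norm x * D)"
    unfolding F using t1 t2 by linarith
  also have "\<dots> = c * (M * (4 + 6 * n)) * norm x * D" by (simp add: algebra_simps)
  finally show ?thesis .
qed

lemma punctured_test_lap: "punctured_test v \<Longrightarrow> punctured_test (lap v)"
  unfolding lap_def[abs_def] by (intro punctured_test_sum punctured_test_pd)

text \<open>The outer Carleman estimate applied to \<open>w\<close> cut off near the sphere of radius \<open>R\<^sub>1\<close> and, on the
  logarithmic scale, at infinity: the error of the latter cutoff vanishes in the limit.\<close>

lemma rellich_weighted:
  fixes w :: "real^'n \<Rightarrow> real"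
  assumes w: "smooth_in UNIV w" and R: "0 < R" "R < R1" "R1 < R2"
    and eq: "\<And>x. norm x > R \<Longrightarrow> lap w x + k\<^sup>2 * w x = 0"
    and bd: "\<And>x. norm x > R \<Longrightarrow> \<bar>w x\<bar> \<le> C * norm x powr (- real CARD('n) / 2)"
      "\<And>x i. norm x > R \<Longrightarrow> \<bar>pd w i x\<bar> \<le> C * norm x powr (- real CARD('n) / 2)"
    and g: "smooth_in UNIV g" "\<And>x. norm x < R1 \<Longrightarrow> g x = 0" "\<And>x. norm x > R2 \<Longrightarrow> g x = w x"
    and m: "m \<ge> 1" and e: "e > 0" and ek: "6 * (real m)\<^sup>2 * e \<le> k\<^sup>2 * (R1\<^sup>2) powr (3/4)"
    and S: "open S" "\<And>x. x \<in> S \<Longrightarrow> R2 < norm x \<and> norm x < rho"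
  shows "(\<integral>x. indicator S x * (slope m e x * (k\<^sup>2 * (x \<bullet> x)) * (outer_wt m e x * w x)\<^sup>2) \<partial>lborel)
     \<le> (\<integral>x. (outer_wt m e x * ((x \<bullet> x) * (lap g x + k\<^sup>2 * g x)))\<^sup>2 \<partial>lborel)"
proof -
  let ?n = "real CARD('n)"
  let ?wt = "outer_wt m e :: real^'n \<Rightarrow> real" and ?sl = "slope m e :: real^'n \<Rightarrow> real"
  obtain M where M: "M > 0" "\<And>t. t \<in> {0..1} \<Longrightarrow> \<bar>deriv step t\<bar> \<le> M \<and> \<bar>deriv (deriv step) t\<bar> \<le> M"
    using step_deriv_bound by metis
  define L where "L = (\<integral>x. indicator S x * (?sl x * (k\<^sup>2 * (x \<bullet> x)) * (?wt x * w x)\<^sup>2) \<partial>lborel)"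
  define F where "F x = (?wt x * ((x \<bullet> x) * (lap g x + k\<^sup>2 * g x)))\<^sup>2" for x
  define B where "B = (M * (4 + 6 * ?n))\<^sup>2 * C\<^sup>2 * (inverse e ^ (2 * m))\<^sup>2"
  define V where "V = unit_ball_vol ?n * 2 ^ CARD('n)"
  have wts: "smooth0 ?wt" using radialD[OF outer_wt_radial[OF m e]] .
  have e_in: "lap g x + k\<^sup>2 * g x = 0" if "norm x < R1 \<or> norm x > R2" for x
  proof (cases "norm x < R1")
    case True
    have "lap g x = lap (\<lambda>x. 0) x" by (rule lap_cong_open[OF open_ball[of 0 R1]]) (use True g in auto)
    then show ?thesis using g(2)[OF True] by (simp add: lap_0)
  next
    case False
    then have x: "norm x > R2" using that by simp
    have o: "open {x::real^'n. norm x > R2}" by (intro open_Collect_less continuous_intros)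
    have "lap g x = lap w x" by (rule lap_cong_open[OF o]) (use x g in auto)
    then show ?thesis using g(3)[OF x] eq[of x] x R by simp
  qed
  have pe: "punctured_test (\<lambda>x. lap g x + k\<^sup>2 * g x)"
  proof (rule punctured_testI[where r = R1 and M = R2])
    show "smooth0 (\<lambda>x. lap g x + k\<^sup>2 * g x)"
      by (rule smooth_in_subset[OF smooth_in_add[OF open_UNIV smooth_lap[OF open_UNIV g(1)] smooth_in_mult[OF open_UNIV smooth_in_const g(1)]]]) simp
  qed (use e_in R in auto)
  have sx: "smooth0 (\<lambda>x::real^'n. ?wt x * (x \<bullet> x))" by (intro smooth_in_mult open_punctured wts radial_smooth)
  have Fi: "integrable lborel F"
  proof -
    have p: "punctured_test (\<lambda>x. (?wt x * (x \<bullet> x)) * (lap g x + k\<^sup>2 * g x))" by (rule punctured_test_mult[OF sx pe])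
    have "integrable lborel (\<lambda>x. ((?wt x * (x \<bullet> x)) * (lap g x + k\<^sup>2 * g x)) * ((?wt x * (x \<bullet> x)) * (lap g x + k\<^sup>2 * g x)))"
      by (rule punctured_test_integrable[OF punctured_test_mult2[OF p p]])
    then show ?thesis by (simp add: F_def[abs_def] power2_eq_square mult_ac)
  qed
  \<comment> \<open>\<open>2^N > rho\<close> puts \<open>S\<close> where the outer cutoff is 1, and
    \<open>2^N > R2\<close> separates the region of the outer cutoff from that of the inner
    one.\<close>
  have main: "L \<le> (\<integral>x. F x \<partial>lborel) + (1 / (2 * real N * ln 2))\<^sup>2 * B * (real (N + 1) * V)"
    if N: "N \<ge> 1" and NR: "2 ^ N > rho" "2 ^ N > R2" for N :: nat
  proof -
    define c where "c = 1 / (2 * real N * ln 2)"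
    define wN where "wN x = log_cutoff c x * g x" for x
    note cv = log_cutoff_values[OF N, folded c_def]
    have pN: "punctured_test wN"
    proof (rule punctured_testI[where r = R1 and M = "2 ^ (2 * N)"])
      show "smooth0 wN" unfolding wN_def
        by (rule smooth_in_mult[OF open_punctured smooth_log_cutoff smooth_in_subset[OF g(1)]]) simp
      show "wN x = 0" if "norm x > 2 ^ (2 * N)" for x
      proof -
        have "norm x > 0" using that by (meson less_trans zero_less_numeral zero_less_power)
        then have "x \<noteq> 0" by auto
        then show ?thesis using cv(2)[of x] that by (simp add: wN_def)
      qed
    qed (use g R in \<open>auto simp: wN_def\<close>)
    have near: "wN x = g x" if "norm x < 2 ^ N" for x
      using cv(1)[of x] that g(2)[of x] R by (cases "x = 0") (auto simp: wN_def)
    have inner: "lap wN x + k\<^sup>2 * wN x = lap g x + k\<^sup>2 * g x" if "norm x < 2 ^ N" for x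
    proof -
      have "lap wN x = lap g x" by (rule lap_cong_open[OF open_ball[of 0 "2 ^ N"]]) (use near that in auto)
      then show ?thesis using near[OF that] by simp
    qed
    \<comment> \<open>The errors of the two cutoffs have disjoint supports. In the outer region
      \<open>outer_wt\<close> times the norm is \<open>sat^(2m)\<close>, at most
      \<open>e^(-2m)\<close>, so the weighted error is of size \<open>c |x|^(-n/2)\<close>, and its
      square lies below \<open>dyadic_bound\<close>.\<close>
    have pw: "(?wt x * ((x \<bullet> x) * (lap wN x + k\<^sup>2 * wN x)))\<^sup>2 \<le> F x + c\<^sup>2 * B * dyadic_bound N x" for x
    proof -
      have c2: "c\<^sup>2 * B * dyadic_bound N x \<ge> 0" by (simp add: B_def dyadic_bound_nonneg)
      have F0: "F x \<ge> 0" by (simp add: F_def)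
      consider "norm x < 2 ^ N" | "2 ^ N \<le> norm x" "norm x \<le> 2 ^ (2 * N)" | "norm x > 2 ^ (2 * N)" by linarith
      then show ?thesis
      proof cases
        case 1 then show ?thesis using inner[OF 1] c2 by (simp add: F_def)
      next
        case 3
        have o: "open {x::real^'n. norm x > 2 ^ (2 * N)}" by (intro open_Collect_less continuous_intros)
        have z: "wN y = 0" if "norm y > 2 ^ (2 * N)" for y
        proof -
          have "norm y > 0" using that by (meson less_trans zero_less_numeral zero_less_power)
          then have "y \<noteq> 0" by auto
          then show ?thesis using cv(2)[of y] that by (simp add: wN_def)
        qed
        have "lap wN x = lap (\<lambda>x. 0) x" by (rule lap_cong_open[OF o]) (use 3 z in auto)
        then show ?thesis using z[OF 3] c2 F0 by (simp add: lap_0)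
      next
        case 2
        then have xR: "norm x > R2" using NR by linarith
        then have x0: "x \<noteq> 0" using R by auto
        have nx: "norm x > R" using xR R by linarith
        have o: "open {x::real^'n. norm x > R2}" by (intro open_Collect_less continuous_intros)
        have "lap wN x = lap (\<lambda>x. log_cutoff c x * w x) x"
          by (rule lap_cong_open[OF o]) (use xR g(3) in \<open>auto simp: wN_def\<close>)
        then have eqw: "lap wN x + k\<^sup>2 * wN x = lap (\<lambda>x. log_cutoff c x * w x) x + k\<^sup>2 * (log_cutoff c x * w x)"
          using g(3)[OF xR] by (simp add: wN_def)
        define D where "D = C * norm x powr (- ?n / 2)"
        have err: "\<bar>(x \<bullet> x) * (lap wN x + k\<^sup>2 * wN x)\<bar> \<le> c * (M * (4 + 6 * ?n)) * norm x * D"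
          unfolding eqw c_def using log_cutoff_error[OF N 2 w eq[OF nx] _ _ M, of D] bd[OF nx] by (simp add: D_def)
        have D2: "D\<^sup>2 = C\<^sup>2 * inverse (norm x ^ CARD('n))"
        proof -
          have "(norm x powr (- ?n / 2))\<^sup>2 = norm x powr (- ?n)" by (simp add: power2_eq_square powr_add[symmetric])
          also have "\<dots> = inverse (norm x ^ CARD('n))" using x0 by (simp add: powr_minus powr_realpow)
          finally show ?thesis by (simp add: D_def power_mult_distrib)
        qed
        have sat1: "0 \<le> sat e x" "sat e x \<le> inverse e"
        proof -
          have q: "sat_q e x \<ge> 0" by (rule sat_q_nonneg[OF m e])
          show "0 \<le> sat e x" using q by (simp add: sat_def[OF m e])
          have "e * (x \<bullet> x) powr (1/4) \<le> 1 + sat_q e x" by (simp add: sat_q_def[OF m e])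
          then show "sat e x \<le> inverse e" using e q by (simp add: sat_def[OF m e] field_simps)
        qed
        have wtn: "\<bar>?wt x * norm x\<bar> \<le> inverse e ^ (2 * m)"
        proof -
          have "(x \<bullet> x) powr (-1/2) * norm x = 1"
          proof -
            have "(x \<bullet> x) powr (-1/2) = (norm x powr 2) powr (-1/2)"
              using x0 by (simp add: power2_norm_eq_inner[symmetric])
            also have "\<dots> = norm x powr (- 1)" by (subst powr_powr) simp
            finally have "(x \<bullet> x) powr (-1/2) = norm x powr (- 1)" .
            then show ?thesis using x0 by (simp add: powr_minus)
          qed
          then have "?wt x * norm x = sat e x ^ (2 * m)" by (simp add: outer_wt_def[OF m e] algebra_simps)
          then show ?thesis using sat1 by (simp add: power_mono)
        qed
        have "\<bar>?wt x * ((x \<bullet> x) * (lap wN x + k\<^sup>2 * wN x))\<bar> \<le> \<bar>?wt x\<bar> * (c * (M * (4 + 6 * ?n)) * norm x * D)"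
          unfolding abs_mult[of "?wt x"] by (rule mult_left_mono[OF err]) simp
        also have "\<dots> = \<bar>?wt x * norm x\<bar> * (c * (M * (4 + 6 * ?n)) * D)" by (simp add: abs_mult)
        also have "\<dots> \<le> inverse e ^ (2 * m) * (c * (M * (4 + 6 * ?n)) * D)"
        proof (rule mult_right_mono[OF wtn])
          have "D \<ge> 0" using bd(1)[OF nx] unfolding D_def by linarith
          then show "0 \<le> c * (M * (4 + 6 * ?n)) * D" using cv(4)[OF x0] M by simp
        qed
        finally have "(?wt x * ((x \<bullet> x) * (lap wN x + k\<^sup>2 * wN x)))\<^sup>2 \<le> (inverse e ^ (2 * m) * (c * (M * (4 + 6 * ?n)) * D))\<^sup>2"
          by (rule abs_le_square_iff[THEN iffD1, OF order_trans[OF _ abs_ge_self]])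
        also have "\<dots> = c\<^sup>2 * B * inverse (norm x ^ CARD('n))" unfolding B_def power_mult_distrib D2 by (simp add: mult_ac)
        also have "\<dots> \<le> c\<^sup>2 * B * dyadic_bound N x"
          by (rule mult_left_mono[OF dyadic_bound_ge[OF 2]]) (simp add: B_def)
        finally show ?thesis using F0 by linarith
      qed
    qed
    have iL: "integrable lborel (\<lambda>x. ?sl x * (k\<^sup>2 * (x \<bullet> x)) * (?wt x * wN x)\<^sup>2)"
    proof -
      have "integrable lborel (\<lambda>x. (?sl x * (k\<^sup>2 * (x \<bullet> x))) * ((?wt x * wN x) * (?wt x * wN x)))"
        by (intro weighted_integrable smooth_in_mult open_punctured radialD[OF slope_radial[OF m e]] smooth_in_const radial_smooth
            punctured_test_mult[OF wts pN])
      then show ?thesis by (simp only: power2_eq_square)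
    qed
    have iN: "integrable lborel (\<lambda>x. (?wt x * ((x \<bullet> x) * (lap wN x + k\<^sup>2 * wN x)))\<^sup>2)"
    proof -
      have p: "punctured_test (\<lambda>x. (?wt x * (x \<bullet> x)) * (lap wN x + k\<^sup>2 * wN x))"
        by (intro punctured_test_mult[OF sx] punctured_test_add punctured_test_lap pN punctured_test_mult[OF smooth_in_const])
      have "integrable lborel (\<lambda>x. ((?wt x * (x \<bullet> x)) * (lap wN x + k\<^sup>2 * wN x)) * ((?wt x * (x \<bullet> x)) * (lap wN x + k\<^sup>2 * wN x)))"
        by (rule punctured_test_integrable[OF punctured_test_mult2[OF p p]])
      then show ?thesis by (simp add: power2_eq_square mult_ac)
    qed
    have nnL: "?sl x * (k\<^sup>2 * (x \<bullet> x)) * (?wt x * f x)\<^sup>2 \<ge> 0" for f and x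
      using sat_q_nonneg[OF m e, of x] by (simp add: slope_def[OF m e])
    have "L = (\<integral>x. indicator S x *\<^sub>R (?sl x * (k\<^sup>2 * (x \<bullet> x)) * (?wt x * wN x)\<^sup>2) \<partial>lborel)"
      unfolding L_def
    proof (intro Bochner_Integration.integral_cong refl)
      fix x
      show "indicator S x * (?sl x * (k\<^sup>2 * (x \<bullet> x)) * (?wt x * w x)\<^sup>2) = indicator S x *\<^sub>R (?sl x * (k\<^sup>2 * (x \<bullet> x)) * (?wt x * wN x)\<^sup>2)"
        using S(2)[of x] near[of x] NR g(3)[of x] by (cases "x \<in> S") auto
    qed
    also have "\<dots> \<le> (\<integral>x. ?sl x * (k\<^sup>2 * (x \<bullet> x)) * (?wt x * wN x)\<^sup>2 \<partial>lborel)"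
      by (intro Bochner_Integration.integral_mono integrable_mult_indicator iL)
        (use S(1) nnL in \<open>auto simp: indicator_def\<close>)
    also have "\<dots> \<le> (\<integral>x. (?wt x * ((x \<bullet> x) * (lap wN x + k\<^sup>2 * wN x)))\<^sup>2 \<partial>lborel)"
      by (rule carleman_outer[OF m e pN _ _ ek]) (use R g(2) in \<open>auto simp: wN_def\<close>)
    also have "\<dots> \<le> (\<integral>x. F x + c\<^sup>2 * B * dyadic_bound N x \<partial>lborel)"
      using Fi dyadic_bound(1)[where 'n = 'n, of N] iN pw by (intro Bochner_Integration.integral_mono) auto
    also have "\<dots> = (\<integral>x. F x \<partial>lborel) + c\<^sup>2 * B * (real (N + 1) * V)"
      using Fi dyadic_bound[where 'n = 'n, of N] by (simp add: V_def)
    finally show ?thesis by (simp add: c_def)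
  qed
  \<comment> \<open>The factor \<open>c^2\<close> is of order \<open>1/N^2\<close> and the integral
    of \<open>dyadic_bound\<close> of order \<open>N\<close>, so the outer error vanishes although
    \<open>|x|^(-n)\<close> is not integrable at infinity.\<close>
  have "(\<lambda>N. (\<integral>x. F x \<partial>lborel) + (1 / (2 * real N * ln 2))\<^sup>2 * B * (real (N + 1) * V)) \<longlonglongrightarrow> (\<integral>x. F x \<partial>lborel) + 0"
  proof (intro tendsto_add tendsto_const)
    have a: "(\<lambda>N. 1 / real N) \<longlonglongrightarrow> 0" by (rule lim_1_over_n)
    have l1: "(\<lambda>N. (1 / (2 * ln 2))\<^sup>2 * B * V * (1 / real N + (1 / real N) * (1 / real N))) \<longlonglongrightarrow> (1 / (2 * ln 2))\<^sup>2 * B * V * (0 + 0 * 0)"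
      by (intro tendsto_mult tendsto_add tendsto_const a)
    have l2: "eventually (\<lambda>N. (1 / (2 * ln 2))\<^sup>2 * B * V * (1 / real N + (1 / real N) * (1 / real N)) = (1 / (2 * real N * ln 2))\<^sup>2 * B * (real (N + 1) * V)) sequentially"
      by (rule eventually_sequentiallyI[of 1]) (simp add: power2_eq_square field_simps)
    from Lim_transform_eventually[OF l1 l2]
    show "(\<lambda>N. (1 / (2 * real N * ln 2))\<^sup>2 * B * (real (N + 1) * V)) \<longlonglongrightarrow> 0" by simp
  qed
  moreover have "eventually (\<lambda>N. L \<le> (\<integral>x. F x \<partial>lborel) + (1 / (2 * real N * ln 2))\<^sup>2 * B * (real (N + 1) * V)) sequentially"
  proof -
    obtain N0 :: nat where N0: "max rho R2 < 2 ^ N0" using real_arch_pow[of 2 "max rho R2"] by auto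
    show ?thesis
    proof (rule eventually_sequentiallyI[of "max 1 N0"])
      fix N assume N: "max 1 N0 \<le> N"
      then have p: "(2::real) ^ N0 \<le> 2 ^ N" by (intro power_increasing) auto
      have "max rho R2 < 2 ^ N" using N0 p by linarith
      then show "L \<le> (\<integral>x. F x \<partial>lborel) + (1 / (2 * real N * ln 2))\<^sup>2 * B * (real (N + 1) * V)"
        using N by (intro main) auto
    qed
  qed
  ultimately have "L \<le> (\<integral>x. F x \<partial>lborel)" using tendsto_lowerbound[of _ "(\<integral>x. F x \<partial>lborel)" sequentially L] by simp
  then show ?thesis by (simp add: L_def F_def)
qed

lemma radial_step_cutoff:
  fixes R1 R2 :: real
  assumes "0 < R1" "R1 < R2"
  defines "chi \<equiv> \<lambda>x::real^'n. step ((x \<bullet> x - R1\<^sup>2) * (1 / (R2\<^sup>2 - R1\<^sup>2)))"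
  shows "smooth_in UNIV chi" "norm x \<le> R1 \<Longrightarrow> chi x = 0" "norm x \<ge> R2 \<Longrightarrow> chi x = 1"
proof -
  have RR: "R1\<^sup>2 < R2\<^sup>2" using assms by (intro power_strict_mono) auto
  show "smooth_in UNIV chi" unfolding chi_def
    by (rule smooth_in_compose_real[OF open_UNIV smooth_in_mult[OF open_UNIV smooth_in_diff[OF open_UNIV radial_smooth smooth_in_const] smooth_in_const] smooth_real_step])
  show "chi x = 0" if "norm x \<le> R1"
  proof -
    have "(norm x)\<^sup>2 \<le> R1\<^sup>2" using that by (intro power_mono) auto
    then show ?thesis unfolding chi_def power2_norm_eq_inner[symmetric] using RR by (intro step_0) (simp add: field_simps)
  qed
  show "chi x = 1" if "norm x \<ge> R2"
  proof -
    have "(norm x)\<^sup>2 \<ge> R2\<^sup>2" using that assms by (intro power_mono) auto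
    then show ?thesis unfolding chi_def power2_norm_eq_inner[symmetric] using RR by (intro step_1) (simp add: field_simps)
  qed
qed

text \<open>Compares the weight on the shell \<open>S\<close> around \<open>x0\<close>, where it is
  governed by \<open>t3\<close>, with its size on the support of the inner cutoff error, governed by
  the smaller \<open>t2\<close>. The square integral of \<open>w\<close> on \<open>S\<close> is then
  at most a constant times \<open>(t2/t3)^(2m)\<close> for every \<open>m\<close>, hence 0.\<close>

lemma rellich_smooth_real:
  fixes w :: "real^'n \<Rightarrow> real"
  assumes w: "smooth_in UNIV w" and R: "0 < R" and k: "k \<noteq> 0"
    and eq: "\<And>x. norm x > R \<Longrightarrow> lap w x + k\<^sup>2 * w x = 0"
    and bd: "\<And>x. norm x > R \<Longrightarrow> \<bar>w x\<bar> \<le> C * norm x powr (- real CARD('n) / 2)"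
      "\<And>x i. norm x > R \<Longrightarrow> \<bar>pd w i x\<bar> \<le> C * norm x powr (- real CARD('n) / 2)"
    and x0: "norm x0 > R"
  shows "w x0 = 0"
proof -
  define R1 where "R1 = R + (norm x0 - R) / 4"
  define R2 where "R2 = R + (norm x0 - R) / 2"
  define R3 where "R3 = R + 3 * (norm x0 - R) / 4"
  define rho where "rho = norm x0 + 1"
  have "R < R1 \<and> R1 < R2 \<and> R2 < R3 \<and> R3 < norm x0 \<and> norm x0 < rho"
    unfolding R1_def R2_def R3_def rho_def by (intro conjI) (use x0 in argo)+
  then have RR: "R < R1" "R1 < R2" "R2 < R3" "R3 < norm x0" "norm x0 < rho" by auto
  define chi where "chi x = step ((x \<bullet> x - R1\<^sup>2) * (1 / (R2\<^sup>2 - R1\<^sup>2)))" for x :: "real^'n"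
  have R1p: "0 < R1" using R RR by linarith
  note chi = radial_step_cutoff[OF R1p RR(2), folded chi_def[abs_def]]
  define g where "g x = chi x * w x" for x
  have gs: "smooth_in UNIV g" unfolding g_def by (rule smooth_in_mult[OF open_UNIV _ w]) (use chi(1) in \<open>simp add: chi_def[abs_def]\<close>)
  have g_in: "g x = 0" if "norm x < R1" for x using chi(2)[of x] that by (simp add: g_def chi_def)
  have g_out: "g x = w x" if "norm x > R2" for x using chi(3)[of x] that by (simp add: g_def chi_def)
  define E where "E x = lap g x + k\<^sup>2 * g x" for x
  have euler0: "E x = 0" if "norm x < R1 \<or> norm x > R2" for x
  proof (cases "norm x < R1")
    case True
    have "lap g x = lap (\<lambda>x. 0) x" by (rule lap_cong_open[OF open_ball[of 0 R1]]) (use True g_in in auto)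
    then show ?thesis using g_in[OF True] by (simp add: lap_0 E_def)
  next
    case False
    then have x: "norm x > R2" using that by simp
    have o: "open {x::real^'n. norm x > R2}" by (intro open_Collect_less continuous_intros)
    have "lap g x = lap w x" by (rule lap_cong_open[OF o]) (use x g_out in auto)
    then show ?thesis using g_out[OF x] eq[of x] x RR by (simp add: E_def)
  qed
  have Ec: "continuous_on UNIV E" unfolding E_def
    by (intro continuous_intros smooth_inD(3)[OF smooth_lap[OF open_UNIV gs]] smooth_inD(3)[OF gs])
  have Ei: "integrable lborel (\<lambda>x. (E x)\<^sup>2)"
    by (rule integrable_cont_supp[where M = R2]) (auto intro!: continuous_intros Ec simp: euler0)
  define S where "S = {x::real^'n. R3 < norm x \<and> norm x < rho}"
  have So: "open S" unfolding S_def by (intro open_Collect_conj open_Collect_less continuous_intros)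
  have wc: "continuous_on UNIV w" by (rule smooth_inD(3)[OF w])
  have Swi: "integrable lborel (\<lambda>x. indicator S x * (w x)\<^sup>2)"
  proof -
    have "integrable lborel (\<lambda>x. indicator (cball 0 rho) x *\<^sub>R (w x)\<^sup>2)"
      by (rule borel_integrable_compact[OF compact_cball]) (intro continuous_intros continuous_on_subset[OF wc], simp)
    from integrable_mult_indicator[OF _ this, of S]
    have "integrable lborel (\<lambda>x. indicator S x *\<^sub>R (indicator (cball 0 rho) x *\<^sub>R (w x)\<^sup>2))" using So by simp
    moreover have "(\<lambda>x. indicator S x *\<^sub>R (indicator (cball 0 rho) x *\<^sub>R (w x)\<^sup>2)) = (\<lambda>x. indicator S x * (w x)\<^sup>2)"
      by (intro ext) (auto simp: S_def indicator_def)
    ultimately show ?thesis by simp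
  qed
  define J where "J = (\<integral>x. (E x)\<^sup>2 \<partial>lborel)"
  define I where "I = (\<integral>x. indicator S x * (w x)\<^sup>2 \<partial>lborel)"
  define t2 where "t2 = (R2\<^sup>2) powr (1/4)"
  define t3 where "t3 = (R3\<^sup>2) powr (1/4)"
  define tr where "tr = (rho\<^sup>2) powr (1/4)"
  have tt: "0 < t2" "t2 < t3" "0 < tr"
  proof -
    have "R2\<^sup>2 < R3\<^sup>2" using RR R by (intro power_strict_mono) auto
    then show "t2 < t3" unfolding t2_def t3_def by (intro powr_less_mono2) auto
    show "0 < t2" "0 < tr" using RR R by (auto simp: t2_def tr_def)
  qed
  \<comment> \<open>Defined by \<open>1 + e0 t3 = sqrt (t3/t2)\<close>: for
    \<open>e \<le> e0\<close> saturation costs at most half of the exponent, leaving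
    \<open>2m\<close> of the \<open>4m\<close> factors \<open>t2/t3\<close>.\<close>
  define e0 where "e0 = (sqrt (t3 / t2) - 1) / t3"
  have e0: "e0 > 0" using tt by (simp add: e0_def)
  define K where "K = R2\<^sup>2 * J * (1 + tr) / k\<^sup>2"
  have bound: "I \<le> K * (t2 / t3) ^ (2 * m)" if m: "m \<ge> 1" for m :: nat
  proof -
    \<comment> \<open>The last bound is hypothesis \<open>ek\<close> and forces \<open>e\<close> to
      shrink with \<open>m\<close>; \<open>e \<le> 1\<close> keeps \<open>slope\<close> above
      \<open>1/(1 + tr)\<close>. No constant in \<open>K\<close> depends on \<open>e\<close> or
      \<open>m\<close>.\<close>
    define e where "e = min (min e0 1) (k\<^sup>2 * (R1\<^sup>2) powr (3/4) / (6 * (real m)\<^sup>2))"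
    have mp: "real m > 0" using m by simp
    have e: "e > 0" "e \<le> e0" "e \<le> 1" using e0 k R1p mp by (auto simp: e_def)
    have ek: "6 * (real m)\<^sup>2 * e \<le> k\<^sup>2 * (R1\<^sup>2) powr (3/4)"
    proof -
      have "e \<le> k\<^sup>2 * (R1\<^sup>2) powr (3/4) / (6 * (real m)\<^sup>2)" by (simp add: e_def)
      then show ?thesis using mp by (simp add: field_simps)
    qed
    let ?wt = "outer_wt m e :: real^'n \<Rightarrow> real"
    define h where "h t = t / (1 + e * t)" for t
    have hmono: "h s \<le> h t" if "0 \<le> s" "s \<le> t" for s t
    proof -
      have "1 + e * s > 0" "1 + e * t > 0" using e that by (auto intro: add_pos_nonneg)
      then show ?thesis using that by (simp add: h_def divide_simps algebra_simps)
    qed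
    \<comment> \<open>The factor \<open>|x|^(-1)\<close> in the weight is chosen to cancel here,
      leaving a pure power of the monotone function \<open>h\<close>.\<close>
    have wt2: "(x \<bullet> x) * (?wt x)\<^sup>2 = h ((x \<bullet> x) powr (1/4)) ^ (4 * m)" if "x \<noteq> 0" for x
    proof -
      have "(x \<bullet> x) powr (-1/2) * (x \<bullet> x) powr (-1/2) = (x \<bullet> x) powr (-1)" by (simp add: powr_add[symmetric])
      then have "(x \<bullet> x) * ((x \<bullet> x) powr (-1/2))\<^sup>2 = 1" using that by (simp add: power2_eq_square powr_minus)
      then show ?thesis
        by (simp add: outer_wt_def[OF m e(1)] sat_def[OF m e(1)] sat_q_def[OF m e(1)] h_def power_mult_distrib power_mult[symmetric] mult.assoc[symmetric])
    qed
    have main: "(\<integral>x. indicator S x * (slope m e x * (k\<^sup>2 * (x \<bullet> x)) * (?wt x * w x)\<^sup>2) \<partial>lborel)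
     \<le> (\<integral>x. (?wt x * ((x \<bullet> x) * E x))\<^sup>2 \<partial>lborel)"
      unfolding E_def
      by (rule rellich_weighted[OF w R RR(1,2) eq bd gs g_in g_out m e(1) ek So]) (use RR in \<open>auto simp: S_def\<close>)
    have low: "k\<^sup>2 / (1 + tr) * h t3 ^ (4 * m) * I \<le> (\<integral>x. indicator S x * (slope m e x * (k\<^sup>2 * (x \<bullet> x)) * (?wt x * w x)\<^sup>2) \<partial>lborel)"
    proof -
      have pt: "k\<^sup>2 / (1 + tr) * h t3 ^ (4 * m) * (indicator S x * (w x)\<^sup>2) \<le> indicator S x * (slope m e x * (k\<^sup>2 * (x \<bullet> x)) * (?wt x * w x)\<^sup>2)" for x
      proof (cases "x \<in> S")
        case True
        then have nx: "R3 < norm x" "norm x < rho" by (auto simp: S_def)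
        then have x: "x \<noteq> 0" using RR R by auto
        have s: "R3\<^sup>2 \<le> x \<bullet> x" "x \<bullet> x \<le> rho\<^sup>2" unfolding power2_norm_eq_inner[symmetric] using nx RR R by (auto intro!: power_mono)
        have t: "t3 \<le> (x \<bullet> x) powr (1/4)" "(x \<bullet> x) powr (1/4) \<le> tr" unfolding t3_def tr_def using s by (auto intro!: powr_mono2)
        have "h t3 ^ (4 * m) \<le> h ((x \<bullet> x) powr (1/4)) ^ (4 * m)"
          using hmono[of t3] t tt e by (intro power_mono) (auto simp: h_def)
        then have a: "h t3 ^ (4 * m) \<le> (x \<bullet> x) * (?wt x)\<^sup>2" unfolding wt2[OF x] .
        have b: "1 / (1 + tr) \<le> slope m e x"
        proof -
          have "e * (x \<bullet> x) powr (1/4) \<le> 1 * tr" using e t by (intro mult_mono) auto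
          then have "1 / (1 + tr) \<le> 1 / (1 + sat_q e x)" using sat_q_nonneg[OF m e(1), of x]
            by (intro divide_left_mono) (auto simp: sat_q_def[OF m e(1)] intro: add_pos_nonneg)
          also have "\<dots> \<le> real m / (1 + sat_q e x)" using m sat_q_nonneg[OF m e(1), of x] by (intro divide_right_mono) auto
          finally show ?thesis by (simp add: slope_def[OF m e(1)])
        qed
        have "1 / (1 + tr) * h t3 ^ (4 * m) \<le> slope m e x * ((x \<bullet> x) * (?wt x)\<^sup>2)"
        proof (rule mult_mono[OF b a])
          show "0 \<le> slope m e x" using b tt by (meson divide_nonneg_pos add_pos_pos less_imp_le order_trans zero_le_one zero_less_one)
          show "0 \<le> h t3 ^ (4 * m)" using tt e by (simp add: h_def)
        qed
        then have "(k\<^sup>2 * (w x)\<^sup>2) * (1 / (1 + tr) * h t3 ^ (4 * m)) \<le> (k\<^sup>2 * (w x)\<^sup>2) * (slope m e x * ((x \<bullet> x) * (?wt x)\<^sup>2))"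
          by (rule mult_left_mono) simp
        then show ?thesis using True by (simp add: power_mult_distrib mult_ac)
      qed simp
      have ti: "integrable lborel (\<lambda>x. indicator S x * (slope m e x * (k\<^sup>2 * (x \<bullet> x)) * (?wt x * w x)\<^sup>2))"
      proof -
        have sl: "continuous_on (-{0}) (slope m e :: real^'n \<Rightarrow> real)" "continuous_on (-{0}) ?wt"
          using smooth_inD(3) radialD[OF slope_radial[OF m e(1)]] radialD[OF outer_wt_radial[OF m e(1)]] by blast+
        have "compact (cball (0::real^'n) rho \<inter> - ball 0 R3)"
          by (intro compact_Int_closed compact_cball closed_Compl open_ball)
        then have "integrable lborel (\<lambda>x. indicator (cball 0 rho \<inter> - ball 0 R3) x *\<^sub>R (slope m e x * (k\<^sup>2 * (x \<bullet> x)) * (?wt x * w x)\<^sup>2))"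
        proof (rule borel_integrable_compact)
          have "cball 0 rho \<inter> - ball 0 R3 \<subseteq> - {0::real^'n}" using RR R by auto
          then show "continuous_on (cball 0 rho \<inter> - ball 0 R3) (\<lambda>x. slope m e x * (k\<^sup>2 * (x \<bullet> x)) * (?wt x * w x)\<^sup>2)"
            by (intro continuous_intros continuous_on_subset[OF sl(1)] continuous_on_subset[OF sl(2)] continuous_on_subset[OF wc]) auto
        qed
        from integrable_mult_indicator[OF _ this, of S]
        have "integrable lborel (\<lambda>x. indicator S x *\<^sub>R (indicator (cball 0 rho \<inter> - ball 0 R3) x *\<^sub>R (slope m e x * (k\<^sup>2 * (x \<bullet> x)) * (?wt x * w x)\<^sup>2)))"
          using So by simp
        moreover have "(\<lambda>x. indicator S x *\<^sub>R (indicator (cball 0 rho \<inter> - ball 0 R3) x *\<^sub>R f x)) = (\<lambda>x. indicator S x * f x)" for f :: "real^'n \<Rightarrow> real"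
          by (intro ext) (auto simp: S_def indicator_def)
        ultimately show ?thesis by simp
      qed
      have "k\<^sup>2 / (1 + tr) * h t3 ^ (4 * m) * I = (\<integral>x. k\<^sup>2 / (1 + tr) * h t3 ^ (4 * m) * (indicator S x * (w x)\<^sup>2) \<partial>lborel)"
        by (simp add: I_def)
      also have "\<dots> \<le> (\<integral>x. indicator S x * (slope m e x * (k\<^sup>2 * (x \<bullet> x)) * (?wt x * w x)\<^sup>2) \<partial>lborel)"
        by (rule Bochner_Integration.integral_mono[OF integrable_mult_right[OF Swi] ti pt])
      finally show ?thesis .
    qed
    have up: "(\<integral>x. (?wt x * ((x \<bullet> x) * E x))\<^sup>2 \<partial>lborel) \<le> R2\<^sup>2 * h t2 ^ (4 * m) * J"
    proof -
      have pt: "(?wt x * ((x \<bullet> x) * E x))\<^sup>2 \<le> R2\<^sup>2 * h t2 ^ (4 * m) * (E x)\<^sup>2" for x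
      proof (cases "R1 \<le> norm x \<and> norm x \<le> R2")
        case True
        then have x: "x \<noteq> 0" using R1p by auto
        have s: "x \<bullet> x \<le> R2\<^sup>2" unfolding power2_norm_eq_inner[symmetric] using True by (auto intro!: power_mono)
        have "(x \<bullet> x) powr (1/4) \<le> t2" unfolding t2_def using s by (intro powr_mono2) auto
        then have "h ((x \<bullet> x) powr (1/4)) ^ (4 * m) \<le> h t2 ^ (4 * m)"
          using hmono[of "(x \<bullet> x) powr (1/4)" t2] e by (intro power_mono) (auto simp: h_def)
        then have "(x \<bullet> x) * ((x \<bullet> x) * (?wt x)\<^sup>2) \<le> R2\<^sup>2 * h t2 ^ (4 * m)" unfolding wt2[OF x]
          using s e by (intro mult_mono) (auto simp: h_def)
        from mult_right_mono[OF this, of "(E x)\<^sup>2"] show ?thesis by (simp add: power2_eq_square mult_ac)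
      next
        case False then show ?thesis using euler0[of x] by auto
      qed
      show ?thesis
      proof (cases "integrable lborel (\<lambda>x. (?wt x * ((x \<bullet> x) * E x))\<^sup>2)")
        case True
        then have "(\<integral>x. (?wt x * ((x \<bullet> x) * E x))\<^sup>2 \<partial>lborel) \<le> (\<integral>x. R2\<^sup>2 * h t2 ^ (4 * m) * (E x)\<^sup>2 \<partial>lborel)"
          by (intro Bochner_Integration.integral_mono integrable_mult_right Ei pt)
        then show ?thesis by (simp add: J_def)
      next
        \<comment> \<open>The integral then has the default value 0, so the estimate holds without
          proving integrability.\<close>
        case False
        moreover have "R2\<^sup>2 * h t2 ^ (4 * m) * J \<ge> 0" using tt e unfolding J_def h_def by simp
        ultimately show ?thesis by (simp add: not_integrable_integral_eq)
      qed
    qed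
    have ratio: "(h t2 / h t3) ^ (4 * m) \<le> (t2 / t3) ^ (2 * m)"
    proof -
      have p: "1 + e * t3 > 0" "1 + e * t2 \<ge> 1" using tt e by (auto intro: add_pos_pos)
      have "1 + e * t3 \<le> sqrt (t3 / t2)"
      proof -
        have "e * t3 \<le> e0 * t3" using e tt by simp
        then show ?thesis using tt by (simp add: e0_def)
      qed
      then have "(1 + e * t3) / (1 + e * t2) \<le> sqrt (t3 / t2)" using p frac_le[of "sqrt (t3 / t2)" "1 + e * t3" 1 "1 + e * t2"] tt by (simp add: less_imp_le)
      then have "(t2 / t3) * ((1 + e * t3) / (1 + e * t2)) \<le> (t2 / t3) * sqrt (t3 / t2)" using tt by (intro mult_left_mono) auto
      also have "\<dots> = sqrt (t2 / t3)"
      proof -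
        have "t2 / t3 = sqrt (t2 / t3) * sqrt (t2 / t3)" using tt by simp
        then have "(t2 / t3) * sqrt (t3 / t2) = sqrt (t2 / t3) * (sqrt (t2 / t3) * sqrt (t3 / t2))" by (metis mult.assoc)
        also have "sqrt (t2 / t3) * sqrt (t3 / t2) = 1" using tt by (simp add: real_sqrt_mult[symmetric])
        finally show ?thesis by simp
      qed
      finally have "h t2 / h t3 \<le> sqrt (t2 / t3)" by (simp add: h_def mult_ac)
      then have "(h t2 / h t3) ^ (4 * m) \<le> sqrt (t2 / t3) ^ (4 * m)" using tt p by (intro power_mono) (auto simp: h_def)
      also have "\<dots> = ((sqrt (t2 / t3))\<^sup>2) ^ (2 * m)" by (simp add: power_mult[symmetric])
      finally show ?thesis using tt by simp
    qed
    have h3: "h t3 > 0" using tt e by (simp add: h_def add_pos_pos)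
    have "k\<^sup>2 / (1 + tr) * h t3 ^ (4 * m) * I \<le> R2\<^sup>2 * h t2 ^ (4 * m) * J" using low main up by linarith
    then have "I \<le> R2\<^sup>2 * h t2 ^ (4 * m) * J / (k\<^sup>2 / (1 + tr) * h t3 ^ (4 * m))"
      using h3 k tt by (subst pos_le_divide_eq) (auto simp: mult_ac add_pos_pos)
    also have "\<dots> = K * (h t2 / h t3) ^ (4 * m)" by (simp add: K_def power_divide)
    also have "\<dots> \<le> K * (t2 / t3) ^ (2 * m)"
      by (rule mult_left_mono[OF ratio]) (use tt in \<open>simp add: K_def J_def\<close>)
    finally show ?thesis .
  qed
  have "(\<lambda>m. K * (t2 / t3) ^ (2 * m)) \<longlonglongrightarrow> K * 0"
  proof (intro tendsto_mult tendsto_const)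
    have "(t2 / t3)\<^sup>2 < 1\<^sup>2" using tt by (intro power_strict_mono) auto
    then have "(\<lambda>m. ((t2 / t3)\<^sup>2) ^ m) \<longlonglongrightarrow> 0" by (intro LIMSEQ_realpow_zero) auto
    then show "(\<lambda>m. (t2 / t3) ^ (2 * m)) \<longlonglongrightarrow> 0" by (simp add: power_mult)
  qed
  moreover have "eventually (\<lambda>m. I \<le> K * (t2 / t3) ^ (2 * m)) sequentially"
    by (rule eventually_sequentiallyI[of 1]) (rule bound)
  ultimately have I0: "I \<le> 0" using tendsto_lowerbound[of _ 0 sequentially I] by simp
  have "(w x0)\<^sup>2 = 0"
  proof (rule continuous_nonneg_integral_le_0[OF So _ _ Swi])
    show "continuous_on UNIV (\<lambda>x. (w x)\<^sup>2)" by (intro continuous_intros wc)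
    show "(\<integral>x. indicator S x * (w x)\<^sup>2 \<partial>lborel) \<le> 0" using I0 by (simp add: I_def)
    show "x0 \<in> S" using RR by (simp add: S_def)
  qed simp
  then show ?thesis by simp
qed

lemma conv_norm_bound:
  fixes w :: "real^'n \<Rightarrow> 'b::euclidean_space"
  assumes w: "continuous_on UNIV w" and \<eta>: "test_function \<eta>" "\<And>x. norm x > d \<Longrightarrow> \<eta> x = 0"
    and bd: "\<And>y. dist y x \<le> d \<Longrightarrow> norm (w y) \<le> B"
  shows "norm (conv w \<eta> x) \<le> (\<integral>y. \<bar>\<eta> y\<bar> \<partial>lborel) * B"
proof -
  have c: "continuous_on UNIV (\<lambda>y. \<bar>\<eta> y\<bar>)" by (intro continuous_intros test_functionD(3)[OF \<eta>(1)])
  have i0: "integrable lborel (\<lambda>y. \<bar>\<eta> y\<bar>)" by (rule integrable_cont_supp[OF c, of d]) (use \<eta>(2) in simp)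
  have lb: "lborel = distr lborel borel (\<lambda>y. x - y :: real^'n)"
    using lborel_affine[of "-1" x] by (simp add: density_1)
  have i1: "integrable lborel (\<lambda>y. \<bar>\<eta> (x - y)\<bar>)"
    using conv_integrable[of "\<lambda>y. 1::real" \<eta> x] \<eta>(1) by (auto dest: integrable_abs)
  have e: "(\<integral>y. \<bar>\<eta> (x - y)\<bar> \<partial>lborel) = (\<integral>y. \<bar>\<eta> y\<bar> \<partial>lborel)"
  proof -
    have "(\<integral>y. \<bar>\<eta> y\<bar> \<partial>lborel) = (\<integral>y. \<bar>\<eta> y\<bar> \<partial>(distr lborel borel (\<lambda>y. x - y)))" using lb by simp
    also have "\<dots> = (\<integral>y. \<bar>\<eta> (x - y)\<bar> \<partial>lborel)" by (rule integral_distr) (use i0 in auto)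
    finally show ?thesis by simp
  qed
  have "norm (conv w \<eta> x) \<le> (\<integral>y. \<bar>\<eta> (x - y)\<bar> * B \<partial>lborel)"
    unfolding conv_def
  proof (rule Bochner_Integration.integral_norm_bound_integral[OF conv_integrable[OF w \<eta>(1)]])
    show "integrable lborel (\<lambda>y. \<bar>\<eta> (x - y)\<bar> * B)" using i1 by simp
    show "norm (\<eta> (x - y) *\<^sub>R w y) \<le> \<bar>\<eta> (x - y)\<bar> * B" for y
      using bd[of y] \<eta>(2)[of "x - y"] by (cases "dist y x \<le> d") (auto simp: dist_norm norm_minus_commute intro: mult_left_mono)
  qed
  also have "\<dots> = (\<integral>y. \<bar>\<eta> y\<bar> \<partial>lborel) * B" using e by simp
  finally show ?thesis .
qed

text \<open>Mollifying at a fixed scale turns decay of \<open>w\<close> into decay of its gradient.\<close>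

theorem rellich:
  fixes w :: "real^'n \<Rightarrow> complex"
  assumes w: "continuous_on UNIV w" and sol: "dsol (of_real (k\<^sup>2)) {x. norm x > R} w" and R: "0 < R" and k: "k \<noteq> 0"
    and bd: "\<And>x. norm x > R \<Longrightarrow> cmod (w x) \<le> C * norm x powr (- real CARD('n) / 2)"
    and x: "norm x > R"
  shows "w x = 0"
proof -
  let ?p = "- real CARD('n) / 2"
  have C0: "C \<ge> 0"
  proof -
    have "0 \<le> C * norm x powr ?p" using bd[OF x] norm_ge_zero[of "w x"] by linarith
    moreover have "norm x > 0" using x R by linarith
    then have "norm x powr ?p > 0" by simp
    ultimately show ?thesis by (simp add: zero_le_mult_iff)
  qed
  have "norm (w x) \<le> e" if e: "e > 0" for e
  proof -
    have "isCont w x" using w by (simp add: continuous_on_eq_continuous_at)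
    then obtain d where d: "d > 0" "\<And>y. dist y x < d \<Longrightarrow> dist (w y) (w x) < e"
      using e by (metis continuous_at_eps_delta)
    define s where "s = min (d/2) ((norm x - R)/2)"
    have s: "s > 0" "s < d" "norm x > R + s"
    proof -
      have "s \<le> (norm x - R)/2" unfolding s_def by (rule min.cobounded2)
      then show "norm x > R + s" using x by argo
      show "s > 0" "s < d" using d x by (auto simp: s_def)
    qed
    obtain \<eta> :: "real^'n \<Rightarrow> real" where \<eta>: "test_function \<eta>" "\<And>x. \<eta> x \<ge> 0" "\<And>x. norm x > s \<Longrightarrow> \<eta> x = 0" "(\<integral>x. \<eta> x \<partial>lborel) = 1"
      using mollifier_exists[OF s(1)] by metis
    define v where "v = conv w \<eta>"
    have vs: "smooth_in UNIV v" unfolding v_def by (rule smooth_conv[OF w \<eta>(1)])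
    define T where "T = R + s"
    have T: "0 < T" "T > R" using R s by (auto simp: T_def)
    \<comment> \<open>For \<open>norm y > T = R + s\<close>, points within \<open>s\<close> of
      \<open>y\<close> have norm at least \<open>(R/T) norm y\<close>, so the negative power there
      is at most a constant times that at \<open>y\<close>. Stated for an arbitrary kernel, this
      serves \<open>\<eta>\<close> and its partial derivatives alike.\<close>
    have decay: "\<exists>K\<ge>0. \<forall>y. norm y > T \<longrightarrow> norm (conv w \<theta> y) \<le> K * norm y powr ?p"
      if \<theta>: "test_function \<theta>" "\<And>x. norm x > s \<Longrightarrow> \<theta> x = 0" for \<theta>
    proof (intro exI conjI allI impI)
      let ?K = "(\<integral>y. \<bar>\<theta> y\<bar> \<partial>lborel) * (C * (R / T) powr ?p)"
      have "(\<integral>y. \<bar>\<theta> y\<bar> \<partial>lborel) \<ge> 0" by (rule Bochner_Integration.integral_nonneg) simp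
      then show "?K \<ge> 0" using C0 by simp
      fix y :: "real^'n" assume y: "norm y > T"
      have "norm (conv w \<theta> y) \<le> (\<integral>y. \<bar>\<theta> y\<bar> \<partial>lborel) * (C * (R / T * norm y) powr ?p)"
      proof (rule conv_norm_bound[OF w \<theta>])
        fix z assume z: "dist z y \<le> s"
        have nz: "norm z \<ge> norm y - s" using z norm_triangle_ineq2[of y z] by (simp add: dist_norm norm_minus_commute)
        have "R / T * norm y \<le> norm y - s"
        proof -
          have "R * norm y = T * norm y - s * norm y" by (simp add: T_def algebra_simps)
          also have "\<dots> \<le> T * norm y - s * T" using y s by simp
          finally have "R * norm y \<le> T * (norm y - s)" by (simp add: algebra_simps)
          then show ?thesis using T by (simp add: field_simps)
        qed
        then have le: "R / T * norm y \<le> norm z" using nz by linarith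
        have pos: "0 < R / T * norm y" using R T y by (intro mult_pos_pos) auto
        have zR: "norm z > R" using nz y by (simp add: T_def)
        have "cmod (w z) \<le> C * norm z powr ?p" by (rule bd[OF zR])
        also have "\<dots> \<le> C * (R / T * norm y) powr ?p"
          using le pos C0 by (intro mult_left_mono powr_mono2') auto
        finally show "norm (w z) \<le> C * (R / T * norm y) powr ?p" .
      qed
      also have "(R / T * norm y) powr ?p = (R / T) powr ?p * norm y powr ?p"
        by (rule powr_mult)
      finally show "norm (conv w \<theta> y) \<le> ?K * norm y powr ?p" by (simp add: mult_ac)
    qed
    have zpd: "pd \<eta> i y = 0" if "norm y > s" for i y by (rule pd_zero_outside[of s]) (use \<eta>(3) that in auto)
    obtain K0 where K0: "K0 \<ge> 0" "\<And>y. norm y > T \<Longrightarrow> norm (v y) \<le> K0 * norm y powr ?p"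
      using decay[OF \<eta>(1,3)] unfolding v_def by blast
    have "\<forall>i. \<exists>K\<ge>0. \<forall>y. norm y > T \<longrightarrow> norm (pd v i y) \<le> K * norm y powr ?p"
      using decay[OF test_function_pd[OF \<eta>(1)] zpd] unfolding v_def pd_conv[OF w \<eta>(1)] by blast
    then obtain Kf where Kf: "\<And>i. Kf i \<ge> 0" "\<And>i y. norm y > T \<Longrightarrow> norm (pd v i y) \<le> Kf i * norm y powr ?p" by metis
    define K where "K = K0 + (\<Sum>i\<in>UNIV. Kf i)"
    have KK: "K0 \<le> K" "Kf i \<le> K" for i
      using K0(1) Kf(1) member_le_sum[of i UNIV Kf] sum_nonneg[of UNIV Kf] by (auto simp: K_def add_increasing)
    have vb: "norm (v y) \<le> K * norm y powr ?p" "norm (pd v i y) \<le> K * norm y powr ?p" if "norm y > T" for y i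
      using K0(2)[OF that] Kf(2)[OF that, of i] KK mult_right_mono[of _ K "norm y powr ?p"] by (meson order_trans powr_ge_zero)+
    have veq: "lap v y + of_real (k\<^sup>2) * v y = 0" if "norm y > T" for y
    proof -
      have "cball y s \<subseteq> {x. norm x > R}"
      proof
        fix z assume "z \<in> cball y s"
        then have "norm z \<ge> norm y - s" using norm_triangle_ineq2[of y z] by (simp add: dist_norm)
        then show "z \<in> {x. norm x > R}" using that by (simp add: T_def)
      qed
      then show ?thesis unfolding v_def using dsol_conv[OF sol w \<eta>(1,3)] by blast
    qed
    have re: "Re (v x) = 0"
    proof (rule rellich_smooth_real[OF smooth_Re_Im(1)[OF open_UNIV vs] T(1) k])
      show "lap (\<lambda>x. Re (v x)) y + k\<^sup>2 * Re (v y) = 0" if "norm y > T" for y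
        using arg_cong[OF veq[OF that], of Re] by (simp add: lap_Re_Im(1)[OF vs])
      show "\<bar>Re (v y)\<bar> \<le> K * norm y powr ?p" if "norm y > T" for y
        using vb(1)[OF that] abs_Re_le_cmod[of "v y"] by linarith
      show "\<bar>pd (\<lambda>x. Re (v x)) i y\<bar> \<le> K * norm y powr ?p" if "norm y > T" for y i
        using vb(2)[OF that, of i] abs_Re_le_cmod[of "pd v i y"] pd_Re[OF smooth_inD(1)[OF vs], of y i] by simp
    qed (use s in \<open>simp add: T_def\<close>)
    have im: "Im (v x) = 0"
    proof (rule rellich_smooth_real[OF smooth_Re_Im(2)[OF open_UNIV vs] T(1) k])
      show "lap (\<lambda>x. Im (v x)) y + k\<^sup>2 * Im (v y) = 0" if "norm y > T" for y
        using arg_cong[OF veq[OF that], of Im] by (simp add: lap_Re_Im(2)[OF vs])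
      show "\<bar>Im (v y)\<bar> \<le> K * norm y powr ?p" if "norm y > T" for y
        using vb(1)[OF that] abs_Im_le_cmod[of "v y"] by linarith
      show "\<bar>pd (\<lambda>x. Im (v x)) i y\<bar> \<le> K * norm y powr ?p" if "norm y > T" for y i
        using vb(2)[OF that, of i] abs_Im_le_cmod[of "pd v i y"] pd_Im[OF smooth_inD(1)[OF vs], of y i] by simp
    qed (use s in \<open>simp add: T_def\<close>)
    have "conv w \<eta> x = 0" using re im by (simp add: v_def complex_eq_iff)
    moreover have "norm (conv w \<eta> x - w x) \<le> e"
    proof (rule conv_approx[OF w \<eta>(1,2,3,4)])
      show "norm (w y - w x) \<le> e" if "dist y x \<le> s" for y
        using d(2)[of y] that s(2) by (simp add: dist_norm)
    qed
    ultimately show ?thesis by simp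
  qed
  then have "norm (w x) \<le> 0" by (rule field_le_epsilon[of _ 0, simplified])
  then show ?thesis by simp
qed

subsection \<open>Corners\<close>

lemma nn_integral_translate:
  fixes f :: "real^'n \<Rightarrow> ennreal"
  assumes [measurable]: "f \<in> borel_measurable borel"
  shows "(\<integral>\<^sup>+x. f (x + c) \<partial>lborel) = (\<integral>\<^sup>+x. f x \<partial>lborel)"
proof -
  have "(\<integral>\<^sup>+x. f x \<partial>lborel) = (\<integral>\<^sup>+x. f x \<partial>(distr lborel borel ((+) c)))" by (simp add: lborel_distr_plus)
  also have "\<dots> = (\<integral>\<^sup>+x. f (c + x) \<partial>lborel)" by (rule nn_integral_distr) auto
  finally show ?thesis by (simp add: add.commute)
qed

lemma nn_integral_reflect:
  fixes f :: "real^'n \<Rightarrow> ennreal"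
  assumes [measurable]: "f \<in> borel_measurable borel"
  shows "(\<integral>\<^sup>+x. f (c - x) \<partial>lborel) = (\<integral>\<^sup>+x. f x \<partial>lborel)"
proof -
  have lb: "lborel = distr lborel borel (\<lambda>y. c - y :: real^'n)"
    using lborel_affine[of "-1" c] by (simp add: density_1)
  have "(\<integral>\<^sup>+x. f x \<partial>lborel) = (\<integral>\<^sup>+x. f x \<partial>(distr lborel borel (\<lambda>y. c - y)))" using lb by simp
  also have "\<dots> = (\<integral>\<^sup>+x. f (c - x) \<partial>lborel)" by (rule nn_integral_distr) auto
  finally show ?thesis by simp
qed

text \<open>Uniqueness of translation invariant measures, by Fubini's theorem: for a linear bijection
  \<open>M\<close>, integrating \<open>f (x + M z) g (M z)\<close> in both orders gives
  \<open>\<integral> f \<cdot> \<integral> g \<circ> M = \<integral> f \<circ> M \<cdot> \<integral> g\<close> for even \<open>g\<close>.\<close>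

lemma linear_invariance_nn:
  fixes M :: "real^'n \<Rightarrow> real^'n" and f g :: "real^'n \<Rightarrow> ennreal"
  assumes M: "linear M" "surj M" and f[measurable]: "f \<in> borel_measurable borel"
    and g[measurable]: "g \<in> borel_measurable borel"
  shows "(\<integral>\<^sup>+x. f x \<partial>lborel) * (\<integral>\<^sup>+z. g (M z) \<partial>lborel) = (\<integral>\<^sup>+z. f (M z) \<partial>lborel) * (\<integral>\<^sup>+x. g x \<partial>lborel)"
proof -
  have [measurable]: "M \<in> borel_measurable borel"
    using linear_continuous_on[OF linear_conv_bounded_linear[THEN iffD1, OF M(1)]] by (rule borel_measurable_continuous_onI)
  have "(\<integral>\<^sup>+x. f x \<partial>lborel) * (\<integral>\<^sup>+z. g (M z) \<partial>lborel) = (\<integral>\<^sup>+z. g (M z) * (\<integral>\<^sup>+x. f x \<partial>lborel) \<partial>lborel)"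
    by (subst nn_integral_multc) (auto simp: mult.commute)
  also have "\<dots> = (\<integral>\<^sup>+z. (\<integral>\<^sup>+x. g (M z) * f (x + M z) \<partial>lborel) \<partial>lborel)"
    by (subst nn_integral_cmult) (auto simp: nn_integral_translate)
  also have "\<dots> = (\<integral>\<^sup>+x. (\<integral>\<^sup>+z. g (M z) * f (x + M z) \<partial>lborel) \<partial>lborel)"
    by (rule lborel_pair.Fubini'[where f = "\<lambda>x z. g (M z) * f (x + M z)"]) measurable
  also have "\<dots> = (\<integral>\<^sup>+x. (\<integral>\<^sup>+z. g (M z - x) * f (M z) \<partial>lborel) \<partial>lborel)"
  proof (rule nn_integral_cong)
    fix x
    obtain y where y: "M y = x" using M(2) by (metis surjD)
    have "(\<integral>\<^sup>+z. g (M z - x) * f (M z) \<partial>lborel) = (\<integral>\<^sup>+z. g (M (z + y) - x) * f (M (z + y)) \<partial>lborel)"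
      by (rule nn_integral_translate[symmetric]) measurable
    also have "\<dots> = (\<integral>\<^sup>+z. g (M z) * f (x + M z) \<partial>lborel)"
      unfolding linear_add[OF M(1)] y by (simp add: add.commute)
    finally show "(\<integral>\<^sup>+z. g (M z) * f (x + M z) \<partial>lborel) = (\<integral>\<^sup>+z. g (M z - x) * f (M z) \<partial>lborel)" by simp
  qed
  also have "\<dots> = (\<integral>\<^sup>+z. (\<integral>\<^sup>+x. g (M z - x) * f (M z) \<partial>lborel) \<partial>lborel)"
    by (rule lborel_pair.Fubini'[symmetric, where f = "\<lambda>x z. g (M z - x) * f (M z)"]) measurable
  also have "\<dots> = (\<integral>\<^sup>+z. (\<integral>\<^sup>+x. g x \<partial>lborel) * f (M z) \<partial>lborel)"
    by (subst nn_integral_multc) (auto simp: nn_integral_reflect)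
  also have "\<dots> = (\<integral>\<^sup>+z. f (M z) \<partial>lborel) * (\<integral>\<^sup>+x. g x \<partial>lborel)"
    by (subst nn_integral_cmult) (auto simp: mult.commute)
  finally show ?thesis .
qed

text \<open>Taking for \<open>g\<close> the indicator of the unit ball in
  \<open>linear_invariance_nn\<close> makes the measures of \<open>A\<close> and of its preimage
  proportional. The factor is positive and finite because the preimage of the ball is a bounded
  neighbourhood of 0. Identifying it with a determinant is avoided: the corner argument only
  transports vanishing integrals.\<close>

lemma lborel_linear_image:
  fixes M :: "real^'n \<Rightarrow> real^'n"
  assumes M: "linear M" "inj M"
  obtains c where "c > 0" "distr lborel borel M = density lborel (\<lambda>_. ennreal c)"
proof -
  have surj: "surj M" using linear_inj_imp_surj[OF M] .
  have cM: "continuous_on UNIV M"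
    using linear_continuous_on[OF linear_conv_bounded_linear[THEN iffD1, OF M(1)]] .
  have mM[measurable]: "M \<in> borel_measurable borel" using cM by (rule borel_measurable_continuous_onI)
  define B where "B = M -` ball 0 1"
  have Bo: "open B" unfolding B_def using cM by (rule open_vimage[OF open_ball])
  have "0 \<in> B" using linear_0[OF M(1)] by (simp add: B_def)
  then have Bp: "emeasure lborel B \<noteq> 0"
  proof -
    obtain e where e: "e > 0" "ball 0 e \<subseteq> B" using Bo \<open>0 \<in> B\<close> open_contains_ball by blast
    have "emeasure lborel (ball (0::real^'n) e) \<le> emeasure lborel B" using Bo e(2) by (intro emeasure_mono) auto
    moreover have "emeasure lborel (ball (0::real^'n) e) \<noteq> 0"
      using content_ball_pos[OF e(1), of "0::real^'n"] by (auto simp: measure_def)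
    ultimately show ?thesis by auto
  qed
  have Bf: "emeasure lborel B < \<infinity>"
  proof -
    obtain b where b: "b > 0" "\<And>x. b * norm x \<le> norm (M x)" using linear_inj_bounded_below_pos[OF M] by metis
    have "B \<subseteq> cball 0 (1 / b)"
    proof
      fix x assume "x \<in> B"
      then have "b * norm x \<le> 1" using b(2)[of x] by (simp add: B_def)
      then show "x \<in> cball 0 (1/b)" using b(1) by (simp add: field_simps)
    qed
    then have "emeasure lborel B \<le> emeasure lborel (cball (0::real^'n) (1/b))" by (intro emeasure_mono) auto
    also have "\<dots> < \<infinity>" by (rule emeasure_lborel_cball_finite)
    finally show ?thesis .
  qed
  define m where "m = measure lborel (ball (0::real^'n) 1)"
  have mp: "m > 0" unfolding m_def using content_ball_pos[of 1 "0::real^'n"] by simp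
  have em: "emeasure lborel (ball (0::real^'n) 1) = ennreal m"
    unfolding m_def using emeasure_eq_ennreal_measure emeasure_lborel_ball_finite by (metis less_irrefl infinity_ennreal_def)
  define b where "b = measure lborel B"
  have eb: "emeasure lborel B = ennreal b" unfolding b_def using Bf by (intro emeasure_eq_ennreal_measure) auto
  have bp: "b > 0" using Bp eb by (metis ennreal_eq_0_iff not_le)
  have key: "emeasure lborel A * ennreal b = emeasure lborel (M -` A) * ennreal m" if A[measurable]: "A \<in> sets borel" for A
  proof -
    have v: "(\<integral>\<^sup>+z. indicator C (M z) \<partial>lborel) = emeasure lborel (M -` C)" if [measurable]: "C \<in> sets borel" for C
    proof -
      have "M -` C \<in> sets lborel" using measurable_sets[OF mM that] by simp
      then have "emeasure lborel (M -` C) = (\<integral>\<^sup>+z. indicator (M -` C) z \<partial>lborel)" by simp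
      then show ?thesis by (simp add: indicator_def vimage_def)
    qed
    have "(\<integral>\<^sup>+x. indicator A x \<partial>lborel) * (\<integral>\<^sup>+z. indicator (ball 0 1) (M z) \<partial>lborel)
       = (\<integral>\<^sup>+z. indicator A (M z) \<partial>lborel) * (\<integral>\<^sup>+x. indicator (ball (0::real^'n) 1) x \<partial>lborel)"
      by (rule linear_invariance_nn[OF M(1) surj]) (use A in \<open>auto intro!: borel_measurable_indicator borel_open\<close>)
    then show ?thesis using v[OF A] v[of "ball 0 1"] by (simp add: B_def[symmetric] eb em)
  qed
  show ?thesis
  proof (rule that[of "b / m"])
    show "b / m > 0" using bp mp by simp
    show "distr lborel borel M = density lborel (\<lambda>_. ennreal (b / m))"
    proof (rule measure_eqI)
      fix A assume "A \<in> sets (distr lborel borel M)"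
      then have A[measurable]: "A \<in> sets borel" by simp
      have "emeasure (distr lborel borel M) A = emeasure lborel (M -` A)" by (subst emeasure_distr) auto
      also have "\<dots> = emeasure lborel (M -` A) * ennreal m * ennreal (1 / m)"
        using mp by (simp add: mult.assoc ennreal_mult[symmetric])
      also have "\<dots> = emeasure lborel A * ennreal b * ennreal (1 / m)" using key[OF A] by simp
      also have "\<dots> = ennreal (b / m) * emeasure lborel A"
      proof -
        have "ennreal b * ennreal (1 / m) = ennreal (b / m)" using mp bp by (simp add: ennreal_mult[symmetric])
        then show ?thesis unfolding mult.assoc by (simp only: mult.commute)
      qed
      also have "\<dots> = emeasure (density lborel (\<lambda>_. ennreal (b / m))) A"
        by (subst emeasure_density) (auto simp: nn_integral_cmult_indicator)
      finally show "emeasure (distr lborel borel M) A = emeasure (density lborel (\<lambda>_. ennreal (b / m))) A" .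
    qed simp
  qed
qed

lemma integral_linear_zero:
  fixes M :: "real^'n \<Rightarrow> real^'n" and F :: "real^'n \<Rightarrow> complex"
  assumes M: "linear M" "inj M" and F: "F \<in> borel_measurable borel" and z: "(\<integral>x. F x \<partial>lborel) = 0"
  shows "(\<integral>x. F (M x) \<partial>lborel) = 0"
proof -
  obtain c where c: "c > 0" "distr lborel borel M = density lborel (\<lambda>_. ennreal c)"
    using lborel_linear_image[OF M] by metis
  have mM: "M \<in> borel_measurable borel"
    using linear_continuous_on[OF linear_conv_bounded_linear[THEN iffD1, OF M(1)]] by (rule borel_measurable_continuous_onI)
  have "(\<integral>x. F (M x) \<partial>lborel) = (\<integral>x. F x \<partial>(distr lborel borel M))"
    by (rule integral_distr[symmetric]) (use mM F in auto)
  also have "\<dots> = (\<integral>x. c *\<^sub>R F x \<partial>lborel)" unfolding c(2)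
    by (rule integral_density) (use F c in auto)
  also have "\<dots> = 0" using z by simp
  finally show ?thesis .
qed

text \<open>Bounded by a series over balls of integer radius. Half of the exponential decay absorbs
  the polynomial growth of the volumes, the other half gives a geometric series.\<close>

lemma integrable_exp_norm:
  fixes c :: real assumes c: "c > 0"
  shows "integrable lborel (\<lambda>x::real^'n. exp (- c * norm x))"
proof -
  let ?V = "unit_ball_vol (real CARD('n))"
  have V: "?V \<ge> 0" by simp
  have le: "ennreal (exp (- c * norm x)) \<le> (\<Sum>k. ennreal (exp (- c * real k)) * indicator (cball 0 (real k + 1)) x)" for x :: "real^'n"
  proof -
    define k where "k = nat \<lfloor>norm x\<rfloor>"
    have k: "real k \<le> norm x" "norm x \<le> real k + 1" unfolding k_def by (auto simp: of_nat_nat)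
    have "ennreal (exp (- c * norm x)) \<le> ennreal (exp (- c * real k)) * indicator (cball 0 (real k + 1)) x"
      using k c by (simp add: ennreal_leI)
    also have "\<dots> \<le> (\<Sum>k. ennreal (exp (- c * real k)) * indicator (cball 0 (real k + 1)) x)"
    proof -
      have "F k \<le> (\<Sum>k. F k)" for F :: "nat \<Rightarrow> ennreal" using sum_le_suminf[of F "{k}"] by simp
      then show ?thesis .
    qed
    finally show ?thesis .
  qed
  have "(\<integral>\<^sup>+x. ennreal (exp (- c * norm x)) \<partial>(lborel :: (real^'n) measure))
     \<le> (\<integral>\<^sup>+x. (\<Sum>k. ennreal (exp (- c * real k)) * indicator (cball 0 (real k + 1)) (x::real^'n)) \<partial>lborel)"
    by (rule nn_integral_mono) (rule le)
  also have "\<dots> = (\<Sum>k. (\<integral>\<^sup>+x. ennreal (exp (- c * real k)) * indicator (cball 0 (real k + 1)) (x::real^'n) \<partial>lborel))"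
  proof (rule nn_integral_suminf)
    fix k :: nat
    have [measurable]: "cball (0::real^'n) (real k + 1) \<in> sets borel" by (rule borel_closed[OF closed_cball])
    show "(\<lambda>x::real^'n. ennreal (exp (- c * real k)) * indicator (cball 0 (real k + 1)) x) \<in> borel_measurable lborel"
      by (intro borel_measurable_times_ennreal borel_measurable_const borel_measurable_indicator) simp
  qed
  also have "\<dots> = (\<Sum>k. ennreal (exp (- c * real k) * (?V * (real k + 1) ^ CARD('n))))"
  proof (rule suminf_cong)
    fix k :: nat
    have "emeasure lborel (cball (0::real^'n) (real k + 1)) = ennreal (?V * (real k + 1) ^ CARD('n))"
      using emeasure_cball[of "real k + 1" "0::real^'n"] by simp
    then show "(\<integral>\<^sup>+x. ennreal (exp (- c * real k)) * indicator (cball 0 (real k + 1)) (x::real^'n) \<partial>lborel)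
       = ennreal (exp (- c * real k) * (?V * (real k + 1) ^ CARD('n)))"
      using V by (subst nn_integral_cmult_indicator) (auto simp: ennreal_mult)
  qed
  also have "\<dots> < \<infinity>"
  proof -
    have "summable (\<lambda>k. exp (- c * real k) * (?V * (real k + 1) ^ CARD('n)))"
    proof -
      have "((\<lambda>x. x ^ CARD('n) / exp x) \<longlongrightarrow> (0::real)) at_top" by (rule tendsto_power_div_exp_0)
      moreover have "filterlim (\<lambda>k. c / 2 * (real k + 1)) at_top sequentially"
        using c by (intro filterlim_tendsto_pos_mult_at_top[OF tendsto_const] filterlim_at_top_mono[OF filterlim_real_sequentially]) auto
      ultimately have "(\<lambda>k. (c / 2 * (real k + 1)) ^ CARD('n) / exp (c / 2 * (real k + 1))) \<longlonglongrightarrow> 0" by (rule filterlim_compose)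
      then have "Bseq (\<lambda>k. (c / 2 * (real k + 1)) ^ CARD('n) / exp (c / 2 * (real k + 1)))" by (intro convergent_imp_Bseq convergentI)
      then obtain K where K: "K > 0" "\<And>k. norm ((c / 2 * (real k + 1)) ^ CARD('n) / exp (c / 2 * (real k + 1))) \<le> K" by (auto elim: BseqE)
      let ?K' = "K * ?V * exp (c / 2) / (c / 2) ^ CARD('n)"
      have "norm (exp (- c * real k) * (?V * (real k + 1) ^ CARD('n))) \<le> ?K' * exp (- c / 2) ^ k" for k
      proof -
        have "(c / 2 * (real k + 1)) ^ CARD('n) \<le> K * exp (c / 2 * (real k + 1))" using K(2)[of k] c by (simp add: field_simps)
        then have "(real k + 1) ^ CARD('n) * (c / 2) ^ CARD('n) \<le> K * exp (c / 2 * (real k + 1))"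
          unfolding power_mult_distrib by (simp only: mult.commute)
        then have "(real k + 1) ^ CARD('n) \<le> K * exp (c / 2 * (real k + 1)) / (c / 2) ^ CARD('n)"
          using c by (subst pos_le_divide_eq) auto
        then have "exp (- c * real k) * (?V * (real k + 1) ^ CARD('n)) \<le> exp (- c * real k) * (?V * (K * exp (c / 2 * (real k + 1)) / (c / 2) ^ CARD('n)))"
          using V by (intro mult_left_mono) auto
        also have "\<dots> = K * ?V / (c / 2) ^ CARD('n) * (exp (- c * real k) * exp (c / 2 * (real k + 1)))" by simp
        also have "exp (- c * real k) * exp (c / 2 * (real k + 1)) = exp (c / 2) * exp (- c / 2) ^ k"
          unfolding exp_of_nat_mult[symmetric] exp_add[symmetric] by (simp add: field_simps)
        finally show ?thesis using V c by (simp add: mult_ac)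
      qed
      moreover have "summable (\<lambda>k. ?K' * exp (- c / 2) ^ k)" using c by (intro summable_mult summable_geometric) simp
      ultimately show ?thesis by (rule summable_comparison_test'[where N = 0, rotated])
    qed
    then show ?thesis
      using V by (subst suminf_ennreal2) (auto intro!: mult_nonneg_nonneg)
  qed
  finally have "(\<integral>\<^sup>+x. ennreal (exp (- c * norm x)) \<partial>(lborel :: (real^'n) measure)) < \<infinity>" .
  then show ?thesis by (intro integrableI_bounded) auto
qed

text \<open>The translate of \<open>T\<close> by \<open>v\<close> lies in \<open>T\<close>, and its
  integral of \<open>E\<close> is a constant multiple of the integral over \<open>T\<close>, hence
  also 0. Subtracting leaves the part of \<open>T\<close> not covered by the translate. Two such
  differences shrink an infinite wedge to a thin prism.\<close>

lemma integral_translation_difference: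
  fixes E :: "real^'n \<Rightarrow> complex"
  assumes i: "integrable lborel (\<lambda>x. indicator T x *\<^sub>R E x)" and z: "(\<integral>x. indicator T x *\<^sub>R E x \<partial>lborel) = 0"
    and E: "\<And>x. E (x - v) = c * E x" "c \<noteq> 0" and T: "\<And>x. x - v \<in> T \<Longrightarrow> x \<in> T"
  shows "integrable lborel (\<lambda>x. indicator (T \<inter> {x. x - v \<notin> T}) x *\<^sub>R E x)"
    "(\<integral>x. indicator (T \<inter> {x. x - v \<notin> T}) x *\<^sub>R E x \<partial>lborel) = 0"
proof -
  have sh: "indicator T (x + - v) *\<^sub>R E (x + - v) = c * (indicator {x. x - v \<in> T} x *\<^sub>R E x)" for x
    using E(1)[of x] by (simp add: indicator_def)
  have "integrable lborel (\<lambda>x. inverse c * (c * (indicator {x. x - v \<in> T} x *\<^sub>R E x)))"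
    using integrable_translate[OF i, of "- v"] unfolding sh by (rule integrable_mult_right)
  then have i2: "integrable lborel (\<lambda>x. indicator {x. x - v \<in> T} x *\<^sub>R E x)" using E(2) by (simp add: mult.assoc[symmetric])
  have "(\<integral>x. indicator T (x + - v) *\<^sub>R E (x + - v) \<partial>lborel) = 0"
    by (rule trans[OF integral_translate[of "\<lambda>x. indicator T x *\<^sub>R E x" "- v"] z])
  then have "c * (\<integral>x. indicator {x. x - v \<in> T} x *\<^sub>R E x \<partial>lborel) = 0"
    unfolding sh integral_mult_right_zero .
  then have z2: "(\<integral>x. indicator {x. x - v \<in> T} x *\<^sub>R E x \<partial>lborel) = 0" using E(2) by simp
  have d: "indicator (T \<inter> {x. x - v \<notin> T}) x *\<^sub>R E x = indicator T x *\<^sub>R E x - indicator {x. x - v \<in> T} x *\<^sub>R E x" for x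
    using T[of x] by (auto simp: indicator_def)
  show "integrable lborel (\<lambda>x. indicator (T \<inter> {x. x - v \<notin> T}) x *\<^sub>R E x)"
    unfolding d using i i2 by (rule Bochner_Integration.integrable_diff)
  show "(\<integral>x. indicator (T \<inter> {x. x - v \<notin> T}) x *\<^sub>R E x \<partial>lborel) = 0"
    unfolding d using i i2 z z2 by simp
qed

text \<open>Testing with \<open>\<eta>(x) e\<^bsup>\<tau> \<zeta> \<cdot> x\<^esup>\<close>, \<open>\<zeta> \<cdot> \<zeta> = 0\<close>, where \<open>\<zeta>\<close> lies in the complexified span of the two normals,
  and rescaling that plane by \<open>1/\<tau>\<close>: only the source survives as \<open>\<tau> \<rightarrow> \<infinity>\<close>, because \<open>w\<close> vanishes on
  the edge.  The limit is the Laplace transform of the sector, which cannot vanish.\<close>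

lemma corner_at_origin:
  fixes w f :: "real^'n \<Rightarrow> complex" and a1 a2 :: "real^'n"
  defines "W \<equiv> {x. a1 \<bullet> x < 0 \<and> a2 \<bullet> x < 0}"
  assumes wc: "continuous_on UNIV w" and fc: "continuous_on UNIV f"
    and ind: "(a1 \<bullet> a2)\<^sup>2 < (a1 \<bullet> a1) * (a2 \<bullet> a2)" and d0: "d0 > 0"
    and off: "\<And>x. norm x < d0 \<Longrightarrow> x \<notin> W \<Longrightarrow> w x = 0"
    and eq: "\<And>\<phi> r. test_function \<phi> \<Longrightarrow> r < d0 \<Longrightarrow> (\<And>x. norm x > r \<Longrightarrow> \<phi> x = 0) \<Longrightarrow>
       (\<integral>x. lap \<phi> x *\<^sub>R w x \<partial>lborel) + l * (\<integral>x. \<phi> x *\<^sub>R w x \<partial>lborel) = (\<integral>x. \<phi> x *\<^sub>R (indicator W x *\<^sub>R f x) \<partial>lborel)"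
  shows "f 0 = 0"
proof (rule ccontr)
  assume f0: "f 0 \<noteq> 0"
  define h where "h x = indicator W x *\<^sub>R f x" for x
  have Wo: "open W" unfolding W_def by (intro open_Collect_conj open_Collect_less continuous_intros)
  \<comment> \<open>The hypothesis concerns real test functions. It extends to complex ones by
    treating real and imaginary parts separately, \<open>l\<close> being a fixed factor of the
    integrals.\<close>
  have ceq: "(\<integral>x. lap \<phi> x * w x \<partial>lborel) + l * (\<integral>x. \<phi> x * w x \<partial>lborel) = (\<integral>x. \<phi> x * h x \<partial>lborel)"
    "integrable lborel (\<lambda>x. lap \<phi> x * w x)" "integrable lborel (\<lambda>x. \<phi> x * w x)" "integrable lborel (\<lambda>x. \<phi> x * h x)"
    if sm: "smooth_in UNIV \<phi>" and r: "r < d0" "\<And>x. norm x > r \<Longrightarrow> \<phi> x = 0" for \<phi> :: "real^'n \<Rightarrow> complex" and r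
  proof -
    have lz: "lap \<phi> x = 0" if "norm x > r" for x
    proof -
      have o: "open {x::real^'n. norm x > r}" by (intro open_Collect_less continuous_intros)
      have "lap \<phi> x = lap (\<lambda>x. 0) x" by (rule lap_cong_open[OF o]) (use that r in auto)
      then show ?thesis by (simp add: lap_0)
    qed
    show "integrable lborel (\<lambda>x. lap \<phi> x * w x)"
      by (rule integrable_cont_supp[where M = r]) (auto simp: lz intro!: continuous_intros wc smooth_inD(3)[OF smooth_lap[OF open_UNIV sm]])
    show i2: "integrable lborel (\<lambda>x. \<phi> x * w x)"
      by (rule integrable_cont_supp[where M = r]) (auto simp: r intro!: continuous_intros wc smooth_inD(3)[OF sm])
    have "integrable lborel (\<lambda>x. \<phi> x * f x)"
      by (rule integrable_cont_supp[where M = r]) (auto simp: r intro!: continuous_intros fc smooth_inD(3)[OF sm])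
    from integrable_mult_indicator[OF _ this, of W] show "integrable lborel (\<lambda>x. \<phi> x * h x)"
      using Wo by (simp add: h_def)
    define fr where "fr x = Re (\<phi> x)" for x
    define fi where "fi x = Im (\<phi> x)" for x
    have s: "smooth_in UNIV fr" "smooth_in UNIV fi" unfolding fr_def fi_def by (rule smooth_Re_Im[OF open_UNIV sm])+
    have t: "test_function fr" "test_function fi"
      by (rule test_functionI[OF s(1), of r], simp add: fr_def r) (rule test_functionI[OF s(2), of r], simp add: fi_def r)
    have sup: "fr x = 0" "fi x = 0" if "norm x > r" for x using r(2)[OF that] by (auto simp: fr_def fi_def)
    have L: "lap fr x = Re (lap \<phi> x)" "lap fi x = Im (lap \<phi> x)" for x
      unfolding fr_def fi_def by (rule lap_Re_Im[OF sm])+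
    have dec: "(\<integral>x. p x * q x \<partial>lborel) = (\<integral>x. Re (p x) *\<^sub>R q x \<partial>lborel) + \<i> * (\<integral>x. Im (p x) *\<^sub>R q x \<partial>lborel)"
      if "integrable lborel (\<lambda>x. Re (p x) *\<^sub>R q x)" "integrable lborel (\<lambda>x. Im (p x) *\<^sub>R q x)" for p q :: "real^'n \<Rightarrow> complex"
    proof -
      have "(\<integral>x. Re (p x) *\<^sub>R q x + \<i> * (Im (p x) *\<^sub>R q x) \<partial>lborel) = (\<integral>x. Re (p x) *\<^sub>R q x \<partial>lborel) + \<i> * (\<integral>x. Im (p x) *\<^sub>R q x \<partial>lborel)"
        using Bochner_Integration.integral_add[OF that(1) integrable_mult_right[OF that(2), of \<i>]]
        unfolding integral_mult_right_zero .
      moreover have "Re (p x) *\<^sub>R q x + \<i> * (Im (p x) *\<^sub>R q x) = p x * q x" for x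
        by (simp add: complex_eq_iff algebra_simps)
      ultimately show ?thesis by simp
    qed
    have j1: "integrable lborel (\<lambda>x. lap g x *\<^sub>R w x)" if tg: "test_function g" for g
    proof -
      obtain M where M: "\<And>x. norm x > M \<Longrightarrow> lap g x = 0" using test_function_supp[OF test_function_lap[OF tg]] by metis
      show ?thesis by (rule integrable_cont_supp[where M = M]) (auto simp: M intro!: continuous_intros wc test_functionD(3)[OF test_function_lap[OF tg]])
    qed
    have j2: "integrable lborel (\<lambda>x. g x *\<^sub>R q x)" if tg: "test_function g" "continuous_on UNIV q" for g and q :: "real^'n \<Rightarrow> complex"
    proof -
      obtain M where M: "\<And>x. norm x > M \<Longrightarrow> g x = 0" using test_function_supp[OF tg(1)] by metis
      show ?thesis by (rule integrable_cont_supp[where M = M]) (auto simp: M intro!: continuous_intros tg(2) test_functionD(3)[OF tg(1)])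
    qed
    have j3: "integrable lborel (\<lambda>x. g x *\<^sub>R h x)" if "test_function g" for g
    proof -
      have "integrable lborel (\<lambda>x. indicator W x *\<^sub>R (g x *\<^sub>R f x))"
        by (rule integrable_mult_indicator[OF _ j2[OF that fc]]) (use Wo in simp)
      then show ?thesis by (simp add: h_def mult.commute)
    qed
    have e1: "(\<integral>x. lap fr x *\<^sub>R w x \<partial>lborel) + l * (\<integral>x. fr x *\<^sub>R w x \<partial>lborel) = (\<integral>x. fr x *\<^sub>R h x \<partial>lborel)"
      unfolding h_def by (rule eq[OF t(1) r(1)]) (rule sup)
    have e2: "(\<integral>x. lap fi x *\<^sub>R w x \<partial>lborel) + l * (\<integral>x. fi x *\<^sub>R w x \<partial>lborel) = (\<integral>x. fi x *\<^sub>R h x \<partial>lborel)"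
      unfolding h_def by (rule eq[OF t(2) r(1)]) (rule sup)
    have k1: "(\<integral>x. lap \<phi> x * w x \<partial>lborel) = (\<integral>x. lap fr x *\<^sub>R w x \<partial>lborel) + \<i> * (\<integral>x. lap fi x *\<^sub>R w x \<partial>lborel)"
      unfolding L by (rule dec) (use j1[OF t(1)] j1[OF t(2)] in \<open>simp_all add: L\<close>)
    have k2: "(\<integral>x. \<phi> x * w x \<partial>lborel) = (\<integral>x. fr x *\<^sub>R w x \<partial>lborel) + \<i> * (\<integral>x. fi x *\<^sub>R w x \<partial>lborel)"
      unfolding fr_def fi_def by (rule dec) (use j2[OF t(1) wc] j2[OF t(2) wc] in \<open>simp_all add: fr_def fi_def\<close>)
    have k3: "(\<integral>x. \<phi> x * h x \<partial>lborel) = (\<integral>x. fr x *\<^sub>R h x \<partial>lborel) + \<i> * (\<integral>x. fi x *\<^sub>R h x \<partial>lborel)"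
      unfolding fr_def fi_def by (rule dec) (use j3[OF t(1)] j3[OF t(2)] in \<open>simp_all add: fr_def fi_def\<close>)
    show "(\<integral>x. lap \<phi> x * w x \<partial>lborel) + l * (\<integral>x. \<phi> x * w x \<partial>lborel) = (\<integral>x. \<phi> x * h x \<partial>lborel)"
      unfolding k1 k2 k3 e1[symmetric] e2[symmetric] by (simp add: algebra_simps)
  qed
  define A where "A = a1 \<bullet> a1" define B where "B = a1 \<bullet> a2" define D where "D = a2 \<bullet> a2"
  define Dl where "Dl = A * D - B\<^sup>2"
  have Dl: "Dl > 0" using ind by (simp add: Dl_def A_def B_def D_def)
  have BB: "a2 \<bullet> a1 = B" by (simp add: B_def inner_commute)
  \<comment> \<open>Minus the dual basis of \<open>a1\<close>, \<open>a2\<close> in their plane,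
    from the inverse of the Gram matrix with determinant \<open>Dl\<close>. In that plane the wedge
    consists of the positive combinations of \<open>p1\<close> and \<open>p2\<close>.\<close>
  define p1 where "p1 = (- D / Dl) *\<^sub>R a1 + (B / Dl) *\<^sub>R a2"
  define p2 where "p2 = (B / Dl) *\<^sub>R a1 + (- A / Dl) *\<^sub>R a2"
  have ap: "a1 \<bullet> p1 = -1" "a2 \<bullet> p1 = 0" "a1 \<bullet> p2 = 0" "a2 \<bullet> p2 = -1"
    using Dl unfolding p1_def p2_def inner_add_right inner_scaleR_right BB A_def[symmetric] B_def[symmetric] D_def[symmetric]
    by (simp_all add: divide_simps) (simp_all add: Dl_def power2_eq_square algebra_simps)
  \<comment> \<open>\<open>Z\<close> is the linear form with the complex vector
    \<open>al + i be\<close>. \<open>be\<close> is \<open>al\<close> turned by a right angle in the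
    plane of the normals, which makes the form isotropic and \<open>exp (t Z)\<close> harmonic. In
    the wedge \<open>Re Z = a1 \<bullet> x + a2 \<bullet> x\<close> is negative, so the exponential
    decays there.\<close>
  define al where "al = a1 + a2"
  define be where "be = (1 / sqrt Dl) *\<^sub>R ((B + D) *\<^sub>R a1 - (A + B) *\<^sub>R a2)"
  define Z where "Z x = Complex (al \<bullet> x) (be \<bullet> x)" for x
  have Zlin: "bounded_linear Z"
  proof -
    have "Z = (\<lambda>x. of_real (al \<bullet> x) + \<i> * of_real (be \<bullet> x))" by (auto simp: Z_def complex_eq_iff)
    then show ?thesis
      by (auto intro!: bounded_linear_add bounded_linear_const_mult bounded_linear_compose[OF bounded_linear_of_real] bounded_linear_inner_right)
  qed
  have albe: "al \<bullet> be = 0" "be \<bullet> be = al \<bullet> al"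
  proof -
    have "al \<bullet> be = (1 / sqrt Dl) * ((B + D) * (A + B) - (A + B) * (B + D))"
      unfolding al_def be_def inner_scaleR_right inner_diff_right inner_add_left BB A_def[symmetric] B_def[symmetric] D_def[symmetric] by simp
    then show "al \<bullet> be = 0" by simp
    have "be \<bullet> be = (1 / sqrt Dl) * (1 / sqrt Dl) * ((B + D) * ((B + D) * A - (A + B) * B) - (A + B) * ((B + D) * B - (A + B) * D))"
    proof -
      have "(c *\<^sub>R (s *\<^sub>R a1 - t *\<^sub>R a2)) \<bullet> (c *\<^sub>R (s *\<^sub>R a1 - t *\<^sub>R a2)) = c * c * (s * (s * A - t * B) - t * (s * B - t * D))" for c s t :: real
        by (simp add: inner_diff_right inner_diff_left BB A_def[symmetric] B_def[symmetric] D_def[symmetric] algebra_simps)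
      then show ?thesis unfolding be_def .
    qed
    also have "(1 / sqrt Dl) * (1 / sqrt Dl) = 1 / Dl" using Dl by simp
    also have "(B + D) * ((B + D) * A - (A + B) * B) - (A + B) * ((B + D) * B - (A + B) * D) = Dl * (A + 2 * B + D)"
      unfolding Dl_def by algebra
    also have "1 / Dl * (Dl * (A + 2 * B + D)) = A + 2 * B + D" using Dl by simp
    also have "\<dots> = al \<bullet> al" unfolding al_def inner_add_left inner_add_right BB A_def[symmetric] B_def[symmetric] D_def[symmetric] by simp
    finally show "be \<bullet> be = al \<bullet> al" .
  qed
  define ze where "ze i = Complex (al $ i) (be $ i)" for i
  have Zax: "Z (axis i 1) = ze i" for i by (simp add: Z_def ze_def inner_axis)
  have ze0: "(\<Sum>i\<in>UNIV. ze i * ze i) = 0"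
  proof -
    have "(\<Sum>i\<in>UNIV. ze i * ze i) = Complex (al \<bullet> al - be \<bullet> be) (2 * (al \<bullet> be))"
      by (simp add: complex_eq_iff ze_def inner_vec_def sum_subtractf sum_distrib_left algebra_simps)
    then show ?thesis using albe by (simp add: complex_eq_iff)
  qed
  have Zsum: "(\<Sum>i\<in>UNIV. of_real (x $ i) * ze i) = Z x" for x
    by (simp add: complex_eq_iff ze_def Z_def inner_vec_def mult.commute)
  define cb where "cb = (\<bar>B + D\<bar> + \<bar>A + B\<bar>) / sqrt Dl"
  have cb0: "cb \<ge> 0" using Dl by (simp add: cb_def)
  have Zn: "cmod (Z x) \<le> (1 + cb) * (\<bar>a1 \<bullet> x\<bar> + \<bar>a2 \<bullet> x\<bar>)" for x
  proof -
    have "be \<bullet> x = (1 / sqrt Dl) * ((B + D) * (a1 \<bullet> x) - (A + B) * (a2 \<bullet> x))"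
      by (simp add: be_def inner_diff_left)
    also have "\<bar>\<dots>\<bar> \<le> (1 / sqrt Dl) * (\<bar>B + D\<bar> * \<bar>a1 \<bullet> x\<bar> + \<bar>A + B\<bar> * \<bar>a2 \<bullet> x\<bar>)"
      using Dl abs_triangle_ineq4[of "(B + D) * (a1 \<bullet> x)" "(A + B) * (a2 \<bullet> x)"] by (simp add: abs_mult divide_right_mono)
    also have "\<dots> \<le> (1 / sqrt Dl) * ((\<bar>B + D\<bar> + \<bar>A + B\<bar>) * (\<bar>a1 \<bullet> x\<bar> + \<bar>a2 \<bullet> x\<bar>))"
    proof (rule mult_left_mono)
      have "p * s + q * t \<le> (p + q) * (s + t)" if "p \<ge> 0" "q \<ge> 0" "s \<ge> 0" "t \<ge> 0" for p q s t :: real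
        using that mult_nonneg_nonneg[of p t] mult_nonneg_nonneg[of q s] by (simp add: algebra_simps)
      then show "\<bar>B + D\<bar> * \<bar>a1 \<bullet> x\<bar> + \<bar>A + B\<bar> * \<bar>a2 \<bullet> x\<bar> \<le> (\<bar>B + D\<bar> + \<bar>A + B\<bar>) * (\<bar>a1 \<bullet> x\<bar> + \<bar>a2 \<bullet> x\<bar>)" by simp
    qed (use Dl in simp)
    finally have b: "\<bar>be \<bullet> x\<bar> \<le> cb * (\<bar>a1 \<bullet> x\<bar> + \<bar>a2 \<bullet> x\<bar>)" by (simp add: cb_def)
    have "cmod (Z x) \<le> \<bar>al \<bullet> x\<bar> + \<bar>be \<bullet> x\<bar>" using cmod_le[of "Z x"] by (simp add: Z_def)
    moreover have "\<bar>al \<bullet> x\<bar> \<le> \<bar>a1 \<bullet> x\<bar> + \<bar>a2 \<bullet> x\<bar>" by (simp add: al_def inner_add_left)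
    ultimately show ?thesis using b by (simp add: algebra_simps)
  qed
  have "isCont f 0" using fc by (simp add: continuous_on_eq_continuous_at)
  then obtain d1 where d1: "d1 > 0" "\<And>y. dist y 0 < d1 \<Longrightarrow> dist (f y) (f 0) < cmod (f 0) / 8"
    using f0 unfolding continuous_at_eps_delta by (metis divide_pos_pos zero_less_norm_iff zero_less_numeral)
  define d where "d = min d1 d0 / 2"
  have d: "0 < d" "d < d0" "d < d1" using d1(1) d0 by (auto simp: d_def)
  define eta where "eta x = flat (d\<^sup>2 - x \<bullet> x)" for x :: "real^'n"
  have ng: "norm x > d \<Longrightarrow> d\<^sup>2 - x \<bullet> x < 0" for x :: "real^'n"
    unfolding power2_norm_eq_inner[symmetric] using d by (simp add: power_strict_mono)
  have eta_s: "smooth_in UNIV eta" unfolding eta_def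
    by (rule smooth_in_compose_real[OF open_UNIV smooth_in_diff[OF open_UNIV smooth_in_const radial_smooth] smooth_real_flat])
  have eta_z: "eta x = 0" if "norm x > d" for x using ng[OF that] by (simp add: eta_def flat_0)
  have eta_nn: "eta x \<ge> 0" for x by (simp add: eta_def flat_nonneg)
  have eta_p: "eta x > 0" if "norm x < d" for x
  proof -
    have "(norm x)\<^sup>2 < d\<^sup>2" using that d by (intro power_strict_mono) auto
    then show ?thesis by (simp add: eta_def power2_norm_eq_inner flat_pos)
  qed
  have eta_t: "test_function eta" by (rule test_functionI[OF eta_s eta_z])
  define F1 where "F1 x = deriv flat (d\<^sup>2 - x \<bullet> x)" for x :: "real^'n"
  have pde: "pd eta i x = F1 x * (- 2 * x $ i)" for i x
  proof -
    have dd: "(\<lambda>x::real^'n. d\<^sup>2 - x \<bullet> x) differentiable at x" by (intro differentiable_diff differentiable_norm_sq differentiable_const)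
    have "((\<lambda>x::real^'n. d\<^sup>2 - x \<bullet> x) has_derivative (\<lambda>h. - (2 * (x \<bullet> h)))) (at x)"
      by (auto intro!: derivative_eq_intros simp: inner_commute)
    from pd_eqI[OF this, of i] have "pd (\<lambda>x. d\<^sup>2 - x \<bullet> x) i x = - 2 * x $ i" by (simp add: inner_axis)
    then show ?thesis unfolding eta_def[abs_def] F1_def
      using pd_compose[OF smooth_real_deriv(1)[OF smooth_real_flat] dd, of i] by simp
  qed
  have F1_c: "continuous_on UNIV F1" unfolding F1_def
    by (intro continuous_on_compose2[OF smooth_real_continuous[OF smooth_real_deriv(2)[OF smooth_real_flat]]] continuous_intros) auto
  have F1_z: "F1 x = 0" if x: "norm x > d" for x
  proof -
    have "((\<lambda>t. 0) has_real_derivative 0) (at (d\<^sup>2 - x \<bullet> x))" by simp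
    then have "(flat has_real_derivative 0) (at (d\<^sup>2 - x \<bullet> x))"
      by (rule has_field_derivative_transform_within_open[where S = "{..<0}"]) (use ng[OF x] in \<open>auto simp: flat_0\<close>)
    then show ?thesis unfolding F1_def by (rule DERIV_imp_deriv)
  qed
  \<comment> \<open>Because \<open>eta\<close> is radial with gradient \<open>-2 F1 x\<close>, the
    cross term in the Laplacian of \<open>eta exp (t Z)\<close> is \<open>mu\<close> times
    \<open>t Z\<close>. The product \<open>t Z\<close> becomes \<open>Z\<close> under the rescaling
    \<open>M t\<close>, so no power of \<open>t\<close> is left over.\<close>
  define ka where "ka x = of_real (lap eta x) + l * of_real (eta x)" for x
  define mu where "mu x = - 4 * complex_of_real (F1 x)" for x
  have le_c: "continuous_on UNIV (lap eta)" by (rule test_functionD(3)[OF test_function_lap[OF eta_t]])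
  have le_z: "lap eta x = 0" if "norm x > d" for x
  proof -
    have o: "open {x::real^'n. norm x > d}" by (intro open_Collect_less continuous_intros)
    have "lap eta x = lap (\<lambda>x. 0) x" by (rule lap_cong_open[OF o]) (use that eta_z in auto)
    then show ?thesis by (simp add: lap_0)
  qed
  have kac: "continuous_on UNIV ka" and muc: "continuous_on UNIV mu" and etac: "continuous_on UNIV eta"
    unfolding ka_def mu_def by (intro continuous_intros le_c F1_c test_functionD(3)[OF eta_t])+
  have kz: "ka x = 0" "mu x = 0" if "norm x > d" for x
    using le_z[OF that] eta_z[OF that] F1_z[OF that] by (auto simp: ka_def mu_def)
  define F where "F t x = exp (of_real t * Z x) * ((ka x + mu x * (of_real t * Z x)) * w x - of_real (eta x) * h x)" for t x
  have Fz: "(\<integral>x. F t x \<partial>lborel) = 0" for t :: real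
  proof -
    define e where "e x = exp (of_real t * Z x)" for x
    have lin: "bounded_linear (\<lambda>x. of_real t * Z x)" by (rule bounded_linear_const_mult[OF Zlin])
    have es: "smooth_in UNIV e" unfolding e_def by (rule smooth_in_exp[OF open_UNIV smooth_in_linear[OF lin]])
    have pe: "pd e i = (\<lambda>x. (of_real t * ze i) * e x)" for i
      unfolding e_def[abs_def] using pd_exp[OF bounded_linear_imp_differentiable[OF lin]] pd_linear[OF lin] Zax by (auto simp: mult.commute)
    have le: "lap e x = 0" for x
    proof -
      have "pd (pd e i) i x = (of_real t * ze i) * ((of_real t * ze i) * e x)" for i
      proof -
        have "pd (\<lambda>x. (of_real t * ze i) * e x) i x = (of_real t * ze i) * pd e i x"
          by (rule pd_bounded_linear[OF bounded_linear_mult_right smooth_inD(1)[OF es UNIV_I]])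
        then show ?thesis by (simp add: pe)
      qed
      then have "lap e x = (of_real t)\<^sup>2 * e x * (\<Sum>i\<in>UNIV. ze i * ze i)"
        by (simp add: lap_def sum_distrib_left power2_eq_square mult_ac)
      then show ?thesis by (simp add: ze0)
    qed
    define ce where "ce x = complex_of_real (eta x)" for x
    have ces: "smooth_in UNIV ce" unfolding ce_def by (rule smooth_in_bounded_linear[OF open_UNIV bounded_linear_of_real eta_s])
    have pce: "pd ce i = (\<lambda>x. of_real (pd eta i x))" for i
      unfolding ce_def[abs_def] using pd_bounded_linear[OF bounded_linear_of_real test_functionD(2)[OF eta_t]] by blast
    have lce: "lap ce x = of_real (lap eta x)" for x
    proof -
      have "pd (\<lambda>x. complex_of_real (pd eta i x)) j x = of_real (pd (pd eta i) j x)" for i j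
        by (rule pd_bounded_linear[OF bounded_linear_of_real test_functionD(2)[OF test_function_pd[OF eta_t]]])
      then show ?thesis by (simp add: lap_def pce)
    qed
    have "lap (\<lambda>x. ce x * e x) x = (of_real (lap eta x) + mu x * (of_real t * Z x)) * e x" for x
    proof -
      have "(\<Sum>i\<in>UNIV. pd ce i x * pd e i x + pd ce i x * pd e i x) = (\<Sum>i\<in>UNIV. (-4 * of_real (F1 x) * of_real t * e x) * (of_real (x $ i) * ze i))"
        by (intro sum.cong refl) (simp add: pce pe pde algebra_simps)
      also have "\<dots> = (-4 * of_real (F1 x) * of_real t * e x) * Z x" unfolding sum_distrib_left[symmetric] Zsum ..
      finally show ?thesis using lap_mult[OF ces es open_UNIV, of x] by (simp add: le lce mu_def algebra_simps)
    qed
    note lap_phi = this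
    have ps: "smooth_in UNIV (\<lambda>x. ce x * e x)" by (rule smooth_in_mult[OF open_UNIV ces es])
    have pz: "ce x * e x = 0" if "norm x > d" for x using eta_z[OF that] by (simp add: ce_def)
    note c = ceq[OF ps d(2) pz]
    have "F t x = lap (\<lambda>x. ce x * e x) x * w x + l * (ce x * e x * w x) - ce x * e x * h x" for x
      unfolding lap_phi unfolding F_def ka_def ce_def e_def by (simp add: algebra_simps)
    then have "(\<integral>x. F t x \<partial>lborel) = (\<integral>x. lap (\<lambda>x. ce x * e x) x * w x + l * (ce x * e x * w x) - ce x * e x * h x \<partial>lborel)" by simp
    also have "\<dots> = (\<integral>x. lap (\<lambda>x. ce x * e x) x * w x \<partial>lborel) + l * (\<integral>x. ce x * e x * w x \<partial>lborel) - (\<integral>x. ce x * e x * h x \<partial>lborel)"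
      using c(2,3,4) by simp
    also have "\<dots> = 0" using c(1) by simp
    finally show ?thesis .
  qed
  \<comment> \<open>\<open>P\<close> is the orthogonal projection onto the plane of the normals,
    \<open>Q\<close> the one onto the edge direction; \<open>M t\<close> shrinks the plane by
    \<open>1/t\<close> and fixes the edge. The wedge is invariant under it.\<close>
  define P where "P x = - (a1 \<bullet> x) *\<^sub>R p1 - (a2 \<bullet> x) *\<^sub>R p2" for x
  define Q where "Q x = x - P x" for x
  define M where "M t x = Q x + (1 / t) *\<^sub>R P x" for t :: real and x
  have aP: "a1 \<bullet> P x = a1 \<bullet> x" "a2 \<bullet> P x = a2 \<bullet> x" for x by (simp_all add: P_def inner_diff_right ap)
  have aQ: "a1 \<bullet> Q x = 0" "a2 \<bullet> Q x = 0" for x by (simp_all add: Q_def inner_diff_right aP)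
  have aM: "a1 \<bullet> M t x = (a1 \<bullet> x) / t" "a2 \<bullet> M t x = (a2 \<bullet> x) / t" for t x
    by (simp_all add: M_def inner_add_right aQ aP)
  have Zform: "Z x = Complex ((a1 \<bullet> x) + (a2 \<bullet> x)) ((1 / sqrt Dl) * ((B + D) * (a1 \<bullet> x) - (A + B) * (a2 \<bullet> x)))" for x
    by (simp add: Z_def al_def be_def inner_add_left inner_diff_left)
  have ZM: "of_real t * Z (M t x) = Z x" if "t > 0" for t x
  proof -
    have "t * (c * (p * (y / t) - q * (z / t))) = c * (p * y - q * z)" for c p q y z :: real
      using that by (simp add: field_simps)
    moreover have "t * (y / t + z / t) = y + z" for y z :: real using that by (simp add: field_simps)
    ultimately show ?thesis unfolding Zform aM complex_eq_iff by simp
  qed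
  have WM: "M t x \<in> W \<longleftrightarrow> x \<in> W" if "t > 0" for t x
    unfolding W_def mem_Collect_eq aM using that by (simp add: divide_less_0_iff)
  have QP: "Q x \<bullet> P x = 0" for x
  proof -
    have "Q x \<bullet> a1 = 0" "Q x \<bullet> a2 = 0" using aQ by (simp_all add: inner_commute)
    then show ?thesis by (simp add: P_def p1_def p2_def inner_diff_right inner_add_right)
  qed
  have Plin: "linear P" unfolding P_def by (rule linearI) (simp_all add: inner_add_right algebra_simps)
  have Mlin: "linear (M t)" for t
    unfolding M_def Q_def by (intro linear_compose_add linear_compose_sub linear_compose_scale_right linear_ident[unfolded id_def] Plin linear_id[unfolded id_def])
  have Minj: "inj (M t)" if t: "t > 0" for t
  proof -
    have "x = 0" if "M t x = 0" for x
    proof -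
      have "a1 \<bullet> x = 0" "a2 \<bullet> x = 0" using aM[of t x] that t by simp_all
      then have "P x = 0" by (simp add: P_def)
      then show "x = 0" using that by (simp add: M_def Q_def)
    qed
    then show ?thesis using linear_injective_0[OF Mlin] by blast
  qed
  have nMQ: "norm (Q x) \<le> norm (M t x)" for t x
  proof -
    have "(norm (M t x))\<^sup>2 = (norm (Q x))\<^sup>2 + (norm ((1/t) *\<^sub>R P x))\<^sup>2"
      unfolding M_def by (rule norm_add_Pythagorean) (simp add: orthogonal_def QP)
    then have "(norm (Q x))\<^sup>2 \<le> (norm (M t x))\<^sup>2" by simp
    then show ?thesis by (rule power2_le_imp_le) simp
  qed
  define H where "H t x = indicator W x *\<^sub>R (exp (Z x) * ((ka (M t x) + mu (M t x) * Z x) * w (M t x) - of_real (eta (M t x)) * f (M t x)))" for t x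
  have FM: "F t (M t x) = H t x" if t: "t > 0" for t x
  proof (cases "x \<in> W")
    case True
    then show ?thesis unfolding F_def H_def ZM[OF t] h_def using WM[OF t, of x] by simp
  next
    case False
    then have nW: "M t x \<notin> W" using WM[OF t] by simp
    have "(ka (M t x) + mu (M t x) * Z x) * w (M t x) = 0"
      using off[OF _ nW] kz[of "M t x"] d by (cases "norm (M t x) > d") auto
    then show ?thesis unfolding F_def H_def ZM[OF t] h_def using nW False by simp
  qed
  have Wm: "W \<in> sets borel" using Wo by simp
  have Fm: "F t \<in> borel_measurable borel" for t
  proof -
    have c: "continuous_on UNIV Z" by (rule bounded_linear.continuous_on[OF Zlin continuous_on_id])
    have [measurable]: "Z \<in> borel_measurable borel" "ka \<in> borel_measurable borel" "mu \<in> borel_measurable borel"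
      "w \<in> borel_measurable borel" "f \<in> borel_measurable borel" "eta \<in> borel_measurable borel"
      using c kac muc wc fc etac by (auto intro: borel_measurable_continuous_onI)
    have [measurable]: "(\<lambda>x. exp (of_real t * Z x)) \<in> borel_measurable borel"
      by (intro borel_measurable_continuous_onI continuous_intros c)
    show ?thesis unfolding F_def h_def using Wm by measurable
  qed
  have Hz: "(\<integral>x. H t x \<partial>lborel) = 0" if t: "t > 0" for t
    using integral_linear_zero[OF Mlin Minj[OF t] Fm Fz, of t] unfolding FM[OF t] .
  define E where "E x = exp (Z x) * (of_real (eta (Q x)) * f (Q x))" for x
  have lim: "(\<lambda>m. H (real (Suc m)) x) \<longlonglongrightarrow> - (indicator W x *\<^sub>R E x)" for x
  proof -
    have "(\<lambda>m. Q x + (1 / real (Suc m)) *\<^sub>R P x) \<longlonglongrightarrow> Q x + 0 *\<^sub>R P x"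
      by (intro tendsto_intros LIMSEQ_inverse_real_of_nat[unfolded inverse_eq_divide])
    then have Ml: "(\<lambda>m. M (real (Suc m)) x) \<longlonglongrightarrow> Q x" by (simp add: M_def)
    have cl: "(\<lambda>m. g (M (real (Suc m)) x)) \<longlonglongrightarrow> g (Q x)" if "continuous_on UNIV g" for g :: "real^'n \<Rightarrow> 'z::topological_space"
      using continuous_on_tendsto_compose[OF that Ml] by simp
    have "(\<lambda>m. H (real (Suc m)) x) \<longlonglongrightarrow> indicator W x *\<^sub>R (exp (Z x) * ((ka (Q x) + mu (Q x) * Z x) * w (Q x) - of_real (eta (Q x)) * f (Q x)))"
      unfolding H_def by (intro tendsto_intros cl kac muc wc fc etac)
    moreover have "(ka (Q x) + mu (Q x) * Z x) * w (Q x) = 0"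
    proof (cases "norm (Q x) > d")
      case False
      have "Q x \<notin> W" using aQ[of x] by (simp add: W_def)
      then show ?thesis using off[of "Q x"] False d by simp
    qed (simp add: kz)
    ultimately show ?thesis by (simp add: E_def)
  qed
  have cK: "compact (cball (0::real^'n) d)" by simp
  obtain K1 where K1: "K1 > 0" "\<And>x. norm x \<le> d \<Longrightarrow> cmod (ka x * w x) \<le> K1"
  proof -
    have "bounded ((\<lambda>x. ka x * w x) ` cball 0 d)"
      by (intro compact_imp_bounded compact_continuous_image cK continuous_intros continuous_on_subset[OF kac] continuous_on_subset[OF wc]) auto
    then show ?thesis unfolding bounded_pos using that by auto
  qed
  obtain K2 where K2: "K2 > 0" "\<And>x. norm x \<le> d \<Longrightarrow> cmod (mu x * w x) \<le> K2"
  proof -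
    have "bounded ((\<lambda>x. mu x * w x) ` cball 0 d)"
      by (intro compact_imp_bounded compact_continuous_image cK continuous_intros continuous_on_subset[OF muc] continuous_on_subset[OF wc]) auto
    then show ?thesis unfolding bounded_pos using that by auto
  qed
  obtain K3 where K3: "K3 > 0" "\<And>x. norm x \<le> d \<Longrightarrow> cmod (of_real (eta x) * f x) \<le> K3"
  proof -
    have "bounded ((\<lambda>x. of_real (eta x) * f x) ` cball 0 d)"
      by (intro compact_imp_bounded compact_continuous_image cK continuous_intros continuous_on_subset[OF etac] continuous_on_subset[OF fc]) auto
    then show ?thesis unfolding bounded_pos using that by auto
  qed
  define PP where "PP = norm p1 + norm p2"
  have PP: "PP > 0"
  proof -
    have "p1 \<noteq> 0" using ap(1) by auto
    then show ?thesis by (simp add: PP_def add_pos_nonneg)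
  qed
  define KK where "KK = (K1 + K2 * (2 * (1 + cb)) + K3) * exp (d / (2 * PP))"
  \<comment> \<open>On the wedge \<open>r = - Re Z\<close> controls everything:
    \<open>cmod (Z x) \<le> (1 + cb) r\<close>, and \<open>norm x \<le> d + PP r\<close> since the
    edge component is at most \<open>d\<close>. From \<open>r \<le> 2 exp (r/2)\<close>, half of the
    factor \<open>exp (-r)\<close> absorbs the linear growth and the other half yields decay in
    \<open>norm x\<close>, uniformly in \<open>t\<close>.\<close>
  have dom: "norm (H t x) \<le> KK * exp (- (1 / (2 * PP)) * norm x)" if t: "t > 0" for t x
  proof (cases "x \<in> W \<and> norm (M t x) \<le> d")
    case False
    have "H t x = 0" using False kz[of "M t x"] eta_z[of "M t x"] by (auto simp: H_def)
    moreover have "KK \<ge> 0" using K1 K2 K3 cb0 by (simp add: KK_def)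
    ultimately show ?thesis by simp
  next
    case True
    define r where "r = - (a1 \<bullet> x) - (a2 \<bullet> x)"
    have W: "a1 \<bullet> x < 0" "a2 \<bullet> x < 0" using True by (auto simp: W_def)
    have r0: "r \<ge> 0" using W by (simp add: r_def)
    have ReZ: "Re (Z x) = - r" by (simp add: Zform r_def)
    have Zr: "cmod (Z x) \<le> (1 + cb) * r" using Zn[of x] W by (simp add: r_def)
    have re: "r \<le> 2 * exp (r / 2)" using exp_ge_add_one_self[of "r / 2"] by linarith
    have "norm x \<le> d + PP * r"
    proof -
      have "norm x \<le> norm (Q x) + norm (P x)" using norm_triangle_ineq[of "Q x" "P x"] by (simp add: Q_def)
      moreover have "norm (Q x) \<le> d" using nMQ[of x t] True by simp
      moreover have "norm (P x) \<le> \<bar>a1 \<bullet> x\<bar> * norm p1 + \<bar>a2 \<bullet> x\<bar> * norm p2"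
        using norm_triangle_ineq4[of "- (a1 \<bullet> x) *\<^sub>R p1" "(a2 \<bullet> x) *\<^sub>R p2"] by (simp add: P_def)
      moreover have "\<bar>a1 \<bullet> x\<bar> * norm p1 + \<bar>a2 \<bullet> x\<bar> * norm p2 \<le> r * norm p1 + r * norm p2"
        using W by (intro add_mono mult_right_mono) (auto simp: r_def)
      ultimately show ?thesis by (simp add: PP_def algebra_simps)
    qed
    then have "- (r / 2) \<le> d / (2 * PP) + (- (1 / (2 * PP)) * norm x)" using PP by (simp add: field_simps)
    then have er: "exp (- (r / 2)) \<le> exp (d / (2 * PP)) * exp (- (1 / (2 * PP)) * norm x)" by (simp add: exp_add[symmetric])
    have "norm (H t x) = exp (- r) * cmod ((ka (M t x) + mu (M t x) * Z x) * w (M t x) - of_real (eta (M t x)) * f (M t x))"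
      using True ReZ by (simp add: H_def norm_mult)
    also have "\<dots> \<le> exp (- r) * (K1 + K2 * ((1 + cb) * r) + K3)"
    proof (rule mult_left_mono)
      have "cmod ((ka (M t x) + mu (M t x) * Z x) * w (M t x) - of_real (eta (M t x)) * f (M t x))
         \<le> cmod (ka (M t x) * w (M t x)) + cmod (mu (M t x) * w (M t x)) * cmod (Z x) + cmod (of_real (eta (M t x)) * f (M t x))"
      proof -
        have "(ka (M t x) + mu (M t x) * Z x) * w (M t x) - of_real (eta (M t x)) * f (M t x)
           = (ka (M t x) * w (M t x) + (mu (M t x) * w (M t x)) * Z x) - of_real (eta (M t x)) * f (M t x)" by (simp add: algebra_simps)
        then show ?thesis
          using norm_triangle_ineq4[of "ka (M t x) * w (M t x) + (mu (M t x) * w (M t x)) * Z x" "of_real (eta (M t x)) * f (M t x)"]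
            norm_triangle_ineq[of "ka (M t x) * w (M t x)" "(mu (M t x) * w (M t x)) * Z x"] by (simp add: norm_mult)
      qed
      also have "\<dots> \<le> K1 + K2 * ((1 + cb) * r) + K3"
        using K1 K2 K3 True Zr by (intro add_mono mult_mono) auto
      finally show "cmod ((ka (M t x) + mu (M t x) * Z x) * w (M t x) - of_real (eta (M t x)) * f (M t x)) \<le> K1 + K2 * ((1 + cb) * r) + K3" .
    qed simp
    also have "\<dots> \<le> exp (- r) * ((K1 + K2 * (2 * (1 + cb)) + K3) * exp (r / 2))"
    proof (rule mult_left_mono)
      have e1: "1 \<le> exp (r / 2)" using r0 by simp
      have "K1 \<le> K1 * exp (r / 2)" "K3 \<le> K3 * exp (r / 2)" using K1(1) K3(1) e1 by simp_all
      moreover have "K2 * ((1 + cb) * r) \<le> K2 * ((1 + cb) * (2 * exp (r / 2)))" using K2(1) cb0 re by (intro mult_left_mono) auto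
      ultimately show "K1 + K2 * ((1 + cb) * r) + K3 \<le> (K1 + K2 * (2 * (1 + cb)) + K3) * exp (r / 2)" by (simp add: algebra_simps)
    qed simp
    also have "\<dots> = (K1 + K2 * (2 * (1 + cb)) + K3) * exp (- (r / 2))"
    proof -
      have "exp (- r) * exp (r / 2) = exp (- (r / 2))" by (simp add: exp_add[symmetric])
      then show ?thesis by (simp add: mult_ac)
    qed
    also have "\<dots> \<le> (K1 + K2 * (2 * (1 + cb)) + K3) * (exp (d / (2 * PP)) * exp (- (1 / (2 * PP)) * norm x))"
      using K1 K2 K3 cb0 by (intro mult_left_mono er) auto
    finally show ?thesis by (simp add: KK_def mult_ac)
  qed
  have Em: "(\<lambda>x. indicator W x *\<^sub>R E x) \<in> borel_measurable lborel"
  proof -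
    have c: "continuous_on UNIV Z" "continuous_on UNIV Q"
      using bounded_linear.continuous_on[OF Zlin continuous_on_id] Plin
      unfolding Q_def by (auto intro!: continuous_intros linear_continuous_on[OF linear_conv_bounded_linear[THEN iffD1, OF Plin]])
    have "continuous_on UNIV E" unfolding E_def
      by (intro continuous_intros c continuous_on_compose2[OF etac c(2)] continuous_on_compose2[OF fc c(2)]) auto
    then have [measurable]: "E \<in> borel_measurable borel" by (rule borel_measurable_continuous_onI)
    show ?thesis using Wm by measurable
  qed
  have Hm: "H t \<in> borel_measurable lborel" if t: "t > 0" for t
  proof -
    have "M t \<in> borel_measurable borel"
      using linear_continuous_on[OF linear_conv_bounded_linear[THEN iffD1, OF Mlin]] by (rule borel_measurable_continuous_onI)
    from measurable_compose[OF this Fm[of t]] show ?thesis unfolding FM[OF t] by simp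
  qed
  have domi: "integrable lborel (\<lambda>x::real^'n. KK * exp (- (1 / (2 * PP)) * norm x))"
    by (intro integrable_mult_right integrable_exp_norm) (use PP in simp)
  have Ei: "integrable lborel (\<lambda>x. indicator W x *\<^sub>R E x)" and E_int: "(\<integral>x. indicator W x *\<^sub>R E x \<partial>lborel) = 0"
  proof -
    have a: "(\<lambda>x. - (indicator W x *\<^sub>R E x)) \<in> borel_measurable lborel" using Em by simp
    have b: "H (real (Suc m)) \<in> borel_measurable lborel" for m by (rule Hm) simp
    have c: "AE x in lborel. (\<lambda>m. H (real (Suc m)) x) \<longlonglongrightarrow> - (indicator W x *\<^sub>R E x)" using lim by simp
    have e: "AE x in lborel. norm (H (real (Suc m)) x) \<le> KK * exp (- (1 / (2 * PP)) * norm x)" for m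
      using dom[of "real (Suc m)"] by simp
    have "integrable lborel (\<lambda>x. - (indicator W x *\<^sub>R E x))" by (rule integrable_dominated_convergence[OF a b domi c e])
    from Bochner_Integration.integrable_minus[OF this] have "integrable lborel (\<lambda>x. - (- (indicator W x *\<^sub>R E x)))" .
    then show "integrable lborel (\<lambda>x. indicator W x *\<^sub>R E x)" by (simp only: minus_minus)
    have "(\<lambda>m. (\<integral>x. H (real (Suc m)) x \<partial>lborel)) \<longlonglongrightarrow> (\<integral>x. - (indicator W x *\<^sub>R E x) \<partial>lborel)"
      by (rule integral_dominated_convergence[OF a b domi c e])
    then show "(\<integral>x. indicator W x *\<^sub>R E x \<partial>lborel) = 0" by (simp add: Hz LIMSEQ_const_iff)
  qed
  obtain rho where rho: "rho > 0" "\<And>z::complex. cmod z < rho \<Longrightarrow> cmod (exp z - 1) < 1/4"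
  proof -
    have "isCont exp (0::complex)" by (intro isCont_exp continuous_ident)
    then obtain r where "r > 0" "\<And>z::complex. dist z 0 < r \<Longrightarrow> dist (exp z) (exp 0) < 1/4"
      unfolding continuous_at_eps_delta by (metis zero_less_divide_1_iff zero_less_numeral)
    then show ?thesis using that[of r] by (simp add: dist_norm)
  qed
  define u where "u = rho / (4 * (1 + cb))"
  have u: "u > 0" "(1 + cb) * (u + u) < rho"
  proof -
    have v: "1 + cb > 0" using cb0 by simp
    then show "u > 0" using rho by (simp add: u_def)
    have "y * (rho / (4 * y)) = rho / 4" if "y > 0" for y :: real using that by (simp add: field_simps)
    from this[OF v] have "(1 + cb) * u = rho / 4" by (simp only: u_def)
    then have "(1 + cb) * (u + u) = rho / 2" by (simp add: distrib_left)
    then show "(1 + cb) * (u + u) < rho" using rho by simp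
  qed
  have Zsub: "Z (x - u *\<^sub>R p) = Z x - of_real u * Z p" for x p
    using linear_diff[OF bounded_linear.linear[OF Zlin], of x "u *\<^sub>R p"] linear_scale[OF bounded_linear.linear[OF Zlin], of u p]
    by (metis scaleR_conv_of_real)
  have Qsub: "Q (x - u *\<^sub>R p) = Q x - u *\<^sub>R Q p" for x p
    unfolding Q_def linear_diff[OF Plin] linear_scale[OF Plin] by (simp add: algebra_simps)
  have Qp: "Q p1 = 0" "Q p2 = 0" by (simp_all add: Q_def P_def ap)
  have Esub: "E (x - u *\<^sub>R p) = exp (- (of_real u * Z p)) * E x" if "Q p = 0" for x p
  proof -
    have "exp (Z x - of_real u * Z p) = exp (- (of_real u * Z p)) * exp (Z x)" by (simp add: exp_add[symmetric])
    then show ?thesis by (simp add: E_def Zsub Qsub that)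
  qed
  \<comment> \<open>Translation by \<open>u p1\<close> or \<open>u p2\<close> leaves
    \<open>Q\<close> unchanged and multiplies \<open>E\<close> by a constant. The two differences
    cut the wedge down to \<open>-u \<le> ai \<bullet> x < 0\<close>, where \<open>Z\<close> is so
    small that \<open>exp (Z x)\<close> is close to 1.\<close>
  define T2 where "T2 = W \<inter> {x. x - u *\<^sub>R p1 \<notin> W}"
  define T3 where "T3 = T2 \<inter> {x. x - u *\<^sub>R p2 \<notin> T2}"
  have T2: "x \<in> T2 \<longleftrightarrow> - u \<le> a1 \<bullet> x \<and> a1 \<bullet> x < 0 \<and> a2 \<bullet> x < 0" for x
    by (auto simp: T2_def W_def inner_diff_right ap)
  have T3: "x \<in> T3 \<longleftrightarrow> - u \<le> a1 \<bullet> x \<and> a1 \<bullet> x < 0 \<and> - u \<le> a2 \<bullet> x \<and> a2 \<bullet> x < 0" for x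
    unfolding T3_def using u by (auto simp: T2 inner_diff_right ap)
  have s1: "x - u *\<^sub>R p1 \<in> W \<Longrightarrow> x \<in> W" for x using u by (auto simp: W_def inner_diff_right ap)
  have s2: "x - u *\<^sub>R p2 \<in> T2 \<Longrightarrow> x \<in> T2" for x using u by (auto simp: T2 inner_diff_right ap)
  have i2: "integrable lborel (\<lambda>x. indicator T2 x *\<^sub>R E x)" "(\<integral>x. indicator T2 x *\<^sub>R E x \<partial>lborel) = 0"
    unfolding T2_def by (rule integral_translation_difference[OF Ei E_int Esub[OF Qp(1)] exp_not_eq_zero]; erule s1)+
  have i3': "integrable lborel (\<lambda>x. indicator T3 x *\<^sub>R E x)" "(\<integral>x. indicator T3 x *\<^sub>R E x \<partial>lborel) = 0"
    unfolding T3_def by (rule integral_translation_difference[OF i2 Esub[OF Qp(2)] exp_not_eq_zero]; erule s2)+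
  define g where "g x = indicator T3 x * Re (cnj (f 0) * E x)" for x
  have geq: "g x = Re (cnj (f 0) * (indicator T3 x *\<^sub>R E x))" for x by (auto simp: g_def indicator_def)
  have gi: "integrable lborel g" unfolding geq[abs_def] by (intro integrable_Re integrable_mult_right i3'(1))
  have g0: "(\<integral>x. g x \<partial>lborel) = 0"
  proof -
    have "(\<integral>x. g x \<partial>lborel) = Re (\<integral>x. cnj (f 0) * (indicator T3 x *\<^sub>R E x) \<partial>lborel)"
      unfolding geq by (rule integral_Re) (intro integrable_mult_right i3'(1))
    then show ?thesis unfolding integral_mult_right_zero i3'(2) by simp
  qed
  \<comment> \<open>With \<open>cmod (exp Z) \<le> 2\<close>, the tolerances 1/8 for
    \<open>f\<close> and 1/4 for the exponential move the product away from \<open>f 0\<close> by at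
    most half of its modulus, so the real part stays positive. Its integral over the prism is
    nevertheless 0.\<close>
  have pos: "Re (cnj (f 0) * (exp (Z x) * f (Q x))) > 0" if "x \<in> T3" "norm (Q x) \<le> d" for x
  proof -
    have "\<bar>a1 \<bullet> x\<bar> + \<bar>a2 \<bullet> x\<bar> \<le> u + u" using that(1) by (auto simp: T3)
    then have "(1 + cb) * (\<bar>a1 \<bullet> x\<bar> + \<bar>a2 \<bullet> x\<bar>) \<le> (1 + cb) * (u + u)" using cb0 by (intro mult_left_mono) auto
    then have "cmod (Z x) < rho" using Zn[of x] u(2) by linarith
    then have e: "cmod (exp (Z x) - 1) < 1/4" by (rule rho(2))
    have fq: "cmod (f (Q x) - f 0) < cmod (f 0) / 8" using d1(2)[of "Q x"] that(2) d by (simp add: dist_norm)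
    have e2: "cmod (exp (Z x)) \<le> 2" using norm_triangle_ineq[of "exp (Z x) - 1" 1] e by simp
    have "exp (Z x) * f (Q x) - f 0 = exp (Z x) * (f (Q x) - f 0) + (exp (Z x) - 1) * f 0" by (simp add: algebra_simps)
    then have "cmod (exp (Z x) * f (Q x) - f 0) \<le> cmod (exp (Z x)) * cmod (f (Q x) - f 0) + cmod (exp (Z x) - 1) * cmod (f 0)"
      using norm_triangle_ineq[of "exp (Z x) * (f (Q x) - f 0)" "(exp (Z x) - 1) * f 0"] by (simp add: norm_mult)
    also have "\<dots> \<le> 2 * (cmod (f 0) / 8) + 1/4 * cmod (f 0)" using e e2 fq by (intro add_mono mult_mono) auto
    finally have v: "cmod (exp (Z x) * f (Q x) - f 0) \<le> cmod (f 0) / 2" by simp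
    have "Re (cnj (f 0) * (exp (Z x) * f (Q x))) = (cmod (f 0))\<^sup>2 + Re (cnj (f 0) * (exp (Z x) * f (Q x) - f 0))"
      unfolding cmod_power2 by (simp add: power2_eq_square algebra_simps)
    moreover have "\<bar>Re (cnj (f 0) * (exp (Z x) * f (Q x) - f 0))\<bar> \<le> cmod (f 0) * (cmod (f 0) / 2)"
      using abs_Re_le_cmod[of "cnj (f 0) * (exp (Z x) * f (Q x) - f 0)"] mult_left_mono[OF v, of "cmod (f 0)"] by (simp add: norm_mult)
    moreover have "(cmod (f 0))\<^sup>2 > 0" using f0 by simp
    moreover have "cmod (f 0) * (cmod (f 0) / 2) = (cmod (f 0))\<^sup>2 / 2" by (simp add: power2_eq_square)
    ultimately show ?thesis by linarith
  qed
  have gE: "Re (cnj (f 0) * E x) = eta (Q x) * Re (cnj (f 0) * (exp (Z x) * f (Q x)))" for x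
    by (simp add: E_def algebra_simps)
  have gnn: "g x \<ge> 0" for x
    using pos[of x] eta_z[of "Q x"] eta_nn[of "Q x"] unfolding g_def gE
    by (cases "norm (Q x) \<le> d"; cases "x \<in> T3") (auto intro!: mult_nonneg_nonneg less_imp_le)
  have AE0: "AE x in lborel. g x = 0" using integral_nonneg_eq_0_iff_AE[OF gi] gnn g0 by simp
  define U where "U = {x. - u < a1 \<bullet> x \<and> a1 \<bullet> x < 0 \<and> - u < a2 \<bullet> x \<and> a2 \<bullet> x < 0 \<and> norm (Q x) < d}"
  have "AE x in lborel. x \<notin> U"
    using AE0
  proof eventually_elim
    fix x assume g: "g x = 0"
    show "x \<notin> U"
    proof
      assume "x \<in> U"
      then have x: "x \<in> T3" "norm (Q x) < d" by (auto simp: U_def T3)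
      then have "g x > 0" unfolding g_def gE using pos[OF x(1)] eta_p[OF x(2)] by simp
      then show False using g by simp
    qed
  qed
  moreover have "open U"
  proof -
    have "continuous_on UNIV Q" unfolding Q_def
      by (intro continuous_intros linear_continuous_on[OF linear_conv_bounded_linear[THEN iffD1, OF Plin]])
    then show ?thesis unfolding U_def by (intro open_Collect_conj open_Collect_less continuous_intros)
  qed
  ultimately have "U = {}" using AE_not_in_open by blast
  moreover have "(u / 2) *\<^sub>R (p1 + p2) \<in> U"
  proof -
    have "Q ((u / 2) *\<^sub>R (p1 + p2)) = 0"
      by (simp add: Q_def P_def inner_add_right ap algebra_simps)
    then show ?thesis using u d by (simp add: U_def inner_add_right ap)
  qed
  ultimately show False by blast
qed

section \<open>Polytopes near a face of codimension two\<close>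

lemma cauchy_schwarz_strict:
  fixes a b :: "'a::real_inner"
  assumes "a \<noteq> 0" "b \<noteq> 0" "\<And>c. b \<noteq> c *\<^sub>R a"
  shows "(a \<bullet> b)\<^sup>2 < (a \<bullet> a) * (b \<bullet> b)"
proof -
  have "\<bar>a \<bullet> b\<bar> \<noteq> norm a * norm b"
  proof
    assume "\<bar>a \<bullet> b\<bar> = norm a * norm b"
    then have "norm a *\<^sub>R b = norm b *\<^sub>R a \<or> norm a *\<^sub>R b = - norm b *\<^sub>R a"
      using norm_cauchy_schwarz_abs_eq[of a b] by simp
    then obtain c where "norm a *\<^sub>R b = c *\<^sub>R a" by metis
    then have "inverse (norm a) *\<^sub>R (norm a *\<^sub>R b) = inverse (norm a) *\<^sub>R (c *\<^sub>R a)" by simp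
    then have "b = (inverse (norm a) * c) *\<^sub>R a" using assms(1) by simp
    then show False using assms(3) by blast
  qed
  then have "\<bar>a \<bullet> b\<bar> < norm a * norm b" using Cauchy_Schwarz_ineq2[of a b] by simp
  then have "\<bar>a \<bullet> b\<bar>\<^sup>2 < (norm a * norm b)\<^sup>2" by (intro power_strict_mono) auto
  then show ?thesis by (simp add: power_mult_distrib power2_norm_eq_inner)
qed

text \<open>At a relative interior point of a codimension two face exactly two inequalities of a minimal
  presentation are active: the normal of a third one would lie in the plane spanned by the other
  two normals, and then one of the three inequalities would be redundant.\<close>

lemma polytope_local_wedge:
  fixes P :: "'a::euclidean_space set"
  assumes P: "polytope P" and int: "interior P \<noteq> {}" and xc: "xc extreme_point_of P" and n: "DIM('a) \<ge> 2" and e: "e > 0"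
  obtains p a1 a2 d where "p \<in> ball xc e" "p \<in> P" "d > 0" "(a1 \<bullet> a2)\<^sup>2 < (a1 \<bullet> a1) * (a2 \<bullet> a2)"
    "\<And>x. x \<in> ball p d \<Longrightarrow> x \<in> interior P \<longleftrightarrow> a1 \<bullet> (x - p) < 0 \<and> a2 \<bullet> (x - p) < 0"
proof -
  have poly: "polyhedron P" using P by (rule polytope_imp_polyhedron)
  have conv: "convex P" using poly by (rule polyhedron_imp_convex)
  have adP: "aff_dim P = int DIM('a)" using int by (rule aff_dim_nonempty_interior)
  have ah: "affine hull P = UNIV" using int by (rule affine_hull_nonempty_interior)
  obtain F where F: "finite F" "P = affine hull P \<inter> \<Inter>F" "\<And>h. h \<in> F \<Longrightarrow> \<exists>a b. a \<noteq> 0 \<and> h = {x. a \<bullet> x \<le> b}"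
    "\<And>F'. F' \<subset> F \<Longrightarrow> P \<subset> affine hull P \<inter> \<Inter>F'"
    using poly unfolding polyhedron_Int_affine_minimal by metis
  obtain a b where ab: "\<And>h. h \<in> F \<Longrightarrow> a h \<noteq> 0 \<and> h = {x. a h \<bullet> x \<le> b h}" using F(3) by metis
  have PF: "P = \<Inter>F" using F(2) ah by simp
  have memP: "x \<in> P \<longleftrightarrow> (\<forall>h\<in>F. a h \<bullet> x \<le> b h)" for x unfolding PF using ab by auto
  have intP: "interior P = {x \<in> P. \<forall>h\<in>F. a h \<bullet> x < b h}"
    using rel_interior_polyhedron_explicit[OF F(1,2) ab F(4)] rel_interior_interior[OF ah] by simp
  note facets = facet_of_polyhedron_explicit[OF F(1,2) ab F(4)]
  obtain y0 where y0: "y0 \<in> interior P" using int by blast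
  have fx: "{xc} face_of P" using xc by (simp add: face_of_singleton)
  have "{xc} \<noteq> P" using adP n aff_dim_sing[of xc] by auto
  then obtain C1 where C1: "C1 facet_of P" "{xc} \<subseteq> C1" using face_of_polyhedron_subset_facet[OF poly fx] by blast
  have C1f: "C1 face_of P" "aff_dim C1 = int DIM('a) - 1" using C1(1) adP by (auto simp: facet_of_def)
  have C1s: "C1 \<subseteq> P" using face_of_imp_subset[OF C1f(1)] .
  have fx1: "{xc} face_of C1" by (rule face_of_subset[OF fx C1(2) C1s])
  have "{xc} \<noteq> C1" using C1f(2) n aff_dim_sing[of xc] by auto
  then obtain R where R: "R facet_of C1" "{xc} \<subseteq> R"
    using face_of_polyhedron_subset_facet[OF face_of_polyhedron_polyhedron[OF poly C1f(1)] fx1] by blast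
  have Rf: "R face_of C1" "aff_dim R = int DIM('a) - 2" "R \<noteq> {}" using R(1) C1f(2) by (auto simp: facet_of_def)
  have RP: "R face_of P" using face_of_trans[OF Rf(1) C1f(1)] .
  have RsP: "R \<subseteq> P" using face_of_imp_subset[OF RP] .
  have RC1: "R \<subseteq> C1" using face_of_imp_subset[OF Rf(1)] .
  have "R = \<Inter>{C. C facet_of P \<and> R \<subseteq> C}" 
  proof (rule face_of_polyhedron[OF poly RP Rf(3)])
    show "R \<noteq> P" using Rf(2) adP by auto
  qed
  moreover have "R \<noteq> C1" using Rf(2) C1f(2) by auto
  ultimately obtain C2 where C2: "C2 facet_of P" "R \<subseteq> C2" "C2 \<noteq> C1" using RC1 C1(1) by blast
  obtain h1 where h1: "h1 \<in> F" "C1 = P \<inter> {x. a h1 \<bullet> x = b h1}" using facets C1(1) by blast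
  obtain h2 where h2: "h2 \<in> F" "C2 = P \<inter> {x. a h2 \<bullet> x = b h2}" using facets C2(1) by blast
  have h12: "h1 \<noteq> h2" using C2(3) h1 h2 by auto
  have Rc: "convex R" using face_of_imp_convex[OF RP] .
  have "xc \<in> closure (rel_interior R)" using R(2) closure_subset[of R] convex_closure_rel_interior[OF Rc] by auto
  then obtain p where p: "p \<in> rel_interior R" "dist p xc < e" using e closure_approachable by blast
  have pR: "p \<in> R" using p(1) rel_interior_subset by blast
  then have pP: "p \<in> P" using RsP by blast
  \<comment> \<open>The hyperplane cuts \<open>P\<close> in a face that meets the relative interior
    of \<open>R\<close>, hence contains all of \<open>R\<close>.\<close>
  have act: "R \<subseteq> {x. a h \<bullet> x = b h}" if h: "h \<in> F" "a h \<bullet> p = b h" for h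
  proof -
    have "P \<inter> {x. a h \<bullet> x = b h} face_of P"
      by (rule face_of_Int_supporting_hyperplane_le[OF conv]) (use memP h in auto)
    moreover have "P \<inter> {x. a h \<bullet> x = b h} \<inter> rel_interior R \<noteq> {}" using p(1) pP h(2) by auto
    ultimately show ?thesis using subset_of_face_of[OF _ RsP] by blast
  qed
  have p12: "a h1 \<bullet> p = b h1" "a h2 \<bullet> p = b h2" using pR RC1 C2(2) h1(2) h2(2) by auto
  have neg: "a h \<bullet> (y0 - p) < 0" if "h \<in> F" "a h \<bullet> p = b h" for h
    using y0 that unfolding intP by (auto simp: inner_diff_right)
  \<comment> \<open>An interior point \<open>y0\<close> lies strictly inside every half space active
    at \<open>p\<close>. This excludes nonpositive multiples, and a positive multiple would give the
    same half space twice.\<close>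
  have noscale: "a h \<noteq> c *\<^sub>R a g" if hg: "h \<in> F" "g \<in> F" "h \<noteq> g" "a h \<bullet> p = b h" "a g \<bullet> p = b g" for h g c
  proof
    assume eq: "a h = c *\<^sub>R a g"
    have "c > 0"
    proof (rule ccontr)
      assume "\<not> c > 0"
      then have "c * (a g \<bullet> (y0 - p)) \<ge> 0" using neg[OF hg(2,5)] by (intro mult_nonpos_nonpos) auto
      then show False using neg[OF hg(1,4)] eq by simp
    qed
    moreover have "b h = c * b g" using hg(4,5) eq by simp
    ultimately have "{x. a h \<bullet> x \<le> b h} = {x. a g \<bullet> x \<le> b g}" using eq by simp
    then show False using ab[OF hg(1)] ab[OF hg(2)] hg(3) by auto
  qed
  have redundant: False
    if g: "g1 \<in> F" "g2 \<in> F" "g3 \<in> F" "g3 \<noteq> g1" "g3 \<noteq> g2"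
      and gp: "a g1 \<bullet> p = b g1" "a g2 \<bullet> p = b g2" "a g3 \<bullet> p = b g3"
      and eq: "a g3 = s *\<^sub>R a g1 + t *\<^sub>R a g2" "s \<ge> 0" "t \<ge> 0" for g1 g2 g3 s t
  proof -
    have "g1 \<inter> g2 \<subseteq> g3"
    proof
      fix x assume "x \<in> g1 \<inter> g2"
      then have "a g1 \<bullet> x \<le> b g1" "a g2 \<bullet> x \<le> b g2" using ab[OF g(1)] ab[OF g(2)] by auto
      then have "s * (a g1 \<bullet> x) + t * (a g2 \<bullet> x) \<le> s * b g1 + t * b g2" using eq by (intro add_mono mult_left_mono) auto
      also have "\<dots> = b g3" using gp eq(1) by (simp add: inner_add_left)
      finally have "a g3 \<bullet> x \<le> b g3" using eq(1) by (simp add: inner_add_left)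
      then show "x \<in> g3" using ab[OF g(3)] by auto
    qed
    then have "\<Inter>(F - {g3}) = \<Inter>F" using g by auto
    moreover have "P \<subset> affine hull P \<inter> \<Inter>(F - {g3})" using g(3) by (intro F(4)) auto
    ultimately show False using PF ah by simp
  qed
  have only: "h = h1 \<or> h = h2" if h: "h \<in> F" "a h \<bullet> p = b h" for h
  proof (rule ccontr)
    assume "\<not> (h = h1 \<or> h = h2)"
    then have ne: "h \<noteq> h1" "h \<noteq> h2" by auto
    \<comment> \<open>\<open>R - p\<close> is orthogonal to all active normals and spans a space of
      dimension \<open>n - 2\<close>, so three active normals span at most a plane.\<close>
    define A where "A = span {a h1, a h2, a h}"
    have "(+) (- p) ` R \<subseteq> {y \<in> UNIV. \<forall>x\<in>A. orthogonal x y}"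
    proof (clarsimp)
      fix r x assume r: "r \<in> R" and x: "x \<in> A"
      have "a g \<bullet> (r - p) = 0" if "g \<in> F" "a g \<bullet> p = b g" for g
        using act[OF that] r that by (auto simp: inner_diff_right)
      then have "\<forall>v\<in>{a h1, a h2, a h}. orthogonal (r - p) v" using h h1(1) h2(1) p12 by (auto simp: orthogonal_def inner_commute)
      then have "orthogonal (r - p) x" using x unfolding A_def by (meson orthogonal_to_span)
      then show "orthogonal x (r - p)" by (simp add: orthogonal_commute)
    qed
    then have "dim ((+) (- p) ` R) \<le> dim {y \<in> UNIV. \<forall>x\<in>A. orthogonal x y}" by (rule dim_subset)
    moreover have "dim {y \<in> UNIV. \<forall>x\<in>A. orthogonal x y} + dim A = DIM('a)"
      using dim_subspace_orthogonal_to_vectors[of A UNIV] by (simp add: A_def)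
    moreover have "int (dim ((+) (- p) ` R)) = int DIM('a) - 2"
      using aff_dim_eq_dim[of p R] hull_inc[OF pR, of affine] Rf(2) by simp
    ultimately have dA: "dim A \<le> 2" by linarith
    have nin: "a h2 \<notin> span {a h1}"
      using noscale[OF h2(1) h1(1) h12[symmetric] p12(2,1)] by (auto simp: span_singleton)
    have ind2: "independent {a h1, a h2}" 
      using nin ab[OF h1(1)] by (subst insert_commute) (auto simp: independent_insert dependent_single)
    have "dim {a h1, a h2} = 2"
    proof -
      have "a h1 \<noteq> a h2" using nin span_base[of "a h1" "{a h1}"] by auto
      then show ?thesis using dim_eq_card_independent[OF ind2] by simp
    qed
    then have "span {a h1, a h2} = span {a h1, a h2, a h}"
      using dA dim_eq_span[of "{a h1, a h2}" "{a h1, a h2, a h}"] by (simp add: A_def)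
    then have "a h \<in> span {a h1, a h2}" using span_base[of "a h" "{a h1, a h2, a h}"] by simp
    then obtain s t where st: "a h = s *\<^sub>R a h1 + t *\<^sub>R a h2"
      by (auto simp: span_insert[of "a h1"] span_singleton algebra_simps)
    have n0: "s * (a h1 \<bullet> (y0 - p)) + t * (a h2 \<bullet> (y0 - p)) < 0" using neg[OF h] st by (simp add: inner_add_left)
    note n1 = neg[OF h1(1) p12(1)] and n2 = neg[OF h2(1) p12(2)]
    \<comment> \<open>In each of the first three cases one of the three normals is a nonnegative
      combination of the other two, contradicting minimality. In the last one the interior point
      \<open>y0\<close> gives the contradiction.\<close>
    consider "s \<ge> 0" "t \<ge> 0" | "s < 0" "t > 0" | "t < 0" "s > 0" | "s \<le> 0" "t \<le> 0" by linarith
    then show False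
    proof cases
      case 1 then show False using redundant[OF h1(1) h2(1) h(1) ne p12 h(2) st] by blast
    next
      case 2
      have e: "a h2 = (1 / t) *\<^sub>R a h + (- s / t) *\<^sub>R a h1" unfolding st using 2 by (simp add: algebra_simps)
      have "0 \<le> 1 / t" "0 \<le> - s / t" using 2 by (simp_all add: divide_nonpos_pos)
      then show False by (rule redundant[OF h(1) h1(1) h2(1) ne(2)[symmetric] h12[symmetric] h(2) p12(1) p12(2) e])
    next
      case 3
      have e: "a h1 = (1 / s) *\<^sub>R a h + (- t / s) *\<^sub>R a h2" unfolding st using 3 by (simp add: algebra_simps)
      have "0 \<le> 1 / s" "0 \<le> - t / s" using 3 by (simp_all add: divide_nonpos_pos)
      then show False by (rule redundant[OF h(1) h2(1) h1(1) ne(1)[symmetric] h12 h(2) p12(2) p12(1) e])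
    next
      case 4
      then have "s * (a h1 \<bullet> (y0 - p)) \<ge> 0" "t * (a h2 \<bullet> (y0 - p)) \<ge> 0" using n1 n2 by (auto intro!: mult_nonpos_nonpos)
      then show False using n0 by linarith
    qed
  qed
  have o: "open (\<Inter>h\<in>F - {h1, h2}. {x. a h \<bullet> x < b h})"
    using F(1) by (intro open_INT) (auto intro!: open_halfspace_lt)
  have "p \<in> (\<Inter>h\<in>F - {h1, h2}. {x. a h \<bullet> x < b h})"
  proof
    fix h assume h: "h \<in> F - {h1, h2}"
    then have "a h \<bullet> p \<le> b h" "a h \<bullet> p \<noteq> b h" using pP memP only by auto
    then show "p \<in> {x. a h \<bullet> x < b h}" by simp
  qed
  then obtain d where d: "d > 0" "ball p d \<subseteq> (\<Inter>h\<in>F - {h1, h2}. {x. a h \<bullet> x < b h})"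
    by (rule openE[OF o])
  show ?thesis
  proof (rule that[of p d "a h1" "a h2"])
    show "p \<in> ball xc e" using p(2) by (simp add: dist_commute)
    show "(a h1 \<bullet> a h2)\<^sup>2 < (a h1 \<bullet> a h1) * (a h2 \<bullet> a h2)"
      by (rule cauchy_schwarz_strict) (use ab h1 h2 noscale[OF h2(1) h1(1) h12[symmetric] p12(2,1)] in auto)
    fix x assume x: "x \<in> ball p d"
    have "x \<in> interior P \<longleftrightarrow> (\<forall>h\<in>F. a h \<bullet> x < b h)"
      unfolding intP using memP less_imp_le by blast
    also have "\<dots> \<longleftrightarrow> a h1 \<bullet> x < b h1 \<and> a h2 \<bullet> x < b h2" using x d(2) h1(1) h2(1) by blast
    also have "\<dots> \<longleftrightarrow> a h1 \<bullet> (x - p) < 0 \<and> a h2 \<bullet> (x - p) < 0" using p12 by (simp add: inner_diff_right)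
    finally show "x \<in> interior P \<longleftrightarrow> a h1 \<bullet> (x - p) < 0 \<and> a h2 \<bullet> (x - p) < 0" .
  qed (use pP d in auto)
qed

text \<open>A translation is a composition of two point reflections, for which everything is already
  known.\<close>

lemma test_function_shift:
  fixes \<psi> :: "real^'n \<Rightarrow> real"
  assumes "test_function \<psi>"
  shows "test_function (\<lambda>y. \<psi> (y - p))" "lap (\<lambda>y. \<psi> (y - p)) y = lap \<psi> (y - p)"
proof -
  have t: "test_function (\<lambda>z. \<psi> (0 - z))" by (rule test_function_reflect[OF assms])
  show "test_function (\<lambda>y. \<psi> (y - p))" using test_function_reflect[OF t, of p] by simp
  show "lap (\<lambda>y. \<psi> (y - p)) y = lap \<psi> (y - p)"
    using lap_reflect[OF t, of p y] lap_reflect[OF assms, of 0 "p - y"] by simp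
qed

lemma corner_vanish:
  fixes w f :: "real^'n \<Rightarrow> complex"
  assumes wc: "continuous_on UNIV w" and fc: "continuous_on UNIV f"
    and ind: "(a1 \<bullet> a2)\<^sup>2 < (a1 \<bullet> a1) * (a2 \<bullet> a2)" and d: "d > 0"
    and D: "\<And>x. x \<in> ball p d \<Longrightarrow> x \<in> D \<longleftrightarrow> a1 \<bullet> (x - p) < 0 \<and> a2 \<bullet> (x - p) < 0"
    and off: "\<And>x. x \<in> ball p d \<Longrightarrow> x \<notin> D \<Longrightarrow> w x = 0"
    and eq: "\<And>\<phi>. test_function \<phi> \<Longrightarrow> closure {x. \<phi> x \<noteq> 0} \<subseteq> ball p d \<Longrightarrow>
       (\<integral>x. lap \<phi> x *\<^sub>R w x \<partial>lborel) + l * (\<integral>x. \<phi> x *\<^sub>R w x \<partial>lborel) = (\<integral>x. \<phi> x *\<^sub>R (indicator D x *\<^sub>R f x) \<partial>lborel)"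
  shows "f p = 0"
proof -
  have "(\<lambda>x. f (x + p)) 0 = 0"
  proof (rule corner_at_origin[of "\<lambda>x. w (x + p)" "\<lambda>x. f (x + p)" a1 a2 d l])
    show "continuous_on UNIV (\<lambda>x. w (x + p))" "continuous_on UNIV (\<lambda>x. f (x + p))"
      by (intro continuous_on_compose2[OF wc] continuous_on_compose2[OF fc] continuous_intros; simp)+
    show "w (x + p) = 0" if "norm x < d" "x \<notin> {x. a1 \<bullet> x < 0 \<and> a2 \<bullet> x < 0}" for x
      using off[of "x + p"] D[of "x + p"] that by (simp add: dist_norm)
    fix \<psi> :: "real^'n \<Rightarrow> real" and r :: real
    assume t: "test_function \<psi>" and r: "r < d" and z: "\<And>x. norm x > r \<Longrightarrow> \<psi> x = 0"
    define \<phi> where "\<phi> y = \<psi> (y - p)" for y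
    have pt: "test_function \<phi>" unfolding \<phi>_def by (rule test_function_shift(1)[OF t])
    have pl: "lap \<phi> y = lap \<psi> (y - p)" for y unfolding \<phi>_def[abs_def] by (rule test_function_shift(2)[OF t])
    have "{x. \<phi> x \<noteq> 0} \<subseteq> cball p r"
    proof
      fix x assume "x \<in> {x. \<phi> x \<noteq> 0}"
      then have "\<not> norm (x - p) > r" using z[of "x - p"] by (auto simp: \<phi>_def)
      then show "x \<in> cball p r" by (simp add: dist_norm norm_minus_commute)
    qed
    then have "closure {x. \<phi> x \<noteq> 0} \<subseteq> cball p r" by (rule closure_minimal) simp
    also have "cball p r \<subseteq> ball p d" using r by auto
    finally have sub: "closure {x. \<phi> x \<noteq> 0} \<subseteq> ball p d" .
    have sh: "(\<integral>x. g (x + p) \<partial>lborel) = (\<integral>x. g x \<partial>lborel)" for g :: "real^'n \<Rightarrow> complex" by (rule integral_translate)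
    have 1: "(\<integral>x. lap \<psi> x *\<^sub>R w (x + p) \<partial>lborel) = (\<integral>x. lap \<phi> x *\<^sub>R w x \<partial>lborel)"
      using sh[of "\<lambda>x. lap \<phi> x *\<^sub>R w x"] by (simp add: pl)
    have 2: "(\<integral>x. \<psi> x *\<^sub>R w (x + p) \<partial>lborel) = (\<integral>x. \<phi> x *\<^sub>R w x \<partial>lborel)"
      using sh[of "\<lambda>x. \<phi> x *\<^sub>R w x"] by (simp add: \<phi>_def)
    have 3: "(\<integral>x. \<psi> x *\<^sub>R (indicator {x. a1 \<bullet> x < 0 \<and> a2 \<bullet> x < 0} x *\<^sub>R f (x + p)) \<partial>lborel) = (\<integral>x. \<phi> x *\<^sub>R (indicator D x *\<^sub>R f x) \<partial>lborel)"
    proof -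
      have "\<psi> x *\<^sub>R (indicator {x. a1 \<bullet> x < 0 \<and> a2 \<bullet> x < 0} x *\<^sub>R f (x + p)) = \<phi> (x + p) *\<^sub>R (indicator D (x + p) *\<^sub>R f (x + p))" for x
      proof (cases "\<psi> x = 0")
        case False
        then have "norm x < d" using z[of x] r by (meson leI le_less_trans)
        then have "x + p \<in> ball p d" by (simp add: dist_norm)
        then show ?thesis using D[of "x + p"] by (simp add: \<phi>_def indicator_def)
      qed (simp add: \<phi>_def)
      then show ?thesis using sh[of "\<lambda>x. \<phi> x *\<^sub>R (indicator D x *\<^sub>R f x)"] by (simp only:)
    qed
    show "(\<integral>x. lap \<psi> x *\<^sub>R w (x + p) \<partial>lborel) + l * (\<integral>x. \<psi> x *\<^sub>R w (x + p) \<partial>lborel)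
      = (\<integral>x. \<psi> x *\<^sub>R (indicator {x. a1 \<bullet> x < 0 \<and> a2 \<bullet> x < 0} x *\<^sub>R f (x + p)) \<partial>lborel)"
      unfolding 1 2 3 by (rule eq[OF pt sub])
  qed (use ind d in auto)
  then show ?thesis by simp
qed

text \<open>The weak equation after a second integration by parts, so that no gradient is left. The
  integrability clause is kept because it also supplies measurability of the term with the
  potential.\<close>

definition dist_helmholtz :: "real \<Rightarrow> (real^'n \<Rightarrow> complex) \<Rightarrow> (real^'n \<Rightarrow> complex) \<Rightarrow> bool" where
  "dist_helmholtz k V u \<longleftrightarrow> continuous_on UNIV u \<and> (\<forall>\<phi>. test_function \<phi> \<longrightarrow>
     integrable lborel (\<lambda>x. \<phi> x *\<^sub>R (of_real (k\<^sup>2) * (1 + V x) * u x)) \<and>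
     (\<integral>x. lap \<phi> x *\<^sub>R u x \<partial>lborel) = - (\<integral>x. \<phi> x *\<^sub>R (of_real (k\<^sup>2) * (1 + V x) * u x) \<partial>lborel))"

lemma total_wave_dist:
  fixes u :: "real^'n \<Rightarrow> complex"
  assumes "total_wave k V ui u" shows "dist_helmholtz k V u"
proof -
  have uc: "continuous_on UNIV u" using assms by (simp add: total_wave_def)
  obtain g where wg: "weak_gradient u g"
    and h: "\<And>\<phi>. test_function \<phi> \<Longrightarrow>
        integrable lborel (\<lambda>x. (of_real (k\<^sup>2) * (1 + V x)) * u x * of_real (\<phi> x)) \<and>
        (\<integral>x. (\<Sum>i\<in>UNIV. g i x * of_real (pd \<phi> i x)) \<partial>lborel)
          = (\<integral>x. (of_real (k\<^sup>2) * (1 + V x)) * u x * of_real (\<phi> x) \<partial>lborel)"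
    using assms unfolding total_wave_def weak_helmholtz_sol_def by blast
  have "integrable lborel (\<lambda>x. \<phi> x *\<^sub>R (of_real (k\<^sup>2) * (1 + V x) * u x)) \<and>
     (\<integral>x. lap \<phi> x *\<^sub>R u x \<partial>lborel) = - (\<integral>x. \<phi> x *\<^sub>R (of_real (k\<^sup>2) * (1 + V x) * u x) \<partial>lborel)"
    if t: "test_function \<phi>" for \<phi>
  proof
    have e: "\<phi> x *\<^sub>R (of_real (k\<^sup>2) * (1 + V x) * u x) = (of_real (k\<^sup>2) * (1 + V x)) * u x * of_real (\<phi> x)" for x
      by (simp add: scaleR_conv_of_real mult_ac)
    show "integrable lborel (\<lambda>x. \<phi> x *\<^sub>R (of_real (k\<^sup>2) * (1 + V x) * u x))" unfolding e using h[OF t] by blast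
    have gi: "integrable lborel (\<lambda>x. u x * of_real (pd (pd \<phi> i) i x))" "integrable lborel (\<lambda>x. g i x * of_real (pd \<phi> i x))"
      "(\<integral>x. u x * of_real (pd (pd \<phi> i) i x) \<partial>lborel) = - (\<integral>x. g i x * of_real (pd \<phi> i x) \<partial>lborel)" for i
      using wg test_function_pd[OF t, of i] unfolding weak_gradient_def by blast+
    have "(\<integral>x. lap \<phi> x *\<^sub>R u x \<partial>lborel) = (\<integral>x. (\<Sum>i\<in>UNIV. u x * of_real (pd (pd \<phi> i) i x)) \<partial>lborel)"
      by (simp add: lap_def scaleR_conv_of_real sum_distrib_left mult.commute)
    also have "\<dots> = (\<Sum>i\<in>UNIV. (\<integral>x. u x * of_real (pd (pd \<phi> i) i x) \<partial>lborel))"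
      by (rule Bochner_Integration.integral_sum) (rule gi(1))
    also have "\<dots> = - (\<Sum>i\<in>UNIV. (\<integral>x. g i x * of_real (pd \<phi> i x) \<partial>lborel))" unfolding gi(3) by (rule sum_negf)
    also have "(\<Sum>i\<in>UNIV. (\<integral>x. g i x * of_real (pd \<phi> i x) \<partial>lborel)) = (\<integral>x. (\<Sum>i\<in>UNIV. g i x * of_real (pd \<phi> i x)) \<partial>lborel)"
      by (rule Bochner_Integration.integral_sum[symmetric]) (rule gi(2))
    also have "\<dots> = (\<integral>x. \<phi> x *\<^sub>R (of_real (k\<^sup>2) * (1 + V x) * u x) \<partial>lborel)" unfolding e using h[OF t] by blast
    finally show "(\<integral>x. lap \<phi> x *\<^sub>R u x \<partial>lborel) = - (\<integral>x. \<phi> x *\<^sub>R (of_real (k\<^sup>2) * (1 + V x) * u x) \<partial>lborel)" .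
  qed
  then show ?thesis using uc by (simp add: dist_helmholtz_def)
qed

lemma test_scaleR_integrable:
  fixes u :: "real^'n \<Rightarrow> complex"
  assumes "test_function \<phi>" "continuous_on UNIV u" shows "integrable lborel (\<lambda>x. \<phi> x *\<^sub>R u x)"
proof -
  obtain M where M: "\<And>x. norm x > M \<Longrightarrow> \<phi> x = 0" using test_function_supp[OF assms(1)] by metis
  show ?thesis by (rule integrable_cont_supp[where M = M]) (auto simp: M intro!: continuous_intros assms test_functionD(3)[OF assms(1)])
qed

lemma dist_helmholtz_diff:
  fixes u u' :: "real^'n \<Rightarrow> complex"
  assumes u: "dist_helmholtz k V u" and u': "dist_helmholtz k V' u'" and t: "test_function \<phi>"
  shows "(\<integral>x. lap \<phi> x *\<^sub>R (u x - u' x) \<partial>lborel)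
     = - (\<integral>x. \<phi> x *\<^sub>R (of_real (k\<^sup>2) * ((1 + V x) * u x - (1 + V' x) * u' x)) \<partial>lborel)"
    "integrable lborel (\<lambda>x. \<phi> x *\<^sub>R (of_real (k\<^sup>2) * ((1 + V x) * u x - (1 + V' x) * u' x)))"
proof -
  have c: "continuous_on UNIV u" "continuous_on UNIV u'" using u u' by (auto simp: dist_helmholtz_def)
  note i = test_scaleR_integrable[OF test_function_lap[OF t] c(1)] test_scaleR_integrable[OF test_function_lap[OF t] c(2)]
  have j: "integrable lborel (\<lambda>x. \<phi> x *\<^sub>R (of_real (k\<^sup>2) * (1 + V x) * u x))" "integrable lborel (\<lambda>x. \<phi> x *\<^sub>R (of_real (k\<^sup>2) * (1 + V' x) * u' x))"
    and e: "(\<integral>x. lap \<phi> x *\<^sub>R u x \<partial>lborel) = - (\<integral>x. \<phi> x *\<^sub>R (of_real (k\<^sup>2) * (1 + V x) * u x) \<partial>lborel)"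
     "(\<integral>x. lap \<phi> x *\<^sub>R u' x \<partial>lborel) = - (\<integral>x. \<phi> x *\<^sub>R (of_real (k\<^sup>2) * (1 + V' x) * u' x) \<partial>lborel)"
    using u u' t unfolding dist_helmholtz_def by blast+
  have d: "\<phi> x *\<^sub>R (of_real (k\<^sup>2) * ((1 + V x) * u x - (1 + V' x) * u' x))
     = \<phi> x *\<^sub>R (of_real (k\<^sup>2) * (1 + V x) * u x) - \<phi> x *\<^sub>R (of_real (k\<^sup>2) * (1 + V' x) * u' x)" for x
    by (simp add: algebra_simps)
  show "integrable lborel (\<lambda>x. \<phi> x *\<^sub>R (of_real (k\<^sup>2) * ((1 + V x) * u x - (1 + V' x) * u' x)))"
    unfolding d by (rule Bochner_Integration.integrable_diff[OF j])
  have "(\<integral>x. lap \<phi> x *\<^sub>R (u x - u' x) \<partial>lborel) = (\<integral>x. lap \<phi> x *\<^sub>R u x \<partial>lborel) - (\<integral>x. lap \<phi> x *\<^sub>R u' x \<partial>lborel)"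
    unfolding scaleR_diff_right by (rule Bochner_Integration.integral_diff[OF i])
  also have "\<dots> = - (\<integral>x. \<phi> x *\<^sub>R (of_real (k\<^sup>2) * ((1 + V x) * u x - (1 + V' x) * u' x)) \<partial>lborel)"
    unfolding d e by (subst Bochner_Integration.integral_diff[OF j]) simp
  finally show "(\<integral>x. lap \<phi> x *\<^sub>R (u x - u' x) \<partial>lborel)
     = - (\<integral>x. \<phi> x *\<^sub>R (of_real (k\<^sup>2) * ((1 + V x) * u x - (1 + V' x) * u' x)) \<partial>lborel)" .
qed

text \<open>The hypothesis is phrased through products so as to hold both where
  \<open>V = V' = cc\<close> and where \<open>V = V'\<close> is arbitrary but \<open>u = u'\<close>.
  The second case lets an equation with one constant extend over layers already peeled off.\<close>

lemma dist_helmholtz_dsol: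
  fixes u u' :: "real^'n \<Rightarrow> complex"
  assumes u: "dist_helmholtz k V u" and u': "dist_helmholtz k V' u'"
    and eq: "\<And>x. x \<in> S \<Longrightarrow> V x * u x - V' x * u' x = cc * (u x - u' x)"
  shows "dsol (of_real (k\<^sup>2) * (1 + cc)) S (\<lambda>x. u x - u' x)"
  unfolding dsol_def
proof (intro allI impI)
  fix \<phi> :: "real^'n \<Rightarrow> real" assume t: "test_function \<phi>" and s: "closure {x. \<phi> x \<noteq> 0} \<subseteq> S"
  have e: "\<phi> x *\<^sub>R (of_real (k\<^sup>2) * ((1 + V x) * u x - (1 + V' x) * u' x)) = of_real (k\<^sup>2) * (1 + cc) * (\<phi> x *\<^sub>R (u x - u' x))" for x
  proof (cases "\<phi> x = 0")
    case False
    then have "x \<in> closure {x. \<phi> x \<noteq> 0}" using closure_subset[of "{x. \<phi> x \<noteq> 0}"] by auto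
    then have "x \<in> S" by (rule subsetD[OF s])
    have "(1 + V x) * u x - (1 + V' x) * u' x = (u x - u' x) + (V x * u x - V' x * u' x)" by (simp add: distrib_right)
    also have "\<dots> = (1 + cc) * (u x - u' x)" unfolding eq[OF \<open>x \<in> S\<close>] by (simp only: distrib_right mult_1_left)
    finally show ?thesis by (simp only: mult_scaleR_right mult.assoc)
  qed simp
  show "(\<integral>y. lap \<phi> y *\<^sub>R (u y - u' y) \<partial>lborel) + of_real (k\<^sup>2) * (1 + cc) * (\<integral>y. \<phi> y *\<^sub>R (u y - u' y) \<partial>lborel) = 0"
    unfolding dist_helmholtz_diff(1)[OF u u' t] e integral_mult_right_zero by (rule left_minus)
qed

text \<open>A point of \<open>B\<close> outside the interior of \<open>P\<close> is a limit of
  points of \<open>B\<close> outside \<open>P\<close>, and the zero set of \<open>w\<close> is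
  closed.\<close>

lemma zero_off_interior:
  fixes w :: "'a::euclidean_space \<Rightarrow> complex"
  assumes w: "continuous_on UNIV w" and B: "open B" and z: "\<And>x. x \<in> B \<Longrightarrow> x \<notin> P \<Longrightarrow> w x = 0"
    and x: "x \<in> B" "x \<notin> interior P"
  shows "w x = 0"
proof -
  have "x \<in> closure (- P)" using x(2) by (simp add: closure_complement)
  then have "x \<in> closure (B \<inter> - P)" using B x(1) open_Int_closure_subset[OF B, of "- P"] by blast
  moreover have "closed {x. w x = 0}" using w by (intro closed_Collect_eq continuous_intros)
  then have "closure (B \<inter> - P) \<subseteq> {x. w x = 0}" by (intro closure_minimal) (use z in auto)
  ultimately show ?thesis by blast
qed

text \<open>In \<open>no_corner\<close> nothing is assumed about the potentials on the frontier of
  the cell; the integrals do not see it.\<close>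

lemma AE_not_frontier:
  fixes P :: "(real^'n) set"
  assumes "convex P" shows "AE x in lborel. x \<notin> frontier P"
proof -
  have "frontier P \<in> null_sets lborel"
    using negligible_convex_frontier[OF assms] by (simp add: negligible_iff_null_sets null_sets_completion_iff)
  then show ?thesis by (rule AE_not_in)
qed

theorem no_corner:
  fixes u u' :: "real^'n \<Rightarrow> complex" and P :: "(real^'n) set"
  assumes u: "dist_helmholtz k V u" and u': "dist_helmholtz k V' u'" and k: "k \<noteq> 0"
    and P: "polytope P" "interior P \<noteq> {}" and xc: "xc extreme_point_of P" and n: "CARD('n) \<ge> 2"
    and nz: "u xc \<noteq> 0 \<or> u' xc \<noteq> 0" and e: "e > 0" and ab: "al \<noteq> be"
    and ins: "\<And>x. x \<in> ball xc e \<Longrightarrow> x \<in> interior P \<Longrightarrow> V x = al \<and> V' x = be"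
    and out: "\<And>x. x \<in> ball xc e \<Longrightarrow> x \<notin> P \<Longrightarrow> V x = V' x \<and> u x = u' x"
  shows False
proof -
  have c: "continuous_on UNIV u" "continuous_on UNIV u'" using u u' by (auto simp: dist_helmholtz_def)
  define w where "w x = u x - u' x" for x
  have wc: "continuous_on UNIV w" unfolding w_def by (intro continuous_intros c)
  have conv: "convex P" using P(1) by (rule polytope_imp_convex)
  have wz: "w x = 0" if "x \<in> ball xc e" "x \<notin> interior P" for x
    by (rule zero_off_interior[OF wc open_ball _ that]) (use out in \<open>auto simp: w_def\<close>)
  have ad: "aff_dim P = int CARD('n)" using aff_dim_nonempty_interior[OF P(2)] by simp
  have "xc \<notin> interior P"
  proof
    assume i: "xc \<in> interior P"
    have "{xc} face_of P" using xc by (simp add: face_of_singleton)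
    moreover have "{xc} \<inter> rel_interior P \<noteq> {}" using i interior_subset_rel_interior by blast
    ultimately have "P \<subseteq> {xc}" using subset_of_face_of[of "{xc}" P P] by blast
    then have "aff_dim P \<le> aff_dim {xc}" by (rule aff_dim_subset)
    then show False using ad n by simp
  qed
  \<comment> \<open>A vertex is not interior, so the two waves agree at it; the hypothesis on
    \<open>u\<close> or \<open>u'\<close> thus becomes one on \<open>u'\<close>.\<close>
  then have "w xc = 0" using wz[of xc] e by simp
  then have "u' xc \<noteq> 0" using nz by (auto simp: w_def)
  moreover have "isCont u' xc" using c(2) by (simp add: continuous_on_eq_continuous_at)
  ultimately obtain r where r: "r > 0" "\<And>x. dist x xc < r \<Longrightarrow> u' x \<noteq> 0"
    using continuous_at_avoid[of xc u' 0] by (metis dist_commute)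
  have mre: "min r e > 0" using r e by simp
  obtain p a1 a2 d where p: "p \<in> ball xc (min r e)" "p \<in> P" "d > 0" "(a1 \<bullet> a2)\<^sup>2 < (a1 \<bullet> a1) * (a2 \<bullet> a2)"
    "\<And>x. x \<in> ball p d \<Longrightarrow> x \<in> interior P \<longleftrightarrow> a1 \<bullet> (x - p) < 0 \<and> a2 \<bullet> (x - p) < 0"
    using polytope_local_wedge[OF P xc _ mre] n by (metis DIM_cart DIM_real mult.right_neutral)
  define s where "s = min d (e - dist xc p)"
  have s: "s > 0" "ball p s \<subseteq> ball p d" "ball p s \<subseteq> ball xc e"
  proof -
    show "s > 0" using p(1,3) by (simp add: s_def)
    show "ball p s \<subseteq> ball p d" by (rule subset_ball) (simp add: s_def)
    have "s \<le> e - dist xc p" by (simp add: s_def)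
    then show "ball p s \<subseteq> ball xc e" by (intro ball_subset_ball_iff[THEN iffD2]) (simp add: dist_commute)
  qed
  \<comment> \<open>In the cell \<open>al u - be u' = al w - (be - al) u'\<close>. Hence
    \<open>w\<close> satisfies the equation with constant \<open>al\<close> and this continuous
    source on the cell.\<close>
  define f where "f x = of_real (k\<^sup>2) * (be - al) * u' x" for x
  have fc: "continuous_on UNIV f" unfolding f_def by (intro continuous_intros c)
  have "f p = 0"
  proof (rule corner_vanish[OF wc fc p(4) s(1), where D = "interior P" and l = "of_real (k\<^sup>2) * (1 + al)"])
    show "x \<in> interior P \<longleftrightarrow> a1 \<bullet> (x - p) < 0 \<and> a2 \<bullet> (x - p) < 0" if "x \<in> ball p s" for x
      using p(5) s(2) that by blast
    show "w x = 0" if "x \<in> ball p s" "x \<notin> interior P" for x using wz s(3) that by blast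
    fix \<phi> :: "real^'n \<Rightarrow> real" assume t: "test_function \<phi>" and sup: "closure {x. \<phi> x \<noteq> 0} \<subseteq> ball p s"
    have i1: "integrable lborel (\<lambda>x. of_real (k\<^sup>2) * (1 + al) * (\<phi> x *\<^sub>R w x))"
      by (rule integrable_mult_right[OF test_scaleR_integrable[OF t wc]])
    have i2: "integrable lborel (\<lambda>x. \<phi> x *\<^sub>R (indicator (interior P) x *\<^sub>R f x))"
    proof -
      have "integrable lborel (\<lambda>x. indicator (interior P) x *\<^sub>R (\<phi> x *\<^sub>R f x))"
        by (rule integrable_mult_indicator[OF _ test_scaleR_integrable[OF t fc]]) simp
      then show ?thesis by (simp add: mult.commute)
    qed
    have "(\<integral>x. \<phi> x *\<^sub>R (of_real (k\<^sup>2) * ((1 + V x) * u x - (1 + V' x) * u' x)) \<partial>lborel)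
      = (\<integral>x. of_real (k\<^sup>2) * (1 + al) * (\<phi> x *\<^sub>R w x) - \<phi> x *\<^sub>R (indicator (interior P) x *\<^sub>R f x) \<partial>lborel)"
    proof (rule integral_cong_AE)
      show "(\<lambda>x. \<phi> x *\<^sub>R (of_real (k\<^sup>2) * ((1 + V x) * u x - (1 + V' x) * u' x))) \<in> borel_measurable lborel"
        using dist_helmholtz_diff(2)[OF u u' t] by (rule borel_measurable_integrable)
      show "(\<lambda>x. of_real (k\<^sup>2) * (1 + al) * (\<phi> x *\<^sub>R w x) - \<phi> x *\<^sub>R (indicator (interior P) x *\<^sub>R f x)) \<in> borel_measurable lborel"
        using Bochner_Integration.integrable_diff[OF i1 i2] by (rule borel_measurable_integrable)
      show "AE x in lborel. \<phi> x *\<^sub>R (of_real (k\<^sup>2) * ((1 + V x) * u x - (1 + V' x) * u' x))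
        = of_real (k\<^sup>2) * (1 + al) * (\<phi> x *\<^sub>R w x) - \<phi> x *\<^sub>R (indicator (interior P) x *\<^sub>R f x)"
        using AE_not_frontier[OF conv]
      proof eventually_elim
        fix x assume fr: "x \<notin> frontier P"
        show "\<phi> x *\<^sub>R (of_real (k\<^sup>2) * ((1 + V x) * u x - (1 + V' x) * u' x))
          = of_real (k\<^sup>2) * (1 + al) * (\<phi> x *\<^sub>R w x) - \<phi> x *\<^sub>R (indicator (interior P) x *\<^sub>R f x)"
        proof (cases "\<phi> x = 0")
          case False
          then have "x \<in> closure {x. \<phi> x \<noteq> 0}" using closure_subset[of "{x. \<phi> x \<noteq> 0}"] by auto
          then have xb: "x \<in> ball xc e" by (rule subsetD[OF s(3) subsetD[OF sup]])
          show ?thesis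
          proof (cases "x \<in> interior P")
            case True
            then show ?thesis using ins[OF xb True]
              by (simp add: w_def f_def scaleR_conv_of_real algebra_simps)
          next
            case F: False
            then have "x \<notin> P" using fr closure_subset[of P] by (auto simp: frontier_def)
            then show ?thesis using out[OF xb] F by (simp add: w_def)
          qed
        qed simp
      qed
    qed
    also have "\<dots> = of_real (k\<^sup>2) * (1 + al) * (\<integral>x. \<phi> x *\<^sub>R w x \<partial>lborel) - (\<integral>x. \<phi> x *\<^sub>R (indicator (interior P) x *\<^sub>R f x) \<partial>lborel)"
      unfolding Bochner_Integration.integral_diff[OF i1 i2] integral_mult_right_zero ..
    finally show "(\<integral>x. lap \<phi> x *\<^sub>R w x \<partial>lborel) + of_real (k\<^sup>2) * (1 + al) * (\<integral>x. \<phi> x *\<^sub>R w x \<partial>lborel)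
      = (\<integral>x. \<phi> x *\<^sub>R (indicator (interior P) x *\<^sub>R f x) \<partial>lborel)"
      unfolding w_def dist_helmholtz_diff(1)[OF u u' t] by simp
  qed
  moreover have "u' p \<noteq> 0" using r(2)[of p] p(1) by (simp add: dist_commute)
  ultimately show False using k ab by (simp add: f_def)
qed

subsection \<open>Nested cells\<close>

text \<open>Separate \<open>x\<close> from each set by a hyperplane. A direction orthogonal to the
  first normal exists in dimension at least 2; up to sign it does not increase the second
  functional. Along that ray both separating inequalities at \<open>x\<close> persist.\<close>

lemma convex_compact_exit_ray:
  fixes K K' :: "'a::euclidean_space set"
  assumes K: "convex K" "closed K" "x \<notin> K" and K': "convex K'" "closed K'" "x \<notin> K'" and n: "DIM('a) \<ge> 2"
  obtains v where "v \<noteq> 0" "\<And>t. t \<ge> 0 \<Longrightarrow> x + t *\<^sub>R v \<notin> K \<union> K'"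
proof -
  obtain a b where a: "a \<bullet> x < b" "\<And>y. y \<in> K \<Longrightarrow> b < a \<bullet> y"
    using separating_hyperplane_closed_point[OF K] by metis
  obtain a' b' where a': "a' \<bullet> x < b'" "\<And>y. y \<in> K' \<Longrightarrow> b' < a' \<bullet> y"
    using separating_hyperplane_closed_point[OF K'] by metis
  obtain v0 where v0: "v0 \<noteq> 0" "orthogonal a v0"
    using orthogonal_to_vector_exists[OF n, of a] by metis
  define v where "v = (if a' \<bullet> v0 \<le> 0 then v0 else - v0)"
  have v: "v \<noteq> 0" "a \<bullet> v = 0" "a' \<bullet> v \<le> 0" using v0 by (auto simp: v_def orthogonal_def)
  have "x + t *\<^sub>R v \<notin> K \<union> K'" if "t \<ge> 0" for t
  proof
    assume "x + t *\<^sub>R v \<in> K \<union> K'"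
    then have "b < a \<bullet> (x + t *\<^sub>R v) \<or> b' < a' \<bullet> (x + t *\<^sub>R v)" using a(2) a'(2) by blast
    then have "b < a \<bullet> x \<or> b' < a' \<bullet> x + t * (a' \<bullet> v)" using v(2) by (simp add: inner_add_right)
    moreover have "t * (a' \<bullet> v) \<le> 0" using \<open>t \<ge> 0\<close> v(3) by (rule mult_nonneg_nonpos)
    ultimately show False using a(1) a'(1) by linarith
  qed
  then show ?thesis using that v(1) by blast
qed

lemma admissible_cell_closure:
  fixes D :: "(real^'n) set"
  assumes "admissible_cell D"
  shows "polytope (closure D)" "interior (closure D) = D" "D \<noteq> {}" "open D"
proof -
  obtain S where S: "finite S" "D = interior (convex hull S)" "D \<noteq> {}" using assms by (auto simp: admissible_cell_def)
  have "closure D = closure (convex hull S)"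
    unfolding S(2) by (rule convex_closure_interior) (use S in auto)
  also have "\<dots> = convex hull S" using S(1) by (simp add: finite_imp_compact_convex_hull compact_imp_closed)
  finally have c: "closure D = convex hull S" .
  show "polytope (closure D)" using S(1) c by (auto simp: polytope_def)
  show "interior (closure D) = D" using c S(2) by simp
  show "D \<noteq> {}" "open D" using S by auto
qed

lemma polyhedral_nested_cell:
  fixes D :: "nat \<Rightarrow> (real^'n) set"
  assumes D: "polyhedral_nested D c" and j: "j \<ge> 1"
  shows "polytope (closure (D j))" "interior (closure (D j)) = D j" "open (D j)" "closure (D (Suc j)) \<subseteq> D j"
    "compact (closure (D j))" "convex (closure (D j))"
proof -
  have "admissible_cell (D j) \<or> D j = {}" using D j by (auto simp: polyhedral_nested_def)
  then show p: "polytope (closure (D j))" and "interior (closure (D j)) = D j" "open (D j)"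
    using admissible_cell_closure[of "D j"] by (auto simp: polytope_empty)
  show "compact (closure (D j))" "convex (closure (D j))" using p by (rule polytope_imp_compact polytope_imp_convex)+
  show "closure (D (Suc j)) \<subseteq> D j" using D j by (auto simp: polyhedral_nested_def compactly_contained_def)
qed

lemma polyhedral_nested_antimono:
  assumes D: "polyhedral_nested D c" and j: "1 \<le> i" "i \<le> j"
  shows "D j \<subseteq> D i"
  using j(2)
proof (induction rule: dec_induct)
  case (step m)
  then have "closure (D (Suc m)) \<subseteq> D m" using polyhedral_nested_cell(4)[OF D] j(1) by simp
  then show ?case using step closure_subset by blast
qed simp

lemma pc_potential_Sigma_cell:
  assumes D: "polyhedral_nested D c" and j: "j \<ge> 1" and x: "x \<in> D j" "x \<notin> closure (D (Suc j))"
  shows "pc_potential D c x = c j"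
proof -
  have "{i. 1 \<le> i \<and> x \<in> Sigma_cell D i} = {j}"
  proof (intro set_eqI iffI)
    fix i assume "i \<in> {i. 1 \<le> i \<and> x \<in> Sigma_cell D i}"
    then have i: "1 \<le> i" "x \<in> D i" "x \<notin> closure (D (Suc i))" by (auto simp: Sigma_cell_def)
    have "\<not> i < j"
    proof
      assume "i < j"
      then have "D j \<subseteq> D (Suc i)" by (intro polyhedral_nested_antimono[OF D]) simp_all
      then show False using x(1) i(3) closure_subset[of "D (Suc i)"] by blast
    qed
    moreover have "\<not> j < i"
    proof
      assume "j < i"
      then have "D i \<subseteq> D (Suc j)" by (intro polyhedral_nested_antimono[OF D]) simp_all
      then show False using x(2) i(2) closure_subset[of "D (Suc j)"] by blast
    qed
    ultimately show "i \<in> {j}" by simp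
  qed (use j x in \<open>auto simp: Sigma_cell_def\<close>)
  then show ?thesis by (simp add: pc_potential_def)
qed

lemma pc_potential_outside:
  assumes D: "polyhedral_nested D c" and x: "x \<notin> D 1"
  shows "pc_potential D c x = 0"
proof -
  have "{i. 1 \<le> i \<and> x \<in> Sigma_cell D i} = {}"
    using polyhedral_nested_antimono[OF D, of 1] x by (auto simp: Sigma_cell_def)
  then show ?thesis by (simp only: pc_potential_def sum.empty)
qed

text \<open>The values are compared on nonempty cells only, since the potential does not determine
  the value attached to an empty one.\<close>

definition same_layers :: "(nat \<Rightarrow> (real^'n) set) \<Rightarrow> (nat \<Rightarrow> complex) \<Rightarrow> (nat \<Rightarrow> (real^'n) set) \<Rightarrow> (nat \<Rightarrow> complex) \<Rightarrow> nat \<Rightarrow> bool" where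
  "same_layers D c D' c' j \<longleftrightarrow> (\<forall>i. 1 \<le> i \<longrightarrow> i \<le> j \<longrightarrow> D i = D' i \<and> (D i \<noteq> {} \<longrightarrow> c i = c' i))"

text \<open>Outside \<open>D j\<close> only layers of index below \<open>j\<close> can contain
  \<open>x\<close>, and layer \<open>i\<close> involves just the cells \<open>i\<close> and
  \<open>Suc i\<close>.\<close>

lemma same_layers_pc_potential:
  assumes D: "polyhedral_nested D c" and D': "polyhedral_nested D' c'"
    and s: "same_layers D c D' c' j" and j: "j \<ge> 1" and x: "x \<notin> D j"
  shows "pc_potential D c x = pc_potential D' c' x"
proof -
  have no: "x \<notin> D i" "x \<notin> D' i" if "i \<ge> j" for i
  proof -
    have "x \<notin> D' j" using s j x by (auto simp: same_layers_def)
    then show "x \<notin> D i" "x \<notin> D' i" using polyhedral_nested_antimono[OF D j that] polyhedral_nested_antimono[OF D' j that] x by auto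
  qed
  have S: "x \<in> Sigma_cell D i \<longleftrightarrow> x \<in> Sigma_cell D' i" "x \<in> Sigma_cell D i \<Longrightarrow> c i = c' i" if "i \<ge> 1" for i
  proof -
    have "D i = D' i" "D (Suc i) = D' (Suc i)" "D i \<noteq> {} \<longrightarrow> c i = c' i" if "i < j"
      using s \<open>i \<ge> 1\<close> that unfolding same_layers_def by auto
    then show "x \<in> Sigma_cell D i \<longleftrightarrow> x \<in> Sigma_cell D' i" "x \<in> Sigma_cell D i \<Longrightarrow> c i = c' i"
      using no[of i] by (cases "i < j"; auto simp: Sigma_cell_def)+
  qed
  show ?thesis unfolding pc_potential_def using S by (intro sum.cong) auto
qed

lemma far_field_diff_bound:
  fixes u u' :: "real^'n \<Rightarrow> complex"
  assumes A: "far_field k ui u A" and A': "far_field k ui u' A'" and same: "\<forall>xh \<in> sphere 0 1. A xh = A' xh"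
  obtains C R where "R > 0" "\<And>x. norm x > R \<Longrightarrow> cmod (u x - u' x) \<le> C * norm x powr (- real CARD('n) / 2)"
proof -
  obtain C R where C: "\<And>r xh. r \<ge> R \<Longrightarrow> xh \<in> sphere 0 1 \<Longrightarrow> cmod (u (r *\<^sub>R xh) - ui (r *\<^sub>R xh)
            - exp (\<i> * of_real (k * r)) / of_real (r powr ((real CARD('n) - 1) / 2)) * A xh) \<le> C * r powr (- real CARD('n) / 2)"
    using A unfolding far_field_def by blast
  obtain C' R' where C': "\<And>r xh. r \<ge> R' \<Longrightarrow> xh \<in> sphere 0 1 \<Longrightarrow> cmod (u' (r *\<^sub>R xh) - ui (r *\<^sub>R xh)
            - exp (\<i> * of_real (k * r)) / of_real (r powr ((real CARD('n) - 1) / 2)) * A' xh) \<le> C' * r powr (- real CARD('n) / 2)"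
    using A' unfolding far_field_def by blast
  show ?thesis
  proof (rule that[of "max 1 (max R R')" "C + C'"])
    fix x :: "real^'n" assume x: "norm x > max 1 (max R R')"
    define xh where "xh = (1 / norm x) *\<^sub>R x"
    have x0: "norm x > 0" using x by linarith
    have xh: "xh \<in> sphere 0 1" "x = norm x *\<^sub>R xh" using x0 by (simp_all add: xh_def)
    define q where "q = ui x + exp (\<i> * of_real (k * norm x)) / of_real (norm x powr ((real CARD('n) - 1) / 2)) * A xh"
    have "cmod (u x - q) \<le> C * norm x powr (- real CARD('n) / 2)"
      using C[of "norm x", OF _ xh(1)] x unfolding xh(2)[symmetric] q_def by (simp add: algebra_simps)
    moreover have "cmod (u' x - q) \<le> C' * norm x powr (- real CARD('n) / 2)"
      using C'[of "norm x", OF _ xh(1)] x same xh(1) unfolding xh(2)[symmetric] q_def by (simp add: algebra_simps)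
    moreover have "cmod (u x - u' x) \<le> cmod (u x - q) + cmod (u' x - q)"
      using norm_triangle_ineq4[of "u x - q" "u' x - q"] by simp
    ultimately show "cmod (u x - u' x) \<le> (C + C') * norm x powr (- real CARD('n) / 2)" by (simp add: distrib_right)
  qed simp
qed

text \<open>Krein-Milman: were all extreme points of \<open>K\<close> in the convex set
  \<open>L\<close>, so would \<open>K\<close> be. With \<open>L\<close> empty it produces a
  vertex.\<close>

lemma exposed_vertex:
  fixes K L :: "(real^'n) set"
  assumes "compact K" "convex K" "closed L" "convex L" "\<not> K \<subseteq> L"
  obtains x where "x extreme_point_of K" "x \<notin> L"
proof -
  have "\<exists>x. x extreme_point_of K \<and> x \<notin> L"
  proof (rule ccontr)
    assume "\<not> ?thesis"
    then have "{x. x extreme_point_of K} \<subseteq> L" by blast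
    then have "convex hull {x. x extreme_point_of K} \<subseteq> L" using assms(4) by (rule hull_minimal)
    then show False using Krein_Milman_Minkowski[OF assms(1,2)] assms(5) by simp
  qed
  then show ?thesis using that by blast
qed

text \<open>The hypotheses are symmetric in the two problems, so facts proved here are available
  with the roles exchanged through \<open>swap\<close>.\<close>

locale two_nested_potentials =
  fixes D D' :: "nat \<Rightarrow> (real^'n) set" and c c' :: "nat \<Rightarrow> complex" and u u' :: "real^'n \<Rightarrow> complex" and k :: real
  assumes n: "CARD('n) \<ge> 2" and k: "k \<noteq> 0"
    and D: "polyhedral_nested D c" and D': "polyhedral_nested D' c'"
    and u: "dist_helmholtz k (pc_potential D c) u" and u': "dist_helmholtz k (pc_potential D' c') u'"
    and vert: "\<And>x. x \<in> cell_vertices D \<union> cell_vertices D' \<Longrightarrow> u x \<noteq> 0 \<or> u' x \<noteq> 0"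
begin

lemma swap: "two_nested_potentials D' D c' c u' u k"
  using n k D D' u u' vert by unfold_locales auto

text \<open>A vertex of \<open>D j\<close> is not in the open cell, hence has a neighbourhood that
  avoids the closure of the next cell. There the first potential is \<open>c j\<close> inside, and
  \<open>no_corner\<close> applies.\<close>

lemma no_vertex_jump:
  assumes j: "j \<ge> 1" and x: "x extreme_point_of closure (D j)" and B: "open B" "x \<in> B" and be: "c j \<noteq> be"
    and ins: "\<And>y. y \<in> B \<Longrightarrow> y \<in> D j \<Longrightarrow> pc_potential D' c' y = be"
    and out: "\<And>y. y \<in> B \<Longrightarrow> y \<notin> closure (D j) \<Longrightarrow> pc_potential D c y = pc_potential D' c' y \<and> u y = u' y"
  shows False
proof -
  note cl = polyhedral_nested_cell[OF D j]
  have xn: "x \<notin> D j" using extreme_point_not_in_interior[OF x] cl(2) n by simp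
  have Dn: "D j \<noteq> {}" using x by (auto simp: extreme_point_of_def)
  have "open (B - closure (D (Suc j)))" using B(1) by (intro open_Diff) auto
  moreover have "x \<in> B - closure (D (Suc j))" using B(2) xn cl(4) by blast
  ultimately obtain e where e: "e > 0" "ball x e \<subseteq> B - closure (D (Suc j))" by (rule openE)
  show False
  proof (rule no_corner[OF u u' k cl(1) _ x n _ e(1) be])
    show "interior (closure (D j)) \<noteq> {}" using cl(2) Dn by simp
    show "u x \<noteq> 0 \<or> u' x \<noteq> 0" using vert[of x] x j Dn by (auto simp: cell_vertices_def)
    show "pc_potential D c y = c j \<and> pc_potential D' c' y = be" if y: "y \<in> ball x e" "y \<in> interior (closure (D j))" for y
    proof -
      have "y \<in> D j" "y \<in> B" "y \<notin> closure (D (Suc j))" using y e(2) cl(2) by auto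
      then show ?thesis using ins pc_potential_Sigma_cell[OF D j] by blast
    qed
    show "pc_potential D c y = pc_potential D' c' y \<and> u y = u' y" if "y \<in> ball x e" "y \<notin> closure (D j)" for y
      using out that e(2) by blast
  qed
qed

text \<open>Otherwise some vertex of the first cell lies off the second closure. Near it the second
  potential still has the value \<open>al\<close> of the surrounding layer, while the first one
  jumps away from it across the cell boundary.\<close>

lemma cell_subset:
  assumes U: "open U" "closure (D (Suc j)) \<subseteq> U"
    and al: "\<And>x. x \<in> U \<Longrightarrow> x \<notin> closure (D' (Suc j)) \<Longrightarrow> pc_potential D' c' x = al" and ne: "D (Suc j) \<noteq> {} \<Longrightarrow> c (Suc j) \<noteq> al"
    and out: "\<And>x. x \<in> U \<Longrightarrow> x \<notin> closure (D (Suc j)) \<Longrightarrow> x \<notin> closure (D' (Suc j)) \<Longrightarrow>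
        pc_potential D c x = pc_potential D' c' x \<and> u x = u' x"
  shows "closure (D (Suc j)) \<subseteq> closure (D' (Suc j))"
proof (rule ccontr)
  note cl = polyhedral_nested_cell[OF D le_add1[of 1 j, unfolded plus_1_eq_Suc]]
  note cl' = polyhedral_nested_cell[OF D' le_add1[of 1 j, unfolded plus_1_eq_Suc]]
  assume "\<not> ?thesis"
  then obtain x where x: "x extreme_point_of closure (D (Suc j))" "x \<notin> closure (D' (Suc j))"
    using exposed_vertex[OF cl(5,6) closed_closure cl'(6)] by blast
  have xc: "x \<in> closure (D (Suc j))" using x(1) by (simp add: extreme_point_of_def)
  then have cal: "c (Suc j) \<noteq> al" by (intro ne) auto
  show False
  proof (rule no_vertex_jump[OF _ x(1) _ _ cal, of "U - closure (D' (Suc j))"])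
    show "open (U - closure (D' (Suc j)))" using U(1) by (intro open_Diff) auto
  qed (use al out U(2) x(2) xc in auto)
qed

text \<open>At a vertex of the common cell both potentials take their new values inside, since the
  closure of the next cell of either problem stays away from it. Different values would be a jump of
  the excluded kind.\<close>

lemma cell_value:
  assumes eq: "D (Suc j) = D' (Suc j)" and ne: "D (Suc j) \<noteq> {}"
    and out: "\<And>x. x \<notin> closure (D (Suc j)) \<Longrightarrow> pc_potential D c x = pc_potential D' c' x \<and> u x = u' x"
  shows "c (Suc j) = c' (Suc j)"
proof (rule ccontr)
  note cl = polyhedral_nested_cell[OF D le_add1[of 1 j, unfolded plus_1_eq_Suc]]
  note cl' = polyhedral_nested_cell[OF D' le_add1[of 1 j, unfolded plus_1_eq_Suc]]
  assume be: "c (Suc j) \<noteq> c' (Suc j)"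
  obtain x where x: "x extreme_point_of closure (D (Suc j))"
    using exposed_vertex[OF cl(5,6) closed_empty convex_empty] ne by auto
  have "x \<notin> D (Suc j)" using extreme_point_not_in_interior[OF x] cl(2) n by simp
  then have xB: "x \<in> - closure (D' (Suc (Suc j)))" using cl'(4) eq by auto
  show False
  proof (rule no_vertex_jump[OF _ x _ xB be])
    show "open (- closure (D' (Suc (Suc j))))" by (rule open_Compl[OF closed_closure])
    show "pc_potential D' c' y = c' (Suc j)" if "y \<in> - closure (D' (Suc (Suc j)))" "y \<in> D (Suc j)" for y
      using that eq by (intro pc_potential_Sigma_cell[OF D']) auto
  qed (use out in auto)
qed

lemma unpeel:
  assumes s: "same_layers D c D' c' j" and off: "\<And>x. j \<ge> 1 \<Longrightarrow> x \<notin> D j \<Longrightarrow> u x = u' x"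
    and far: "\<And>x. norm x > R \<Longrightarrow> u x = u' x"
  shows "same_layers D c D' c' (Suc j) \<and> (\<forall>x. x \<notin> D (Suc j) \<longrightarrow> u x = u' x)"
proof -
  interpret swapped: two_nested_potentials D' D c' c u' u k by (rule swap)
  define K where "K = closure (D (Suc j))"
  define K' where "K' = closure (D' (Suc j))"
  \<comment> \<open>The exterior counts as layer 0: all of space, with potential 0 and nothing
    peeled off yet.\<close>
  define U where "U = (if j = 0 then UNIV else D j)"
  define cc where "cc = (if j = 0 then 0 else c j)"
  note cl = polyhedral_nested_cell[OF D le_add1[of 1 j, unfolded plus_1_eq_Suc], folded K_def]
  note cl' = polyhedral_nested_cell[OF D' le_add1[of 1 j, unfolded plus_1_eq_Suc], folded K'_def]
  have sj: "D j = D' j" "D j \<noteq> {} \<Longrightarrow> c j = c' j" if "j \<noteq> 0"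
    using s that by (auto simp: same_layers_def)
  have U: "open U" "K \<subseteq> U" "K' \<subseteq> U"
    using polyhedral_nested_cell(3,4)[OF D, of j] polyhedral_nested_cell(4)[OF D', of j] sj
    by (auto simp: U_def K_def K'_def)
  have VU: "pc_potential D c x = cc" if "x \<in> U" "x \<notin> K" for x
  proof (cases "j = 0")
    case True
    then have "x \<notin> D 1" using that(2) closure_subset[of "D 1"] by (auto simp: K_def)
    then show ?thesis using pc_potential_outside[OF D] True by (simp add: cc_def)
  next
    case False
    then show ?thesis using pc_potential_Sigma_cell[OF D, of j x] that by (simp add: cc_def U_def K_def)
  qed
  have VU': "pc_potential D' c' x = cc" if "x \<in> U" "x \<notin> K'" for x
  proof (cases "j = 0")
    case True
    then have "x \<notin> D' 1" using that(2) closure_subset[of "D' 1"] by (auto simp: K'_def)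
    then show ?thesis using pc_potential_outside[OF D'] True by (simp add: cc_def)
  next
    case False
    then have "c j = c' j" "x \<in> D' j" using sj that by (auto simp: U_def)
    then show ?thesis using pc_potential_Sigma_cell[OF D', of j x] that False by (simp add: cc_def K'_def)
  qed
  have Uc: "pc_potential D c x = pc_potential D' c' x" "u x = u' x" if "x \<notin> U" for x
    using that off[of x] same_layers_pc_potential[OF D D' s, of x] by (auto simp: U_def split: if_splits)
  have cn: "c (Suc j) \<noteq> cc"
    using D by (cases j) (auto simp: cc_def polyhedral_nested_def)
  \<comment> \<open>For \<open>D'\<close> the surrounding value is \<open>c' j\<close>. It equals
    \<open>cc = c j\<close> only if the \<open>j\<close>-th cell is nonempty, which the assumption
    provides.\<close>
  have cn': "c' (Suc j) \<noteq> cc" if "D' (Suc j) \<noteq> {}"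
  proof (cases "j = 0")
    case True then show ?thesis using D' by (simp add: cc_def polyhedral_nested_def)
  next
    case False
    have "D j \<noteq> {}" using that U(3) closure_subset[of "D' (Suc j)"] False by (auto simp: U_def K'_def)
    then have "c j = c' j" by (rule sj(2)[OF False])
    then show ?thesis using D' False by (auto simp: cc_def polyhedral_nested_def)
  qed
  \<comment> \<open>The constant \<open>cc\<close> is valid on the whole complement, although the
    potentials take other values outside \<open>U\<close>: there they agree and so do the waves, so
    the zero order term vanishes. This allows rays to leave \<open>D j\<close> and cross the outer
    layers.\<close>
  have "dsol (of_real (k\<^sup>2) * (1 + cc)) (- (K \<union> K')) (\<lambda>x. u x - u' x)"
  proof (rule dist_helmholtz_dsol[OF u u'])
    fix x assume "x \<in> - (K \<union> K')"
    then show "pc_potential D c x * u x - pc_potential D' c' x * u' x = cc * (u x - u' x)"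
      using VU[of x] VU'[of x] Uc[of x] by (cases "x \<in> U") (auto simp: right_diff_distrib)
  qed
  note sol = this
  have wc: "continuous_on UNIV (\<lambda>x. u x - u' x)"
    using u u' by (intro continuous_intros) (auto simp: dist_helmholtz_def)
  have w0: "u x = u' x" if x: "x \<notin> K" "x \<notin> K'" for x
  proof -
    obtain v where v: "v \<noteq> 0" "\<And>t. t \<ge> 0 \<Longrightarrow> x + t *\<^sub>R v \<notin> K \<union> K'"
      by (rule convex_compact_exit_ray[OF cl(6) _ x(1) cl'(6) _ x(2)]) (use n in \<open>auto simp: K_def K'_def\<close>)
    \<comment> \<open>Chosen so that the end point \<open>q\<close> has norm at least
      \<open>\<bar>R\<bar> + 1\<close>; the unit ball around it then lies where the waves are known
      to agree.\<close>
    define t where "t = (\<bar>R\<bar> + 1 + norm x) / norm v"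
    have t0: "t \<ge> 0" by (simp add: t_def)
    define q where "q = x + t *\<^sub>R v"
    have "norm (t *\<^sub>R v) = \<bar>R\<bar> + 1 + norm x" using v(1) by (simp add: t_def)
    moreover have "norm (t *\<^sub>R v) \<le> norm q + norm x" using norm_triangle_ineq4[of q x] by (simp add: q_def)
    ultimately have q: "norm q \<ge> \<bar>R\<bar> + 1" by simp
    have "u x - u' x = 0"
    proof (rule unique_continuation_segment[OF wc sol _ _ zero_less_one])
      show "open (- (K \<union> K'))" unfolding K_def K'_def by (intro open_Compl closed_Un closed_closure)
      show "closed_segment q x \<subseteq> - (K \<union> K')"
      proof
        fix y assume "y \<in> closed_segment q x"
        then have "y \<in> closed_segment x q" by (simp add: closed_segment_commute)
        then obtain s where s: "0 \<le> s" "y = (1 - s) *\<^sub>R x + s *\<^sub>R q" by (auto simp: closed_segment_def)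
        then have "y = x + (s * t) *\<^sub>R v" by (simp add: q_def algebra_simps)
        then show "y \<in> - (K \<union> K')" using v(2)[of "s * t"] s(1) t0 by simp
      qed
      show "u y - u' y = 0" if "y \<in> ball q 1" for y
      proof -
        have "norm q \<le> norm y + dist q y" using norm_triangle_ineq[of y "q - y"] by (simp add: dist_norm)
        moreover have "dist q y < 1" using that by simp
        ultimately have "norm y > R" using q by linarith
        then show ?thesis using far by simp
      qed
    qed
    then show ?thesis by simp
  qed
  have out: "pc_potential D c x = pc_potential D' c' x \<and> u x = u' x" if "x \<notin> K" "x \<notin> K'" for x
    using VU[of x] VU'[of x] Uc[of x] w0[of x] that by (cases "x \<in> U") auto
  have "K \<subseteq> K'"
    unfolding K_def K'_def by (rule cell_subset[OF U(1) U(2)[unfolded K_def] VU'[unfolded K'_def] cn out[unfolded K_def K'_def]])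
  moreover have "K' \<subseteq> K"
  proof -
    have "pc_potential D' c' x = pc_potential D c x \<and> u' x = u x" if "x \<notin> K'" "x \<notin> K" for x using out[of x] that by simp
    then show ?thesis unfolding K_def K'_def
      by (intro swapped.cell_subset[OF U(1) U(3)[unfolded K'_def] VU[unfolded K_def] cn']) (auto simp: K_def K'_def)
  qed
  ultimately have KK: "K = K'" by simp
  then have DD: "D (Suc j) = D' (Suc j)" using cl(2) cl'(2) by simp
  have "c (Suc j) = c' (Suc j)" if "D (Suc j) \<noteq> {}"
    by (rule cell_value[OF DD that]) (use out KK in \<open>auto simp: K_def\<close>)
  then have "same_layers D c D' c' (Suc j)"
    using s DD by (auto simp: same_layers_def le_Suc_eq)
  moreover have "u x = u' x" if "x \<notin> D (Suc j)" for x
  proof -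
    have "u x - u' x = 0"
      by (rule zero_off_interior[OF wc open_UNIV _ UNIV_I, of K]) (use w0 KK cl(2) that in auto)
    then show ?thesis by simp
  qed
  ultimately show ?thesis by blast
qed

text \<open>Rellich's lemma provides agreement of the waves far out, which starts the peeling. The
  induction reaches every index, so infinitely many nonempty cells are covered, and agreement of all
  cells and values determines the sum.\<close>

theorem same_potential:
  assumes far: "\<And>x. norm x > R \<Longrightarrow> cmod (u x - u' x) \<le> C * norm x powr (- real CARD('n) / 2)"
  shows "pc_potential D c = pc_potential D' c'"
proof -
  have "bounded (closure (D 1) \<union> closure (D' 1))"
    using polyhedral_nested_cell(5)[OF D, of 1] polyhedral_nested_cell(5)[OF D', of 1] by (simp add: compact_imp_bounded)
  then obtain R1 where R1: "\<And>x. x \<in> D 1 \<union> D' 1 \<Longrightarrow> norm x \<le> R1"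
    unfolding bounded_iff using closure_subset[of "D 1"] closure_subset[of "D' 1"] by blast
  define R2 where "R2 = max 1 (max R R1)"
  have "dsol (of_real (k\<^sup>2) * (1 + 0)) {x. norm x > R2} (\<lambda>x. u x - u' x)"
  proof (rule dist_helmholtz_dsol[OF u u'])
    fix x :: "real^'n" assume "x \<in> {x. norm x > R2}"
    then have "x \<notin> D 1" "x \<notin> D' 1" using R1[of x] by (auto simp: R2_def)
    then show "pc_potential D c x * u x - pc_potential D' c' x * u' x = 0 * (u x - u' x)"
      using pc_potential_outside[OF D] pc_potential_outside[OF D'] by simp
  qed
  then have sol: "dsol (of_real (k\<^sup>2)) {x. norm x > R2} (\<lambda>x. u x - u' x)" by (simp only: add_0_right mult_1_right)
  have wc: "continuous_on UNIV (\<lambda>x. u x - u' x)"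
    using u u' by (intro continuous_intros) (auto simp: dist_helmholtz_def)
  have R2: "0 < R2" by (simp add: R2_def)
  have z: "u x = u' x" if "norm x > R2" for x
    using rellich[OF wc sol R2 k _ that, of C] far by (simp add: R2_def)
  have all: "same_layers D c D' c' j \<and> (j \<ge> 1 \<longrightarrow> (\<forall>x. x \<notin> D j \<longrightarrow> u x = u' x))" for j
  proof (induction j)
    case 0 show ?case by (simp add: same_layers_def)
  next
    case (Suc j)
    then show ?case using unpeel[of j R2] z by blast
  qed
  have same: "D i = D' i" "D i \<noteq> {} \<Longrightarrow> c i = c' i" if "i \<ge> 1" for i
    using all[of i] that by (auto simp: same_layers_def)
  show ?thesis
  proof
    fix x
    have "Sigma_cell D i = Sigma_cell D' i" "x \<in> Sigma_cell D i \<Longrightarrow> c i = c' i" if "i \<ge> 1" for i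
      using same[OF that] same(1)[of "Suc i"] by (auto simp: Sigma_cell_def)
    then show "pc_potential D c x = pc_potential D' c' x"
      unfolding pc_potential_def by (intro sum.cong) auto
  qed
qed

end

theorem theorem2p7:
  fixes V V' :: "real^'n \<Rightarrow> complex"
    and D D' :: "nat \<Rightarrow> (real^'n) set"
    and c c' :: "nat \<Rightarrow> complex"
    and ui u u' A A' :: "real^'n \<Rightarrow> complex"
    and k :: real
  assumes dim: "CARD('n) = 2 \<or> CARD('n) = 3"
    and k_pos: "k > 0"
    and V: "pc_nested_potential V D c"
    and V': "pc_nested_potential V' D' c'"
    and inc: "entire_helmholtz k ui"
    and u: "total_wave k V ui u"
    and u': "total_wave k V' ui u'"
    and vert: "\<forall>xc \<in> cell_vertices D \<union> cell_vertices D'. u xc \<noteq> 0 \<or> u' xc \<noteq> 0"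
    and A: "far_field k ui u A"
    and A': "far_field k ui u' A'"
    and same: "\<forall>xh \<in> sphere 0 1. A xh = A' xh"
  shows "V = V'"
proof -
  have VD: "V = pc_potential D c" "polyhedral_nested D c" "V' = pc_potential D' c'" "polyhedral_nested D' c'"
    using V V' by (auto simp: pc_nested_potential_def)
  interpret two_nested_potentials D D' c c' u u' k
    using dim k_pos VD(2,4) total_wave_dist[OF u] total_wave_dist[OF u'] vert
    by unfold_locales (auto simp: VD(1,3))
  obtain C R where "\<And>x. norm x > R \<Longrightarrow> cmod (u x - u' x) \<le> C * norm x powr (- real CARD('n) / 2)"
    using far_field_diff_bound[OF A A' same] by metis
  then show ?thesis unfolding VD(1,3) by (rule same_potential)
qed

end
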